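(* Let $\alpha_1,\alpha_2>-1$ with $\alpha_1-\alpha_2\notin\mathbb Z$, and let $\beta=0$. Let $\theta\in(0,1)$ be fixed, and let $\vec n=(n_1,n_2)$ run through multi-indices tending to infinity with $n_1+n_2=2n$ and $\frac{n_2}{n_1+n_2}=\frac\theta2$ (so $n_2=\theta n\in\mathbb Z$ and $n_1=(2-\theta)n$). Let $P_{\vec n}$ be the monic polynomial of degree $n_1+n_2$ satisfying $\int_0^1P_{\vec n}(x)x^kx^{\alpha_j}\,dx=0$ for $k=0,\dots,n_j-1$, $j=1,2$. Then, uniformly for $z$ on the $\pm$ sides of $\Delta=[0,1]$ and of $\Gamma^*=[x^*,0]$, away from the end points $x^*,0,1$ (that is, for $z$ in compact subsets of $(0,1)\cup(x^*,0)$, every function on the right-hand side being replaced by its boundary value from the upper half-plane for the sign $+$ and from the lower half-plane for the sign $-$), as $n\to\infty$, $$P_{\vec n}(z)=e^{n\tilde H_0(z)}\Bigg\{\frac{4^{\alpha_1}(\varphi_0(z)-\theta_1)(\varphi_0(z)-\theta_2)^{\alpha_2-\alpha_1+1}\varphi_0(z)^{2\alpha_1-\alpha_2}}{[(2+\theta)(4-\theta)]^{\alpha_1}z^{\alpha_1}\sqrt{\mathcal D(\varphi_0(z))}}+O\Big(\frac1n\Big)$$ $$\pm e^{n(H_1(z)-H_0(z))}\Bigg[\frac{4^{\alpha_1}(\varphi_1(z)-\theta_1)(\varphi_1(z)-\theta_2)^{\alpha_2-\alpha_1+1}\varphi_1(z)^{2\alpha_1-\alpha_2}}{[(2+\theta)(4-\theta)]^{\alpha_1}z^{\alpha_1}\sqrt{\mathcal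 D(\varphi_1(z))}}+O\Big(\frac1n\Big)\Bigg]\Bigg\}.$$
   Context: Notation, for $\theta\in(0,1)$: $\theta_1=\frac{2-\theta}{4-\theta}$, $\theta_2=\frac{\theta}{2+\theta}$, $c_0=\frac{4}{(2+\theta)(4-\theta)}$, $s^*=3\theta_1\theta_2$, $x^*=-\frac{27\theta^2(2-\theta)^2}{(2+\theta)^2(4-\theta)^2(1-\theta)^2}<0$, and $$R(s)=\frac{c_0s^3}{(s-\theta_1)(s-\theta_2)}.$$ The critical points of $R$ are $0$ (double), $1$ and $s^*$, with values $0,1,x^*$. The equation $R(s)=z$ has the holomorphic branches $\varphi_0$ on $\mathbb C\setminus[0,1]$ with $\varphi_0(z)=z/c_0+O(1)$ as $z\to\infty$; $\varphi_1$ on $\mathbb C\setminus[x^*,1]$ with $\varphi_1(z)\to\theta_1$ as $z\to\infty$; $\varphi_2$ on $\mathbb C\setminus[x^*,0]$ with $\varphi_2(z)\to\theta_2$ as $z\to\infty$. Superscripts $\pm$ denote boundary values from the upper/lower half-plane. $\mathcal D(s)=s^2(s-1)(s-s^* )$. The function $\sqrt{\mathcal D(s)}$ is holomorphic in $\mathbb C$ minus the curve $\varphi_1^-([0,1])\cup\varphi_1^+([x^*,0])$ (a curve joining $1$ to $0$ and then $0$ to $s^*$) and positive for large positive $s$. All powers $(\cdot)^{\alpha_2-\alpha_1+1}$, $(\cdot)^{2\alpha_1-\alpha_2}$ and $z^{\alpha_1}$ are principal branches for non-real $z$, boundary values being taken on the real line. For $j=0,1$ and $z\in\mathbb C\setminus(-\infty,1]$: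 $H_j(z)=(2-\theta)\ln(\varphi_j(z)-\theta_1)+\theta\ln(\varphi_j(z)-\theta_2)+C$ (principal logarithms), with $C=(2-\theta)\ln\frac1{\theta_1}+\theta\ln\frac1{\theta_2}$. Further $C_0=C+2\ln\frac1{c_0}$ and $\tilde H_0=H_0-C_0$. *)

theory Defs
  imports
    "HOL-Complex_Analysis.Complex_Analysis"
    "HOL-Computational_Algebra.Polynomial"
    "HOL-Library.Landau_Symbols"
begin

definition theta1 :: "real \<Rightarrow> real" where
  "theta1 \<theta> = (2 - \<theta>) / (4 - \<theta>)"

definition theta2 :: "real \<Rightarrow> real" where
  "theta2 \<theta> = \<theta> / (2 + \<theta>)"

definition c0 :: "real \<Rightarrow> real" where
  "c0 \<theta> = 4 / ((2 + \<theta>) * (4 - \<theta>))"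

definition s_star :: "real \<Rightarrow> real" where
  "s_star \<theta> = 3 * theta1 \<theta> * theta2 \<theta>"

definition x_star :: "real \<Rightarrow> real" where
  "x_star \<theta> = - (27 * \<theta>^2 * (2 - \<theta>)^2) / ((2 + \<theta>)^2 * (4 - \<theta>)^2 * (1 - \<theta>)^2)"

definition R :: "real \<Rightarrow> complex \<Rightarrow> complex" where
  "R \<theta> s = of_real (c0 \<theta>) * s^3 / ((s - of_real (theta1 \<theta>)) * (s - of_real (theta2 \<theta>)))"

text \<open>
  The value 0 that \<^term>\<open>R \<theta>\<close> takes at its poles (division by zero) does not interfere with
  the two definitions below: 0 lies outside the domains of both branches.
\<close>

definition is_phi0 :: "real \<Rightarrow> (complex \<Rightarrow> complex) \<Rightarrow> bool" where
  "is_phi0 \<theta> \<phi> \<longleftrightarrow>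
     \<phi> holomorphic_on (- closed_segment 0 1) \<and>
     (\<forall>z \<in> - closed_segment 0 1. R \<theta> (\<phi> z) = z) \<and>
     (\<lambda>z. \<phi> z - z / of_real (c0 \<theta>)) \<in> O[at_infinity](\<lambda>_. 1)"

definition is_phi1 :: "real \<Rightarrow> (complex \<Rightarrow> complex) \<Rightarrow> bool" where
  "is_phi1 \<theta> \<phi> \<longleftrightarrow>
     \<phi> holomorphic_on (- closed_segment (of_real (x_star \<theta>)) 1) \<and>
     (\<forall>z \<in> - closed_segment (of_real (x_star \<theta>)) 1. R \<theta> (\<phi> z) = z) \<and>
     (\<phi> \<longlongrightarrow> of_real (theta1 \<theta>)) at_infinity"

text \<open>
  Boundary value at the real point \<open>x\<close>, from the upper half-plane for \<open>\<sigma> = 1\<close> and from the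
  lower half-plane for \<open>\<sigma> = -1\<close>.
\<close>

definition bdry :: "real \<Rightarrow> (complex \<Rightarrow> complex) \<Rightarrow> real \<Rightarrow> complex" where
  "bdry \<sigma> f x = Lim (at (of_real x) within {z. 0 < \<sigma> * Im z}) f"

definition calD :: "real \<Rightarrow> complex \<Rightarrow> complex" where
  "calD \<theta> s = s^2 * (s - 1) * (s - of_real (s_star \<theta>))"

definition sqrtD_cut :: "real \<Rightarrow> (complex \<Rightarrow> complex) \<Rightarrow> complex set" where
  "sqrtD_cut \<theta> \<phi>1 = bdry (-1) \<phi>1 ` {0..1} \<union> bdry 1 \<phi>1 ` {x_star \<theta>..0}"

definition is_sqrtD :: "real \<Rightarrow> (complex \<Rightarrow> complex) \<Rightarrow> (complex \<Rightarrow> complex) \<Rightarrow> bool" where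
  "is_sqrtD \<theta> \<phi>1 q \<longleftrightarrow>
     q holomorphic_on (- sqrtD_cut \<theta> \<phi>1) \<and>
     (\<forall>s \<in> - sqrtD_cut \<theta> \<phi>1. (q s)^2 = calD \<theta> s) \<and>
     (\<forall>\<^sub>F s in at_top. \<exists>r>0. q (of_real s) = of_real r)"

definition C_const :: "real \<Rightarrow> real" where
  "C_const \<theta> = (2 - \<theta>) * ln (1 / theta1 \<theta>) + \<theta> * ln (1 / theta2 \<theta>)"

definition C0_const :: "real \<Rightarrow> real" where
  "C0_const \<theta> = C_const \<theta> + 2 * ln (1 / c0 \<theta>)"

text \<open>
  \<open>H\<close> and \<open>amplitude\<close> are only used through \<^const>\<open>bdry\<close>, so the principal logarithms and
  powers, and \<open>q (\<phi> z)\<close>, are only evaluated at non-real \<open>z\<close>.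
\<close>

definition H :: "real \<Rightarrow> (complex \<Rightarrow> complex) \<Rightarrow> complex \<Rightarrow> complex" where
  "H \<theta> \<phi> z = of_real (2 - \<theta>) * ln (\<phi> z - of_real (theta1 \<theta>))
            + of_real \<theta> * ln (\<phi> z - of_real (theta2 \<theta>)) + of_real (C_const \<theta>)"

definition H0_tilde :: "real \<Rightarrow> (complex \<Rightarrow> complex) \<Rightarrow> complex \<Rightarrow> complex" where
  "H0_tilde \<theta> \<phi>0 z = H \<theta> \<phi>0 z - of_real (C0_const \<theta>)"

definition amplitude ::
  "real \<Rightarrow> real \<Rightarrow> real \<Rightarrow> (complex \<Rightarrow> complex) \<Rightarrow> (complex \<Rightarrow> complex) \<Rightarrow> complex \<Rightarrow> complex" where
  "amplitude \<alpha>1 \<alpha>2 \<theta> q \<phi> z =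
     4 powr of_real \<alpha>1 * (\<phi> z - of_real (theta1 \<theta>))
       * (\<phi> z - of_real (theta2 \<theta>)) powr of_real (\<alpha>2 - \<alpha>1 + 1)
       * \<phi> z powr of_real (2 * \<alpha>1 - \<alpha>2)
     / (of_real ((2 + \<theta>) * (4 - \<theta>)) powr of_real \<alpha>1 * z powr of_real \<alpha>1 * q (\<phi> z))"

definition is_multiple_orthogonal ::
  "real \<Rightarrow> real \<Rightarrow> nat \<Rightarrow> nat \<Rightarrow> real poly \<Rightarrow> bool" where
  "is_multiple_orthogonal \<alpha>1 \<alpha>2 n1 n2 P \<longleftrightarrow>
     lead_coeff P = 1 \<and> degree P = n1 + n2 \<and>
     (\<forall>k<n1. ((\<lambda>x. poly P x * x^k * x powr \<alpha>1) has_integral 0) {0..1}) \<and>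
     (\<forall>k<n2. ((\<lambda>x. poly P x * x^k * x powr \<alpha>2) has_integral 0) {0..1})"

end

(*
Orthogonality says that the partial fraction sum_k p_k / (w - k) of the coefficients of P vanishes
at w = -1 - alpha_j - i for i < n_j.  It is therefore the rational function
G(w) = c * prod (w+1+alpha_1+i) * prod (w+1+alpha_2+i) / prod_{k <= 2n} (w - k), which determines c
and the p_k and is expanded at w = n t by Stirling-type estimates.  For x < 0 the terms p_k x^k all
have the same sign and P(x) is found by Laplace's method for sums.  For 0 < x < 1 one writes
2 pi i P(x) as the integral of G(w) x^w around the poles and deforms the contour to pass through
two conjugate saddle points.  Under t = 2s/(s-1) the saddle point equation becomes R(s) = x, which
is how the boundary values of phi_0 and phi_1 enter.  For x_star < x < 0 the phi_1 term is
exponentially small, because |phi_1 - theta_j| <= theta_j < |phi_0 - theta_j| there, and goes into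
the error term.
*)
theory Submission
  imports Defs "HOL-Probability.Distributions" "HOL-Real_Asymp.Real_Asymp"
begin

text \<open>In the coordinate u = (1 - 1/s)/2 = 1/t the equation R(s) = z becomes
  \<open>zeta u = 1/z\<close>, where \<open>zeta\<close> is a cubic polynomial without linear term.
  Hence the three roots t sum to zero; on both intervals they are r + iY, r - iY and -2r, and the
  real number r with x = \<open>X r\<close> serves as parameter in place of x. Two difficulties
  shape the proof. Uniformity: one constant has to serve all x in a compact set, so Laplace's method
  is proved for families of exponents in which every r0 is the critical point of its own member.
  Branches: phi_0, phi_1 and the square root are given only by holomorphy and normalisation. As Im
  (zeta u) is -2 Im u times \<open>J u\<close>, the signs of Im z and Im u fix that of
  \<open>J u\<close>, which confines each branch to a closed region that contains no other candidate
  root. The sign of the square root along phi_0 is read off at large real points; it is carried over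
  to phi_1 at a point of (0,1), where phi_0 from below and phi_1 from above have the same limit, off
  the cut. Finally the logarithms from Stirling's formula have to be matched with the principal ones
  without losing a multiple of 2 pi i.\<close>

abbreviation "cor \<equiv> complex_of_real"

section \<open>Gaussian integrals and Laplace's method at a single critical point\<close>

lemma gaussian_has_integral_centered:
 fixes n c :: real
 assumes "n > 0"
 shows "((%s. exp (- (n*(s - c)^2/2))) has_integral sqrt (2 * pi/n)) UNIV"
proof -
 define sg where "sg = 1/sqrt n"
 have s: "sg > 0" "sg^2 = 1/n" using assms by (auto simp: sg_def power_divide)
 have "((normal_density c sg) has_integral 1) UNIV"
  using has_integral_integral_lborel[OF integrable_normal_density[OF s(1), of c]]
     integral_normal_density[OF s(1), of c] by simp
 hence "((%x. sqrt (2 * pi/n)*normal_density c sg x) has_integral (sqrt (2 * pi/n)*1)) UNIV"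
  by (rule has_integral_mult_right)
 moreover have "sqrt (2 * pi/n)*normal_density c sg x = exp (- (n*(x - c)^2/2))" for x
  using assms by (simp add: normal_density_def s field_simps)
 ultimately show ?thesis by simp
qed

lemma gaussian_has_integral:
 fixes n :: real
 assumes "n > 0"
 shows "((%s. exp (- (n * s^2/2))) has_integral sqrt (2 * pi/n)) UNIV"
 using gaussian_has_integral_centered[OF assms, of 0] by simp

text \<open>Outside the interval half of the exponent is at least n x^2/4. This leaves the factor
  exp (- n x^2/4) in front of a Gaussian of half the rate, whose total mass is sqrt (4
  pi/n).\<close>

lemma gaussian_integral_truncated:
 fixes n x :: real
 assumes "n > 0" "x > 0"
 shows "\<bar>integral {-x..x} (%s. exp (- (n * s^2/2))) - sqrt (2 * pi/n)\<bar>
     <= exp (- (n*x^2/4)) * sqrt (4 * pi/n)"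
proof -
 let ?f = "%s::real. exp (- (n * s^2/2))"
 let ?g = "%s::real. exp (- (n*x^2/4))*exp (- ((n/2) * s^2/2))"
 have i1: "(?f has_integral sqrt (2 * pi/n)) UNIV"
  using gaussian_has_integral[OF assms(1)] .
 have i2: "(?g has_integral (exp (- (n*x^2/4)) * sqrt (2 * pi/(n/2)))) UNIV"
  by (rule has_integral_mult_right, rule gaussian_has_integral) (use assms in auto)
 have i3: "(?f has_integral (integral {-x..x} ?f)) {-x..x}"
  by (intro integrable_integral integrable_continuous_interval continuous_intros) auto
 have i4: "((%s. if s : {-x..x} then ?f s else 0) has_integral (integral {-x..x} ?f)) UNIV"
  using i3 by (subst has_integral_restrict_UNIV)
 have i5: "((%s. ?f s - (if s : {-x..x} then ?f s else 0)) has_integral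
       (sqrt (2 * pi/n) - integral {-x..x} ?f)) UNIV"
  by (rule has_integral_diff[OF i1 i4])
 have le: "?f s - (if s : {-x..x} then ?f s else 0) <= ?g s" for s
 proof (cases "s : {-x..x}")
  case False
  hence "\<bar>x\<bar> <= \<bar>s\<bar>" using assms by auto
  hence "x^2 <= s^2" by (simp only: abs_le_square_iff)
  hence "n*x^2 <= n * s^2" using assms by simp
  thus ?thesis using False by (simp add: exp_add[symmetric])
 qed simp
 have "sqrt (2 * pi/n) - integral {-x..x} ?f <= exp (- (n*x^2/4)) * sqrt (2 * pi/(n/2))"
  using has_integral_le[OF i5 i2 le] by simp
 moreover have "0 <= sqrt (2 * pi/n) - integral {-x..x} ?f"
  by (rule has_integral_nonneg[OF i5]) auto
 ultimately show ?thesis by (simp add: abs_if)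
qed

lemma Re_csqrt_ge:
 assumes "Re A >= 0" shows "Re (csqrt A) >= sqrt (Re A)"
 using complex_Re_le_cmod[of A] by simp

text \<open>With a = \<open>csqrt A\<close> the left integral is that of exp (- n w^2/2) over the
  segment from -a de to a de. An entire primitive \<open>Q\<close> allows replacing it by the
  segment from -x de to x de with x = Re a, which is a real Gaussian. On the short vertical
  connections Re (w^2) is at least de^2 Re A, so they are exponentially small.\<close>

lemma complex_gaussian_truncated:
 fixes n de c :: real and A :: complex
 assumes "n > 0" "de > 0" "c > 0" "Re A >= 2 * c"
 shows "norm (csqrt A*integral {-de..de} (%s. exp (- (cor n*A * cor s^2/2))) - cor (sqrt (2 * pi/n)))
  <= exp (- (n * c*de^2/2))*(2*norm (csqrt A)*de + sqrt (4 * pi/n))"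
proof -
 define a where "a = csqrt A"
 have a2: "a^2 = A" by (simp add: a_def)
 obtain Q :: "complex => complex" where Q: "!!w. (Q has_field_derivative exp (- (cor n*w^2/2))) (at w)"
 proof (rule holomorphic_convex_primitive'[of UNIV "%w. exp (- (cor n*w^2/2))"])
  show "(%w. exp (- (cor n*w^2/2))) holomorphic_on UNIV"
   by (intro holomorphic_intros) auto
 qed auto
 define x where "x = Re a"
 have xpos: "x >= sqrt (Re A)" using Re_csqrt_ge[of A] assms by (simp add: x_def a_def)
 have "sqrt (Re A) > 0" using assms by simp
 hence xp: "x > 0" using xpos by linarith
 have x2: "x^2 - (Im a)^2 = Re A" using a2 by (metis Re_power2 x_def)
 have "((%s. a*exp (- (cor n*(a * cor s)^2/2))) has_integral (Q (a * cor de) - Q (a * cor (-de)))) {-de..de}"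
 proof (rule fundamental_theorem_of_calculus)
  show "-de <= de" using assms by simp
  fix s :: real assume "s : {-de..de}"
  have "((%z. Q (a*z)) has_field_derivative exp (- (cor n*(a * cor s)^2/2))*a) (at (cor s))"
   by (rule DERIV_chain'[where g=Q]) (auto intro!: derivative_eq_intros Q)
  hence "((%s. Q (a * cor s)) has_vector_derivative exp (- (cor n*(a * cor s)^2/2))*a) (at s within {-de..de})"
   using has_vector_derivative_real_field has_vector_derivative_at_within by blast
  thus "((%s. Q (a * cor s)) has_vector_derivative a*exp (- (cor n*(a * cor s)^2/2))) (at s within {-de..de})"
   by (simp add: mult.commute)
 qed
 moreover have "(%s. a*exp (- (cor n*(a * cor s)^2/2))) = (%s. a*exp (- (cor n*A * cor s^2/2)))"
  by (simp add: power_mult_distrib a2 mult.assoc)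
 ultimately have I1: "a*integral {-de..de} (%s. exp (- (cor n*A * cor s^2/2))) = Q (a * cor de) - Q (- (a * cor de))"
  by (simp add: integral_unique integral_mult_right[symmetric] del: integral_mult_right)
 have gQ: "((%s. exp (- (cor n*(cor s)^2/2))) has_integral (Q (cor (x*de)) - Q (cor (-(x*de))))) {-(x*de)..(x*de)}"
 proof (rule fundamental_theorem_of_calculus)
  show "-(x*de) <= x*de" using assms xp by simp
  fix s :: real
  show "((%s. Q (cor s)) has_vector_derivative exp (- (cor n*(cor s)^2/2))) (at s within {-(x*de)..(x*de)})"
   using has_vector_derivative_real_field[OF Q] has_vector_derivative_at_within by blast
 qed
 have gE: "(%s. exp (- (cor n*(cor s)^2/2))) = (%s. cor (exp (- (n * s^2/2))))"
  by (simp add: exp_of_real[symmetric])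
 have I2: "Q (cor (x*de)) - Q (- cor (x*de)) = cor (integral {-(x*de)..(x*de)} (%s. exp (- (n * s^2/2))))"
 proof -
  have "((%s. cor (exp (- (n * s^2/2)))) has_integral cor (integral {-(x*de)..(x*de)} (%s. exp (- (n * s^2/2))))) {-(x*de)..(x*de)}"
   by (intro has_integral_of_real integrable_integral integrable_continuous_interval continuous_intros) auto
  from has_integral_unique[OF this]
  show ?thesis using gQ gE by simp
 qed
 \<comment> \<open>The cost of moving one end point to the real axis; the two values of
   \<open>e\<close> are the two ends.\<close>
 have endp: "norm (Q (e*(a * cor de)) - Q (e * cor (x*de))) <= exp (- (n * c*de^2))*(norm a*de)" if e: "e = 1 | e = -1" for e :: complex
 proof -
  have "norm (Q (e*(a * cor de)) - Q (e * cor (x*de))) <= exp (- (n * c*de^2))*norm (e*(a * cor de) - e * cor (x*de))"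
  proof (rule field_differentiable_bound[of "closed_segment (e*(a * cor de)) (e * cor (x*de))" _ "%w. exp (- (cor n*w^2/2))"])
   fix z assume z: "z : closed_segment (e*(a * cor de)) (e * cor (x*de))"
   then obtain u where u: "0 <= u" "u <= 1" "z = (1-u) *\<^sub>R (e*(a * cor de)) + u *\<^sub>R (e * cor (x*de))"
    by (auto simp: in_segment)
   have "z = e*(cor de*(cor (1-u)*a + cor u * cor x))"
    unfolding u(3) scaleR_conv_of_real by (simp add: algebra_simps)
   also have "cor (1-u)*a + cor u * cor x = Complex x ((1-u)*Im a)"
    by (auto simp: complex_eq_iff x_def algebra_simps)
   finally have "z^2 = (cor de)^2*(Complex x ((1-u)*Im a))^2"
    using e by (auto simp: power_mult_distrib)
   hence "Re (z^2) = de^2*(x^2 - ((1-u)*Im a)^2)"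
    by (simp add: Re_power2 power2_eq_square)
   moreover have "((1-u)*Im a)^2 <= (Im a)^2"
    unfolding power_mult_distrib using u by (simp add: mult_left_le_one_le power_le_one)
   ultimately have "Re (z^2) >= de^2 * Re A" using x2 assms by (simp add: mult_left_mono)
   moreover have "de^2 * Re A >= de^2*(2*c)" using assms by (intro mult_left_mono) auto
   ultimately have "n*(de^2*(2*c)) <= n * Re (z^2)" using assms by (intro mult_left_mono) linarith+
   moreover have "Re (cor n*z^2/2) = n * Re (z^2)/2" by simp
   ultimately have "n * c*de^2 <= Re (cor n*z^2/2)" by (simp add: algebra_simps)
   thus "norm (exp (- (cor n*z^2/2))) <= exp (- (n * c*de^2))"
    by (simp only: norm_exp_eq_Re uminus_complex.sel exp_le_cancel_iff neg_le_iff_le)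
  qed (auto intro: has_field_derivative_at_within Q)
  also have "norm (e*(a * cor de) - e * cor (x*de)) = norm (a - cor x)*de"
  proof -
   have "e*(a * cor de) - e * cor (x*de) = e*((a - cor x) * cor de)" by (simp add: algebra_simps)
   thus ?thesis using e assms by (auto simp: norm_mult)
  qed
  also have "... <= norm a*de"
  proof -
   have "a - cor x = \<i> * cor (Im a)" by (auto simp: complex_eq_iff x_def)
   thus ?thesis using assms abs_Im_le_cmod[of a] by (simp add: norm_mult mult_right_mono)
  qed
  finally show ?thesis by (simp add: mult_left_mono)
 qed
 have ex: "exp (- (n * c*de^2)) <= exp (- (n * c*de^2/2))" using assms by simp
 have "x^2 >= 2 * c" using x2 assms zero_le_power2[of "Im a"] by linarith
 hence "de^2*(2*c) <= de^2*x^2" by (intro mult_left_mono) auto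
 hence "n*(de^2*(2*c)) <= n*(de^2*x^2)" using assms by (intro mult_left_mono) auto
 hence "exp (- (n*(x*de)^2/4)) <= exp (- (n * c*de^2/2))" by (simp add: power_mult_distrib algebra_simps)
 hence tr: "norm (cor (integral {-(x*de)..(x*de)} (%s. exp (- (n * s^2/2)))) - cor (sqrt (2 * pi/n))) <= exp (- (n * c*de^2/2)) * sqrt (4 * pi/n)"
 proof -
  assume e: "exp (- (n*(x*de)^2/4)) <= exp (- (n * c*de^2/2))"
  have "exp (- (n*(x*de)^2/4)) * sqrt (4 * pi/n) <= exp (- (n * c*de^2/2)) * sqrt (4 * pi/n)"
   using assms by (intro mult_right_mono e) auto
  moreover have "x*de > 0" using assms xp by simp
  ultimately show ?thesis unfolding of_real_diff[symmetric] norm_of_real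
   using gaussian_integral_truncated[of n "x*de"] assms(1) by linarith
 qed
 have dec: "csqrt A*integral {-de..de} (%s. exp (- (cor n*A * cor s^2/2))) - cor (sqrt (2 * pi/n))
  = (Q (1*(a * cor de)) - Q (1 * cor (x*de))) - (Q ((-1)*(a * cor de)) - Q ((-1) * cor (x*de)))
   + (cor (integral {-(x*de)..(x*de)} (%s. exp (- (n * s^2/2)))) - cor (sqrt (2 * pi/n)))"
  using I1 I2 by (simp add: a_def algebra_simps)
 have "norm (csqrt A*integral {-de..de} (%s. exp (- (cor n*A * cor s^2/2))) - cor (sqrt (2 * pi/n))) <=
  exp (- (n * c*de^2))*(norm a*de) + exp (- (n * c*de^2))*(norm a*de) + exp (- (n * c*de^2/2)) * sqrt (4 * pi/n)"
  unfolding dec by (intro order_trans[OF norm_triangle_ineq] order_trans[OF norm_triangle_ineq4] add_mono endp tr) auto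
 also have "... <= exp (- (n * c*de^2/2))*(norm a*de) + exp (- (n * c*de^2/2))*(norm a*de) + exp (- (n * c*de^2/2)) * sqrt (4 * pi/n)"
  using assms by (intro add_mono mult_right_mono ex) auto
 finally show ?thesis by (simp add: a_def algebra_simps)
qed

text \<open>Taylor's formula of first order at Y; exp is bounded by exp r on the whole segment
  because the half plane Re <= r is convex.\<close>

lemma norm_exp_diff2_le:
 fixes X Y :: complex
 assumes "Re X <= r" "Re Y <= r"
 shows "norm (exp X - exp Y - (X - Y)*exp Y) <= norm (X - Y)^2*exp r"
proof -
 have "norm (exp X - (\<Sum>i\<le>1. exp Y*(X - Y)^i/fact i)) <= exp r*norm (X - Y)^(Suc 1)/fact 1"
 proof (rule complex_Taylor[of "closed_segment Y X" 1 "%_. exp"])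
  fix x assume "x : closed_segment Y X"
  hence "Re x : closed_segment (Re Y) (Re X)"
   by (metis closed_segment_linear_image imageI bounded_linear_Re bounded_linear.linear)
  hence "Re x <= r" using assms by (auto simp: closed_segment_eq_real_ivl split: if_splits)
  thus "norm (exp x) <= exp r" by simp
 qed (auto intro: has_field_derivative_at_within DERIV_exp)
 thus ?thesis by (simp add: algebra_simps power2_eq_square)
qed

lemma power_le_exp:
 fixes z :: real assumes "z >= 0" "k > 0"
 shows "z^k <= real k ^ k*exp z"
proof -
 have "z/k <= exp (z/k)" using exp_ge_add_one_self[of "z/k"] by linarith
 hence "(z/k)^k <= exp (z/k)^k" using assms by (intro power_mono) auto
 also have "... = exp z" using assms by (simp add: exp_of_nat_mult[symmetric])
 finally show ?thesis using assms by (simp add: power_divide field_simps)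
qed

lemma cubic_le_exp:
 fixes c :: real assumes "c > 0"
 obtains K where "K > 0" "!!y. y >= 0 ==> (y + y^2 + y^3)*exp (- c*y) <= K*exp (- c*y/2)"
proof -
 define K where "K = (2/c) + 4*(2/c)^2 + 27*(2/c)^3"
 have "(y + y^2 + y^3)*exp (- c*y) <= K*exp (- c*y/2)" if "y >= 0" for y
 proof -
  define z where "z = c*y/2"
  have z: "z >= 0" "y = (2/c)*z" using that assms by (auto simp: z_def)
  have "y + y^2 + y^3 = (2/c)*z^1 + (2/c)^2*z^2 + (2/c)^3*z^3"
   by (simp add: z(2) power_mult_distrib[symmetric])
  also have "... <= (2/c)*exp z + (2/c)^2*(4*exp z) + (2/c)^3*(27*exp z)"
   using power_le_exp[OF z(1), of 1] power_le_exp[OF z(1), of 2] power_le_exp[OF z(1), of 3] assms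
   by (intro add_mono mult_left_mono) auto
  also have "... = K*exp z" by (simp add: K_def algebra_simps)
  finally have "(y + y^2 + y^3)*exp (- c*y) <= K*exp z*exp (- c*y)" by simp
  also have "... = K*exp (- c*y/2)" by (simp add: z_def exp_add[symmetric] mult.assoc)
  finally show ?thesis .
 qed
 moreover have "K > 0" using assms by (auto simp: K_def intro!: add_pos_pos)
 ultimately show ?thesis using that by blast
qed

lemma integral_odd_eq_0:
 fixes f :: "real => complex"
 assumes "!!s. f (- s) = - f s"
 shows "integral {-d..d} f = 0"
proof -
 have "integral {-d..d} f = integral {-d..d} (%s. f (- s))"
  using Henstock_Kurzweil_Integration.integral_reflect_real[of d "-d" f] by simp
 also have "... = - integral {-d..d} f" by (simp add: assms)
 finally show ?thesis by simp
qed

text \<open>The integrand is compared with a Gaussian times B0 + B1 s - n D B0 s^3. The last two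
  terms are odd and integrate to zero, so keeping them here improves the final relative error from
  1/sqrt n to 1/n. In the variable y = n s^2 everything that is dropped is at most (y + y^2 + y^3)/n
  times the Gaussian.\<close>

lemma laplace_pointwise:
 fixes c M de n s :: real and X A D b B0 B1 :: complex
 assumes c: "c > 0" and d: "de > 0" and M: "M >= 0" and n: "n >= 1" and s: "\<bar>s\<bar> <= de"
  and g: "norm (X + A * cor s^2/2 + D * cor s^3) <= M * s^4"
  and b: "norm (b - B0 - B1 * cor s) <= M * s^2"
  and r: "Re X <= - c * s^2"
  and bd: "norm D <= M" "norm B0 <= M" "norm B1 <= M" "Re A >= 2 * c"
 defines "Y \<equiv> - (cor n*A * cor s^2/2)"
  and "M1 \<equiv> M*(1 + de + de^2)" and "W \<equiv> M*(1 + de)" and "y \<equiv> n * s^2"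
 shows "norm (exp (cor n*X)*b - exp Y*(B0 + B1 * cor s - B0*(cor n*D * cor s^3)))
  <= (M + M1*M + M*W + M1*W^2)/n*((y + y^2 + y^3)*exp (- c*y))"
proof -
 define u where "u = \<bar>s\<bar>"
 have u: "u >= 0" "u <= de" "s^2 = u^2" "s^4 = u^4" "norm (cor s :: complex) = u"
  using s by (auto simp: u_def)
 have W0: "W >= 0" "M1 >= 0" using M d by (auto simp: W_def M1_def)
 define Z where "Z = cor n*X"
 define e where "e = exp (- c*y)"
 have e0: "e > 0" by (simp add: e_def)
 have y0: "y >= 0" using n by (simp add: y_def)
 have ReZ: "Re Z <= - c*y" using mult_left_mono[OF r, of n] n by (simp add: Z_def y_def algebra_simps)
 have "Re Y = - (n*(Re A) * s^2/2)" by (simp add: Y_def Re_power2 power2_eq_square)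
 moreover have "n * s^2*(2*c) <= n * s^2 * Re A" using bd(4) n by (intro mult_left_mono) auto
 ultimately have ReY: "Re Y <= - c*y" by (simp add: y_def algebra_simps)
 hence eY: "norm (exp Y) <= e" by (simp add: e_def)
 define ro where "ro = X + A * cor s^2/2 + D * cor s^3"
 have ZY: "Z - Y = cor n*(ro - D * cor s^3)"
  by (simp add: Z_def Y_def ro_def algebra_simps)
 have u4: "u^4 <= de*u^3"
 proof -
  have "u^4 = u*u^3" by (simp add: power4_eq_xxxx power3_eq_cube)
  thus ?thesis using mult_right_mono[OF u(2), of "u^3"] u(1) by simp
 qed
 have n3: "norm (D * cor s^3) <= M*u^3"
  unfolding norm_mult norm_power u(5) by (intro mult_right_mono bd(1) zero_le_power u(1))
 have n4: "norm ro <= M*u^4" using g unfolding ro_def u(4) .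
 have "norm (ro - D * cor s^3) <= M*u^4 + M*u^3"
  by (rule order_trans[OF norm_triangle_ineq4 add_mono[OF n4 n3]])
 also have "... <= M*(de*u^3) + M*u^3" using u4 M by (intro add_mono mult_left_mono) auto
 also have "... = W*u^3" by (simp add: W_def algebra_simps)
 finally have nZY: "norm (Z - Y) <= n*(W*u^3)"
  unfolding ZY norm_mult using n by (simp add: mult_left_mono)
 have p1: "norm (exp Z - exp Y - (Z - Y)*exp Y) <= (n*(W*u^3))^2*e"
 proof -
  have "norm (exp Z - exp Y - (Z - Y)*exp Y) <= norm (Z - Y)^2*exp (- c*y)"
   by (rule norm_exp_diff2_le[OF ReZ ReY])
  also have "... <= (n*(W*u^3))^2*exp (- c*y)"
   by (intro mult_right_mono power_mono nZY) auto
  finally show ?thesis by (simp add: e_def)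
 qed
 have p2: "norm (cor n*ro*exp Y) <= n*(M*u^4)*e"
  unfolding norm_mult using n4 n u(1) eY M
  by (intro mult_mono) (auto intro!: mult_nonneg_nonneg)
 have "exp Z - exp Y*(1 - cor n*D * cor s^3) = (exp Z - exp Y - (Z - Y)*exp Y) + cor n*ro*exp Y"
  unfolding ZY by (simp add: algebra_simps)
 hence q1: "norm (exp Z - exp Y*(1 - cor n*D * cor s^3)) <= (n*(W*u^3))^2*e + n*(M*u^4)*e"
  by (simp only: norm_triangle_mono[OF p1 p2])
 have "norm b <= norm (b - B0 - B1 * cor s) + norm (B0 + B1 * cor s)"
  using norm_triangle_ineq[of "b - B0 - B1 * cor s" "B0 + B1 * cor s"] by simp
 also have "norm (B0 + B1 * cor s) <= M + M*u"
  using bd u by (intro order_trans[OF norm_triangle_ineq] add_mono) (auto simp: norm_mult intro!: mult_right_mono)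
 also have "norm (b - B0 - B1 * cor s) <= M*u^2" using b u by simp
 finally have "norm b <= M*u^2 + (M + M*u)" by simp
 also have "... <= M*de^2 + (M + M*de)" using u M by (intro add_mono mult_left_mono power_mono) auto
 finally have nb: "norm b <= M1" by (simp add: M1_def algebra_simps)
 have "norm (b - B0) <= norm (b - B0 - B1 * cor s) + norm (B1 * cor s)"
  using norm_triangle_ineq[of "b - B0 - B1 * cor s" "B1 * cor s"] by simp
 also have "... <= M*u^2 + M*u"
  using bd b u by (intro add_mono) (auto simp: norm_mult intro!: mult_right_mono)
 also have "... <= M*(de*u) + M*u" using u M by (intro add_mono mult_left_mono) (auto simp: power2_eq_square mult_right_mono)
 finally have nbb: "norm (b - B0) <= W*u" by (simp add: W_def algebra_simps)
 have q2: "norm ((b - B0 - B1 * cor s) - cor n*D * cor s^3*(b - B0)) <= M*u^2 + n*M*u^3*(W*u)"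
 proof (rule order_trans[OF norm_triangle_ineq4], rule add_mono)
  show "norm (b - B0 - B1 * cor s) <= M*u^2" using b u by simp
  show "norm (cor n*D * cor s^3*(b - B0)) <= n*M*u^3*(W*u)"
   unfolding norm_mult norm_power u(5) using nbb bd n u W0 M
   by (intro mult_mono) auto
 qed
 have "exp Z*b - exp Y*(B0 + B1 * cor s - B0*(cor n*D * cor s^3))
   = (exp Z - exp Y*(1 - cor n*D * cor s^3))*b + exp Y*((b - B0 - B1 * cor s) - cor n*D * cor s^3*(b - B0))"
  by (simp add: algebra_simps)
 hence "norm (exp Z*b - exp Y*(B0 + B1 * cor s - B0*(cor n*D * cor s^3)))
  <= ((n*(W*u^3))^2*e + n*(M*u^4)*e)*M1 + e*(M*u^2 + n*M*u^3*(W*u))"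
 proof -
  have "norm ((exp Z - exp Y*(1 - cor n*D * cor s^3))*b) <= ((n*(W*u^3))^2*e + n*(M*u^4)*e)*M1"
   unfolding norm_mult using q1 nb e0 n M u by (intro mult_mono) (auto intro!: add_nonneg_nonneg mult_nonneg_nonneg)
  moreover have "norm (exp Y*((b - B0 - B1 * cor s) - cor n*D * cor s^3*(b - B0))) <= e*(M*u^2 + n*M*u^3*(W*u))"
   unfolding norm_mult using q2 eY e0 by (intro mult_mono) auto
  ultimately show ?thesis
   using norm_triangle_mono \<open>exp Z*b - _ = _\<close> by metis
 qed
 also have "... = (M*y + (M1*M + M*W)*y^2 + M1*W^2*y^3)/n*e"
  using n by (simp add: y_def u field_simps) (simp add: power2_eq_square numeral_eq_Suc algebra_simps)
 also have "... <= (M + M1*M + M*W + M1*W^2)*(y + y^2 + y^3)/n*e"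
 proof (intro mult_right_mono divide_right_mono)
  have "M*y + (M1*M + M*W)*y^2 + M1*W^2*y^3 <=
   (M + (M1*M + M*W) + M1*W^2)*y + (M + (M1*M + M*W) + M1*W^2)*y^2 + (M + (M1*M + M*W) + M1*W^2)*y^3"
  proof -
   have "M1*M >= 0" "M*W >= 0" "M1*W^2 >= 0" using M W0 by auto
   thus ?thesis using M y0 by (intro add_mono[OF add_mono[OF mult_right_mono mult_right_mono] mult_right_mono]) auto
  qed
  thus "M*y + (M1*M + M*W)*y^2 + M1*W^2*y^3 <= (M + M1*M + M*W + M1*W^2)*(y + y^2 + y^3)"
   by (simp add: algebra_simps)
 qed (use n e0 in auto)
 finally show ?thesis by (simp only: Z_def e_def) (simp add: mult.assoc)
qed

text \<open>The exponent \<open>g\<close> is normalised to vanish at its critical point 0. A single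
  M bounds all Taylor data, so that the constant obtained from de, c, M is the same for every member
  of a family; this is the source of the uniformity in x.\<close>

definition laplace_data ::
 "real => real => real => (real => complex) => (real => complex) => complex => complex => complex => complex => bool" where
 "laplace_data de c M g B A D B0 B1 \<longleftrightarrow>
  continuous_on {-de..de} g & continuous_on {-de..de} B &
  (ALL s:{-de..de}. norm (g s + A * cor s^2/2 + D * cor s^3) <= M * s^4) &
  (ALL s:{-de..de}. norm (B s - B0 - B1 * cor s) <= M * s^2) &
  (ALL s:{-de..de}. Re (g s) <= - c * s^2) &
  norm A <= M & norm D <= M & norm B0 <= M & norm B1 <= M & Re A >= 2 * c"

lemma laplace_local:
 fixes c M de :: real
 assumes c: "c > 0" and d: "de > 0" and M: "M >= 0"
 shows "EX C>=0. ALL g B A D B0 B1 n. n >= 1 --> laplace_data de c M g B A D B0 B1 -->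
  norm (integral {-de..de} (%s. exp (cor n*g s)*B s) - B0 * cor (sqrt (2 * pi/n))/csqrt A)
   <= C/(n * sqrt n)"
proof -
 obtain K where K: "K > 0" "!!y. y >= 0 ==> (y + y^2 + y^3)*exp (- c*y) <= K*exp (- c*y/2)"
  using cubic_le_exp[OF c] by blast
 define M1 where "M1 = M*(1 + de + de^2)"
 define W where "W = M*(1 + de)"
 define P where "P = M + M1*M + M*W + M1*W^2"
 define C1 where "C1 = P*K * sqrt (2 * pi/c)"
 define C2 where "C2 = M/sqrt (2*c)*(16/(c^2*de^4))*(2 * sqrt M*de + sqrt (4 * pi))"
 have P0: "P >= 0" using M d by (auto simp: P_def M1_def W_def intro!: add_nonneg_nonneg mult_nonneg_nonneg)
 have C0: "C1 + C2 >= 0" using P0 K M c d by (auto simp: C1_def C2_def)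
 have main: "norm (integral {-de..de} (%s. exp (cor n*g s)*B s) - B0 * cor (sqrt (2 * pi/n))/csqrt A)
   <= (C1 + C2)/(n * sqrt n)"
  if n: "n >= 1" and ld: "laplace_data de c M g B A D B0 B1"
  for g B :: "real => complex" and A D B0 B1 n
 proof -
  have cg: "continuous_on {-de..de} g" and cB: "continuous_on {-de..de} B"
   and g: "!!s. s : {-de..de} ==> norm (g s + A * cor s^2/2 + D * cor s^3) <= M * s^4"
   and B: "!!s. s : {-de..de} ==> norm (B s - B0 - B1 * cor s) <= M * s^2"
   and r: "!!s. s : {-de..de} ==> Re (g s) <= - c * s^2"
   and bd: "norm A <= M" "norm D <= M" "norm B0 <= M" "norm B1 <= M" "Re A >= 2 * c"
   using ld unfolding laplace_data_def by blast+
  define Y where "Y = (%s::real. - (cor n*A * cor s^2/2))"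
  define O' where "O' = (%s::real. exp (Y s)*(B1 * cor s - B0*(cor n*D * cor s^3)))"
  let ?F = "%s. exp (cor n*g s)*B s"
  let ?E = "%s::real. exp (Y s)*B0 + O' s"
  let ?G = "%s::real. P*K/n*exp (- (n * c * s^2/2))"
  have cY: "continuous_on {-de..de} Y" unfolding Y_def by (intro continuous_intros) auto
  have cO: "continuous_on {-de..de} O'" unfolding O'_def by (intro continuous_intros cY)
  have iF: "?F integrable_on {-de..de}"
   by (intro integrable_continuous_interval continuous_intros cg cB)
  have iE: "?E integrable_on {-de..de}" "(%s. exp (Y s)*B0) integrable_on {-de..de}" "O' integrable_on {-de..de}"
   by (intro integrable_continuous_interval continuous_intros cY cO)+
  have nc: "n * c > 0" using n c by simp
  have G: "(?G has_integral P*K/n * sqrt (2 * pi/(n * c))) UNIV"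
   by (rule has_integral_mult_right[OF gaussian_has_integral[OF nc]])
  have iG: "?G integrable_on {-de..de}"
   by (intro integrable_continuous_interval continuous_intros) auto
  have "norm (integral {-de..de} (%s. ?F s - ?E s)) <= integral {-de..de} ?G"
  proof (rule integral_norm_bound_integral[OF integrable_diff[OF iF iE(1)] iG])
   fix s assume s: "s : {-de..de}"
   have s': "\<bar>s\<bar> <= de" using s by auto
   have "norm (?F s - ?E s) <= P/n*((n * s^2 + (n * s^2)^2 + (n * s^2)^3)*exp (- c*(n * s^2)))"
    using laplace_pointwise[OF c d M n s' g[OF s] B[OF s] r[OF s] bd(2-5)]
    by (simp add: P_def M1_def W_def Y_def O'_def algebra_simps)
   also have "... <= P/n*(K*exp (- c*(n * s^2)/2))"
    using P0 n by (intro mult_left_mono K) auto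
   finally show "norm (?F s - ?E s) <= ?G s" by (simp add: algebra_simps)
  qed
  also have "... <= integral UNIV ?G"
   by (rule integral_subset_le[OF _ iG]) (use G P0 K n in \<open>auto simp: has_integral_iff\<close>)
  also have "... = P*K/n * sqrt (2 * pi/(n * c))" using G by (rule integral_unique)
  also have "... = C1/(n * sqrt n)" using n c by (simp add: C1_def real_sqrt_mult real_sqrt_divide)
  finally have b1: "norm (integral {-de..de} ?F - integral {-de..de} ?E) <= C1/(n * sqrt n)"
   by (simp add: Henstock_Kurzweil_Integration.integral_diff[OF iF iE(1)])
  \<comment> \<open>The odd corrections, which are of relative size 1/sqrt n pointwise, disappear
    here.\<close>
  have "integral {-de..de} O' = 0" by (rule integral_odd_eq_0) (simp add: O'_def Y_def algebra_simps)
  hence IE: "integral {-de..de} ?E = integral {-de..de} (%s. exp (Y s))*B0"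
   by (simp add: Henstock_Kurzweil_Integration.integral_add[OF iE(2,3)])
  have n0: "n > 0" using n by simp
  have A0: "sqrt (2*c) <= norm (csqrt A)"
  proof -
   have "Re A >= 0" using bd c by linarith
   hence "sqrt (Re A) <= norm (csqrt A)" using Re_csqrt_ge[of A] complex_Re_le_cmod[of "csqrt A"] by linarith
   thus ?thesis using bd by (meson order_trans real_sqrt_le_mono)
  qed
  have s0: "sqrt (2*c) > 0" using c by simp
  hence Anz: "csqrt A ~= 0" using A0 by fastforce
  \<comment> \<open>The exponentially small tail is weakened to the order of the other error by z^2
    <= 4 exp z.\<close>
  have ex: "exp (- (n * c*de^2/2)) <= 16/(c^2*de^4)/(n * sqrt n)"
  proof -
   let ?z = "n * c*de^2/2"
   have "?z^2 <= 4*exp ?z" using power_le_exp[of ?z 2] n c by simp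
   hence "exp (- ?z) <= 4 / ?z^2" using n c d by (simp add: exp_minus field_simps)
   also have "... = 16/(c^2*de^4)/n^2" by (simp add: power_mult_distrib power_divide power_mult[symmetric])
   also have "... <= 16/(c^2*de^4)/(n * sqrt n)"
    using n c d by (intro divide_left_mono) (auto simp: power2_eq_square real_sqrt_le_iff intro!: mult_left_mono real_le_lsqrt)
   finally show ?thesis .
  qed
  have "norm (integral {-de..de} ?E - B0 * cor (sqrt (2 * pi/n))/csqrt A) =
   norm B0/norm (csqrt A)*norm (csqrt A*integral {-de..de} (%s. exp (Y s)) - cor (sqrt (2 * pi/n)))"
   unfolding IE norm_mult[symmetric] norm_divide[symmetric] using Anz by (simp add: field_simps)
  also have "... <= M/sqrt (2*c)*(16/(c^2*de^4)/(n * sqrt n)*(2 * sqrt M*de + sqrt (4 * pi)))"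
  proof (rule mult_mono)
   show "norm B0/norm (csqrt A) <= M/sqrt (2*c)" using bd A0 s0 M by (intro frac_le) auto
   have "norm (csqrt A*integral {-de..de} (%s. exp (Y s)) - cor (sqrt (2 * pi/n)))
     <= exp (- (n * c*de^2/2))*(2*norm (csqrt A)*de + sqrt (4 * pi/n))"
    using complex_gaussian_truncated[OF n0 d c bd(5)] by (simp add: Y_def)
   also have "... <= 16/(c^2*de^4)/(n * sqrt n)*(2 * sqrt M*de + sqrt (4 * pi))"
   proof (rule mult_mono[OF ex])
    have "norm (csqrt A) <= sqrt M" using bd by simp
    moreover have "sqrt (4 * pi/n) <= sqrt (4 * pi)" using n by (simp add: field_simps)
    ultimately show "2*norm (csqrt A)*de + sqrt (4 * pi/n) <= 2 * sqrt M*de + sqrt (4 * pi)"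
     using d M by (intro add_mono mult_mono) auto
   qed (use c d n in auto)
   finally show "norm (csqrt A*integral {-de..de} (%s. exp (Y s)) - cor (sqrt (2 * pi/n)))
     <= 16/(c^2*de^4)/(n * sqrt n)*(2 * sqrt M*de + sqrt (4 * pi))" .
  qed (use M c in auto)
  also have "... = C2/(n * sqrt n)" by (simp only: C2_def times_divide_eq_left times_divide_eq_right divide_divide_eq_left mult.assoc)
  finally have b2: "norm (integral {-de..de} ?E - B0 * cor (sqrt (2 * pi/n))/csqrt A) <= C2/(n * sqrt n)" .
  show ?thesis using norm_triangle_mono[OF b1 b2] by (simp add: add_divide_distrib)
 qed
 show ?thesis using C0 main by blast
qed

section \<open>Laplace's method along a curve, uniform in a moving critical point\<close>

lemma taylor_on_real_interval:
 fixes F :: "complex => complex" and a b :: real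
 assumes S: "open S" and F: "F holomorphic_on S" and sub: "!!r. r : {a..b} ==> cor r : S"
 obtains M where "M >= 0" "!!i r. i <= 4 ==> r : {a..b} ==> norm ((deriv ^^ i) F (cor r)) <= M"
  "!!r r0. r : {a..b} ==> r0 : {a..b} ==>
   norm (F (cor r) - (\<Sum>i\<le>3. (deriv ^^ i) F (cor r0)*(cor r - cor r0)^i/fact i)) <= M*(r - r0)^4"
  "!!r r0. r : {a..b} ==> r0 : {a..b} ==>
   norm (F (cor r) - F (cor r0) - deriv F (cor r0)*(cor r - cor r0)) <= M*(r - r0)^2"
proof -
 let ?I = "cor ` {a..b}"
 have sub': "?I \<subseteq> S" using sub by auto
 have cI: "compact ?I" by (intro compact_continuous_image continuous_intros) auto
 have vI: "convex ?I" by (intro convex_linear_image) (auto simp: linear_of_real)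
 have h: "(deriv ^^ i) F holomorphic_on S" for i by (rule holomorphic_higher_deriv[OF F S])
 have "EX M. ALL x:?I. norm ((deriv ^^ i) F x) <= M" for i
 proof -
  have "compact ((deriv ^^ i) F ` ?I)"
   by (intro compact_continuous_image cI holomorphic_on_imp_continuous_on holomorphic_on_subset[OF h sub'])
  from compact_imp_bounded[OF this] show ?thesis by (auto simp: bounded_iff)
 qed
 then obtain N where N: "!!i x. x : ?I ==> norm ((deriv ^^ i) F x) <= N i" by metis
 define M where "M = (\<Sum>i\<le>4. \<bar>N i\<bar>)"
 have NM: "N i <= M" if "i <= 4" for i
 proof -
  have "\<bar>N i\<bar> <= M" unfolding M_def by (rule member_le_sum) (use that in auto)
  thus ?thesis by simp
 qed
 have M0: "M >= 0" by (simp add: M_def sum_nonneg)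
 have bd: "norm ((deriv ^^ i) F x) <= M" if "i <= 4" "x : ?I" for i x
  using N[OF that(2), of i] NM[OF that(1)] by linarith
 have der: "((deriv ^^ i) F has_field_derivative (deriv ^^ Suc i) F x) (at x within ?I)" if "x : ?I" for i x
  using holomorphic_derivI[OF h S] sub' that by (auto intro: has_field_derivative_at_within)
 have nr: "norm (cor r - cor r0 :: complex) = \<bar>r - r0\<bar>" for r r0 :: real
  by (metis norm_of_real of_real_diff)
 show ?thesis
 proof (rule that[OF M0])
  fix r r0 assume r: "r : {a..b}" "r0 : {a..b}"
  have "norm ((deriv ^^ 0) F (cor r) - (\<Sum>i\<le>3. (deriv ^^ i) F (cor r0)*(cor r - cor r0)^i/fact i)) <= M*norm (cor r - cor r0 :: complex)^(Suc 3)/fact 3"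
   by (rule complex_Taylor[OF vI]) (use der bd r in auto)
  also have "... <= M*(r - r0)^4" using M0 by (simp add: nr fact_numeral)
  finally show "norm (F (cor r) - (\<Sum>i\<le>3. (deriv ^^ i) F (cor r0)*(cor r - cor r0)^i/fact i)) <= M*(r - r0)^4" by simp
  have "norm ((deriv ^^ 0) F (cor r) - (\<Sum>i\<le>1. (deriv ^^ i) F (cor r0)*(cor r - cor r0)^i/fact i)) <= M*norm (cor r - cor r0 :: complex)^(Suc 1)/fact 1"
   by (rule complex_Taylor[OF vI]) (use der bd[of 2] r in \<open>auto simp: numeral_2_eq_2\<close>)
  thus "norm (F (cor r) - F (cor r0) - deriv F (cor r0)*(cor r - cor r0)) <= M*(r - r0)^2"
   by (simp add: nr algebra_simps power2_eq_square[symmetric])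
 qed (use bd in auto)
qed

text \<open>The exponent belonging to r0 is Ps + Lb(r0) T, and \<open>Ps_deriv\<close> says that r0
  is its critical point, for every r0 at once. Because of \<open>Re_T\<close> the real part of the
  exponent has derivative Lb r0 - Lb r along the real interval; as Lb grows at least at rate m, its
  maximum is at r0.\<close>

locale laplace_curve =
 fixes S :: "complex set" and Ps T B :: "complex => complex" and Lb Lb' :: "real => real" and a b m :: real
 assumes open_S: "open S"
  and hol: "Ps holomorphic_on S" "T holomorphic_on S" "B holomorphic_on S"
  and ab: "a < b" and sub: "!!r. r : {a..b} ==> cor r : S"
  and Lb_deriv: "!!r. r : {a..b} ==> (Lb has_real_derivative Lb' r) (at r within {a..b})"
  and Lb'_cont: "continuous_on {a..b} Lb'"
  and m: "m > 0" "!!r. r : {a..b} ==> Lb' r >= m"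
  and Ps_deriv: "!!r. r : {a..b} ==> deriv Ps (cor r) = - cor (Lb r)*deriv T (cor r)"
  and Re_T: "!!r. r : {a..b} ==> Re (deriv T (cor r)) = 1"
begin

definition phase :: "real => real => complex" where
 "phase r0 r = Ps (cor r) + cor (Lb r0)*T (cor r)"

lemma Lb_cont: "continuous_on {a..b} Lb"
 using Lb_deriv by (meson DERIV_continuous continuous_on_eq_continuous_within)

lemma Lb_growth:
 assumes "r : {a..b}" "r' : {a..b}" "r <= r'"
 shows "Lb r' - Lb r >= m*(r' - r)"
proof -
 have "(%x. Lb x - m*x) r <= (%x. Lb x - m*x) r'"
 proof (rule DERIV_nonneg_imp_increasing_open[OF assms(3)])
  show "continuous_on {r..r'} (%x. Lb x - m*x)"
   by (intro continuous_intros continuous_on_subset[OF Lb_cont]) (use assms in auto)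
  fix x assume x: "r < x" "x < r'"
  have "(Lb has_real_derivative Lb' x) (at x)"
   using Lb_deriv[of x] x assms at_within_Icc_at[of a x b] by auto
  thus "EX y. ((%x. Lb x - m*x) has_real_derivative y) (at x) & 0 <= y"
   using m(2)[of x] x assms by (intro exI[of _ "Lb' x - m"]) (auto intro!: derivative_eq_intros)
 qed
 thus ?thesis by (simp add: algebra_simps)
qed

lemma Re_phase_deriv:
 assumes "r : {a..b}"
 shows "((%r. Re (phase r0 r)) has_real_derivative (Lb r0 - Lb r)) (at r within {a..b})"
proof -
 have "((%z. Ps z + cor (Lb r0)*T z) has_field_derivative (deriv Ps (cor r) + cor (Lb r0)*deriv T (cor r))) (at (cor r))"
  by (auto intro!: derivative_eq_intros holomorphic_derivI[OF _ open_S] hol sub assms)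
 hence "((%r. phase r0 r) has_vector_derivative (deriv Ps (cor r) + cor (Lb r0)*deriv T (cor r))) (at r within {a..b})"
  unfolding phase_def by (rule has_vector_derivative_at_within[OF has_vector_derivative_real_field])
 hence "((%r. Re (phase r0 r)) has_vector_derivative Re (deriv Ps (cor r) + cor (Lb r0)*deriv T (cor r))) (at r within {a..b})"
  by (rule bounded_linear.has_vector_derivative[OF bounded_linear_Re])
 thus ?thesis using Ps_deriv[OF assms] Re_T[OF assms] by (simp add: has_real_derivative_iff_has_vector_derivative)
qed

text \<open>The derivative Lb r0 - Lb r has the sign of r0 - r and modulus at least m |r - r0|;
  adding m/2 (r - r0)^2 therefore still leaves a function with maximum at r0.\<close>

lemma Re_phase_le:
 assumes "r0 : {a..b}" "r : {a..b}"
 shows "Re (phase r0 r) <= Re (phase r0 r0) - m/2*(r - r0)^2"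
proof -
 define f where "f = (%r. Re (phase r0 r) + m/2*(r - r0)^2)"
 have f: "(f has_real_derivative (Lb r0 - Lb r + m*(r - r0))) (at r within {a..b})" if "r : {a..b}" for r
  unfolding f_def by (rule derivative_eq_intros Re_phase_deriv that refl)+ (simp add: algebra_simps)
 have f': "(f has_real_derivative (Lb r0 - Lb r + m*(r - r0))) (at r)" if "a < r" "r < b" for r
  using f[of r] that at_within_Icc_at[of a r b] by auto
 have fc: "continuous_on {a..b} f"
  using f by (meson DERIV_continuous continuous_on_eq_continuous_within)
 have "f r <= f r0"
 proof (cases "r <= r0")
  case True
  show ?thesis
  proof (rule DERIV_nonneg_imp_increasing_open[OF True])
   fix x assume x: "r < x" "x < r0"
   have "Lb r0 - Lb x >= m*(r0 - x)" by (rule Lb_growth) (use x assms in auto)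
   thus "EX y. (f has_real_derivative y) (at x) & 0 <= y"
    using f'[of x] x assms by (intro exI[of _ "Lb r0 - Lb x + m*(x - r0)"]) (auto simp: algebra_simps)
  qed (use assms in \<open>auto intro: continuous_on_subset[OF fc]\<close>)
 next
  case False
  hence le: "r0 <= r" by simp
  show ?thesis
  proof (rule DERIV_nonpos_imp_decreasing_open[OF le])
   fix x assume x: "r0 < x" "x < r"
   have "Lb x - Lb r0 >= m*(x - r0)" by (rule Lb_growth) (use x assms in auto)
   thus "EX y. (f has_real_derivative y) (at x) & y <= 0"
    using f'[of x] x assms by (intro exI[of _ "Lb r0 - Lb x + m*(x - r0)"]) (auto simp: algebra_simps)
  qed (use assms in \<open>auto intro: continuous_on_subset[OF fc]\<close>)
 qed
 thus ?thesis by (simp add: f_def)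
qed

text \<open>The critical point relation \<open>Ps_deriv\<close> holds along the whole interval and
  can be differentiated; the terms with Lb(r0) cancel and only Lb' T' survives.\<close>

lemma second_deriv:
 assumes "a < r0" "r0 < b"
 shows "deriv (deriv Ps) (cor r0) + cor (Lb r0)*deriv (deriv T) (cor r0) = - cor (Lb' r0)*deriv T (cor r0)"
proof -
 have hd: "deriv Ps holomorphic_on S" "deriv T holomorphic_on S"
  using hol by (auto intro: holomorphic_deriv open_S)
 have r0: "r0 : {a..b}" "cor r0 : S" using assms sub by auto
 have v: "((%r. F (cor r)) has_vector_derivative deriv F (cor r0)) (at r0)" if "F holomorphic_on S" for F
  by (rule has_vector_derivative_real_field[OF holomorphic_derivI[OF that open_S r0(2)]])
 have L: "(Lb has_real_derivative Lb' r0) (at r0)"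
  using Lb_deriv[OF r0(1)] assms at_within_Icc_at[of a r0 b] by auto
 have L': "((%r. cor (Lb r)) has_vector_derivative cor (Lb' r0)) (at r0)"
  by (rule has_vector_derivative_of_real) (use L in \<open>simp add: has_real_derivative_iff_has_vector_derivative\<close>)
 have "((%r. - (cor (Lb r)*deriv T (cor r))) has_vector_derivative
     - (cor (Lb r0)*deriv (deriv T) (cor r0) + cor (Lb' r0)*deriv T (cor r0))) (at r0)"
  by (intro has_vector_derivative_minus has_vector_derivative_mult L' v hd)
 moreover have "((%r. deriv Ps (cor r)) has_vector_derivative deriv (deriv Ps) (cor r0)) (at r0)"
  by (rule v[OF hd(1)])
 ultimately have "deriv (deriv Ps) (cor r0) = - (cor (Lb r0)*deriv (deriv T) (cor r0) + cor (Lb' r0)*deriv T (cor r0))"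
 proof (intro vector_derivative_unique_at)
  assume "((%r. - (cor (Lb r)*deriv T (cor r))) has_vector_derivative
     - (cor (Lb r0)*deriv (deriv T) (cor r0) + cor (Lb' r0)*deriv T (cor r0))) (at r0)"
  thus "((%r. deriv Ps (cor r)) has_vector_derivative
     - (cor (Lb r0)*deriv (deriv T) (cor r0) + cor (Lb' r0)*deriv T (cor r0))) (at r0)"
   by (rule has_vector_derivative_transform_within_open[of _ _ _ "{a<..<b}"]) (use assms Ps_deriv in auto)
 qed
 thus ?thesis by (simp add: algebra_simps)
qed

text \<open>In the window of radius de around r0 the local estimate applies with Taylor bounds taken
  over the whole compact interval. Outside the window \<open>Re_phase_le\<close> makes the integrand
  exponentially small.\<close>

lemma laplace_uniform:
 assumes "de > 0"
 obtains C where "C >= 0" "!!n r0. n >= 1 ==> r0 : {a+de..b-de} ==>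
  norm (integral {a..b} (%r. exp (cor n * phase r0 r)*B (cor r))
   - exp (cor n * phase r0 r0)*(B (cor r0) * cor (sqrt (2 * pi/n))/csqrt (deriv T (cor r0) * cor (Lb' r0))))
  <= C/(n * sqrt n)*exp (n * Re (phase r0 r0))"
proof -
 obtain MPs where Psb: "MPs >= 0" "!!i r. i <= 4 ==> r : {a..b} ==> norm ((deriv ^^ i) Ps (cor r)) <= MPs"
  "!!r r0. r : {a..b} ==> r0 : {a..b} ==>
   norm (Ps (cor r) - (\<Sum>i\<le>3. (deriv ^^ i) Ps (cor r0)*(cor r - cor r0)^i/fact i)) <= MPs*(r - r0)^4"
  by (rule taylor_on_real_interval[OF open_S hol(1)]) (erule sub, rule that)
 obtain MT where Tb: "MT >= 0" "!!i r. i <= 4 ==> r : {a..b} ==> norm ((deriv ^^ i) T (cor r)) <= MT"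
  "!!r r0. r : {a..b} ==> r0 : {a..b} ==>
   norm (T (cor r) - (\<Sum>i\<le>3. (deriv ^^ i) T (cor r0)*(cor r - cor r0)^i/fact i)) <= MT*(r - r0)^4"
  by (rule taylor_on_real_interval[OF open_S hol(2)]) (erule sub, rule that)
 obtain MB where Bb: "MB >= 0" "!!i r. i <= 4 ==> r : {a..b} ==> norm ((deriv ^^ i) B (cor r)) <= MB"
  "!!r r0. r : {a..b} ==> r0 : {a..b} ==>
   norm (B (cor r) - B (cor r0) - deriv B (cor r0)*(cor r - cor r0)) <= MB*(r - r0)^2"
  by (rule taylor_on_real_interval[OF open_S hol(3)]) (erule sub, rule that)
 have "bounded (Lb ` {a..b})" "bounded (Lb' ` {a..b})"
  by (intro compact_imp_bounded compact_continuous_image Lb_cont Lb'_cont compact_Icc)+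
 then obtain L0 L1 where "ALL r:{a..b}. \<bar>Lb r\<bar> <= L0" "ALL r:{a..b}. \<bar>Lb' r\<bar> <= L1"
  unfolding bounded_iff by auto
 hence "ALL r:{a..b}. \<bar>Lb r\<bar> <= max 0 (max L0 L1) & \<bar>Lb' r\<bar> <= max 0 (max L0 L1)" by fastforce
 then obtain L where L: "L >= 0" "!!r. r : {a..b} ==> \<bar>Lb r\<bar> <= L" "!!r. r : {a..b} ==> \<bar>Lb' r\<bar> <= L"
  using max.cobounded1[of 0 "max L0 L1"] by blast
 define M where "M = MPs + L*MT + MB + L*MT"
 have M0: "M >= 0" using Psb(1) Tb(1) Bb(1) L(1) by (simp add: M_def)
 define c where "c = m/2"
 have c: "c > 0" using m by (simp add: c_def)
 obtain C where C: "C >= 0" "!!g B A D B0 B1 n. n >= 1 ==> laplace_data de c M g B A D B0 B1 ==>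
  norm (integral {-de..de} (%s. exp (cor n*g s)*B s) - B0 * cor (sqrt (2 * pi/n))/csqrt A)
   <= C/(n * sqrt n)"
  using laplace_local[OF c assms M0] by blast
 define C2 where "C2 = M*(b - a)*(4/(c*de^2)^2)"
 have C2: "C2 >= 0" using M0 ab c assms by (simp add: C2_def)
 have cont: "continuous_on {a..b} (%r. F (cor r))" if "F holomorphic_on S" for F
  by (rule continuous_on_compose2[OF holomorphic_on_imp_continuous_on[OF that]]) (use sub in \<open>auto intro!: continuous_intros\<close>)
 have phc: "continuous_on {a..b} (phase r0)" for r0
  unfolding phase_def by (intro continuous_intros cont hol)
 have MB: "norm (B (cor r)) <= M" if "r : {a..b}" for r
 proof -
  have "L*MT >= 0" using Tb(1) L(1) by simp
  thus ?thesis using Bb(2)[OF _ that, of 0] Psb(1) by (simp add: M_def)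
 qed
 have main: "norm (integral {a..b} (%r. exp (cor n * phase r0 r)*B (cor r))
   - exp (cor n * phase r0 r0)*(B (cor r0) * cor (sqrt (2 * pi/n))/csqrt (deriv T (cor r0) * cor (Lb' r0))))
  <= (C + C2)/(n * sqrt n)*exp (n * Re (phase r0 r0))"
  if n: "n >= 1" and r0: "r0 : {a+de..b-de}" for n r0
 proof -
  have r0': "r0 : {a..b}" "a < r0" "r0 < b" using r0 assms by auto
  have LTp: "L*MT >= 0" using Tb(1) L(1) by simp
  have in_ab: "r0 + s : {a..b}" if "s : {-de..de}" for s using that r0 by auto
  define g where "g = (%s. phase r0 (r0 + s) - phase r0 r0)"
  define f where "f = (%r. exp (cor n * phase r0 r)*B (cor r))"
  define A where "A = deriv T (cor r0) * cor (Lb' r0)"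
  \<comment> \<open>\<open>laplace_data\<close> has the exponent as - A s^2/2 - D s^3, so D is minus
    the third Taylor coefficient; that A is minus the second derivative is
    \<open>second_deriv\<close>.\<close>
  define D where "D = - (((deriv^^3) Ps (cor r0) + cor (Lb r0)*(deriv^^3) T (cor r0))/6)"
  define Z where "Z = integral {-de..de} (%s. exp (cor n*g s)*B (cor (r0 + s)))"
  have lap: "norm (Z - B (cor r0) * cor (sqrt (2 * pi/n))/csqrt A) <= C/(n * sqrt n)"
   unfolding Z_def
  proof (rule C(2)[OF n])
   show "laplace_data de c M g (%s. B (cor (r0 + s))) A D (B (cor r0)) (deriv B (cor r0))"
    unfolding laplace_data_def
   proof (intro conjI ballI)
   have im: "(%s. r0 + s) ` {-de..de} \<subseteq> {a..b}" using in_ab by blast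
   show "continuous_on {-de..de} g" unfolding g_def
    by (intro continuous_intros continuous_on_compose2[OF phc _ im])
   show "continuous_on {-de..de} (%s. B (cor (r0 + s)))"
    by (rule continuous_on_compose2[OF cont[OF hol(3)] _ im]) (intro continuous_intros)
   show "norm (B (cor (r0 + s)) - B (cor r0) - deriv B (cor r0) * cor s) <= M * s^2" if s: "s : {-de..de}" for s
   proof -
    have "norm (B (cor (r0 + s)) - B (cor r0) - deriv B (cor r0) * cor s) <= MB * s^2"
     using Bb(3)[OF in_ab[OF s] r0'(1)] by simp
    also have "... <= M * s^2" using Psb(1) LTp by (intro mult_right_mono) (auto simp: M_def)
    finally show ?thesis .
   qed
   show "Re (g s) <= - c * s^2" if s: "s : {-de..de}" for s
    using Re_phase_le[OF r0'(1) in_ab[OF s]] by (simp add: g_def c_def)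
   show "norm (g s + A * cor s^2/2 + D * cor s^3) <= M * s^4" if s: "s : {-de..de}" for s
   proof -
    let ?PPs = "\<Sum>i\<le>3. (deriv ^^ i) Ps (cor r0)*(cor s)^i/fact i"
    let ?PT = "\<Sum>i\<le>3. (deriv ^^ i) T (cor r0)*(cor s)^i/fact i"
    have e1: "norm (Ps (cor (r0 + s)) - ?PPs) <= MPs * s^4" using Psb(3)[OF in_ab[OF s] r0'(1)] by simp
    have e2: "norm (T (cor (r0 + s)) - ?PT) <= MT * s^4" using Tb(3)[OF in_ab[OF s] r0'(1)] by simp
    have d1: "deriv Ps (cor r0) + cor (Lb r0)*deriv T (cor r0) = 0" using Ps_deriv[OF r0'(1)] by simp
    have d2: "A = - (deriv (deriv Ps) (cor r0) + cor (Lb r0)*deriv (deriv T) (cor r0))"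
     using second_deriv[OF r0'(2,3)] by (simp add: A_def)
    have "g s + A * cor s^2/2 + D * cor s^3 - (deriv Ps (cor r0) + cor (Lb r0)*deriv T (cor r0)) * cor s
     = (Ps (cor (r0 + s)) - ?PPs) + cor (Lb r0)*(T (cor (r0 + s)) - ?PT)"
     unfolding g_def phase_def d2 D_def
     by (simp add: atMost_nat_numeral fact_numeral numeral_2_eq_2 numeral_3_eq_3 algebra_simps) (simp add: field_simps)
    hence "norm (g s + A * cor s^2/2 + D * cor s^3) = norm ((Ps (cor (r0 + s)) - ?PPs) + cor (Lb r0)*(T (cor (r0 + s)) - ?PT))"
     unfolding d1 by simp
    also have "... <= MPs * s^4 + L*(MT * s^4)"
     using e1 e2 L(1) L(2)[OF r0'(1)] Tb(1) by (intro order_trans[OF norm_triangle_ineq] add_mono) (auto simp: norm_mult intro!: mult_mono)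
    also have "... = (MPs + L*MT) * s^4" by (simp add: algebra_simps)
    also have "... <= M * s^4" using Bb(1) LTp by (intro mult_right_mono) (auto simp: M_def)
    finally show ?thesis .
   qed
   have LT: "norm (cor x*(deriv ^^ i) T (cor r0)) <= L*MT" if "\<bar>x\<bar> <= L" "i <= 4" for x i
    unfolding norm_mult using that Tb(2)[OF that(2) r0'(1)] L(1) by (intro mult_mono) auto
   show "norm A <= M" unfolding A_def using LT[OF L(3)[OF r0'(1)], of 1] Bb(1) Psb(1) LTp by (simp add: M_def mult.commute)
   have "norm D <= norm ((deriv^^3) Ps (cor r0) + cor (Lb r0)*(deriv^^3) T (cor r0))"
    by (simp add: D_def norm_divide)
   also have "... <= MPs + L*MT"
    by (intro order_trans[OF norm_triangle_ineq] add_mono Psb(2) r0'(1) LT L(2)) auto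
   finally show "norm D <= M" using Bb(1) LTp by (simp add: M_def)
   show "norm (B (cor r0)) <= M" by (rule MB[OF r0'(1)])
   show "norm (deriv B (cor r0)) <= M" using Bb(2)[of 1, OF _ r0'(1)] Psb(1) LTp by (simp add: M_def)
   show "Re A >= 2 * c" using Re_T[OF r0'(1)] m(2)[OF r0'(1)] by (simp add: A_def c_def)
   qed
  qed
  have fi: "f integrable_on {u..v}" if "{u..v} \<subseteq> {a..b}" for u v
   unfolding f_def by (intro integrable_continuous_interval continuous_intros continuous_on_subset[OF _ that] phc cont hol)
  have "integral {r0-de..r0+de} f = integral {-de..de} (%s. f (r0 + s))"
   using integral_shift_Icc_real[of "-de" de f r0] by (simp add: add.commute o_def)
  also have "(%s. f (r0 + s)) = (%s. exp (cor n * phase r0 r0)*(exp (cor n*g s)*B (cor (r0 + s))))"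
   by (simp add: f_def g_def algebra_simps exp_add[symmetric] mult.assoc[symmetric])
  finally have cen: "integral {r0-de..r0+de} f = exp (cor n * phase r0 r0)*Z" by (simp add: Z_def)
  define E where "E = exp (n * Re (phase r0 r0))"
  have n0: "n > 0" using n by simp
  have ex: "exp (- (n * c*de^2)) <= (4/(c*de^2)^2)/(n * sqrt n)"
  proof -
   let ?z = "n*(c*de^2)"
   have "?z^2 <= 4*exp ?z" using power_le_exp[of ?z 2] n c by simp
   hence "exp (- ?z) <= 4 / ?z^2" using n c assms by (simp add: exp_minus field_simps)
   also have "... = 4/(c*de^2)^2/n^2" by (simp add: power_mult_distrib)
   also have "... <= 4/(c*de^2)^2/(n * sqrt n)"
    using n c by (intro divide_left_mono) (auto simp: power2_eq_square intro!: mult_left_mono real_le_lsqrt)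
   finally show ?thesis by (simp add: mult.assoc)
  qed
  have fb: "norm (f r) <= M*exp (- (n * c*de^2))*E" if "r : {a..b}" "\<bar>r - r0\<bar> >= de" for r
  proof -
   have "de^2 <= (r - r0)^2" using that(2) assms by (metis abs_le_square_iff abs_of_pos)
   hence "c*de^2 <= c*(r - r0)^2" using c by simp
   hence "Re (phase r0 r) <= Re (phase r0 r0) - c*de^2" using Re_phase_le[OF r0'(1) that(1)] by (simp add: c_def)
   hence "n * Re (phase r0 r) <= n*(Re (phase r0 r0) - c*de^2)" using n by (intro mult_left_mono) auto
   hence "exp (n * Re (phase r0 r)) <= exp (- (n * c*de^2))*E" by (simp add: E_def exp_add[symmetric] algebra_simps)
   hence "exp (n * Re (phase r0 r))*norm (B (cor r)) <= exp (- (n * c*de^2))*E*M"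
    by (intro mult_mono MB that) (auto simp: E_def)
   thus ?thesis by (simp add: f_def norm_mult algebra_simps)
  qed
  have i1: "norm (integral {a..r0-de} f) <= M*exp (- (n * c*de^2))*E*((r0 - de) - a)"
  proof (rule integral_bound)
   show "continuous_on {a..r0-de} f" unfolding f_def
    by (intro continuous_intros continuous_on_subset[OF phc] continuous_on_subset[OF cont[OF hol(3)]]) (use r0 assms in auto)
  qed (use r0 assms in \<open>auto intro!: fb\<close>)
  have i2: "norm (integral {r0+de..b} f) <= M*exp (- (n * c*de^2))*E*(b - (r0 + de))"
  proof (rule integral_bound)
   show "continuous_on {r0+de..b} f" unfolding f_def
    by (intro continuous_intros continuous_on_subset[OF phc] continuous_on_subset[OF cont[OF hol(3)]]) (use r0 assms in auto)
  qed (use r0 assms in \<open>auto intro!: fb\<close>)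
  have "integral {a..b} f = integral {a..r0-de} f + integral {r0-de..b} f"
   by (rule Henstock_Kurzweil_Integration.integral_combine[symmetric]) (use r0 assms in \<open>auto intro!: fi\<close>)
  also have "integral {r0-de..b} f = integral {r0-de..r0+de} f + integral {r0+de..b} f"
   by (rule Henstock_Kurzweil_Integration.integral_combine[symmetric]) (use r0 assms in \<open>auto intro!: fi\<close>)
  finally have split: "integral {a..b} f = integral {a..r0-de} f + integral {r0+de..b} f + exp (cor n * phase r0 r0)*Z"
   using cen by simp
  let ?R = "B (cor r0) * cor (sqrt (2 * pi/n))/csqrt A"
  have "norm (integral {a..b} f - exp (cor n * phase r0 r0) * ?R) = norm (integral {a..r0-de} f + integral {r0+de..b} f + exp (cor n * phase r0 r0)*(Z - ?R))"
   unfolding split by (simp add: algebra_simps)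
  also have "... <= M*exp (- (n * c*de^2))*E*((r0 - de) - a) + M*exp (- (n * c*de^2))*E*(b - (r0 + de)) + E*(C/(n * sqrt n))"
   using mult_left_mono[OF lap, of E] by (intro norm_triangle_le add_mono i1 i2) (auto simp: norm_mult E_def)
  also have "... <= (M*(b - a))*exp (- (n * c*de^2))*E + E*(C/(n * sqrt n))"
  proof -
   have "0 <= (2*de)*(M*exp (- (n * c*de^2))*E)" using assms M0 by (simp add: E_def)
   thus ?thesis by (simp add: algebra_simps)
  qed
  also have "... <= (M*(b - a))*((4/(c*de^2)^2)/(n * sqrt n))*E + E*(C/(n * sqrt n))"
   using M0 ab by (intro add_right_mono mult_right_mono mult_left_mono ex) (auto simp: E_def)
  also have "... = (C + C2)/(n * sqrt n)*E" by (simp add: C2_def add_divide_distrib algebra_simps)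
  finally show ?thesis by (simp add: f_def E_def A_def)
 qed
 show ?thesis by (rule that[of "C + C2"]) (use C(1) C2 main in auto)
qed

end

section \<open>Stirling-type estimates for products of linear factors\<close>

definition lf :: "complex => complex" where "lf v = v * Ln v - v"

text \<open>On this set the argument lies in [0, pi), so a difference of two logarithms has
  imaginary part in (-pi, pi) and \<open>Ln\<close> of a quotient splits without a correction by 2
  pi i. The set is stable under shifts to the right.\<close>

definition upper_slit :: "complex set" where "upper_slit = {y. Im y >= 0 & y ~: \<real>\<^sub>\<le>\<^sub>0}"

lemma upper_slit_add:
 assumes "y : upper_slit" "r >= 0" shows "y + cor r : upper_slit"
 using assms by (auto simp: upper_slit_def complex_nonpos_Reals_iff)

lemma upper_slit_nonzero: "y : upper_slit ==> y ~= 0"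
 by (auto simp: upper_slit_def)

lemma Im_Ln_upper_slit:
 assumes "y : upper_slit" shows "0 <= Im (Ln y)" "Im (Ln y) < pi"
proof -
 have y: "y ~= 0" "Im y >= 0" "y ~: \<real>\<^sub>\<le>\<^sub>0" using assms by (auto simp: upper_slit_def)
 show "0 <= Im (Ln y)" using Im_Ln_pos_le[OF y(1)] y(2) by simp
 have "Im (Ln y) ~= pi" using y Im_Ln_eq_pi[OF y(1)] by (auto simp: complex_nonpos_Reals_iff)
 thus "Im (Ln y) < pi" using Im_Ln_le_pi[OF y(1)] by simp
qed

lemma Ln_divide_upper_slit:
 assumes "y : upper_slit" "y' : upper_slit"
 shows "Ln (y' / y) = Ln y' - Ln y"
proof -
 have "exp (Ln y' - Ln y) = y' / y" using assms[THEN upper_slit_nonzero] by (simp add: exp_diff)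
 moreover have "Ln (exp (Ln y' - Ln y)) = Ln y' - Ln y"
  using Im_Ln_upper_slit[OF assms(1)] Im_Ln_upper_slit[OF assms(2)] by (intro Ln_exp) auto
 ultimately show ?thesis by simp
qed

lemma Ln_add_one:
 assumes "y : upper_slit" shows "Ln (y + 1) = Ln y + Ln (1 + 1/y)"
proof -
 have "y + 1 : upper_slit" using upper_slit_add[OF assms, of 1] by simp
 from Ln_divide_upper_slit[OF assms this] show ?thesis
  using upper_slit_nonzero[OF assms] by (simp add: add_divide_distrib)
qed

lemma norm_Ln_one_plus_diff1:
 fixes z :: complex assumes "norm z <= 1/2"
 shows "norm (Ln (1 + z) - z) <= 2*norm z^2"
proof -
 have "norm (Ln (1 + z) - z) <= norm z^2/(1 - norm z)" using assms by (intro Ln_approx_linear) auto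
 also have "... <= norm z^2/(1/2)" using assms by (intro divide_left_mono) auto
 finally show ?thesis by simp
qed

lemma norm_Ln_one_plus_diff2:
 fixes z :: complex assumes "norm z <= 1/2"
 shows "norm (Ln (1 + z) - z + z^2/2) <= 2*norm z^3"
proof -
 have "norm ((Ln (1 + z) - z + z^2/2) - (Ln (1 + 0) - 0 + 0^2/2)) <= (2*norm z^2)*norm (z - 0)"
 proof (rule field_differentiable_bound[of "cball 0 (norm z)" "%z. Ln (1 + z) - z + z^2/2" "%z. z^2/(1 + z)"])
  fix w :: complex assume w: "w : cball 0 (norm z)"
  have nw: "norm w <= 1/2" using w assms by simp
  have r: "Re (1 + w) >= 1/2" using nw abs_Re_le_cmod[of w] by simp
  have nz: "1 + w ~= 0" "1 + w ~: \<real>\<^sub>\<le>\<^sub>0"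
   using r by (auto simp: complex_nonpos_Reals_iff complex_eq_iff)
  have "((%z. Ln (1 + z) - z + z^2/2) has_field_derivative (inverse (1 + w) - 1 + w)) (at w)"
   using nz by (auto intro!: derivative_eq_intros)
  also have "inverse (1 + w) - 1 + w = w^2/(1 + w)" using nz by (simp add: field_simps power2_eq_square)
  finally show "((%z. Ln (1 + z) - z + z^2/2) has_field_derivative w^2/(1 + w)) (at w within cball 0 (norm z))"
   by (rule has_field_derivative_at_within)
  have "1/2 <= norm (1 + w)" using r complex_Re_le_cmod[of "1+w"] by simp
  hence "norm (w^2)/norm (1 + w) <= norm z^2/(1/2)"
   using w by (intro frac_le) (auto simp: norm_power intro: power_mono)
  thus "norm (w^2/(1 + w)) <= 2*norm z^2" by (simp add: norm_divide)
 qed auto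
 thus ?thesis by (simp add: power2_eq_square power3_eq_cube)
qed

definition step_const :: "real => real" where "step_const be = 2*be^2 + 2 + (\<bar>be\<bar> + 1/2)*2"

lemma step_const_pos: "step_const be > 0"
 unfolding step_const_def by (intro add_nonneg_pos add_pos_nonneg mult_nonneg_nonneg) auto

text \<open>One step of Stirling's formula: \<open>lf\<close> is the primitive of Ln. Its increment
  over a unit step is Ln y + 1/(2y) and the second summand contributes (be - 1/2)/y, which together
  give Ln (y + be) up to O(1/|y|^2). The error must be quadratic in 1/|y|, since about n of these
  steps with |y| of order n are to be multiplied.\<close>

lemma lf_step:
 assumes y: "y : upper_slit" and big: "norm y >= 2*(1 + \<bar>be\<bar>)"
 obtains e where "norm e <= step_const be/norm y^2"
  "y + cor be = exp (lf (y + 1) - lf y + (cor be - 1/2)*(Ln (y + 1) - Ln y) + e)"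
proof -
 define z where "z = 1/y"
 have y0: "y ~= 0" using upper_slit_nonzero[OF y] .
 have ny: "norm y > 0" "norm z = 1/norm y" using y0 by (auto simp: z_def norm_divide)
 have nz: "norm z <= 1/2" "norm (cor be*z) <= 1/2"
 proof -
  have y2: "norm y >= 2" "norm y >= 2 * \<bar>be\<bar>" using big by auto
  show "norm z <= 1/2" unfolding ny(2) using y2 ny(1) by (simp add: divide_le_eq)
  show "norm (cor be*z) <= 1/2" unfolding norm_mult ny(2) using y2 ny(1) by (simp add: divide_le_eq)
 qed
 define e where "e = Ln (1 + cor be*z) - (y + cor be + 1/2)*Ln (1 + z) + 1"
 have "Re (1 + cor be*z) > 0" using nz(2) abs_Re_le_cmod[of "cor be*z"] by (simp del: Re_complex_of_real)
 hence nz1: "1 + cor be*z ~= 0" by (metis less_irrefl zero_complex.sel(1))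
 have L: "Ln (y + 1) = Ln y + Ln (1 + z)" using Ln_add_one[OF y] by (simp add: z_def)
 have "lf (y + 1) - lf y + (cor be - 1/2)*(Ln (y + 1) - Ln y) + e = Ln y + Ln (1 + cor be*z)"
  unfolding e_def lf_def L by (simp add: algebra_simps)
 moreover have "exp (Ln y + Ln (1 + cor be*z)) = y + cor be"
  using y0 nz1 by (simp add: exp_add algebra_simps z_def)
 ultimately have eq: "y + cor be = exp (lf (y + 1) - lf y + (cor be - 1/2)*(Ln (y + 1) - Ln y) + e)" by simp
 have yz: "y*z = 1" "y*z^2 = z" using y0 by (auto simp: z_def power2_eq_square)
 have "e = (Ln (1 + cor be*z) - cor be*z) - y*(Ln (1 + z) - z + z^2/2) - (cor be + 1/2)*(Ln (1 + z) - z)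
    - y*z + y*z^2/2 - z/2 + 1" by (simp add: e_def algebra_simps)
 also have "... = (Ln (1 + cor be*z) - cor be*z) - y*(Ln (1 + z) - z + z^2/2) - (cor be + 1/2)*(Ln (1 + z) - z)"
  unfolding yz by simp
 finally have e: "e = ..." .
 have "norm e <= 2*norm (cor be*z)^2 + norm y*(2*norm z^3) + (\<bar>be\<bar> + 1/2)*(2*norm z^2)"
 proof -
  have "norm (cor be + 1/2 :: complex) <= \<bar>be\<bar> + 1/2"
   by (rule order_trans[OF norm_triangle_ineq]) simp
  thus ?thesis unfolding e
   by (intro order_trans[OF norm_triangle_ineq4] add_mono norm_Ln_one_plus_diff1 nz)
    (auto simp: norm_mult intro!: mult_mono mult_left_mono norm_Ln_one_plus_diff1 norm_Ln_one_plus_diff2 nz)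
 qed
 also have "... = step_const be/norm y^2"
  using ny(1) by (simp add: step_const_def ny(2) norm_mult field_simps power2_eq_square power3_eq_cube)
 finally show ?thesis using that eq by blast
qed

text \<open>The increments of \<open>lf\<close> and Ln telescope over the steps; only the m errors
  add up.\<close>

lemma lf_product:
 assumes v: "v : upper_slit" and ro: "ro > 0" and ro': "ro >= 2*(1 + \<bar>be\<bar>)"
  and far: "!!j. j < m ==> norm (v + of_nat j) >= ro"
 obtains e where "norm e <= step_const be * m/ro^2"
  "(\<Prod>j<m. v + of_nat j + cor be) = exp (lf (v + of_nat m) - lf v + (cor be - 1/2)*(Ln (v + of_nat m) - Ln v) + e)"
proof -
 have "EX e. norm e <= step_const be * m/ro^2 &
  (\<Prod>j<m. v + of_nat j + cor be) = exp (lf (v + of_nat m) - lf v + (cor be - 1/2)*(Ln (v + of_nat m) - Ln v) + e)"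
  using far
 proof (induction m)
  case 0 thus ?case by (intro exI[of _ 0]) auto
 next
  case (Suc m)
  then obtain e where e: "norm e <= step_const be * m/ro^2"
   "(\<Prod>j<m. v + of_nat j + cor be) = exp (lf (v + of_nat m) - lf v + (cor be - 1/2)*(Ln (v + of_nat m) - Ln v) + e)"
   by auto
  have y: "v + of_nat m : upper_slit" using upper_slit_add[OF v, of "real m"] by simp
  have big: "norm (v + of_nat m) >= ro" using Suc.prems by simp
  obtain e' where e': "norm e' <= step_const be/norm (v + of_nat m)^2"
   "v + of_nat m + cor be = exp (lf (v + of_nat m + 1) - lf (v + of_nat m) + (cor be - 1/2)*(Ln (v + of_nat m + 1) - Ln (v + of_nat m)) + e')"
   using lf_step[OF y order_trans[OF ro' big]] by blast
  have nv: "norm (v + of_nat m) > 0" using ro big by linarith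
  have "norm e' <= step_const be/ro^2"
   by (rule order_trans[OF e'(1)]) (use step_const_pos[of be] ro big nv in \<open>intro divide_left_mono power_mono mult_pos_pos zero_less_power; simp\<close>)
  hence "norm (e + e') <= step_const be * m/ro^2 + step_const be/ro^2"
   using e(1) by (intro norm_triangle_le add_mono)
  also have "... = step_const be * Suc m/ro^2" by (simp add: algebra_simps add_divide_distrib)
  finally have n: "norm (e + e') <= step_const be * Suc m/ro^2" .
  have vS: "v + of_nat m + 1 = v + of_nat (Suc m)" by simp
  have "(\<Prod>j<Suc m. v + of_nat j + cor be) = (\<Prod>j<m. v + of_nat j + cor be)*(v + of_nat m + cor be)"
   by simp
  also have "... = exp ((lf (v + of_nat m) - lf v + (cor be - 1/2)*(Ln (v + of_nat m) - Ln v) + e) +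
    (lf (v + of_nat (Suc m)) - lf (v + of_nat m) + (cor be - 1/2)*(Ln (v + of_nat (Suc m)) - Ln (v + of_nat m)) + e'))"
   unfolding e(2) exp_add using e'(2) unfolding vS exp_add by (simp only:)
  also have "(lf (v + of_nat m) - lf v + (cor be - 1/2)*(Ln (v + of_nat m) - Ln v) + e) +
    (lf (v + of_nat (Suc m)) - lf (v + of_nat m) + (cor be - 1/2)*(Ln (v + of_nat (Suc m)) - Ln (v + of_nat m)) + e')
   = lf (v + of_nat (Suc m)) - lf v + (cor be - 1/2)*(Ln (v + of_nat (Suc m)) - Ln v) + (e + e')"
   by (simp add: algebra_simps del: of_nat_Suc)
  finally have "(\<Prod>j<Suc m. v + of_nat j + cor be) = exp (lf (v + of_nat (Suc m)) - lf v + (cor be - 1/2)*(Ln (v + of_nat (Suc m)) - Ln v) + (e + e'))" .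
  thus ?case using n by blast
 qed
 thus ?thesis using that by blast
qed

section \<open>Stirling's formula for factorials with an error term of order 1/k\<close>

definition stir :: "nat => real" where "stir k = ln (fact k) - (k + 1/2)*ln k + k"

lemma stir_step:
 assumes "k >= 4"
 shows "\<bar>stir (Suc k) - stir k\<bar> <= step_const 1/k^2"
proof -
 have y: "of_nat k : upper_slit" using assms by (auto simp: upper_slit_def complex_nonpos_Reals_iff)
 obtain e where e: "norm e <= step_const 1/norm (of_nat k :: complex)^2"
  "of_nat k + cor 1 = exp (lf (of_nat k + 1) - lf (of_nat k) + (cor 1 - 1/2)*(Ln (of_nat k + 1) - Ln (of_nat k)) + e)"
  using lf_step[OF y, of 1] assms by auto
 have k1: "Ln (of_nat k + 1) = cor (ln (k + 1))" using Ln_of_real[of "real k + 1"] by simp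
 have k0: "Ln (of_nat k) = cor (ln k)" using Ln_of_real[of "real k"] assms by simp
 have "norm (of_nat k + cor 1 :: complex) = exp (Re (lf (of_nat k + 1) - lf (of_nat k) + (cor 1 - 1/2)*(Ln (of_nat k + 1) - Ln (of_nat k)) + e))"
  unfolding e(2) by (rule norm_exp_eq_Re)
 also have "norm (of_nat k + cor 1 :: complex) = real k + 1"
  by (metis of_nat_1 of_nat_add norm_of_nat of_real_1)
 finally have "ln (real k + 1) = Re (lf (of_nat k + 1) - lf (of_nat k) + (cor 1 - 1/2)*(Ln (of_nat k + 1) - Ln (of_nat k)) + e)"
  by (metis ln_exp)
 also have "... = (k + 1)*ln (k + 1) - (k + 1) - (k*ln k - k) + 1/2*(ln (k + 1) - ln k) + Re e"
  unfolding lf_def k1 k0 by simp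
 finally have st: "ln (real k + 1) = (k + 1)*ln (k + 1) - (k + 1) - (k*ln k - k) + 1/2*(ln (k + 1) - ln k) + Re e" .
 have fa: "ln (fact (Suc k)) = ln (real k + 1) + ln (fact k)"
  by (subst fact_Suc, subst ln_mult) (auto simp: add.commute)
 have "stir (Suc k) - stir k = Re e"
  using st unfolding stir_def fa by (simp add: algebra_simps)
 thus ?thesis using e(1) abs_Re_le_cmod[of e] by simp
qed

text \<open>Consecutive differences are O(1/k^2) and are dominated by the telescoping differences 2K
  (1/k - 1/(k+1)). So the sequence is Cauchy and approaches its limit at rate 1/k.\<close>

lemma stir_limit:
 obtains L C where "C >= 0" "!!k. k >= 1 ==> \<bar>stir k - L\<bar> <= C/k" "stir \<longlonglongrightarrow> L"
proof -
 define K where "K = step_const 1"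
 have K: "K > 0" using step_const_pos by (simp add: K_def)
 have b: "\<bar>stir (k + j) - stir k\<bar> <= 2*K*(1/k - 1/(k+j))" if "k >= 4" for k j :: nat
 proof (induction j)
  case (Suc j)
  have kj: "real k + j >= 4" using that by linarith
  have "\<bar>stir (Suc (k + j)) - stir (k + j)\<bar> <= K/(k + j)^2"
   using stir_step[of "k + j"] that by (simp add: K_def)
  also have "... <= 2*K*(1/(k+j) - 1/(k + Suc j))"
  proof -
   have "1/(real k + j)^2 <= 2*(1/(k+j) - 1/(k + j + 1))" if "real k + j >= 4"
   proof -
    define x where "x = real k + j"
    have "x >= 4" using that by (simp add: x_def)
    have "1/x^2 = 2/(2*x^2)" by simp
    also have "... <= 2/(x*(x + 1))"
    proof (rule divide_left_mono)
     have "x*1 <= x*x" using \<open>x >= 4\<close> by (intro mult_left_mono) auto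
     thus "x*(x + 1) <= 2*x^2" by (simp add: power2_eq_square algebra_simps)
    qed (use \<open>x >= 4\<close> in auto)
    also have "... = 2*(1/x - 1/(x+1))" using \<open>x >= 4\<close> by (simp add: field_simps)
    finally have "1/x^2 <= 2*(1/x - 1/(x+1))" .
    thus ?thesis by (simp add: x_def add_ac)
   qed
   from mult_left_mono[OF this[OF kj], of K] K show ?thesis by (simp add: algebra_simps)
  qed
  finally have "\<bar>stir (Suc (k + j)) - stir (k + j)\<bar> <= 2*K*(1/(k+j) - 1/(k + Suc j))" .
  with Suc.IH have "\<bar>stir (Suc (k + j)) - stir k\<bar> <= 2*K*(1/k - 1/(k+j)) + 2*K*(1/(k+j) - 1/(k + Suc j))" by linarith
  thus ?case by (simp add: algebra_simps)
 qed simp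
 have b2: "\<bar>stir j - stir k\<bar> <= 2*K/k" if "k >= 4" "j >= k" for k j :: nat
 proof -
  have "\<bar>stir j - stir k\<bar> <= 2*K*(1/k - 1/j)" using b[OF that(1), of "j - k"] that by simp
  also have "... <= 2*K*(1/k)" using K by (intro mult_left_mono) auto
  finally show ?thesis by simp
 qed
 have "Cauchy stir"
  unfolding Cauchy_altdef
 proof (intro allI impI)
  fix e :: real assume e: "e > 0"
  obtain N :: nat where N: "N > 2*K/e" using reals_Archimedean2 by blast
  define k where "k = max 4 N"
  have "real k > 2*K/e" using N by (simp add: k_def)
  hence ke: "2*K/k < e" using e K by (simp add: field_simps k_def)
  show "EX M. ALL m>=M. ALL n>m. dist (stir m) (stir n) < e"
  proof (intro exI[of _ k] allI impI)
   fix m n assume mn: "m >= k" "n > m"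
   have "\<bar>stir n - stir m\<bar> <= 2*K/m" using b2[of m n] mn by (simp add: k_def)
   also have "... <= 2*K/k" using mn K by (intro divide_left_mono) (auto simp: k_def)
   finally show "dist (stir m) (stir n) < e" using ke by (simp add: dist_real_def)
  qed
 qed
 then obtain L where L: "stir \<longlonglongrightarrow> L" using Cauchy_convergent_iff convergent_def by blast
 have lim: "\<bar>stir k - L\<bar> <= 2*K/k" if "k >= 4" for k
 proof -
  have "(%j. \<bar>stir j - stir k\<bar>) \<longlonglongrightarrow> \<bar>L - stir k\<bar>" by (intro tendsto_intros L)
  hence "\<bar>L - stir k\<bar> <= 2*K/k" by (rule Lim_bounded[of _ _ k]) (use b2 that in auto)
  thus ?thesis by simp
 qed
 \<comment> \<open>The second summand takes care of k < 4, where \<open>stir_step\<close> does not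
   apply; the factor 4 absorbs the multiplication by k.\<close>
 define C where "C = 2*K + 4*(\<Sum>k<4. \<bar>stir k - L\<bar>)"
 have "\<bar>stir k - L\<bar> <= C/k" if k: "k >= 1" for k
 proof (cases "k >= 4")
  case True
  have "2*K/k <= C/k" by (intro divide_right_mono) (auto simp: C_def sum_nonneg)
  thus ?thesis using lim[OF True] by linarith
 next
  case False
  have "\<bar>stir k - L\<bar> <= (\<Sum>k<4. \<bar>stir k - L\<bar>)" by (rule member_le_sum) (use False in auto)
  moreover have "real k*(\<Sum>k<4. \<bar>stir k - L\<bar>) <= 4*(\<Sum>k<4. \<bar>stir k - L\<bar>)" using False by (intro mult_right_mono) (auto simp: sum_nonneg)
  ultimately have "k * \<bar>stir k - L\<bar> <= C" using K mult_left_mono[of "\<bar>stir k - L\<bar>" "(\<Sum>k<4. \<bar>stir k - L\<bar>)" "real k"]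
   by (simp add: C_def)
  thus ?thesis using k by (simp add: field_simps)
 qed
 moreover have "C >= 0" using K by (simp add: C_def sum_nonneg)
 ultimately show ?thesis using that L by blast
qed

lemma wallis_fact:
 "(\<Prod>k=1..n. (4*real k^2)/(4*real k^2 - 1)) = 2^(4*n)*(fact n :: real)^4/((fact (2*n))^2*(2*real n+1))"
proof (induction n)
 case (Suc n)
 have f: "(fact (2 * Suc n) :: real) = (2*real n + 2)*(2*real n + 1)*fact (2*n)" by (simp add: algebra_simps)
 have g: "(fact (Suc n) :: real) = (real n + 1)*fact n" by simp
 have d: "4*real (Suc n)^2 - 1 = (2*real n + 1)*(2*real n + 3)" by (simp add: power2_eq_square algebra_simps)
 have p: "(2::real)^(4 * Suc n) = 16*2^(4*n)" by (simp add: power_add)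
 have h: "4*real (Suc n)^2 = (2*real n + 2)^2" "2*real (Suc n) + 1 = 2*real n + 3" by (auto simp: power2_eq_square algebra_simps)
 have nz: "2*real n + 1 ~= 0" "2*real n + 3 ~= 0" "2*real n + 2 ~= 0" "(fact (2*n) :: real) ~= 0" by (linarith+) simp
 have "(\<Prod>k=1..Suc n. (4*real k^2)/(4*real k^2 - 1)) = 2^(4*n)*fact n^4/((fact (2*n))^2*(2*real n+1))*(4*real (Suc n)^2/(4*real (Suc n)^2 - 1))"
  using Suc.IH by simp
 also have "... = 2^(4*n)*fact n^4/((fact (2*n))^2*(2*real n+1))*((2*real n + 2)^2/((2*real n + 1)*(2*real n + 3)))"
  unfolding h(1) d[unfolded h(1)] ..
 also have "... = 16*2^(4*n)*((real n + 1)*fact n)^4/(((2*real n + 2)*(2*real n + 1)*fact (2*n))^2*(2*real n + 3))"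
 proof -
  have "a*b^4/(c^2*u)*(v^2/(u*w)) = 16*a*((v/2)*b)^4/((v * u * c)^2*w)"
   if "u ~= 0" "v ~= 0" "w ~= 0" "c ~= 0" for a b c u v w :: real
   using that by (simp add: field_simps power2_eq_square power4_eq_xxxx)
  from this[OF nz(1,3,2,4), of "2^(4*n)" "fact n"] show ?thesis by (simp add: add_divide_distrib)
 qed
 finally show ?case unfolding f g p h(2) .
qed simp

text \<open>In Wallis' product, written with factorials, 4 stir n - 2 stir (2n) tends to 2L and the
  remaining factor to 1/4, while the product tends to pi/2. Hence exp (2L) = 2 pi.\<close>

lemma stir_limit_value:
 assumes L: "stir \<longlonglongrightarrow> L" shows "L = ln (2 * pi)/2"
proof -
 have ev: "(\<Prod>k=1..n. (4*real k^2)/(4*real k^2 - 1)) = exp (4 * stir n - 2 * stir (2*n))*(n/(2*(2*n + 1)))" if n: "n >= 1" for n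
 proof -
  have f: "fact k = exp (stir k + (k + 1/2)*ln k - k)" for k by (simp add: stir_def)
  have l2: "ln (real (2*n)) = ln 2 + ln n" using n by (simp add: ln_mult)
  define u where "u = 2*real n + 1"
  have u: "u > 0" by (simp add: u_def)
  have n0: "real n > 0" using n by simp
  have "(\<Prod>k=1..n. (4*real k^2)/(4*real k^2 - 1)) = exp (ln (2^(4*n)*(fact n :: real)^4/((fact (2*n))^2*u)))"
   unfolding wallis_fact u_def[symmetric] using u by (subst exp_ln) auto
  also have "ln (2^(4*n)*(fact n :: real)^4/((fact (2*n))^2*u)) = 4*n*ln 2 + 4*ln (fact n) - 2*ln (fact (2*n)) - ln u"
   using u by (simp add: ln_mult ln_div ln_realpow)
  also have "... = 4*n*ln 2 + 4*(stir n + (n + 1/2)*ln n - n) - 2*(stir (2*n) + (2*n + 1/2)*ln (real (2*n)) - 2*n) - ln u"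
   by (simp add: stir_def)
  also have "... = (4 * stir n - 2 * stir (2*n)) + (ln n - ln 2 - ln u)"
   unfolding l2 by (simp add: algebra_simps)
  also have "ln (real n) - ln 2 - ln u = ln (n/(2*u))"
   using n0 u by (simp add: ln_div ln_mult)
  finally have fin: "(\<Prod>k=1..n. (4*real k^2)/(4*real k^2 - 1)) = exp (4 * stir n - 2 * stir (2*n))*exp (ln (n/(2*u)))"
   by (simp only: exp_add)
  have "exp (ln (n/(2*u))) = n/(2*u)" using n0 u by simp
  with fin show ?thesis by (simp only: u_def)
 qed
 have L2: "(%n. stir (2*n)) \<longlonglongrightarrow> L"
  by (rule LIMSEQ_subseq_LIMSEQ[OF L, unfolded o_def]) (auto simp: strict_mono_def)
 have q: "(%n. real n/(2*(2*n + 1))) \<longlonglongrightarrow> 1/4" by real_asymp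
 have "(%n. exp (4 * stir n - 2 * stir (2*n))*(n/(2*(2*n + 1)))) \<longlonglongrightarrow> exp (4*L - 2*L)*(1/4)"
  by (intro tendsto_intros L L2 q)
 hence "(%n. (\<Prod>k=1..n. (4*real k^2)/(4*real k^2 - 1))) \<longlonglongrightarrow> exp (4*L - 2*L)*(1/4)"
  by (rule Lim_transform_eventually) (use ev in \<open>auto intro!: eventually_sequentiallyI[of 1]\<close>)
 from LIMSEQ_unique[OF this wallis] have "exp (2*L) = 2 * pi" by simp
 hence "2*L = ln (2 * pi)" by (metis ln_exp)
 thus ?thesis by simp
qed

lemma stirling:
 obtains C where "C >= 0" "!!k. k >= 1 ==> EX e::real. \<bar>e\<bar> <= C/k &
  fact k = exp (k*ln k - k + ln k/2 + ln (2 * pi)/2 + e)"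
proof -
 obtain L C where *: "C >= 0" "!!k. k >= 1 ==> \<bar>stir k - L\<bar> <= C/k" "stir \<longlonglongrightarrow> L"
  by (rule stir_limit) (rule that)
 have L: "L = ln (2 * pi)/2" by (rule stir_limit_value[OF *(3)])
 show ?thesis
 proof (rule that[OF *(1)])
  fix k :: nat assume k: "k >= 1"
  have "k*ln k - k + ln k/2 + ln (2 * pi)/2 + (stir k - L) = ln (fact k)"
   by (simp add: stir_def L algebra_simps)
  thus "EX e::real. \<bar>e\<bar> <= C/k & fact k = exp (k*ln k - k + ln k/2 + ln (2 * pi)/2 + e)"
   using *(2)[OF k] by (intro exI[of _ "stir k - L"]) simp
 qed
qed

section \<open>The coefficients of P from the orthogonality relations\<close>

definition Npr :: "real => real => nat => nat => complex => complex" where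
 "Npr av1 av2 n1 n2 w = (\<Prod>j<n1. w + of_nat j + cor (1 + av1))*(\<Prod>j<n2. w + of_nat j + cor (1 + av2))"

text \<open>The value that gives the rational function residue 1 at w = n1 + n2, which is the
  condition that P is monic.\<close>

definition cnst :: "real => real => nat => nat => complex" where
 "cnst av1 av2 n1 n2 = fact (n1 + n2)/Npr av1 av2 n1 n2 (of_nat (n1 + n2))"

lemma moment_integral:
 fixes av :: real assumes "av > -1"
 shows "((%x. x ^ m*x powr av) has_integral 1/(m + av + 1)) {0..1}"
proof -
 have "((%x. x powr (m + av)) has_integral (1 powr (m + av + 1)/(m + av + 1))) {0..1}"
  by (rule has_integral_powr_from_0) (use assms in auto)
 moreover have "x ^ m*x powr av = x powr (m + av)" if "x : {0..1}" for x :: real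
  using that by (cases "x = 0") (auto simp: powr_add powr_realpow)
 ultimately have "((%x. x ^ m*x powr av) has_integral (1 powr (m + av + 1)/(m + av + 1))) {0..1}"
  using has_integral_eq[of "{0..1}" "%x. x powr (m + av)" "%x. x ^ m*x powr av"] by auto
 thus ?thesis by simp
qed

lemma orthogonality_coeff:
 fixes P :: "real poly" and av :: real
 assumes "av > -1" and "((%x. poly P x*x^i*x powr av) has_integral 0) {0..1}"
 shows "(\<Sum>k\<le>degree P. coeff P k/(k + i + av + 1)) = 0"
proof -
 have "((%x. \<Sum>k\<le>degree P. coeff P k*(x ^ (k + i)*x powr av)) has_integral
     (\<Sum>k\<le>degree P. coeff P k*(1/((k + i :: nat) + av + 1)))) {0..1}"
  by (intro has_integral_sum has_integral_mult_right moment_integral assms) auto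
 moreover have "(%x. \<Sum>k\<le>degree P. coeff P k*(x ^ (k + i)*x powr av)) = (%x. poly P x*x^i*x powr av)"
  by (auto simp: poly_altdef sum_distrib_right sum_distrib_left power_add mult_ac intro!: sum.cong)
 ultimately show ?thesis using has_integral_unique[OF assms(2)] by simp
qed

lemma prod_int_diff:
 assumes "k <= d"
 shows "(\<Prod>j\<in>{..d}-{k}. (of_nat k - of_nat j :: complex)) = (-1)^(d-k)*fact k*fact (d-k)"
proof -
 have e: "{..d}-{k} = {..<k} \<union> {k<..d}" using assms by auto
 have "(\<Prod>j\<in>{..d}-{k}. (of_nat k - of_nat j :: complex)) = (\<Prod>j<k. of_nat k - of_nat j)*(\<Prod>j\<in>{k<..d}. of_nat k - of_nat j)"
  unfolding e by (rule prod.union_disjoint) auto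
 also have "(\<Prod>j<k. of_nat k - of_nat j :: complex) = fact k"
 proof -
  have "(\<Prod>j<k. of_nat k - of_nat j :: complex) = (\<Prod>j<k. of_nat (Suc j))"
   by (rule prod.reindex_bij_witness[of _ "%j. k - Suc j" "%j. k - Suc j"]) (auto simp: of_nat_diff)
  also have "... = fact k" by (simp add: fact_prod_Suc atLeast0LessThan)
  finally show ?thesis .
 qed
 also have "(\<Prod>j\<in>{k<..d}. of_nat k - of_nat j :: complex) = (-1)^(d-k)*fact (d-k)"
 proof -
  have "(\<Prod>j\<in>{k<..d}. of_nat k - of_nat j :: complex) = (\<Prod>j<d-k. (-1) * of_nat (Suc j))"
   by (rule prod.reindex_bij_witness[of _ "%j. k + Suc j" "%j. j - Suc k"]) (auto simp: of_nat_diff)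
  also have "... = (-1)^(d-k)*fact (d-k)"
   unfolding prod.distrib by (simp add: fact_prod_Suc atLeast0LessThan)
  finally show ?thesis .
 qed
 finally show ?thesis by (simp add: mult_ac)
qed

locale mop =
 fixes av1 av2 :: real and n1 n2 :: nat and P :: "real poly"
 assumes av: "av1 > -1" "av2 > -1" "av1 - av2 ~: \<int>"
  and mo: "is_multiple_orthogonal av1 av2 n1 n2 P"
begin

abbreviation "d \<equiv> n1 + n2"

text \<open>The numerator of the sum of p_k/(w - k) over the common denominator prod (w - k).
  Orthogonality prescribes d zeros of it.\<close>

definition Fp :: "complex poly" where
 "Fp = (\<Sum>k\<le>d. smult (cor (coeff P k)) (\<Prod>j\<in>{..d}-{k}. [:- of_nat j, 1:]))"

definition Np :: "complex poly" where
 "Np = (\<Prod>j<n1. [:of_nat j + cor (1 + av1), 1:])*(\<Prod>j<n2. [:of_nat j + cor (1 + av2), 1:])"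

lemma poly_Np: "poly Np w = Npr av1 av2 n1 n2 w"
 by (simp add: Np_def Npr_def poly_prod add_ac)

lemma poly_Fp: "poly Fp w = (\<Sum>k\<le>d. cor (coeff P k)*(\<Prod>j\<in>{..d}-{k}. w - of_nat j))"
 by (simp add: Fp_def poly_sum poly_prod)

lemma degree_Fp: "degree Fp <= d"
proof -
 have "degree (smult (cor (coeff P k)) (\<Prod>j\<in>{..d}-{k}. [:- of_nat j, 1:] :: complex poly)) <= d" if "k <= d" for k
 proof -
  have "degree (\<Prod>j\<in>{..d}-{k}. [:- of_nat j, 1:] :: complex poly) = (\<Sum>j\<in>{..d}-{k}. 1)"
   by (subst degree_prod_eq_sum_degree) auto
  also have "... = d" using that by simp
  finally show ?thesis by (metis degree_smult_le)
 qed
 thus ?thesis unfolding Fp_def by (intro degree_sum_le) auto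
qed

lemma degree_Np: "degree Np = d" and lead_Np: "lead_coeff Np = 1"
proof -
 have a: "degree (\<Prod>j<m. [:of_nat j + c, 1:] :: complex poly) = m" for m c
  by (subst degree_prod_eq_sum_degree) auto
 have b: "lead_coeff (\<Prod>j<m. [:of_nat j + c, 1:] :: complex poly) = 1" for m c
  by (simp add: lead_coeff_prod)
 have nz: "(\<Prod>j<m. [:of_nat j + c, 1:] :: complex poly) ~= 0" for m c by simp
 show "degree Np = d" unfolding Np_def by (subst degree_mult_eq) (auto simp only: nz a)
 show "lead_coeff Np = 1" unfolding Np_def lead_coeff_mult b by simp
qed

lemma degree_P: "degree P = d" and lead_P: "coeff P d = 1"
 using mo by (auto simp: is_multiple_orthogonal_def)

lemma partial_fraction_sum:
 assumes "w ~: of_nat ` {..d}"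
 shows "poly Fp w = (\<Prod>k\<le>d. w - of_nat k)*(\<Sum>k\<le>d. cor (coeff P k)/(w - of_nat k))"
 unfolding poly_Fp sum_distrib_left
proof (intro sum.cong refl)
 fix k assume k: "k : {..d}"
 have "w - of_nat k ~= 0" using assms k by auto
 moreover have "(\<Prod>k\<le>d. w - of_nat k) = (w - of_nat k)*(\<Prod>j\<in>{..d}-{k}. w - of_nat j)"
  using k by (subst prod.remove[of _ k]) auto
 ultimately show "cor (coeff P k)*(\<Prod>j\<in>{..d}-{k}. w - of_nat j) = (\<Prod>k\<le>d. w - of_nat k)*(cor (coeff P k)/(w - of_nat k))"
  by simp
qed

lemma Fp_zero:
 assumes "(av = av1 & i < n1) | (av = av2 & i < n2)"
 shows "poly Fp (- (of_nat i + cor (1 + av))) = 0"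
proof -
 have al: "av > -1" using assms av by auto
 have "((%x. poly P x*x^i*x powr av) has_integral 0) {0..1}"
  using assms mo by (auto simp: is_multiple_orthogonal_def)
 from orthogonality_coeff[OF al this] have s: "(\<Sum>k\<le>d. coeff P k/(k + i + av + 1)) = 0" by (simp add: degree_P)
 define w where "w = - (of_nat i + cor (1 + av))"
 have w: "w = cor (- (i + 1 + av))" by (simp add: w_def)
 have "w ~= of_nat k" for k
 proof
  assume "w = of_nat k"
  hence "Re w = real k" by simp
  thus False using al by (simp add: w)
 qed
 hence "poly Fp w = (\<Prod>k\<le>d. w - of_nat k)*(\<Sum>k\<le>d. cor (coeff P k)/(w - of_nat k))"
  by (intro partial_fraction_sum) auto
 also have "(\<Sum>k\<le>d. cor (coeff P k)/(w - of_nat k)) = cor (\<Sum>k\<le>d. coeff P k/(- (k + i + av + 1)))"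
  unfolding of_real_sum w by (intro sum.cong refl) (simp add: algebra_simps)
 also have "(\<Sum>k\<le>d. coeff P k/(- (k + i + av + 1))) = - (\<Sum>k\<le>d. coeff P k/(k + i + av + 1))"
  by (simp only: divide_minus_right sum_negf)
 finally show ?thesis unfolding w_def[symmetric] s by simp
qed

text \<open>The difference of the two sides has degree below d, because their coefficients of degree
  d agree, and it vanishes at the d points -1 - av1 - i and -1 - av2 - i. These are pairwise
  distinct since av1 - av2 is not an integer.\<close>

lemma Fp_eq: "Fp = smult (coeff Fp d) Np"
proof (rule ccontr)
 assume ne: "Fp ~= smult (coeff Fp d) Np"
 define Q where "Q = Fp - smult (coeff Fp d) Np"
 have Q0: "Q ~= 0" using ne by (simp add: Q_def)
 have cQ: "coeff Q d = 0" using lead_Np by (simp add: Q_def degree_Np)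
 have "degree Q <= d" unfolding Q_def by (rule degree_diff_le) (auto simp: degree_Fp degree_Np intro: order_trans[OF degree_smult_le])
 hence dQ: "degree Q < d" using cQ Q0 by (metis le_neq_implies_less leading_coeff_0_iff)
 define f1 where "f1 = (%i::nat. - (of_nat i + cor (1 + av1)))"
 define f2 where "f2 = (%i::nat. - (of_nat i + cor (1 + av2)))"
 have inj: "inj_on f1 {..<n1}" "inj_on f2 {..<n2}" by (auto simp: inj_on_def f1_def f2_def)
 have disj: "f1 ` {..<n1} \<inter> f2 ` {..<n2} = {}"
 proof (rule ccontr)
  assume "f1 ` {..<n1} \<inter> f2 ` {..<n2} ~= {}"
  then obtain i j where "f1 i = f2 j" by auto
  hence "Re (f1 i) = Re (f2 j)" by simp
  hence "av1 - av2 = of_int (int j - int i)" by (simp add: f1_def f2_def)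
  thus False using av(3) by (metis Ints_of_int)
 qed
 have "card (f1 ` {..<n1} \<union> f2 ` {..<n2}) = d"
  using inj disj by (simp add: card_Un_disjoint card_image)
 moreover have "f1 ` {..<n1} \<union> f2 ` {..<n2} \<subseteq> {x. poly Q x = 0}"
 proof -
  have "poly Q (f1 i) = 0" if "i < n1" for i
  proof -
   have "poly Np (f1 i) = 0" using that by (auto simp: Np_def poly_prod f1_def)
   thus ?thesis using Fp_zero[of av1 i] that by (simp add: Q_def f1_def)
  qed
  moreover have "poly Q (f2 i) = 0" if "i < n2" for i
  proof -
   have "poly Np (f2 i) = 0" using that by (auto simp: Np_def poly_prod f2_def)
   thus ?thesis using Fp_zero[of av2 i] that by (simp add: Q_def f2_def)
  qed
  ultimately show ?thesis by auto
 qed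
 ultimately have "d <= card {x. poly Q x = 0}" by (metis card_mono poly_roots_finite[OF Q0])
 also have "... <= degree Q" by (rule card_poly_roots_bound[OF Q0])
 finally show False using dQ by simp
qed

lemma Npr_nonzero: "Npr av1 av2 n1 n2 (of_nat k) ~= 0"
proof -
 have "of_nat k + of_nat j + cor (1 + av) ~= 0" if "av > -1" for j and av :: real
 proof
  assume "of_nat k + of_nat j + cor (1 + av) = 0"
  hence "Re (of_nat k + of_nat j + cor (1 + av)) = 0" by simp
  thus False using that by simp
 qed
 thus ?thesis using av by (auto simp: Npr_def)
qed

lemma poly_Fp_nat:
 assumes "k <= d"
 shows "poly Fp (of_nat k) = cor (coeff P k)*((-1)^(d-k)*fact k*fact (d-k))"
proof -
 have "poly Fp (of_nat k) = (\<Sum>i\<in>{k}. cor (coeff P i)*(\<Prod>j\<in>{..d}-{i}. of_nat k - of_nat j))"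
  unfolding poly_Fp by (rule sum.mono_neutral_right) (use assms in auto)
 thus ?thesis using prod_int_diff[OF assms] by simp
qed

lemma coeff_Fp: "coeff Fp d = cnst av1 av2 n1 n2"
proof -
 have "poly Fp (of_nat d) = coeff Fp d*Npr av1 av2 n1 n2 (of_nat d)"
  using arg_cong[OF Fp_eq, of "%F. poly F (of_nat d)"] by (simp add: poly_Np)
 moreover have "poly Fp (of_nat d) = fact d" using poly_Fp_nat[of d] by (simp add: lead_P)
 ultimately show ?thesis using Npr_nonzero[of d] by (simp add: cnst_def field_simps)
qed

lemma coeff_formula:
 assumes "k <= d"
 shows "cor (coeff P k) = cnst av1 av2 n1 n2*Npr av1 av2 n1 n2 (of_nat k)*(-1)^(d-k)/(fact k*fact (d-k))"
proof -
 have Y: "cor (coeff P k)*((-1)^(d-k)*fact k*fact (d-k)) = cnst av1 av2 n1 n2*Npr av1 av2 n1 n2 (of_nat k)"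
  (is "?X*(?s * ?f * ?g) = ?Y")
  using arg_cong[OF Fp_eq, of "%F. poly F (of_nat k)"] poly_Fp_nat[OF assms] by (simp add: poly_Np coeff_Fp)
 have ss: "?s * ?s = 1" by (cases "even (d - k)") auto
 have "?X*(?f * ?g) = ?X*(?f * ?g)*(?s * ?s)" unfolding ss by simp
 also have "... = ?X*(?s * ?f * ?g) * ?s" by (simp only: mult_ac)
 finally have "?X*(?f * ?g) = ?Y * ?s" unfolding Y .
 thus ?thesis by (simp add: field_simps)
qed

lemma partial_fraction:
 assumes "w ~: of_nat ` {..d}"
 shows "(\<Sum>k\<le>d. cor (coeff P k)/(w - of_nat k)) = cnst av1 av2 n1 n2*Npr av1 av2 n1 n2 w/(\<Prod>k\<le>d. w - of_nat k)"
proof -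
 have "(\<Prod>k\<le>d. w - of_nat k) ~= 0" using assms by auto
 moreover have "poly Fp w = cnst av1 av2 n1 n2*Npr av1 av2 n1 n2 w"
  using arg_cong[OF Fp_eq, of "%F. poly F w"] by (simp add: poly_Np coeff_Fp)
 ultimately show ?thesis using partial_fraction_sum[OF assms] by (simp add: field_simps)
qed

end

section \<open>Asymptotics of the rational function and of the coefficients at scale n\<close>

lemma lf_scale:
 assumes "n > 0" "t ~= 0"
 shows "lf (cor n*t) = cor n*lf t + cor n*t * cor (ln n)"
 using assms(1) unfolding lf_def Ln_times_of_real[OF assms] by (simp add: Ln_of_real ring_distribs)

text \<open>The distance from t to the segment [-2, 0], which contains all -j/n for the factors w +
  j that occur, since n1, n2 and n1 + n2 are at most 2n.\<close>

definition clear_right :: "real => complex => bool" where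
 "clear_right et t \<longleftrightarrow> t : upper_slit & (ALL ta. 0 <= ta --> ta <= 2 --> norm (t + cor ta) >= et)"

lemma poch_asymptotics:
 fixes n c be et :: real and m :: nat
 assumes n: "n > 0" and m: "real m = c*n" and c: "0 <= c" "c <= 2"
  and t: "t : upper_slit" and far: "!!ta. 0 <= ta ==> ta <= 2 ==> norm (t + cor ta) >= et"
  and et: "et > 0" "et*n >= 2*(1 + \<bar>be\<bar>)"
 obtains e where "norm e <= (step_const be*2/et^2)/n"
  "(\<Prod>j<m. cor n*t + of_nat j + cor be) =
   exp (cor n*(lf (t + cor c) - lf t) + cor (n * c*ln n) + (cor be - 1/2)*(Ln (t + cor c) - Ln t) + e)"
proof -
 let ?v = "cor n*t"
 have t0: "t ~= 0" "t + cor c : upper_slit" "t + cor c ~= 0"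
  using upper_slit_nonzero[OF t] upper_slit_add[OF t c(1)] upper_slit_nonzero by auto
 have v: "?v : upper_slit" using t n by (auto simp: upper_slit_def complex_nonpos_Reals_iff mult_le_0_iff)
 have ro: "et*n > 0" using n et by simp
 have fj: "norm (?v + of_nat j) >= et*n" if "j < m" for j
 proof -
  have "c*n <= 2*n" using c(2) n by (intro mult_right_mono) auto
  hence "real j <= 2*n" using that m by linarith
  hence j2: "real j/n <= 2" using n by (simp add: divide_le_eq)
  have j0: "0 <= real j/n" using n by simp
  have "cor n*(t + cor (real j/n)) = ?v + of_nat j" using n by (simp add: distrib_left)
  hence "norm (?v + of_nat j) = n*norm (t + cor (real j/n))" using n by (metis norm_mult norm_of_real abs_of_pos)
  moreover have "n*et <= n*norm (t + cor (real j/n))" using far[OF j0 j2] n by (intro mult_left_mono) auto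
  ultimately show ?thesis by (simp only: mult.commute)
 qed
 obtain e where e: "norm e <= step_const be * m/(et*n)^2"
  "(\<Prod>j<m. ?v + of_nat j + cor be) = exp (lf (?v + of_nat m) - lf ?v + (cor be - 1/2)*(Ln (?v + of_nat m) - Ln ?v) + e)"
  by (rule lf_product[OF v ro et(2) fj]) (assumption, rule that)
 have "step_const be * m/(et*n)^2 <= step_const be*(2*n)/(et*n)^2"
  using m c n step_const_pos[of be] by (intro divide_right_mono mult_left_mono) auto
 also have "... = (step_const be*2/et^2)/n" using n by (simp add: power2_eq_square)
 finally have ne: "norm e <= (step_const be*2/et^2)/n" using e(1) by linarith
 have vm: "?v + of_nat m = cor n*(t + cor c)"
  using arg_cong[OF m, of cor] by (simp add: algebra_simps)
 have "lf (?v + of_nat m) - lf ?v = cor n*(lf (t + cor c) - lf t) + cor (n * c*ln n)"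
  unfolding vm lf_scale[OF n t0(1)] lf_scale[OF n t0(3)] by (simp add: algebra_simps)
 moreover have "Ln (?v + of_nat m) - Ln ?v = Ln (t + cor c) - Ln t"
  unfolding vm Ln_times_of_real[OF n t0(1)] Ln_times_of_real[OF n t0(3)] by simp
 ultimately show ?thesis using that[OF ne] e(2) by simp
qed

locale jp =
 fixes av1 av2 tt :: real
 assumes av: "av1 > -1" "av2 > -1" and tt: "0 < tt" "tt < 1"
begin

abbreviation "a \<equiv> 2 - tt"

text \<open>The scale n is a real number: n1, n2 and 2n are integers, n itself may be a
  half-integer.\<close>

definition scaled :: "real => nat => nat => bool" where
 "scaled n n1 n2 \<longleftrightarrow> real n1 = a*n & real n2 = tt*n"

lemma scaled_sum: "scaled n n1 n2 ==> real (n1 + n2) = 2*n"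
 by (simp add: scaled_def algebra_simps)

definition hN :: "complex => complex" where
 "hN t = lf (t + cor a) + lf (t + cor tt) - 2*lf t"

definition eN :: "complex => complex" where
 "eN t = (cor av1 + 1/2)*(Ln (t + cor a) - Ln t) + (cor av2 + 1/2)*(Ln (t + cor tt) - Ln t)"

text \<open>The exponential rate of the constant: \<open>hN\<close> is the rate of the numerator
  \<open>Npr\<close>, evaluated at w = 2n, and \<open>lf 2\<close> that of (2n)!, the terms 2 n ln n
  being common to both. \<open>eN\<close> is the term of order n^0.\<close>

definition kp0 :: complex where "kp0 = hN 2 - lf 2"

lemma Npr_asymptotics:
 assumes "et > 0"
 obtains C N where "C >= 0" "N > 0"
  "!!n n1 n2 t. scaled n n1 n2 ==> n >= N ==> clear_right et t ==>
   EX e. norm e <= C/n & Npr av1 av2 n1 n2 (cor n*t) = exp (cor n*hN t + cor (2*n*ln n) + eN t + e)"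
proof -
 define C where "C = step_const (1 + av1)*2/et^2 + step_const (1 + av2)*2/et^2"
 define N where "N = 2*(1 + \<bar>1 + av1\<bar> + \<bar>1 + av2\<bar>)/et"
 have Cge: "C >= 0" using step_const_pos[of "1 + av1"] step_const_pos[of "1 + av2"] by (simp add: C_def)
 have N0: "N > 0" unfolding N_def using assms by (intro divide_pos_pos mult_pos_pos) auto
 have main: "EX e. norm e <= C/n & Npr av1 av2 n1 n2 (cor n*t) = exp (cor n*hN t + cor (2*n*ln n) + eN t + e)"
  if s: "scaled n n1 n2" and n: "n >= N" and cr: "clear_right et t" for n n1 n2 t
 proof -
  have t: "t : upper_slit" and far: "!!ta. 0 <= ta ==> ta <= 2 ==> norm (t + cor ta) >= et"
   using cr by (auto simp: clear_right_def)
  have n0: "n > 0" using n N0 by simp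
  have "et*n >= et*N" using n assms by simp
  also have "et*N = 2*(1 + \<bar>1 + av1\<bar> + \<bar>1 + av2\<bar>)" using assms by (simp add: N_def)
  finally have b: "2*(1 + \<bar>1 + av1\<bar> + \<bar>1 + av2\<bar>) <= et*n" .
  have b1: "et*n >= 2*(1 + \<bar>1 + av1\<bar>)" by (rule order_trans[OF _ b]) simp
  have b2: "et*n >= 2*(1 + \<bar>1 + av2\<bar>)" by (rule order_trans[OF _ b]) simp
  have s1: "real n1 = a*n" "real n2 = tt*n" using s by (auto simp: scaled_def)
  obtain e1 where e1: "norm e1 <= (step_const (1 + av1)*2/et^2)/n"
   "(\<Prod>j<n1. cor n*t + of_nat j + cor (1 + av1)) =
   exp (cor n*(lf (t + cor a) - lf t) + cor (n*a*ln n) + (cor (1 + av1) - 1/2)*(Ln (t + cor a) - Ln t) + e1)"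
   by (rule poch_asymptotics[OF n0 s1(1) _ _ t far assms b1]) (use tt in \<open>auto intro: that\<close>)
  obtain e2 where e2: "norm e2 <= (step_const (1 + av2)*2/et^2)/n"
   "(\<Prod>j<n2. cor n*t + of_nat j + cor (1 + av2)) =
   exp (cor n*(lf (t + cor tt) - lf t) + cor (n*tt*ln n) + (cor (1 + av2) - 1/2)*(Ln (t + cor tt) - Ln t) + e2)"
   by (rule poch_asymptotics[OF n0 s1(2) _ _ t far assms b2]) (use tt in \<open>auto intro: that\<close>)
  have "norm (e1 + e2) <= C/n"
   using norm_triangle_mono[OF e1(1) e2(1)] by (simp add: C_def add_divide_distrib)
  moreover have "Npr av1 av2 n1 n2 (cor n*t) = exp (cor n*hN t + cor (2*n*ln n) + eN t + (e1 + e2))"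
   unfolding Npr_def e1(2) e2(2) exp_add[symmetric] by (rule arg_cong[of _ _ exp]) (simp add: hN_def eN_def algebra_simps)
  ultimately show ?thesis by blast
 qed
 show ?thesis by (rule that[OF Cge N0 main])
qed

lemma cnst_asymptotics:
 obtains C N where "C >= 0" "N > 0"
  "!!n n1 n2. scaled n n1 n2 ==> n >= N ==>
   EX e. norm e <= C/n & cnst av1 av2 n1 n2 = cor (sqrt (4 * pi*n))*exp (- (cor n * kp0) - eN 2 + e)"
proof -
 have two: "(2::complex) : upper_slit" by (auto simp: upper_slit_def complex_nonpos_Reals_iff)
 have far2: "norm (2 + cor ta :: complex) >= 1" if "0 <= ta" for ta
 proof -
  have "(2 + cor ta :: complex) = cor (2 + ta)" by simp
  hence "norm (2 + cor ta :: complex) = \<bar>2 + ta\<bar>" by (simp only: norm_of_real)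
  thus ?thesis using that by simp
 qed
 obtain C1 N1 where 1: "C1 >= 0" "N1 > 0"
  "!!n n1 n2 t. scaled n n1 n2 ==> n >= N1 ==> clear_right 1 t ==>
   EX e. norm e <= C1/n & Npr av1 av2 n1 n2 (cor n*t) = exp (cor n*hN t + cor (2*n*ln n) + eN t + e)"
  by (rule Npr_asymptotics[OF zero_less_one]) (rule that)
 obtain C2 where 2: "C2 >= 0" "!!k. k >= 1 ==> EX e::real. \<bar>e\<bar> <= C2/k &
  fact k = exp (k*ln k - k + ln k/2 + ln (2 * pi)/2 + e)"
  by (rule stirling) (rule that)
 have main: "EX e. norm e <= (C1 + C2)/n & cnst av1 av2 n1 n2 = cor (sqrt (4 * pi*n))*exp (- (cor n * kp0) - eN 2 + e)"
  if s: "scaled n n1 n2" and n: "n >= max 1 N1" for n n1 n2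
 proof -
  have n0: "n > 0" using n by simp
  have d: "real (n1 + n2) = 2*n" by (rule scaled_sum[OF s])
  obtain e1 where e1: "norm e1 <= C1/n" "Npr av1 av2 n1 n2 (cor n*2) = exp (cor n*hN 2 + cor (2*n*ln n) + eN 2 + e1)"
   using 1(3)[OF s, of 2] two n far2 by (auto simp: clear_right_def)
  have d1: "n1 + n2 >= 1" using d n by linarith
  obtain e2 :: real where e2: "\<bar>e2\<bar> <= C2/real (n1 + n2)" "fact (n1 + n2) = exp (real (n1 + n2)*ln (real (n1 + n2)) - real (n1 + n2) + ln (real (n1 + n2))/2 + ln (2 * pi)/2 + e2)"
   using 2(2)[OF d1] by blast
  have f: "(fact (n1 + n2) :: complex) = exp (cor (2*n*ln (2*n) - 2*n + ln (2*n)/2 + ln (2 * pi)/2 + e2))"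
   using arg_cong[OF e2(2), of cor] unfolding d by (simp only: of_real_fact exp_of_real)
  have dn: "of_nat (n1 + n2) = cor n*2"
   using arg_cong[OF d, of cor] by simp
  have l2: "ln (2*n) = ln 2 + ln n" using n0 by (simp add: ln_mult)
  have Ln2: "Ln 2 = cor (ln 2)" using Ln_of_real[of 2] by simp
  have sq: "exp (cor (ln (2*n)/2 + ln (2 * pi)/2)) = cor (sqrt (4 * pi*n))"
  proof -
   have "ln (2*n) + ln (2 * pi) = ln (4 * pi*n)"
   proof -
    have e: "4 * pi*n = (2*n)*(2 * pi)" by simp
    show ?thesis unfolding e using n0 by (subst ln_mult[of "2*n" "2 * pi"]) auto
   qed
   hence "exp (ln (2*n)/2 + ln (2 * pi)/2) = exp (ln (4 * pi*n)/2)"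
    by (simp only: add_divide_distrib[symmetric])
   also have "... = sqrt (4 * pi*n)" using n0 by (simp add: ln_sqrt[symmetric])
   finally show ?thesis by (simp only: exp_of_real)
  qed
  have "cnst av1 av2 n1 n2 = exp (cor (ln (2*n)/2 + ln (2 * pi)/2))*exp (- (cor n * kp0) - eN 2 + (cor e2 - e1))"
   unfolding cnst_def dn e1(2) f exp_diff[symmetric] exp_add[symmetric]
   unfolding kp0_def lf_def Ln2 l2 by (rule arg_cong[of _ _ exp]) (simp add: algebra_simps)
  hence "cnst av1 av2 n1 n2 = cor (sqrt (4 * pi*n))*exp (- (cor n * kp0) - eN 2 + (cor e2 - e1))"
   by (simp only: sq)
  moreover have "norm (cor e2 - e1) <= (C1 + C2)/n"
  proof -
   have "C2/real (n1 + n2) <= C2/n" unfolding d using n0 2(1) by (intro divide_left_mono) auto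
   hence "norm (cor e2) <= C2/n" using e2(1) by simp
   from norm_triangle_ineq4[THEN order_trans, OF add_mono[OF this e1(1)]] show ?thesis by (simp add: add_divide_distrib)
  qed
  ultimately show ?thesis by blast
 qed
 have "C1 + C2 >= 0" "max 1 N1 > 0" using 1(1) 2(1) by auto
 thus ?thesis by (rule that[OF _ _ main])
qed

text \<open>The exponent of G at w = n t off the real axis. Its companion \<open>hm\<close> belongs
  to the coefficients at k = n t with 0 < t < 2, where the product of the w - k is replaced by k!
  (2n - k)!; accordingly \<open>lf (2 - t)\<close> appears in place of \<open>lf (t - 2)\<close>.
  \<open>A0\<close> and \<open>Am\<close> are the amplitudes that go with them.\<close>

definition h0 :: "complex => complex" where "h0 t = hN t + lf (t - 2) - lf t"
definition hm :: "complex => complex" where "hm t = hN t - lf t - lf (2 - t)"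

definition A0 :: "complex => complex" where
 "A0 t = exp (eN t - eN 2 - (Ln t + Ln (t - 2))/2)"

definition Am :: "complex => complex" where
 "Am t = exp (eN t - eN 2 - (Ln t + Ln (2 - t))/2)"

definition G :: "nat => nat => complex => complex" where
 "G n1 n2 w = cnst av1 av2 n1 n2*Npr av1 av2 n1 n2 w/(\<Prod>k\<le>n1+n2. w - of_nat k)"

text \<open>The distance from the ray (-infinity, 2]. It contains the scaled zeros and poles of G as
  well as the cuts of all logarithms in \<open>h0\<close> and \<open>A0\<close>.\<close>

definition far :: "real => complex => bool" where
 "far et t \<longleftrightarrow> Im t >= 0 & (ALL ta<=2. norm (t - cor ta) >= et)"

lemma G_asymptotics:
 assumes et: "et > 0"
 obtains C N where "C >= 0" "N > 0"
  "!!n n1 n2 t. scaled n n1 n2 ==> n >= N ==> far et t ==>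
   EX e. norm e <= C/n & G n1 n2 (cor n*t) = cor (sqrt (4 * pi/n))*exp (cor n*(h0 t - kp0))*A0 t*exp e"
proof -
 obtain C1 N1 where 1: "C1 >= 0" "N1 > 0"
  "!!n n1 n2 t. scaled n n1 n2 ==> n >= N1 ==> clear_right et t ==>
   EX e. norm e <= C1/n & Npr av1 av2 n1 n2 (cor n*t) = exp (cor n*hN t + cor (2*n*ln n) + eN t + e)"
  by (rule Npr_asymptotics[OF et]) (rule that)
 obtain C2 N2 where 2: "C2 >= 0" "N2 > 0"
  "!!n n1 n2. scaled n n1 n2 ==> n >= N2 ==>
   EX e. norm e <= C2/n & cnst av1 av2 n1 n2 = cor (sqrt (4 * pi*n))*exp (- (cor n * kp0) - eN 2 + e)"
  by (rule cnst_asymptotics) (rule that)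
 define C3 where "C3 = step_const 0*2/et^2"
 define N where "N = max (max N1 N2) (2/et)"
 have C3: "C3 >= 0" using step_const_pos[of 0] by (simp add: C3_def)
 have main: "EX e. norm e <= (C1 + C2 + C3)/n & G n1 n2 (cor n*t) = cor (sqrt (4 * pi/n))*exp (cor n*(h0 t - kp0))*A0 t*exp e"
  if s: "scaled n n1 n2" and n: "n >= N" and t: "far et t" for n n1 n2 t
 proof -
  have nN: "n >= N1" "n >= N2" "n > 0" "n >= 2/et" using n 1(2) by (auto simp: N_def)
  have farp: "norm (t - cor ta) >= et" if "ta <= 2" for ta using t that by (simp add: far_def)
  have up2: "t - 2 : upper_slit"
  proof -
   have "t - 2 ~: \<real>\<^sub>\<le>\<^sub>0"
   proof
    assume "t - 2 : \<real>\<^sub>\<le>\<^sub>0"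
    then obtain r where r: "t - 2 = cor r" "r <= 0" by (auto elim: nonpos_Reals_cases)
    hence "t - cor (r + 2) = 0" by (simp add: algebra_simps)
    thus False using farp[of "r + 2"] r et by simp
   qed
   thus ?thesis using t by (auto simp: upper_slit_def far_def)
  qed
  have up: "t : upper_slit" using upper_slit_add[OF up2, of 2] by simp
  have t0: "t ~= 0" using upper_slit_nonzero[OF up] .
  have f1: "norm (t + cor ta) >= et" if "0 <= ta" "ta <= 2" for ta using farp[of "-ta"] that by simp
  have f2: "norm (t - 2 + cor ta) >= et" if "0 <= ta" "ta <= 2" for ta using farp[of "2-ta"] that by (simp add: algebra_simps)
  obtain e1 where e1: "norm e1 <= C1/n" "Npr av1 av2 n1 n2 (cor n*t) = exp (cor n*hN t + cor (2*n*ln n) + eN t + e1)"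
   using 1(3)[OF s nN(1), of t] up f1 by (auto simp: clear_right_def)
  obtain e2 where e2: "norm e2 <= C2/n" "cnst av1 av2 n1 n2 = cor (sqrt (4 * pi*n))*exp (- (cor n * kp0) - eN 2 + e2)"
   using 2(3)[OF s nN(2)] by blast
  have d: "real (n1 + n2) = 2*n" by (rule scaled_sum[OF s])
  have en: "et*n >= 2*(1 + \<bar>0\<bar>)" using nN(4) et by (simp add: divide_le_eq mult.commute)
  obtain e3 where e3: "norm e3 <= (step_const 0*2/et^2)/n"
   "(\<Prod>j<n1+n2. cor n*(t - 2) + of_nat j + cor 0) =
   exp (cor n*(lf (t - 2 + cor 2) - lf (t - 2)) + cor (n*2*ln n) + (cor 0 - 1/2)*(Ln (t - 2 + cor 2) - Ln (t - 2)) + e3)"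
   by (rule poch_asymptotics[OF nN(3) d _ _ up2 f2 et en]) (auto intro: that)
  have dc: "of_nat (n1 + n2) = cor n*2"
   using arg_cong[OF d, of cor] by simp
  \<comment> \<open>The factor k = 0 is split off; the others, read from k = 2n downwards, form an
    ascending product that starts at n (t - 2), to which \<open>poch_asymptotics\<close>
    applies.\<close>
  have "(\<Prod>k\<le>n1+n2. cor n*t - of_nat k) = cor n*t*(\<Prod>k\<in>{0<..n1+n2}. cor n*t - of_nat k)"
   by (subst prod.remove[of _ 0]) (auto intro!: prod.cong)
  also have "(\<Prod>k\<in>{0<..n1+n2}. cor n*t - of_nat k) = (\<Prod>j<n1+n2. cor n*(t - 2) + of_nat j + cor 0)"
  proof (rule prod.reindex_bij_witness[of _ "%j. n1 + n2 - j" "%k. n1 + n2 - k"])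
   fix k assume "k : {0<..n1+n2}"
   hence "of_nat (n1 + n2 - k) = cor n*2 - of_nat k" by (simp only: of_nat_diff dc greaterThanAtMost_iff)
   thus "cor n*(t - 2) + of_nat (n1 + n2 - k) + cor 0 = cor n*t - of_nat k" by (simp add: algebra_simps)
  qed auto
  finally have D0: "(\<Prod>k\<le>n1+n2. cor n*t - of_nat k) = cor n*t*(\<Prod>j<n1+n2. cor n*(t - 2) + of_nat j + cor 0)" .
  have W: "cor n*t = exp (cor (ln n) + Ln t)"
   using nN(3) t0 by (simp add: exp_add exp_of_real)
  have D: "(\<Prod>k\<le>n1+n2. cor n*t - of_nat k) = exp (cor (ln n) + Ln t + (cor n*(lf t - lf (t - 2)) + cor (n*2*ln n) - 1/2*(Ln t - Ln (t - 2)) + e3))"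
   unfolding D0 e3(2) unfolding W by (simp add: exp_add[symmetric])
  have sq: "cor (sqrt (4 * pi*n)) = cor (sqrt (4 * pi/n))*exp (cor (ln n))"
  proof -
   have "sqrt (4 * pi*n) = sqrt (4 * pi/n*n^2)" using nN(3) by (simp add: power2_eq_square)
   also have "... = sqrt (4 * pi/n)*n" using nN(3) by (simp only: real_sqrt_mult) simp
   finally show ?thesis using nN(3) by (simp add: exp_of_real)
  qed
  have gen: "s'*exp l*exp X*exp Y/exp Z = s'*exp (l + X + Y - Z)" for s' l X Y Z :: complex
   by (simp add: exp_add exp_diff)
  have "G n1 n2 (cor n*t) = cor (sqrt (4 * pi/n))*exp (cor n*(h0 t - kp0) + (eN t - eN 2 - (Ln t + Ln (t - 2))/2) + (e1 + e2 - e3))"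
   unfolding G_def e1(2) e2(2) D sq gen
   by (rule arg_cong[of _ _ "%x. cor (sqrt (4 * pi/n))*exp x"]) (simp add: h0_def field_simps)
  hence "G n1 n2 (cor n*t) = cor (sqrt (4 * pi/n))*exp (cor n*(h0 t - kp0))*A0 t*exp (e1 + e2 - e3)"
   by (simp add: A0_def exp_add mult.assoc)
  moreover have "norm (e1 + e2 - e3) <= (C1 + C2 + C3)/n"
   unfolding add_divide_distrib using e1(1) e2(1) e3(1)
   by (intro order_trans[OF norm_triangle_ineq4] add_mono order_trans[OF norm_triangle_ineq]) (auto simp: C3_def)
  ultimately show ?thesis by blast
 qed
 have "C1 + C2 + C3 >= 0" "N > 0" using 1(1,2) 2(1) C3 by (auto simp: N_def)
 thus ?thesis by (rule that[OF _ _ main])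
qed

text \<open>Stirling's formula is applied to k! and (2n - k)! separately. Both arguments have to be
  of order n, hence the distance ep from the ends 0 and 2.\<close>

lemma term_asymptotics:
 assumes ep: "ep > 0"
 obtains C N where "C >= 0" "N > 0"
  "!!n n1 n2 k t. scaled n n1 n2 ==> n >= N ==> real k = n*t ==> ep <= t ==> t <= 2 - ep ==>
   EX e. norm e <= C/n & cnst av1 av2 n1 n2*Npr av1 av2 n1 n2 (of_nat k)/(fact k*fact (n1 + n2 - k))
    = exp (cor n*(hm (cor t) - kp0))*Am (cor t)*exp e/cor (sqrt (pi*n))"
proof -
 obtain C1 N1 where 1: "C1 >= 0" "N1 > 0"
  "!!n n1 n2 t. scaled n n1 n2 ==> n >= N1 ==> clear_right ep t ==>
   EX e. norm e <= C1/n & Npr av1 av2 n1 n2 (cor n*t) = exp (cor n*hN t + cor (2*n*ln n) + eN t + e)"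
  by (rule Npr_asymptotics[OF ep]) (rule that)
 obtain C2 N2 where 2: "C2 >= 0" "N2 > 0"
  "!!n n1 n2. scaled n n1 n2 ==> n >= N2 ==>
   EX e. norm e <= C2/n & cnst av1 av2 n1 n2 = cor (sqrt (4 * pi*n))*exp (- (cor n * kp0) - eN 2 + e)"
  by (rule cnst_asymptotics) (rule that)
 obtain C3 where 3: "C3 >= 0" "!!k. k >= 1 ==> EX e::real. \<bar>e\<bar> <= C3/k &
  fact k = exp (k*ln k - k + ln k/2 + ln (2 * pi)/2 + e)"
  by (rule stirling) (rule that)
 have fac: "EX e. norm e <= (C3/ep)/n & (fact k :: complex) = exp (cor n*lf (cor t) + cor (n*t*ln n) + cor (ln n)/2 + Ln (cor t)/2 + cor (ln (2 * pi))/2 + e)"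
  if k: "real k = n*t" and t: "t >= ep" and n: "n > 0" for n t k
 proof -
  have t0: "t > 0" using t ep by simp
  have "real k > 0" using k t0 n by simp
  hence k1: "k >= 1" by simp
  obtain e :: real where e: "\<bar>e\<bar> <= C3/k" "fact k = exp (k*ln k - k + ln k/2 + ln (2 * pi)/2 + e)"
   using 3(2)[OF k1] by blast
  have "C3/k <= C3/(n*ep)" unfolding k using 3(1) n t ep t0 by (intro divide_left_mono mult_left_mono mult_pos_pos) auto
  hence "norm (cor e) <= (C3/ep)/n" using e(1) by (simp add: mult.commute)
  moreover have "(fact k :: complex) = exp (cor (k*ln k - k + ln k/2 + ln (2 * pi)/2 + e))"
   using arg_cong[OF e(2), of cor] by (simp only: of_real_fact exp_of_real)
  moreover have "cor (k*ln k - k + ln k/2 + ln (2 * pi)/2 + e) = cor n*lf (cor t) + cor (n*t*ln n) + cor (ln n)/2 + Ln (cor t)/2 + cor (ln (2 * pi))/2 + cor e"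
   unfolding k using n t0 by (simp add: lf_def Ln_of_real ln_mult algebra_simps add_divide_distrib)
  ultimately show ?thesis by metis
 qed
 define N where "N = max N1 N2"
 define C where "C = C1 + C2 + (C3/ep + C3/ep)"
 have main: "EX e. norm e <= C/n & cnst av1 av2 n1 n2*Npr av1 av2 n1 n2 (of_nat k)/(fact k*fact (n1 + n2 - k))
    = exp (cor n*(hm (cor t) - kp0))*Am (cor t)*exp e/cor (sqrt (pi*n))"
  if s: "scaled n n1 n2" and n: "n >= N" and k: "real k = n*t" and t: "ep <= t" "t <= 2 - ep" for n n1 n2 k t
 proof -
  have nN: "n >= N1" "n >= N2" "n > 0" using n 1(2) by (auto simp: N_def)
  have t0: "t > 0" using t ep by simp
  have up: "cor t : upper_slit" using t0 by (simp add: upper_slit_def complex_nonpos_Reals_iff)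
  have f1: "norm (cor t + cor ta) >= ep" if "0 <= ta" for ta
   unfolding of_real_add[symmetric] norm_of_real using t that by simp
  have kc: "of_nat k = cor n * cor t" using arg_cong[OF k, of cor] by simp
  obtain e1 where e1: "norm e1 <= C1/n" "Npr av1 av2 n1 n2 (of_nat k) = exp (cor n*hN (cor t) + cor (2*n*ln n) + eN (cor t) + e1)"
   using 1(3)[OF s nN(1), of "cor t"] up f1 unfolding kc by (auto simp: clear_right_def)
  obtain e2 where e2: "norm e2 <= C2/n" "cnst av1 av2 n1 n2 = cor (sqrt (4 * pi*n))*exp (- (cor n * kp0) - eN 2 + e2)"
   using 2(3)[OF s nN(2)] by blast
  have d: "real (n1 + n2) = 2*n" by (rule scaled_sum[OF s])
  have "n*t <= n*2" using t ep nN(3) by (intro mult_left_mono) auto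
  hence "k <= n1 + n2" using k d by linarith
  hence dk: "real (n1 + n2 - k) = n*(2 - t)" unfolding of_nat_diff[OF \<open>k <= n1 + n2\<close>] d k by (simp add: algebra_simps)
  obtain e3 where e3: "norm e3 <= (C3/ep)/n" "(fact k :: complex) = exp (cor n*lf (cor t) + cor (n*t*ln n) + cor (ln n)/2 + Ln (cor t)/2 + cor (ln (2 * pi))/2 + e3)"
   using fac[OF k t(1) nN(3)] by blast
  have "2 - t >= ep" using t by simp
  from fac[OF dk this nN(3)]
  obtain e4 where e4: "norm e4 <= (C3/ep)/n" "(fact (n1 + n2 - k) :: complex) = exp (cor n*lf (cor (2 - t)) + cor (n*(2 - t)*ln n) + cor (ln n)/2 + Ln (cor (2 - t))/2 + cor (ln (2 * pi))/2 + e4)"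
   by blast
  have sq: "cor (sqrt (4 * pi*n)) = exp (cor (ln n + ln (2 * pi)))/cor (sqrt (pi*n))"
  proof -
   have "sqrt (4 * pi*n) * sqrt (pi*n) = sqrt ((2 * pi*n)^2)"
    unfolding real_sqrt_mult[symmetric] by (simp add: power2_eq_square)
   also have "... = exp (ln n + ln (2 * pi))" using nN(3) by (simp add: exp_add)
   finally have "sqrt (4 * pi*n) = exp (ln n + ln (2 * pi))/sqrt (pi*n)" using nN(3) by (simp add: field_simps)
   thus ?thesis by (simp only: of_real_divide exp_of_real)
  qed
  have two: "cor (2 - t) = 2 - cor t" by simp
  have "cnst av1 av2 n1 n2*Npr av1 av2 n1 n2 (of_nat k)/(fact k*fact (n1 + n2 - k))
   = exp ((cor (ln n + ln (2 * pi)) + (- (cor n * kp0) - eN 2 + e2)) + (cor n*hN (cor t) + cor (2*n*ln n) + eN (cor t) + e1)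
     - ((cor n*lf (cor t) + cor (n*t*ln n) + cor (ln n)/2 + Ln (cor t)/2 + cor (ln (2 * pi))/2 + e3)
      + (cor n*lf (cor (2 - t)) + cor (n*(2 - t)*ln n) + cor (ln n)/2 + Ln (cor (2 - t))/2 + cor (ln (2 * pi))/2 + e4)))/cor (sqrt (pi*n))"
   unfolding e1(2) e2(2) e3(2) e4(2) sq exp_add exp_diff by (simp add: field_simps)
  also have "((cor (ln n + ln (2 * pi)) + (- (cor n * kp0) - eN 2 + e2)) + (cor n*hN (cor t) + cor (2*n*ln n) + eN (cor t) + e1)
     - ((cor n*lf (cor t) + cor (n*t*ln n) + cor (ln n)/2 + Ln (cor t)/2 + cor (ln (2 * pi))/2 + e3)
      + (cor n*lf (cor (2 - t)) + cor (n*(2 - t)*ln n) + cor (ln n)/2 + Ln (cor (2 - t))/2 + cor (ln (2 * pi))/2 + e4)))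
    = cor n*(hm (cor t) - kp0) + (eN (cor t) - eN 2 - (Ln (cor t) + Ln (2 - cor t))/2) + (e1 + e2 - (e3 + e4))"
   unfolding hm_def two by (simp add: algebra_simps add_divide_distrib)
  finally have "cnst av1 av2 n1 n2*Npr av1 av2 n1 n2 (of_nat k)/(fact k*fact (n1 + n2 - k))
    = exp (cor n*(hm (cor t) - kp0))*Am (cor t)*exp (e1 + e2 - (e3 + e4))/cor (sqrt (pi*n))"
   by (simp only: Am_def exp_add mult.assoc)
  moreover have "norm (e1 + e2 - (e3 + e4)) <= C/n"
   unfolding C_def add_divide_distrib using e1(1) e2(1) e3(1) e4(1)
   by (intro order_trans[OF norm_triangle_ineq4] add_mono order_trans[OF norm_triangle_ineq]) auto
  ultimately show ?thesis by blast
 qed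
 have "C >= 0" "N > 0" using 1(1,2) 2(1) 3(1) ep by (auto simp: N_def C_def)
 thus ?thesis by (rule that[OF _ _ main])
qed

end

section \<open>One-sided limits at the real line and tools for selecting branches\<close>

definition half :: "real => complex set" where "half sg = {z. 0 < sg*Im z}"

lemma half_connected: "connected (half sg)"
proof -
 have "half sg = (%z. sg*Im z) -` {0<..}" by (auto simp: half_def)
 moreover have "convex ((%z. sg*Im z) -` {0<..})"
  by (rule convex_linear_vimage) (auto intro!: linearI simp: algebra_simps)
 ultimately show ?thesis by (simp add: convex_connected)
qed

lemma half_not_bot:
 assumes "sg ~= 0" shows "at (cor x) within half sg ~= bot"
proof -
 have "cor x islimpt half sg"
  unfolding islimpt_approachable
 proof (intro allI impI)
  fix e :: real assume e: "e > 0"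
  define w where "w = Complex x (sgn sg*e/2)"
  have "w - cor x = Complex 0 (sgn sg*e/2)" by (simp add: w_def complex_eq_iff)
  hence "norm (w - cor x) = \<bar>sgn sg*e/2\<bar>" by (simp add: complex_norm)
  also have "... < e" using assms e by (auto simp: sgn_if)
  finally have "dist w (cor x) < e" by (simp add: dist_norm)
  moreover have "w : half sg" using assms e by (auto simp: w_def half_def sgn_if zero_less_mult_iff)
  moreover have "w ~= cor x" using assms e by (auto simp: w_def complex_eq_iff sgn_if)
  ultimately show "EX x':half sg. x' ~= cor x & dist x' (cor x) < e" by blast
 qed
 thus ?thesis by (simp add: trivial_limit_within)
qed

lemma bdry_eqI:
 assumes "sg ~= 0" "(f \<longlongrightarrow> l) (at (cor x) within half sg)" shows "bdry sg f x = l"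
 unfolding bdry_def using tendsto_Lim[OF half_not_bot[OF assms(1)] assms(2)] by (simp add: half_def)

lemma connected_same_sign:
 fixes f :: "complex => real"
 assumes "connected S" "continuous_on S f" "!!z. z : S ==> f z ~= 0" "z0 : S" "f z0 > 0" "z : S"
 shows "f z > 0"
proof (rule ccontr)
 assume "~ f z > 0"
 hence "f z < 0" using assms(3)[OF assms(6)] by linarith
 moreover have "connected (f ` S)" by (rule connected_continuous_image[OF assms(2,1)])
 ultimately have "0 : f ` S"
  using assms(4,5,6) by (meson connected_iff_interval imageI less_imp_le)
 thus False using assms(3) by auto
qed

text \<open>The quotient g/h is continuous with values in {1, -1}, so it is constant on a connected
  set.\<close>

lemma connected_square_root_unique:
 fixes g h :: "complex => complex"
 assumes S: "connected S" and g: "continuous_on S g" and h: "continuous_on S h"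
  and sq: "!!z. z : S ==> g z ^ 2 = h z ^ 2" and nz: "!!z. z : S ==> h z ~= 0"
 obtains e where "e = 1 | e = -1" "!!z. z : S ==> g z = e*h z"
proof (cases "S = {}")
 case False
 then obtain z0 where z0: "z0 : S" by blast
 define k where "k = (%z. g z/h z)"
 have k: "k z = 1 | k z = -1" if "z : S" for z
 proof -
  have "(k z)^2 = 1" using sq[OF that] nz[OF that] by (simp add: k_def power_divide)
  thus ?thesis by (simp add: power2_eq_1_iff)
 qed
 have "continuous_on S k" unfolding k_def by (intro continuous_intros g h) (use nz in auto)
 moreover have "finite (k ` S)" by (rule finite_subset[of _ "{1,-1}"]) (use k in auto)
 ultimately have "k constant_on S" by (intro continuous_finite_range_constant S)
 hence "!!z. z : S ==> k z = k z0" using z0 unfolding constant_on_def by metis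
 hence "g z = k z0*h z" if "z : S" for z using nz[OF that] that by (metis k_def nonzero_eq_divide_eq)
 thus ?thesis using that k[OF z0] by blast
qed (use that in auto)

text \<open>For Im w < 0 the principal root lies in the fourth quadrant; multiplication by i turns
  it into the first, where it is again principal.\<close>

lemma csqrt_minus_lower:
 assumes "Im w < 0" shows "csqrt (- w) = \<i> * csqrt w"
proof (rule csqrt_unique)
 show "(\<i> * csqrt w)^2 = - w" by (simp add: power_mult_distrib)
 have "Im (csqrt w) < 0"
 proof -
  have imw: "Im w = 2 * Re (csqrt w)*Im (csqrt w)" using Im_power2[of "csqrt w"] unfolding power2_csqrt .
  have re: "Re (csqrt w) >= 0" using csqrt_principal[of w] by (auto simp del: csqrt.sel)
  show ?thesis
  proof (rule ccontr)
   assume "~ Im (csqrt w) < 0"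
   hence "0 <= 2 * Re (csqrt w)*Im (csqrt w)" using re by (intro mult_nonneg_nonneg) linarith+
   thus False using imw assms by linarith
  qed
 qed
 thus "0 < Re (\<i> * csqrt w) | Re (\<i> * csqrt w) = 0 & 0 <= Im (\<i> * csqrt w)" by (simp del: csqrt.sel)
qed

lemma tendsto_in_region:
 fixes f :: "'a => complex"
 assumes F: "((%z. (f z - u0)*(f z - u1)*(f z - u2)) \<longlongrightarrow> 0) F"
  and S: "closed S" "eventually (%z. f z : S) F"
  and u: "u1 ~: S | u1 = u0" "u2 ~: S | u2 = u0"
 shows "(f \<longlongrightarrow> u0) F"
proof -
 have sep: "EX de>0. ALL w:S. norm (w - u0) >= e --> norm (w - v) >= de" if e: "e > 0" and v: "v ~: S | v = u0" for e v
 proof (cases "v = u0")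
  case False
  hence "open (- S)" "v : - S" using v S by auto
  then obtain de where d: "de > 0" "ball v de \<subseteq> - S" by (meson openE)
  show ?thesis
  proof (intro exI[of _ de] conjI ballI impI d(1))
   fix w assume "w : S"
   hence "w ~: ball v de" using d by auto
   thus "norm (w - v) >= de" by (simp add: dist_norm norm_minus_commute)
  qed
 qed (use e in auto)
 show ?thesis
  unfolding tendsto_iff dist_norm
 proof (intro allI impI)
  fix e :: real assume e: "e > 0"
  obtain d1 where d1: "d1 > 0" "ALL w:S. norm (w - u0) >= e --> norm (w - u1) >= d1" using sep[OF e u(1)] by blast
  obtain d2 where d2: "d2 > 0" "ALL w:S. norm (w - u0) >= e --> norm (w - u2) >= d2" using sep[OF e u(2)] by blast
  have "e*d1*d2 > 0" using e d1 d2 by simp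
  hence "eventually (%z. dist ((f z - u0)*(f z - u1)*(f z - u2)) 0 < e*d1*d2) F"
   using F by (auto simp: tendsto_iff)
  thus "eventually (%z. norm (f z - u0) < e) F"
   using S(2)
  proof eventually_elim
   case (elim z)
   show ?case
   proof (rule ccontr)
    assume n: "~ norm (f z - u0) < e"
    hence "norm (f z - u1) >= d1" "norm (f z - u2) >= d2" using d1 d2 elim by auto
    hence "e*d1*d2 <= norm (f z - u0)*norm (f z - u1)*norm (f z - u2)"
     using n e d1 d2 by (intro mult_mono) auto
    thus False using elim by (simp add: norm_mult)
   qed
  qed
 qed
qed

section \<open>The equation R(s) = z in the coordinate u = (1 - 1/s)/2\<close>

locale jth =
 fixes tt :: real
 assumes tt01: "0 < tt" "tt < 1"
begin

definition "pp = tt*(2 - tt)"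
definition "qq = 4 - pp"

lemma pp: "0 < pp" "pp < 1"
proof -
 show "0 < pp" using tt01 by (simp add: pp_def)
 have "1 - pp = (1 - tt)^2" by (simp add: pp_def power2_eq_square algebra_simps)
 moreover have "(1 - tt)^2 > 0" using tt01 by simp
 ultimately show "pp < 1" by linarith
qed

lemma qq: "3 < qq" "qq < 4" "0 < qq" using pp by (auto simp: qq_def)

text \<open>This is 1/R(s) for u = (1 - 1/s)/2. The linear term is missing because (2 - tt) + tt - 2
  = 0; the coefficients depend on tt only through pp = tt (2 - tt).\<close>

definition zeta :: "complex => complex" where
 "zeta u = 1 - cor qq*u^2 - 2 * cor pp*u^3"

lemma zeta_factor3: "zeta u = (1 + cor (2 - tt)*u)*(1 + cor tt*u)*(1 - 2*u)"
 by (simp add: zeta_def qq_def pp_def algebra_simps power2_eq_square power3_eq_cube)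

definition us :: "complex => complex" where "us s = (1 - 1/s)/2"

lemma theta_consts:
 "theta1 tt > 0" "theta2 tt > 0" "theta1 tt > theta2 tt" "c0 tt > 0" "(2 + tt)*(4 - tt) = 8 + pp"
proof -
 show "theta1 tt > 0" "theta2 tt > 0" "c0 tt > 0" using tt01 by (auto simp: theta1_def theta2_def c0_def)
 have "theta2 tt < 1/3" using tt01 by (simp add: theta2_def divide_less_eq)
 moreover have "theta1 tt > 1/3" using tt01 by (simp add: theta1_def less_divide_eq)
 ultimately show "theta1 tt > theta2 tt" by linarith
 show "(2 + tt)*(4 - tt) = 8 + pp" by (simp add: pp_def algebra_simps)
qed

lemma R_eq:
 assumes "s ~= 0" "R tt s ~= 0"
 shows "zeta (us s) = 1/R tt s"
proof -
 have d: "2 + tt ~= 0" "4 - tt ~= 0" using tt01 by auto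
 hence d': "(2 + cor tt) ~= 0" "(4 - cor tt) ~= 0"
  by (metis of_real_add of_real_diff of_real_eq_0_iff of_real_numeral)+
 have nz: "s - cor (theta1 tt) ~= 0" "s - cor (theta2 tt) ~= 0"
  using assms(2) by (auto simp: R_def)
 have t1: "(4 - cor tt)*(s - cor (theta1 tt)) = (4 - cor tt) * s - (2 - cor tt)"
  using d' by (simp add: theta1_def algebra_simps) (simp add: field_simps)
 have t2: "(2 + cor tt)*(s - cor (theta2 tt)) = (2 + cor tt) * s - cor tt"
  using d' by (simp add: theta2_def algebra_simps) (simp add: field_simps)
 have "zeta (us s) * s^3*4 = ((4 - cor tt) * s - (2 - cor tt))*((2 + cor tt) * s - cor tt)"
  unfolding zeta_factor3 us_def using assms(1)
  by (simp add: field_simps power2_eq_square power3_eq_cube)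
 also have "... = ((2 + cor tt)*(4 - cor tt))*((s - cor (theta1 tt))*(s - cor (theta2 tt)))"
  unfolding t1[symmetric] t2[symmetric] by (simp only: mult_ac)
 finally have e: "zeta (us s) * s^3*4 = ((2 + cor tt)*(4 - cor tt))*((s - cor (theta1 tt))*(s - cor (theta2 tt)))" .
 have "1/R tt s = ((2 + cor tt)*(4 - cor tt))*((s - cor (theta1 tt))*(s - cor (theta2 tt)))/(4 * s^3)"
  using nz assms(1) d' by (simp add: R_def c0_def)
 also have "... = zeta (us s)" unfolding e[symmetric] using assms(1) by simp
 finally show ?thesis by simp
qed

lemma us_inv: assumes "s ~= 0" shows "s = 1/(1 - 2*us s)" "1 - 2*us s ~= 0"
proof -
 have e: "1 - 2*us s = 1/s" using assms by (simp add: us_def field_simps)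
 show "s = 1/(1 - 2*us s)" "1 - 2*us s ~= 0" unfolding e using assms by auto
qed

lemma us_of_inv: assumes "1 - 2*u ~= 0" shows "us (1/(1 - 2*u)) = u"
 using assms by (simp add: us_def)

lemma R_of_u:
 assumes "zeta u ~= 0" shows "R tt (1/(1 - 2*u)) = 1/zeta u"
proof -
 have u: "1 - 2*u ~= 0" using assms by (auto simp: zeta_factor3)
 define s where "s = 1/(1 - 2*u)"
 have s0: "s ~= 0" using u by (simp add: s_def)
 have us: "us s = u" unfolding s_def by (rule us_of_inv[OF u])
 have "R tt s ~= 0"
 proof
  assume "R tt s = 0"
  hence "s = cor (theta1 tt) | s = cor (theta2 tt)" using s0 theta_consts(4) by (auto simp: R_def)
  hence "1 + cor (2 - tt)*us s = 0 | 1 + cor tt*us s = 0"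
  proof
   assume h: "s = cor (theta1 tt)"
   have "1 + (2 - tt)*((1 - 1/theta1 tt)/2) = 0" using tt01 by (simp add: theta1_def field_simps)
   hence "cor (1 + (2 - tt)*((1 - 1/theta1 tt)/2)) = 0" by (simp only: of_real_0)
   thus ?thesis by (simp add: h us_def)
  next
   assume h: "s = cor (theta2 tt)"
   have "1 + tt*((1 - 1/theta2 tt)/2) = 0" using tt01 by (simp add: theta2_def field_simps)
   hence "cor (1 + tt*((1 - 1/theta2 tt)/2)) = 0" by (simp only: of_real_0)
   thus ?thesis by (simp add: h us_def)
  qed
  hence "zeta (us s) = 0" by (auto simp: zeta_factor3)
  thus False using assms us by simp
 qed
 hence "zeta u = 1/R tt s" using R_eq[OF s0] us by simp
 thus ?thesis by (simp add: s_def)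
qed

text \<open>The second factor of Im (zeta u), see \<open>Im_zeta\<close>. Its zero set is a
  hyperbola, on which all non-real preimages of the real line lie.\<close>

definition J :: "complex => real" where "J u = qq * Re u + pp*(3 * Re u^2 - Im u^2)"

lemma Im_zeta: "Im (zeta u) = - 2*Im u*J u"
 by (simp add: zeta_def J_def power2_eq_square power3_eq_cube algebra_simps)

lemma cont_J: "continuous_on UNIV J"
 unfolding J_def by (intro continuous_intros)

lemma Im_us: assumes "s ~= 0" shows "Im (us s) = Im s/(2*norm s^2)"
proof -
 have "Im (1/s) = - Im s/(norm s)^2" by (simp add: Im_divide cmod_power2)
 thus ?thesis by (simp add: us_def)
qed

text \<open>\<open>Sreg0 sg\<close> and \<open>Sreg1 sg\<close> are closed regions in the u-plane
  which contain the values of phi_0 and phi_1 for z in the half plane of sign sg. They are made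
  closed so that the limits at the real line stay in them.\<close>

definition Sreg0 where "Sreg0 sg = {u. Re u >= 0 & sg*Im u >= 0 & J u >= 0}"
definition Sreg1 where "Sreg1 sg = {u. sg*Im u <= 0 & J u <= 0}"

lemma closed_Sreg: "closed (Sreg0 sg)" "closed (Sreg1 sg)"
proof -
 have "Sreg0 sg = {u. Re u >= 0} \<inter> {u. sg*Im u >= 0} \<inter> {u. J u >= 0}" by (auto simp: Sreg0_def)
 moreover have "closed {u. sg*Im u >= 0}" "closed {u. Re u >= 0}" "closed {u. J u >= 0}"
  by (intro closed_Collect_le continuous_intros cont_J)+
 ultimately show "closed (Sreg0 sg)" by (simp add: closed_Int)
 have "Sreg1 sg = {u. sg*Im u <= 0} \<inter> {u. J u <= 0}" by (auto simp: Sreg1_def)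
 moreover have "closed {u. sg*Im u <= 0}" "closed {u. J u <= 0}"
  by (intro closed_Collect_le continuous_intros cont_J)+
 ultimately show "closed (Sreg1 sg)" by (simp add: closed_Int)
qed

lemma J_sign:
 assumes z: "0 < sg*Im z" "zeta u = 1/z" and sg: "sg = 1 | sg = -1"
 shows "0 < sg*Im u ==> J u > 0" "sg*Im u < 0 ==> J u < 0"
proof -
 have z0: "z ~= 0" using z(1) by auto
 have "Im (1/z) = - Im z/norm z^2" by (simp add: Im_divide cmod_power2)
 hence "2*Im u*J u*norm z^2 = Im z" using Im_zeta[of u] z(2) z0 by (simp add: field_simps)
 hence "0 < 2*(sg*Im u)*J u*norm z^2" using z(1) by (metis mult.assoc mult.left_commute)
 hence *: "0 < (sg*Im u)*J u" by (simp add: zero_less_mult_iff)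
 show "J u > 0" if "0 < sg*Im u" using zero_less_mult_pos[OF*that] .
 show "J u < 0" if "sg*Im u < 0"
 proof (rule ccontr)
  assume "~ J u < 0"
  hence "sg*Im u*J u <= 0" using that mult_nonpos_nonneg[of "sg*Im u" "J u"] by simp
  thus False using*by simp
 qed
qed

text \<open>\<open>Wf\<close> is -1/2 times the derivative of \<open>zeta\<close>. By
  \<open>calD_eq\<close> below D(s) is s^4 Wf(u) times the positive constant \<open>CD\<close>, so
  the square root of D is reduced to that of \<open>Wf\<close>; the second derivative at a saddle
  point is a multiple of \<open>Wf\<close> as well.\<close>

definition Wf :: "complex => complex" where "Wf u = u*(cor qq + 3 * cor pp*u)"
definition "CD = 4/(8 + pp)"

lemma CD_pos: "CD > 0" using pp by (simp add: CD_def)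

lemma calD_eq:
 assumes "s ~= 0" shows "calD tt s = s^4 * cor CD*Wf (us s)"
proof -
 have e: "s_star tt = 3 * pp/(8 + pp)"
  using theta_consts(5) by (simp add: s_star_def theta1_def theta2_def pp_def mult_ac)
 have n8: "(8 + cor pp) ~= 0"
  using pp by (metis add_pos_pos of_real_add of_real_eq_0_iff of_real_numeral order_less_irrefl zero_less_numeral)
 have "calD tt s*(8 + cor pp) = s^2*(s - 1)*((8 + cor pp) * s - 3 * cor pp)"
  unfolding calD_def e using n8 by (simp add: field_simps)
 also have "... = s^4*4*Wf (us s)"
  unfolding Wf_def us_def qq_def using assms
  by (simp add: field_simps power2_eq_square power4_eq_xxxx)
 finally show ?thesis using n8 by (simp add: CD_def field_simps)
qed

lemma Im_Wf: "Im (Wf u) = Im u*(qq + 6 * pp * Re u)"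
 and Re_Wf: "Re (Wf u) = J u - 2 * pp*Im u^2"
 by (auto simp: Wf_def J_def algebra_simps power2_eq_square)

lemma Wf_region0:
 assumes "Re u > 0" "Im u ~= 0 | J u >= 0" shows "Wf u ~: \<real>\<^sub>\<le>\<^sub>0"
proof (cases "Im u = 0")
 case False
 have "qq + 6 * pp * Re u > 0" using assms pp qq by (intro add_pos_pos) auto
 thus ?thesis using False by (auto simp: complex_nonpos_Reals_iff Im_Wf)
next
 case True
 have "J u > 0" using True assms(1) pp qq by (simp add: J_def add_pos_pos)
 thus ?thesis using True by (auto simp: complex_nonpos_Reals_iff Re_Wf)
qed

text \<open>Re (Wf u) = J u - 2 pp (Im u)^2 is at most 0 here, so it is the negative of
  \<open>Wf\<close> that has a continuous principal root along phi_1, whereas along phi_0 it is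
  \<open>Wf\<close> itself.\<close>

lemma Wf_region1:
 assumes "J u <= 0" "Wf u ~= 0" shows "- Wf u ~: \<real>\<^sub>\<le>\<^sub>0"
proof
 assume "- Wf u : \<real>\<^sub>\<le>\<^sub>0"
 hence h: "Re (Wf u) >= 0" "Im (Wf u) = 0" by (auto simp: complex_nonpos_Reals_iff)
 have "2 * pp*Im u^2 >= 0" using pp by simp
 hence "Re (Wf u) = 0" using h(1) assms(1) Re_Wf[of u] by linarith
 thus False using h(2) assms(2) by (simp add: complex_eq_iff)
qed

text \<open>The roots of \<open>R s = x\<close> for real \<open>x\<close>, in the variable \<open>t = 2 s/(s - 1)\<close>: a pair with
 real part \<open>r\<close>, and \<open>- 2 r\<close>.\<close>

definition X :: "real => real" where "X r = 4*r^3/(pp - qq*r + 4*r^3)"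
definition Y :: "real => real" where "Y r = \<bar>r\<bar> * sqrt ((3 * pp + qq*r)/(pp - qq*r))"

lemma Xden_pos:
 assumes "- (3 * pp/qq) <= r" "r <= pp/qq" shows "pp - qq*r + 4*r^3 > 0"
proof -
 have rq: "qq*r <= pp" using assms(2) qq by (simp add: le_divide_eq mult.commute)
 show ?thesis
 proof (cases "r > 0")
  case True thus ?thesis using rq by (intro add_nonneg_pos) auto
 next
  case False
  define ro where "ro = - r"
  have r0: "ro >= 0" using False by (simp add: ro_def)
  have "qq*ro <= 3 * pp" using assms(1) qq by (simp add: ro_def minus_le_iff divide_le_eq le_divide_eq mult.commute)
  hence "qq*ro < qq*1" using pp qq by linarith
  hence r1: "ro < 1" using qq by simp
  have "ro^3 <= ro" using power_decreasing[of 1 3 ro] r0 r1 by simp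
  hence a: "qq*ro^3 <= qq*ro" using qq by simp
  have "ro^3 < 1" using \<open>ro^3 <= ro\<close> r1 by linarith
  hence b: "pp*ro^3 < pp*1" using pp by (intro mult_strict_left_mono) auto
  have "pp - qq*r + 4*r^3 = pp + qq*ro - 4*ro^3" by (simp add: ro_def)
  also have "4*ro^3 = qq*ro^3 + pp*ro^3" by (simp add: qq_def algebra_simps)
  finally show ?thesis using a b by linarith
 qed
qed

lemma X_cont: "continuous_on {- (3 * pp/qq)..pp/qq} X"
 unfolding X_def by (intro continuous_intros ballI) (use Xden_pos in force)

lemma x_star_eq: "X (- (3 * pp/qq)) = x_star tt"
proof -
 have q0: "qq ~= 0" using qq by simp
 have a: "(2 + tt)^2*(4 - tt)^2*(1 - tt)^2 = (8 + pp)^2*(1 - pp)"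
 proof -
  have "1 - pp = (1 - tt)^2" by (simp add: pp_def power2_eq_square algebra_simps)
  thus ?thesis by (simp add: theta_consts(5)[symmetric] power_mult_distrib)
 qed
 have "X (- (3 * pp/qq)) = - (27 * pp^2)/(qq^3 - 27 * pp^2)"
 proof -
  define k where "k = - (27 * pp^2)/qq^3"
  have num: "4*(- (3 * pp/qq))^3 = 4 * pp * k" using q0 by (simp add: k_def power_divide power3_eq_cube power2_eq_square)
  have den: "pp - qq*(- (3 * pp/qq)) = 4 * pp" using q0 by simp
  have "X (- (3 * pp/qq)) = (4 * pp * k)/(4 * pp*(1 + k))"
   unfolding X_def num den by (simp add: distrib_left)
  also have "... = k/(1 + k)" using pp by (intro nonzero_mult_divide_mult_cancel_left) auto
  finally have "X (- (3 * pp/qq)) = (- (27 * pp^2)/qq^3)/(1 + (- (27 * pp^2)/qq^3))" by (simp only: k_def)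
  also have "1 + (- (27 * pp^2)/qq^3) = (qq^3 - 27 * pp^2)/qq^3" using q0 by (simp add: field_simps)
  finally show ?thesis using q0 by simp
 qed
 moreover have "qq^3 - 27 * pp^2 = (8 + pp)^2*(1 - pp)"
  by (simp add: qq_def power2_eq_square power3_eq_cube algebra_simps)
 moreover have "x_star tt = - (27 * pp^2)/((8 + pp)^2*(1 - pp))"
  unfolding x_star_def a by (simp add: pp_def power_mult_distrib)
 ultimately show ?thesis by simp
qed

lemma X_at_1: "X (pp/qq) = 1"
 using pp qq by (simp add: X_def)

lemma X_surj_pos:
 assumes "0 < x" "x < 1" obtains r where "0 < r" "r < pp/qq" "X r = x"
proof -
 have "EX r>=0. r <= pp/qq & X r = x"
 proof (rule IVT')
  show "continuous_on {0..pp/qq} X" by (rule continuous_on_subset[OF X_cont]) (use pp qq in auto)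
  show "X 0 <= x" using assms by (simp add: X_def)
  show "x <= X (pp/qq)" using assms X_at_1 by simp
 qed (use pp qq in auto)
 then obtain r where r: "0 <= r" "r <= pp/qq" "X r = x" by blast
 have "r ~= 0" "r ~= pp/qq" using r(3) assms X_at_1 by (auto simp: X_def)
 thus ?thesis using that r by (metis order_less_le)
qed

lemma X_surj_neg:
 assumes "x_star tt < x" "x < 0" obtains r where "- (3 * pp/qq) < r" "r < 0" "X r = x"
proof -
 have "EX r>=- (3 * pp/qq). r <= 0 & X r = x"
 proof (rule IVT')
  show "continuous_on {- (3 * pp/qq)..0} X" by (rule continuous_on_subset[OF X_cont]) (use pp qq in auto)
  show "X (- (3 * pp/qq)) <= x" using assms x_star_eq by simp
  show "x <= X 0" using assms by (simp add: X_def)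
 qed (use pp qq in auto)
 then obtain r where r: "- (3 * pp/qq) <= r" "r <= 0" "X r = x" by blast
 have "r ~= 0" "r ~= - (3 * pp/qq)" using r(3) assms x_star_eq by (auto simp: X_def)
 thus ?thesis using that r by (metis order_less_le)
qed

text \<open>The ends and the gap correspond to the exceptional x. At -3 pp/qq, which is included, Y
  = 0, the pair is a double root and x = x_star; r = 0 belongs to x = 0; at pp/qq, where x = 1, Y
  becomes infinite.\<close>

definition valid :: "real => bool" where "valid r \<longleftrightarrow> - (3 * pp/qq) <= r & r < pp/qq & r ~= 0"

lemma validD:
 assumes "valid r"
 shows "pp - qq*r > 0" "3 * pp + qq*r >= 0" "r ~= 0" "Y r^2 = r^2*(3 * pp + qq*r)/(pp - qq*r)"
  "r^2 + Y r^2 = 4*r^2 * pp/(pp - qq*r)" "X r ~= 0" "1/X r = 1 + (pp - qq*r)/(4*r^3)"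
  "3 * pp - 2*qq*r > 0"
proof -
 show a: "pp - qq*r > 0" using assms qq by (simp add: valid_def less_divide_eq mult.commute)
 show b: "3 * pp + qq*r >= 0"
 proof -
  have "qq * - (3 * pp/qq) <= qq*r" using assms qq by (intro mult_left_mono) (auto simp: valid_def)
  thus ?thesis using qq by simp
 qed
 show c: "r ~= 0" using assms by (simp add: valid_def)
 show d: "Y r^2 = r^2*(3 * pp + qq*r)/(pp - qq*r)"
  using a b by (simp add: Y_def power_mult_distrib)
 show "r^2 + Y r^2 = 4*r^2 * pp/(pp - qq*r)" unfolding d using a by (simp add: field_simps)
 have "pp - qq*r + 4*r^3 > 0" by (rule Xden_pos) (use assms in \<open>auto simp: valid_def\<close>)
 thus "X r ~= 0" "1/X r = 1 + (pp - qq*r)/(4*r^3)" using c by (auto simp: X_def field_simps)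
 show "3 * pp - 2*qq*r > 0" using a pp by linarith
qed

text \<open>In t = 1/u the equation has no quadratic term, so a conjugate pair r + iY, r - iY forces
  the third root -2r. \<open>Y r\<close> and \<open>X r\<close> are the solutions of the two
  remaining coefficient equations.\<close>

lemma zeta_roots:
 assumes "valid r"
 shows "zeta u - 1/cor (X r) = - 2 * cor pp*((u - 1/Complex r (Y r))*(u - 1/Complex r (- Y r))*(u - cor (- 1/(2*r))))"
proof -
 note v = validD[OF assms]
 define m where "m = r^2 + Y r^2"
 have m0: "m > 0" using v(3) by (simp add: m_def add_pos_nonneg)
 have t1: "1/Complex r (Y r) = Complex (r/m) (- (Y r/m))" "1/Complex r (- Y r) = Complex (r/m) (Y r/m)"
  by (auto simp: complex_eq_iff Re_divide Im_divide m_def)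
 have "(u - Complex (r/m) (- (Y r/m)))*(u - Complex (r/m) (Y r/m)) = u^2 - cor (2*r/m)*u + cor (1/m)"
 proof -
  have "Complex (r/m) (- (Y r/m)) + Complex (r/m) (Y r/m) = cor (2*r/m)" by (simp add: complex_eq_iff)
  moreover have "Complex (r/m) (- (Y r/m))*Complex (r/m) (Y r/m) = cor (1/m)"
  proof -
   have c: "Complex r (Y r)*Complex r (- Y r) = cor m" by (simp add: complex_eq_iff m_def power2_eq_square)
   have "1/Complex r (Y r)*(1/Complex r (- Y r)) = 1/(Complex r (Y r)*Complex r (- Y r))" by simp
   also have "... = cor (1/m)" unfolding c by simp
   finally show ?thesis unfolding t1 .
  qed
  moreover have "(u - P)*(u - Q) = u^2 - (P + Q)*u + P*Q" for P Q :: complex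
   by (simp add: algebra_simps power2_eq_square)
  ultimately show ?thesis by simp
 qed
 hence "- 2 * cor pp*((u - 1/Complex r (Y r))*(u - 1/Complex r (- Y r))*(u - cor (- 1/(2*r))))
  = - 2 * cor pp*((u^2 - cor (2*r/m)*u + cor (1/m))*(u + cor (1/(2*r))))"
  unfolding t1 by simp
 also have "... = - 2 * cor pp*u^3 - cor (2 * pp*(1/(2*r) - 2*r/m))*u^2 - cor (2 * pp*(1/m - (2*r/m)*(1/(2*r))))*u - cor (2 * pp*(1/m*(1/(2*r))))"
 proof -
  have gen: "- 2*P*((u^2 - A*u + B)*(u + C)) = - 2*P*u^3 - 2*P*(C - A)*u^2 - 2*P*(B - A*C)*u - 2*P*(B*C)" for P A B C :: complex
   by (simp add: algebra_simps power2_eq_square power3_eq_cube)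
  show ?thesis unfolding gen by (simp only: of_real_mult of_real_diff of_real_numeral)
 qed
 also have "2 * pp*(1/(2*r) - 2*r/m) = qq"
  unfolding m_def v(5) using v(1,3) pp by (simp add: field_simps power2_eq_square)
 also have "1/m - (2*r/m)*(1/(2*r)) = 0" using v(3) by simp
 also have "2 * pp*(1/m*(1/(2*r))) = 1/X r - 1"
  unfolding m_def v(5) v(7) using v(1,3) pp by (simp add: field_simps power2_eq_square power3_eq_cube)
 finally show ?thesis by (simp add: zeta_def)
qed

end

lemma real_segment_complex:
 "closed_segment (cor a) (cor b) = cor ` closed_segment a b"
 by (metis closed_segment_of_real)

section \<open>Boundary values of phi_0 and phi_1\<close>

locale jbr = jth +
 fixes fy0 fy1 qf :: "complex => complex"
 assumes p0: "is_phi0 tt fy0" and p1: "is_phi1 tt fy1" and qs: "is_sqrtD tt fy1 qf"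
begin

lemma x_star_neg: "x_star tt < 0"
proof -
 have "- (3 * pp/qq) < 0" "- (3 * pp/qq) <= pp/qq" using pp qq by (auto intro: order_trans[of _ 0])
 hence "pp - qq*(- (3 * pp/qq)) + 4*(- (3 * pp/qq))^3 > 0" by (intro Xden_pos) auto
 moreover have "4*(- (3 * pp/qq))^3 < 0" using \<open>- (3 * pp/qq) < 0\<close> by (simp add: power_less_zero_eq)
 ultimately have "X (- (3 * pp/qq)) < 0" unfolding X_def by (intro divide_neg_pos)
 thus ?thesis by (simp add: x_star_eq)
qed

definition "dom0 = - closed_segment 0 (1::complex)"
definition "dom1 = - closed_segment (cor (x_star tt)) (1::complex)"

lemma dom1_alt: "z : dom1 \<longleftrightarrow> ~ (EX x. x_star tt <= x & x <= 1 & z = cor x)"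
 using real_segment_complex[of "x_star tt" 1] x_star_neg
 by (auto simp: dom1_def closed_segment_eq_real_ivl)

lemma dom0_alt: "z : dom0 \<longleftrightarrow> ~ (EX x. 0 <= x & x <= 1 & z = cor x)"
 using real_segment_complex[of 0 1] by (auto simp: dom0_def closed_segment_eq_real_ivl)

lemma dom1_sub: "dom1 \<subseteq> dom0" using x_star_neg by (force simp: dom0_alt dom1_alt)

lemma half_sub: "half sg \<subseteq> dom1" "half sg \<subseteq> dom0"
 by (auto simp: half_def dom0_alt dom1_alt)

lemma dom_nz: assumes "z : dom0" shows "z ~= 0"
proof
 assume "z = 0"
 hence "EX x. 0 <= x & x <= 1 & z = cor x" by (intro exI[of _ 0]) simp
 thus False using assms unfolding dom0_alt by (rule notE[rotated])
qed

lemma cont_phi: "continuous_on dom0 fy0" "continuous_on dom1 fy1"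
 using p0 p1 by (auto simp: is_phi0_def is_phi1_def dom0_def dom1_def intro: holomorphic_on_imp_continuous_on)

lemma phi0_val: assumes "z : dom0" shows "R tt (fy0 z) = z" "fy0 z ~= 0" "zeta (us (fy0 z)) = 1/z"
proof -
 show a: "R tt (fy0 z) = z" using p0 assms by (auto simp: is_phi0_def dom0_def)
 show b: "fy0 z ~= 0" using a dom_nz[OF assms] by (auto simp: R_def)
 show "zeta (us (fy0 z)) = 1/z" using R_eq[OF b] a dom_nz[OF assms] by simp
qed

lemma phi1_val: assumes "z : dom1" shows "R tt (fy1 z) = z" "fy1 z ~= 0" "zeta (us (fy1 z)) = 1/z"
proof -
 show a: "R tt (fy1 z) = z" using p1 assms by (auto simp: is_phi1_def dom1_def)
 have nz: "z ~= 0" using dom_nz dom1_sub assms by blast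
 show b: "fy1 z ~= 0" using a nz by (auto simp: R_def)
 show "zeta (us (fy1 z)) = 1/z" using R_eq[OF b] a nz by simp
qed

lemma R_real: assumes "Im s = 0" shows "Im (R tt s) = 0"
proof -
 have "s = cor (Re s)" using assms by (simp add: complex_eq_iff)
 hence "R tt s = cor (c0 tt * Re s^3/((Re s - theta1 tt)*(Re s - theta2 tt)))"
  unfolding R_def by (simp only: of_real_mult of_real_divide of_real_diff of_real_power)
 thus ?thesis by simp
qed

lemma continuous_us: assumes "continuous_on S f" "!!z. z : S ==> f z ~= 0" shows "continuous_on S (%z. us (f z))"
 unfolding us_def by (intro continuous_intros assms) (use assms(2) in auto)

text \<open>R maps real numbers to real ones, so phi_0 is non-real on the half plane and Im has
  constant sign there; it is that of Im z, as phi_0 is z/c0 up to a bounded term. Then J > 0, and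
  since J <= 0 on the imaginary axis, Re u cannot change sign either.\<close>

lemma region0:
 assumes z: "z : half sg" and sg: "sg = 1 | sg = -1"
 shows "0 < sg*Im (us (fy0 z))" "Re (us (fy0 z)) > 0" "J (us (fy0 z)) > 0" "us (fy0 z) : Sreg0 sg"
proof -
 have cp: "continuous_on (half sg) fy0" using cont_phi(1) half_sub continuous_on_subset by blast
 have "(%z. fy0 z - z/cor (c0 tt)) : O[at_infinity](%_. 1)" using p0 by (simp add: is_phi0_def)
 then obtain K where K: "K > 0" "eventually (%z. norm (fy0 z - z/cor (c0 tt)) <= K*norm (1::complex)) at_infinity"
  by (auto elim: landau_o.bigE)
 then obtain B where B: "!!z. norm z >= B ==> norm (fy0 z - z/cor (c0 tt)) <= K"
  by (auto simp: eventually_at_infinity)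
 define y where "y = max B (c0 tt*(K + 2))"
 have c0: "c0 tt > 0" by (rule theta_consts)
 have y: "y >= B" "y >= c0 tt*(K + 2)" by (auto simp: y_def)
 have ypos: "y > 0" using y(2) c0 K mult_pos_pos[of "c0 tt" "K+2"] by linarith
 define z0 where "z0 = Complex 0 (sg*y)"
 have z0: "z0 : half sg" "norm z0 = y" using sg ypos by (auto simp: z0_def half_def complex_norm)
 have "\<bar>sg*Im (fy0 z0 - z0/cor (c0 tt))\<bar> <= K"
  using B[of z0] z0(2) y(1) abs_Im_le_cmod[of "fy0 z0 - z0/cor (c0 tt)"] sg by auto
 moreover have "sg*Im (z0/cor (c0 tt)) = y/c0 tt" using sg by (auto simp: z0_def)
 moreover have "sg*Im (fy0 z0 - z0/cor (c0 tt)) = sg*Im (fy0 z0) - sg*Im (z0/cor (c0 tt))" by (simp only: minus_complex.sel right_diff_distrib)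
 moreover have "y/c0 tt >= K + 2" using y(2) c0 by (simp add: le_divide_eq mult.commute)
 ultimately have im0: "sg*Im (fy0 z0) > 1" by linarith
 have n0: "norm (fy0 z0) > 1" using im0 abs_Im_le_cmod[of "fy0 z0"] sg by auto
 have imnz: "sg*Im (fy0 w) ~= 0" if w: "w : half sg" for w
 proof
  assume "sg*Im (fy0 w) = 0"
  hence "Im (fy0 w) = 0" using sg by auto
  from R_real[OF this] have "Im w = 0" using phi0_val(1)[of w] half_sub[of sg] w by auto
  thus False using w by (simp add: half_def)
 qed
 have impos: "sg*Im (fy0 w) > 0" if w: "w : half sg" for w
  by (rule connected_same_sign[OF half_connected[of sg], of "%w. sg*Im (fy0 w)" z0 w])
   (use imnz z0 im0 w in \<open>auto intro!: continuous_intros cp\<close>)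
 have usim: "sg*Im (us (fy0 w)) > 0" if w: "w : half sg" for w
 proof -
  have nz: "fy0 w ~= 0" using phi0_val(2) half_sub w by blast
  have "sg*Im (us (fy0 w)) = sg*Im (fy0 w)/(2*norm (fy0 w)^2)" using Im_us[OF nz] by simp
  thus ?thesis using impos[OF w] nz by simp
 qed
 have Jpos: "J (us (fy0 w)) > 0" if w: "w : half sg" for w
  using J_sign(1)[of sg w "us (fy0 w)", OF _ phi0_val(3) sg usim[OF w]] w half_sub by (auto simp: half_def)
 have renz: "Re (us (fy0 w)) ~= 0" if w: "w : half sg" for w
 proof
  assume "Re (us (fy0 w)) = 0"
  hence "J (us (fy0 w)) = - (pp*Im (us (fy0 w))^2)" by (simp add: J_def)
  thus False using Jpos[OF w] pp by (metis neg_0_less_iff_less not_less zero_le_power2 mult_nonneg_nonneg less_imp_le)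
 qed
 have re0: "Re (us (fy0 z0)) > 0"
 proof -
  have "norm (1/fy0 z0) < 1" using n0 by (simp add: norm_divide divide_less_eq)
  hence "Re (1/fy0 z0) < 1" using complex_Re_le_cmod[of "1/fy0 z0"] by linarith
  thus ?thesis by (simp add: us_def)
 qed
 have cu: "continuous_on (half sg) (%w. us (fy0 w))"
  by (rule continuous_us[OF cp]) (use phi0_val(2) half_sub in blast)
 have repos: "Re (us (fy0 z)) > 0"
  by (rule connected_same_sign[OF half_connected[of sg], of "%w. Re (us (fy0 w))" z0 z])
   (use renz z0 re0 z in \<open>auto intro!: continuous_intros cu\<close>)
 show "0 < sg*Im (us (fy0 z))" "Re (us (fy0 z)) > 0" "J (us (fy0 z)) > 0" using usim[OF z] repos Jpos[OF z] by auto
 thus "us (fy0 z) : Sreg0 sg" by (simp add: Sreg0_def)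
qed

text \<open>As for phi_0 the sign of Im is constant. Near infinity z (phi_1 - theta_1) tends to a
  positive number by R(phi_1) = z, so at a point of the imaginary axis Im phi_1 has the sign
  opposite to Im z.\<close>

lemma region1:
 assumes z: "z : half sg" and sg: "sg = 1 | sg = -1"
 shows "sg*Im (us (fy1 z)) < 0" "J (us (fy1 z)) < 0" "us (fy1 z) : Sreg1 sg"
proof -
 have cp: "continuous_on (half sg) fy1" using cont_phi(2) half_sub continuous_on_subset by blast
 define K where "K = c0 tt*theta1 tt^3/(theta1 tt - theta2 tt)"
 have K: "K > 0" using theta_consts by (simp add: K_def)
 have lim: "(fy1 \<longlongrightarrow> cor (theta1 tt)) at_infinity" using p1 by (simp add: is_phi1_def)
 have "((%z. cor (c0 tt)*fy1 z^3/(fy1 z - cor (theta2 tt))) \<longlongrightarrow>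
     cor (c0 tt) * cor (theta1 tt)^3/(cor (theta1 tt) - cor (theta2 tt))) at_infinity"
  by (intro tendsto_intros lim) (use theta_consts(3) in auto)
 hence "((%z. Re (cor (c0 tt)*fy1 z^3/(fy1 z - cor (theta2 tt)))) \<longlongrightarrow> Re (cor K)) at_infinity"
  by (intro tendsto_Re) (simp add: K_def)
 hence "eventually (%z. Re (cor (c0 tt)*fy1 z^3/(fy1 z - cor (theta2 tt))) > 0) at_infinity"
  using K by (intro order_tendstoD) auto
 then obtain B where B: "!!z. norm z >= B ==> Re (cor (c0 tt)*fy1 z^3/(fy1 z - cor (theta2 tt))) > 0"
  by (auto simp: eventually_at_infinity)
 define y where "y = max B 1"
 define z0 where "z0 = Complex 0 (sg*y)"
 have z0: "z0 : half sg" "norm z0 = y" "y > 0" using sg by (auto simp: z0_def half_def complex_norm y_def)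
 have z0d: "z0 : dom1" using z0(1) half_sub by blast
 have Rz: "R tt (fy1 z0) = z0" by (rule phi1_val(1)[OF z0d])
 have "z0 ~= 0" using z0 by auto
 hence "fy1 z0 - cor (theta1 tt) ~= 0" "fy1 z0 - cor (theta2 tt) ~= 0" using Rz by (auto simp: R_def)
 hence "z0*(fy1 z0 - cor (theta1 tt)) = cor (c0 tt)*fy1 z0^3/(fy1 z0 - cor (theta2 tt))"
  by (subst (1) Rz[symmetric]) (simp add: R_def)
 hence "Re (z0*(fy1 z0 - cor (theta1 tt))) > 0" using B[of z0] z0(2) by (simp add: y_def)
 moreover have "Re (z0*(fy1 z0 - cor (theta1 tt))) = - (y*(sg*Im (fy1 z0)))" by (simp add: z0_def)
 ultimately have im0: "- (sg*Im (fy1 z0)) > 0" using z0(3) by (metis mult_minus_right zero_less_mult_pos)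
 have imnz: "- (sg*Im (fy1 w)) ~= 0" if w: "w : half sg" for w
 proof
  assume "- (sg*Im (fy1 w)) = 0"
  hence "Im (fy1 w) = 0" using sg by auto
  from R_real[OF this] have "Im w = 0" using phi1_val(1)[of w] half_sub[of sg] w by auto
  thus False using w by (simp add: half_def)
 qed
 have imneg: "- (sg*Im (fy1 z)) > 0"
  by (rule connected_same_sign[OF half_connected[of sg], of "%w. - (sg*Im (fy1 w))" z0 z])
   (use imnz z0 im0 z in \<open>auto intro!: continuous_intros cp\<close>)
 have zd: "z : dom1" using z half_sub by blast
 have nz: "fy1 z ~= 0" by (rule phi1_val(2)[OF zd])
 have "sg*Im (us (fy1 z)) = sg*Im (fy1 z)/(2*norm (fy1 z)^2)" using Im_us[OF nz] by simp
 thus a: "sg*Im (us (fy1 z)) < 0" using imneg nz by (simp add: divide_neg_pos)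
 show b: "J (us (fy1 z)) < 0"
  using J_sign(2)[of sg z "us (fy1 z)", OF _ phi1_val(3)[OF zd] sg a] z by (auto simp: half_def)
 show "us (fy1 z) : Sreg1 sg" using a b by (simp add: Sreg1_def)
qed

lemma ev_half: "eventually (%z. z : half sg) (at x within half sg)"
 by (simp add: eventually_at_filter)

definition root :: "real => real => complex" where "root sg r = 1/Complex r (sg*Y r)"

lemma root_parts:
 "Re (root sg r) = r/(r^2 + (sg*Y r)^2)" "Im (root sg r) = - (sg*Y r)/(r^2 + (sg*Y r)^2)"
 by (simp_all add: root_def Re_divide Im_divide)

lemma Y_nonneg: "valid r ==> Y r >= 0"
 using validD[of r] by (simp add: Y_def)

text \<open>The product is \<open>zeta (f z) - 1/X r\<close> up to the factor -2 pp, and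
  \<open>zeta (f z)\<close> is 1/z. So a branch can approach only the three roots at
  \<open>X r\<close>.\<close>

lemma product_limit:
 assumes v: "valid r" and sg: "sg = 1 | sg = -1"
  and f: "!!z. z : half sg ==> zeta (f z) = 1/z"
 shows "((%z. (f z - root sg r)*(f z - root (-sg) r)*(f z - cor (- 1/(2*r)))) \<longlongrightarrow> 0) (at (cor (X r)) within half sg)"
proof -
 have x0: "X r ~= 0" using validD(6)[OF v] .
 have p: "cor pp ~= 0" using pp by simp
 have e: "(u - root sg r)*(u - root (-sg) r)*(u - cor (- 1/(2*r))) = (zeta u - 1/cor (X r))/(- 2 * cor pp)" for u
  using zeta_roots[OF v, of u] sg p by (auto simp: root_def mult_ac)
 have "((%z. (1/z - 1/cor (X r))/(- 2 * cor pp)) \<longlongrightarrow> (1/cor (X r) - 1/cor (X r))/(- 2 * cor pp)) (at (cor (X r)) within half sg)"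
  by (intro tendsto_intros) (use x0 p in auto)
 hence "((%z. (1/z - 1/cor (X r))/(- 2 * cor pp)) \<longlongrightarrow> 0) (at (cor (X r)) within half sg)" by simp
 thus ?thesis
 proof (rule Lim_transform_eventually)
  show "eventually (%z. (1/z - 1/cor (X r))/(- 2 * cor pp) = (f z - root sg r)*(f z - root (-sg) r)*(f z - cor (- 1/(2*r)))) (at (cor (X r)) within half sg)"
   using ev_half
  proof eventually_elim
   case (elim z)
   show ?case unfolding e by (simp only: f[OF elim])
  qed
 qed
qed

lemma J_third:
 assumes "valid r" shows "J (cor (- 1/(2*r))) > 0"
proof -
 have "J (cor (- 1/(2*r))) = (3 * pp - 2*qq*r)/(4*r^2)"
  using validD(3)[OF assms] by (simp add: J_def field_simps power2_eq_square)
 thus ?thesis using validD(3,8)[OF assms] by simp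
qed

text \<open>For r > 0 the region requires a non-negative real part and sg Im u >= 0, which leaves
  only one root of the conjugate pair. For r < 0 the pair has negative real part and the real root
  -1/(2r) remains.\<close>

lemma us_limit0:
 assumes v: "valid r" and sg: "sg = 1 | sg = -1"
 shows "((%z. us (fy0 z)) \<longlongrightarrow> (if r > 0 then root (-sg) r else cor (- 1/(2*r)))) (at (cor (X r)) within half sg)"
proof -
 let ?F = "at (cor (X r)) within half sg"
 have pl: "((%z. (us (fy0 z) - root sg r)*(us (fy0 z) - root (-sg) r)*(us (fy0 z) - cor (- 1/(2*r)))) \<longlongrightarrow> 0) ?F"
  by (rule product_limit[OF v sg]) (use phi0_val(3) half_sub in blast)
 have ev: "eventually (%z. us (fy0 z) : Sreg0 sg) ?F"
  using ev_half by eventually_elim (use region0(4) sg in blast)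
 show ?thesis
 proof (cases "r > 0")
  case True
  have Y: "Y r > 0" using validD[OF v] True pp qq by (simp add: Y_def add_pos_pos)
  have m: "r^2 + (Y r)^2 > 0" using True by (simp add: add_pos_nonneg)
  have "sg*Im (root sg r) = - (Y r/(r^2 + Y r^2))" using sg by (auto simp: root_parts)
  hence "root sg r ~: Sreg0 sg" using Y m by (auto simp: Sreg0_def not_le)
  moreover have "cor (- 1/(2*r)) ~: Sreg0 sg" using True by (auto simp: Sreg0_def)
  ultimately show ?thesis using True
   by (simp only: if_True) (rule tendsto_in_region[OF _ closed_Sreg(1) ev, of _ "root sg r" "cor (- 1/(2*r))"], use pl in \<open>auto simp: mult_ac\<close>)
 next
  case False
  hence r: "r < 0" using validD(3)[OF v] by simp
  have "Re (root e r) < 0" for e using r by (simp add: root_parts divide_neg_pos add_pos_nonneg)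
  hence "root e r ~: Sreg0 sg" for e by (simp add: Sreg0_def not_le)
  thus ?thesis using False
   by (simp only: if_False) (rule tendsto_in_region[OF _ closed_Sreg(1) ev, of _ "root sg r" "root (-sg) r"], use pl in \<open>auto simp: mult_ac\<close>)
 qed
qed

text \<open>The real root is excluded by J > 0 there, one member of the pair by the sign of its
  imaginary part. At the left end of the range of r the pair coincides and nothing needs to be
  excluded.\<close>

lemma us_limit1:
 assumes v: "valid r" and sg: "sg = 1 | sg = -1"
 shows "((%z. us (fy1 z)) \<longlongrightarrow> root sg r) (at (cor (X r)) within half sg)"
proof -
 let ?F = "at (cor (X r)) within half sg"
 have pl: "((%z. (us (fy1 z) - root sg r)*(us (fy1 z) - root (-sg) r)*(us (fy1 z) - cor (- 1/(2*r)))) \<longlongrightarrow> 0) ?F"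
  by (rule product_limit[OF v sg]) (use phi1_val(3) half_sub in blast)
 have ev: "eventually (%z. us (fy1 z) : Sreg1 sg) ?F"
  using ev_half by eventually_elim (use region1(3) sg in blast)
 have "root (-sg) r ~: Sreg1 sg | root (-sg) r = root sg r"
 proof (cases "Y r = 0")
  case False
  hence Y: "Y r > 0" using Y_nonneg[OF v] by simp
  have m: "r^2 + (Y r)^2 > 0" using validD(3)[OF v] by (simp add: add_pos_nonneg)
  have "sg*Im (root (-sg) r) = Y r/(r^2 + Y r^2)" using sg by (auto simp: root_parts)
  hence "root (-sg) r ~: Sreg1 sg" using Y m by (auto simp: Sreg1_def not_le)
  thus ?thesis by simp
 qed (simp add: root_def)
 moreover have "cor (- 1/(2*r)) ~: Sreg1 sg" using J_third[OF v] by (simp add: Sreg1_def not_le)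
 ultimately show ?thesis
  by (intro tendsto_in_region[OF pl closed_Sreg(2) ev]) auto
qed

text \<open>At z = 1 the cubic has the double root 0; the third root has J > 0 and lies outside the
  region of phi_1.\<close>

lemma us_limit1_at_1:
 assumes sg: "sg = 1 | sg = -1"
 shows "((%z. us (fy1 z)) \<longlongrightarrow> 0) (at (cor 1) within half sg)"
proof -
 let ?F = "at (cor 1) within half sg"
 have p: "cor pp ~= 0" using pp by simp
 have e: "(u - 0)*(u - 0)*(u - cor (- qq/(2 * pp))) = (zeta u - 1)/(- 2 * cor pp)" for u
  using p by (simp add: zeta_def field_simps power2_eq_square power3_eq_cube)
 have "((%z. (1/z - 1)/(- 2 * cor pp)) \<longlongrightarrow> (1/cor 1 - 1)/(- 2 * cor pp)) ?F"
  by (intro tendsto_intros) (use p in auto)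
 hence "((%z. (1/z - 1)/(- 2 * cor pp)) \<longlongrightarrow> 0) ?F" by simp
 hence pl: "((%z. (us (fy1 z) - 0)*(us (fy1 z) - 0)*(us (fy1 z) - cor (- qq/(2 * pp)))) \<longlongrightarrow> 0) ?F"
 proof (rule Lim_transform_eventually)
  show "eventually (%z. (1/z - 1)/(- 2 * cor pp) = (us (fy1 z) - 0)*(us (fy1 z) - 0)*(us (fy1 z) - cor (- qq/(2 * pp)))) ?F"
   using ev_half
  proof eventually_elim
   case (elim z)
   hence "z : dom1" using half_sub by blast
   thus ?case unfolding e by (simp only: phi1_val(3))
  qed
 qed
 have ev: "eventually (%z. us (fy1 z) : Sreg1 sg) ?F"
  using ev_half by eventually_elim (use region1(3) sg in blast)
 have "J (cor (- qq/(2 * pp))) = qq^2/(4 * pp)"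
  using pp by (simp add: J_def field_simps power2_eq_square)
 hence "cor (- qq/(2 * pp)) ~: Sreg1 sg" using pp qq by (simp add: Sreg1_def not_le)
 thus ?thesis by (intro tendsto_in_region[OF pl closed_Sreg(2) ev]) auto
qed

text \<open>Here s tends to 0 and u to infinity, so the estimate is made in s: c0 |s|^3 <= |z| (|s|
  + 1)^2. For |s| >= e this gives c0 |s| <= |z| (1 + 1/e)^2, which fails for |z| < d.\<close>

lemma phi1_limit_at_0:
 shows "(fy1 \<longlongrightarrow> 0) (at (cor 0) within half sg)"
 unfolding tendsto_iff dist_norm
proof (intro allI impI)
 fix e :: real assume e: "e > 0"
 define d where "d = c0 tt*e/(1 + 1/e)^2"
 have d: "d > 0" using e theta_consts by (auto simp: d_def intro!: divide_pos_pos add_pos_pos zero_less_power)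
 have "eventually (%z. z : half sg & dist z (cor 0) < d) (at (cor 0) within half sg)"
  using ev_half eventually_at_ball'[OF d, of "cor 0" "half sg"]
  by eventually_elim (auto simp: dist_commute)
 thus "eventually (%z. norm (fy1 z - 0) < e) (at (cor 0) within half sg)"
 proof eventually_elim
  case (elim z)
  define s where "s = fy1 z"
  have zd: "z : dom1" using elim half_sub by blast
  have Rz: "R tt s = z" "s ~= 0" using phi1_val[OF zd] by (auto simp: s_def)
  have nz: "z ~= 0" using zd dom1_sub dom_nz by blast
  hence n: "s - cor (theta1 tt) ~= 0" "s - cor (theta2 tt) ~= 0" using Rz by (auto simp: R_def)
  have "cor (c0 tt) * s^3 = z*((s - cor (theta1 tt))*(s - cor (theta2 tt)))"
  proof -
   have "z = cor (c0 tt) * s^3/((s - cor (theta1 tt))*(s - cor (theta2 tt)))" using Rz(1) by (simp add: R_def)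
   moreover have "(s - cor (theta1 tt))*(s - cor (theta2 tt)) ~= 0" using n by simp
   moreover have "z = N/D ==> D ~= 0 ==> N = z*D" for N D :: complex by simp
   ultimately show ?thesis by blast
  qed
  hence "c0 tt*norm s^3 = norm z*(norm (s - cor (theta1 tt))*norm (s - cor (theta2 tt)))"
   using theta_consts(4) by (metis abs_of_pos norm_mult norm_of_real norm_power)
  also have "... <= norm z*((norm s + 1)*(norm s + 1))"
  proof -
   have "theta1 tt <= 1" "theta2 tt <= 1" using tt01 by (auto simp: theta1_def theta2_def)
   thus ?thesis using theta_consts
    by (intro mult_left_mono mult_mono order_trans[OF norm_triangle_ineq4]) auto
  qed
  finally have b: "c0 tt*norm s^3 <= norm z*(norm s + 1)^2" by (simp add: power2_eq_square)
  show ?case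
  proof (rule ccontr)
   assume "~ norm (fy1 z - 0) < e"
   hence se: "norm s >= e" by (simp add: s_def)
   have "norm s + 1 <= norm s*(1 + 1/e)" using se e by (simp add: field_simps)
   hence "(norm s + 1)^2 <= (norm s*(1 + 1/e))^2" by (intro power_mono) auto
   hence "norm z*(norm s + 1)^2 <= norm z*(norm s^2*(1 + 1/e)^2)" by (intro mult_left_mono) (auto simp: power_mult_distrib)
   with b have "norm s^2*(c0 tt*norm s) <= norm s^2*(norm z*(1 + 1/e)^2)"
    by (simp add: power2_eq_square power3_eq_cube mult_ac)
   hence "c0 tt*norm s <= norm z*(1 + 1/e)^2" using Rz(2) by simp
   moreover have "c0 tt*e <= c0 tt*norm s" using se theta_consts by simp
   moreover have "norm z*(1 + 1/e)^2 < d*(1 + 1/e)^2"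
   proof (rule mult_strict_right_mono)
    have "1 + 1/e > 0" using e by (simp add: add_pos_pos)
    thus "0 < (1 + 1/e)^2" by (rule zero_less_power)
   qed (use elim in \<open>simp add: dist_norm\<close>)
   moreover have "d*(1 + 1/e)^2 = c0 tt*e"
   proof -
    have "1 + 1/e > 0" using e by (simp add: add_pos_pos)
    thus ?thesis by (simp add: d_def)
   qed
   ultimately show False by linarith
  qed
 qed
qed

end

section \<open>The square root of D along the two branches\<close>

lemma tendsto_csqrt_off_cut:
 assumes "(f \<longlongrightarrow> l) F" "l ~: \<real>\<^sub>\<le>\<^sub>0" shows "((%z. csqrt (f z)) \<longlongrightarrow> csqrt l) F"
 by (rule isCont_tendsto_compose[OF continuous_at_csqrt[OF assms(2)] assms(1)])

lemma continuous_on_csqrt_off_cut: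
 assumes "continuous_on S f" "!!z. z : S ==> f z ~: \<real>\<^sub>\<le>\<^sub>0" shows "continuous_on S (%z. csqrt (f z))"
 using assms unfolding continuous_on_def by (blast intro: tendsto_csqrt_off_cut)

context jbr
begin

definition sv :: "complex => complex" where "sv u = 1/(1 - 2*u)"

lemma root_zeta:
 assumes "valid r" "sg = 1 | sg = -1"
 shows "zeta (root sg r) = 1/cor (X r)"
 using zeta_roots[OF assms(1), of "root sg r"] assms(2) by (auto simp: root_def)

lemma third_zeta: "valid r ==> zeta (cor (- 1/(2*r))) = 1/cor (X r)"
 using zeta_roots[of r "cor (- 1/(2*r))"] by simp

lemma zeta_nz: "zeta u ~= 0 ==> 1 - 2*u ~= 0"
 by (auto simp: zeta_factor3)

lemma root_nz: assumes "valid r" "sg = 1 | sg = -1" shows "1 - 2*root sg r ~= 0"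
 using zeta_nz root_zeta[OF assms] validD(6)[OF assms(1)] by simp

lemma third_nz: assumes "valid r" shows "1 - 2 * cor (- 1/(2*r)) ~= 0"
 using zeta_nz[OF third_zeta[OF assms, THEN ssubst, of "%x. x ~= 0"]] validD(6)[OF assms] by simp

lemma sv_us: "s ~= 0 ==> sv (us s) = s"
 using us_inv(1)[of s] by (simp add: sv_def)

lemma us_sv: "1 - 2*u ~= 0 ==> us (sv u) = u"
 unfolding sv_def by (rule us_of_inv)

lemma limit_of_us:
 assumes "((%z. us (f z)) \<longlongrightarrow> u0) F" "1 - 2*u0 ~= 0" "eventually (%z. f z ~= 0) F"
 shows "(f \<longlongrightarrow> sv u0) F"
proof -
 have "((%z. sv (us (f z))) \<longlongrightarrow> sv u0) F" unfolding sv_def by (intro tendsto_intros assms)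
 thus ?thesis by (rule Lim_transform_eventually) (use assms(3) in \<open>eventually_elim, simp add: sv_us\<close>)
qed

lemma ev_phi_nz: "eventually (%z. fy0 z ~= 0) (at x within half sg)" "eventually (%z. fy1 z ~= 0) (at x within half sg)"
proof -
 show "eventually (%z. fy0 z ~= 0) (at x within half sg)"
  using ev_half by eventually_elim (use phi0_val(2) half_sub in blast)
 show "eventually (%z. fy1 z ~= 0) (at x within half sg)"
  using ev_half by eventually_elim (use phi1_val(2) half_sub in blast)
qed

definition u0 :: "real => real => complex" where
 "u0 sg r = (if r > 0 then root (-sg) r else cor (- 1/(2*r)))"

lemma u0_nz: assumes "valid r" "sg = 1 | sg = -1" shows "1 - 2*u0 sg r ~= 0"
 using root_nz[OF assms(1), of "-sg"] third_nz[OF assms(1)] assms(2) unfolding u0_def by (cases "r > 0") auto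

lemma phi0_limit:
 assumes v: "valid r" "sg = 1 | sg = -1"
 shows "(fy0 \<longlongrightarrow> sv (u0 sg r)) (at (cor (X r)) within half sg)"
 by (rule limit_of_us[OF us_limit0[OF v, folded u0_def] u0_nz[OF v] ev_phi_nz(1)])

lemma phi1_limit:
 assumes v: "valid r" "sg = 1 | sg = -1"
 shows "(fy1 \<longlongrightarrow> sv (root sg r)) (at (cor (X r)) within half sg)"
 by (rule limit_of_us[OF us_limit1[OF v] root_nz[OF v] ev_phi_nz(2)])

lemma valid_endpoint: "valid (- (3 * pp/qq))"
 using pp qq by (auto simp: valid_def intro: order_less_trans[of _ 0])

lemma bdry_phi1_neg:
 assumes "x_star tt <= x" "x < 0" "sg = 1 | sg = -1"
 obtains r where "valid r" "r < 0" "X r = x" "bdry sg fy1 x = sv (root sg r)"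
proof -
 have "EX r. valid r & r < 0 & X r = x"
 proof (cases "x = x_star tt")
  case True
  thus ?thesis using valid_endpoint x_star_eq pp qq by (intro exI[of _ "- (3 * pp/qq)"]) auto
 next
  case False
  hence "x_star tt < x" using assms by simp
  then obtain r where r: "- (3 * pp/qq) < r" "r < 0" "X r = x" using X_surj_neg[OF _ assms(2)] by metis
  have "pp/qq > 0" using pp qq by simp
  hence "valid r" using r by (simp add: valid_def)
  thus ?thesis using r by blast
 qed
 then obtain r where r: "valid r" "r < 0" "X r = x" by blast
 have "bdry sg fy1 x = sv (root sg r)"
  using bdry_eqI[OF _ phi1_limit[OF r(1) assms(3)]] assms(3) r(3) by auto
 thus ?thesis using that r by blast
qed

lemma bdry_phi1_pos:
 assumes "0 < x" "x < 1" "sg = 1 | sg = -1"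
 obtains r where "valid r" "r > 0" "X r = x" "bdry sg fy1 x = sv (root sg r)"
proof -
 obtain r where r: "0 < r" "r < pp/qq" "X r = x" using X_surj_pos[OF assms(1,2)] by metis
 have "- (3 * pp/qq) <= 0" using pp qq by simp
 hence v: "valid r" using r by (simp add: valid_def)
 have "bdry sg fy1 x = sv (root sg r)"
  using bdry_eqI[OF _ phi1_limit[OF v assms(3)]] assms(3) r(3) by auto
 thus ?thesis using that r v by blast
qed

lemma bdry_phi1_0: "sg ~= 0 ==> bdry sg fy1 0 = 0"
 using bdry_eqI[OF _ phi1_limit_at_0] by simp

lemma bdry_phi1_1: assumes "sg = 1 | sg = -1" shows "bdry sg fy1 1 = 1"
proof -
 have "(fy1 \<longlongrightarrow> sv 0) (at (cor 1) within half sg)"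
  by (rule limit_of_us[OF us_limit1_at_1[OF assms] _ ev_phi_nz(2)]) simp
 thus ?thesis using bdry_eqI[of sg fy1 "sv 0" 1] assms by (auto simp: sv_def)
qed

lemma R_sv: "zeta u ~= 0 ==> R tt (sv u) = 1/zeta u"
 unfolding sv_def by (rule R_of_u)

text \<open>Expresses the points of the cut through the parameter r, so that membership can be
  refuted by signs of real and imaginary parts in the u-plane.\<close>

lemma cut_cases:
 assumes "s : sqrtD_cut tt fy1"
 obtains "s = 0" | "s = 1"
  | r where "valid r" "r > 0" "s = sv (root (-1) r)"
  | r where "valid r" "r < 0" "s = sv (root 1 r)"
proof -
 from assms consider x where "0 <= x" "x <= 1" "s = bdry (-1) fy1 x" | x where "x_star tt <= x" "x <= 0" "s = bdry 1 fy1 x"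
  unfolding sqrtD_cut_def by auto
 thus ?thesis
 proof cases
  case (1 x)
  consider "x = 0" | "x = 1" | "0 < x" "x < 1" using 1 by linarith
  thus ?thesis
  proof cases
   case a: 1
   show ?thesis by (rule that(1)) (use 1 a bdry_phi1_0[of "-1"] in simp)
  next
   case a: 2
   show ?thesis by (rule that(2)) (use 1 a bdry_phi1_1[of "-1"] in simp)
  next
   case a: 3
   have m: "(-1::real) = 1 | (-1::real) = -1" by simp
   obtain r where "valid r" "r > 0" "bdry (-1) fy1 x = sv (root (-1) r)" using bdry_phi1_pos[OF a m] by metis
   thus ?thesis using that(3) 1 by simp
  qed
 next
  case (2 x)
  show ?thesis
  proof (cases "x = 0")
   case True
   show ?thesis by (rule that(1)) (use 2 True bdry_phi1_0[of 1] in simp)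
  next
   case False
   hence x: "x < 0" using 2 by simp
   have m: "(1::real) = 1 | (1::real) = -1" by simp
   obtain r where "valid r" "r < 0" "bdry 1 fy1 x = sv (root 1 r)" using bdry_phi1_neg[OF 2(1) x m] by metis
   thus ?thesis using that(4) 2 by simp
  qed
 qed
qed

lemma X_range:
 assumes "valid r" shows "x_star tt <= X r" "X r <= 1"
proof -
 have d: "pp - qq*r + 4*r^3 > 0" by (rule Xden_pos) (use assms in \<open>auto simp: valid_def\<close>)
 show "X r <= 1" unfolding X_def using d validD(1)[OF assms] by (simp add: divide_le_eq)
 show "x_star tt <= X r"
 proof (cases "r > 0")
  case True
  hence "X r >= 0" unfolding X_def using d by simp
  thus ?thesis using x_star_neg by linarith
 next
  case False
  hence r: "r < 0" using validD(3)[OF assms] by simp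
  define r1 where "r1 = - (3 * pp/qq)"
  have r1: "r1 <= r" "r1 < 0" using assms pp qq by (auto simp: valid_def r1_def)
  have d1: "pp - qq*r1 + 4*r1^3 > 0" by (rule Xden_pos) (use pp qq in \<open>auto simp: r1_def intro: order_trans[of _ 0]\<close>)
  \<comment> \<open>This is X r1 <= X r multiplied out; the products 16 r1^3 r^3 occur on both
    sides.\<close>
  have c: "r1^3*(pp - qq*r) <= r^3*(pp - qq*r1)"
  proof -
   have "r1^3 <= r^3" using r1 by (simp add: power_mono_odd)
   hence a: "pp*r1^3 <= pp*r^3" using pp by simp
   have "\<bar>r\<bar> <= \<bar>r1\<bar>" using r1 r by simp
   hence r2: "r^2 <= r1^2" by (simp only: abs_le_square_iff)
   have "0 <= r*r1" using r r1 mult_nonpos_nonpos[of r r1] by simp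
   hence "0 <= qq*(r*r1)" using qq by simp
   from mult_left_mono[OF r2 this] have "(qq*(r*r1))*r^2 <= (qq*(r*r1))*r1^2" .
   hence "r^3*(qq*r1) <= r1^3*(qq*r)" by (simp add: power2_eq_square power3_eq_cube mult_ac)
   thus ?thesis using a by (simp add: algebra_simps)
  qed
  have gen: "a/b <= e/f" if "b > 0" "f > 0" "a*f <= e*b" for a b e f :: real
   using that by (simp add: field_simps)
  have "X r1 <= X r" unfolding X_def
  proof (rule gen[OF d1 d])
   have "4*(r1^3*(pp - qq*r)) + 16*(r1^3*r^3) <= 4*(r^3*(pp - qq*r1)) + 16*(r1^3*r^3)" using c by simp
   thus "4*r1^3*(pp - qq*r + 4*r^3) <= 4*r^3*(pp - qq*r1 + 4*r1^3)" by (simp add: algebra_simps)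
  qed
  thus ?thesis by (simp add: r1_def x_star_eq)
 qed
qed

text \<open>R maps the cut into [x_star, 1], while z lies off this segment.\<close>

lemma not_in_cut:
 assumes z: "z : dom1" and s: "R tt s = z" "s ~= 0" shows "s ~: sqrtD_cut tt fy1"
proof
 assume "s : sqrtD_cut tt fy1"
 hence "EX x. x_star tt <= x & x <= 1 & R tt s = cor x"
 proof (cases rule: cut_cases)
  case 1 thus ?thesis using s by simp
 next
  case 2
  have "R tt (sv 0) = 1" using R_sv[of 0] by (simp add: zeta_def)
  thus ?thesis using 2 x_star_neg by (intro exI[of _ 1]) (simp add: sv_def)
 next
  case (3 r)
  have m: "(-1::real) = 1 | (-1::real) = -1" by simp
  have "zeta (root (-1) r) = 1/cor (X r)" by (rule root_zeta[OF 3(1) m])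
  hence "R tt s = cor (X r)" using R_sv[of "root (-1) r"] validD(6)[OF 3(1)] 3(3) by simp
  thus ?thesis using X_range[OF 3(1)] by blast
 next
  case (4 r)
  have m: "(1::real) = 1 | (1::real) = -1" by simp
  have "zeta (root 1 r) = 1/cor (X r)" by (rule root_zeta[OF 4(1) m])
  hence "R tt s = cor (X r)" using R_sv[of "root 1 r"] validD(6)[OF 4(1)] 4(3) by simp
  thus ?thesis using X_range[OF 4(1)] by blast
 qed
 thus False using z s(1) unfolding dom1_alt by simp
qed

lemma Y_pos: assumes "valid r" "r ~= - (3 * pp/qq)" shows "Y r > 0"
proof -
 have "3 * pp + qq*r ~= 0" using assms(2) qq by (simp add: field_simps)
 hence "3 * pp + qq*r > 0" using validD(2)[OF assms(1)] by simp
 thus ?thesis using validD(1,3)[OF assms(1)] by (simp add: Y_def)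
qed

lemma Im_root_sign:
 assumes "valid r" "r ~= - (3 * pp/qq)" shows "Im (root 1 r) < 0" "Im (root (-1) r) > 0"
 using Y_pos[OF assms] validD(3)[OF assms(1)] by (auto simp: root_parts divide_neg_pos divide_pos_pos add_pos_nonneg)

lemma Im_sv: assumes "1 - 2*u ~= 0" shows "Im (sv u) = 2*Im u/norm (1 - 2*u)^2"
 by (simp add: sv_def Im_divide cmod_power2)

lemma pos_not_endpoint: "r > 0 ==> r ~= - (3 * pp/qq)"
proof -
 have "3 * pp/qq > 0" using pp qq by simp
 thus "r > 0 ==> r ~= - (3 * pp/qq)" by linarith
qed

text \<open>The point lies in the lower half plane. Points of the cut coming from (0,1) lie in the
  upper one, and those coming from [x_star, 0) have Re u < 0, whereas here Re u > 0. At this point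
  the square roots along phi_0 and phi_1 will be compared.\<close>

lemma s1_not_in_cut:
 assumes v: "valid r" "r > 0" shows "sv (root 1 r) ~: sqrtD_cut tt fy1"
proof
 have m: "(1::real) = 1 | (1::real) = -1" by simp
 have m': "(-1::real) = 1 | (-1::real) = -1" by simp
 have nz: "1 - 2*root 1 r ~= 0" by (rule root_nz[OF v(1) m])
 have neg: "Im (sv (root 1 r)) < 0"
  unfolding Im_sv[OF nz] using Im_root_sign(1)[OF v(1) pos_not_endpoint[OF v(2)]] nz by (intro divide_neg_pos) auto
 assume "sv (root 1 r) : sqrtD_cut tt fy1"
 thus False
 proof (cases rule: cut_cases)
  case 1 thus ?thesis using neg by simp
 next
  case 2 thus ?thesis using neg by simp
 next
  case (3 r')
  have nz': "1 - 2*root (-1) r' ~= 0" by (rule root_nz[OF 3(1) m'])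
  have "Im (sv (root (-1) r')) > 0"
   unfolding Im_sv[OF nz'] using Im_root_sign(2)[OF 3(1) pos_not_endpoint[OF 3(2)]] nz' by (intro divide_pos_pos) auto
  thus ?thesis using neg 3(3) by simp
 next
  case (4 r')
  have nz': "1 - 2*root 1 r' ~= 0" by (rule root_nz[OF 4(1) m])
  have "root 1 r = us (sv (root 1 r))" by (rule us_sv[OF nz, symmetric])
  also have "... = root 1 r'" unfolding 4(3) by (rule us_sv[OF nz'])
  finally have "root 1 r = root 1 r'" .
  moreover have "Re (root 1 r) > 0" using v(2) by (simp add: root_parts add_pos_nonneg)
  moreover have "Re (root 1 r') < 0" using 4(2) by (simp add: root_parts divide_neg_pos add_pos_nonneg)
  ultimately show ?thesis by simp
 qed
qed

lemma qf_cont: "continuous_on (- sqrtD_cut tt fy1) qf"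
 using qs by (auto simp: is_sqrtD_def intro: holomorphic_on_imp_continuous_on)

text \<open>The zeros of \<open>Wf\<close> are the critical points of \<open>zeta\<close>: u = 0
  belongs to z = 1, the other one to z = x_star, both excluded from the domain.\<close>

lemma Wf_nonzero:
 assumes z: "z : dom1" "zeta u = 1/z" shows "Wf u ~= 0"
proof
 assume "Wf u = 0"
 hence "u = 0 | cor qq + 3 * cor pp*u = 0" by (auto simp: Wf_def)
 thus False
 proof
  assume "u = 0"
  hence "z = 1" using z(2) by (simp add: zeta_def)
  thus False using z(1) x_star_neg unfolding dom1_alt by (auto intro: exI[of _ 1])
 next
  assume "cor qq + 3 * cor pp*u = 0"
  moreover have pc: "cor pp ~= 0" using pp by simp
  ultimately have "u = - cor qq/(3 * cor pp)" by (simp add: field_simps) (metis add.commute add_eq_0_iff mult.commute mult.left_commute)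
  hence u: "u = cor (- qq/(3 * pp))" by simp
  have m: "(1::real) = 1 | (1::real) = -1" by simp
  have "Y (- (3 * pp/qq)) = 0" using qq by (simp add: Y_def)
  hence "root 1 (- (3 * pp/qq)) = u" using pp qq by (simp add: root_def u complex_eq_iff Re_divide Im_divide power2_eq_square)
  hence "1/z = 1/cor (x_star tt)" using root_zeta[OF valid_endpoint m] z(2) x_star_eq by simp
  hence "z = cor (x_star tt)" by simp
  thus False using z(1) x_star_neg unfolding dom1_alt by auto
 qed
qed

lemma half_cases:
 assumes "Im z ~= 0" obtains sg where "sg = 1 | sg = -1" "z : half sg"
 using that[of "sgn (Im z)"] assms by (auto simp: half_def sgn_if)

text \<open>At a real point of the domain the branches are continuous, so the closed regions of both
  half planes contain the value; this pins its imaginary part for phi_0.\<close>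

lemma us_real_limit:
 assumes z: "z : dom1" "Im z = 0"
 shows "us (fy0 z) : Sreg0 1 \<inter> Sreg0 (-1)" "us (fy1 z) : Sreg1 1 \<inter> Sreg1 (-1)"
proof -
 have zr: "z = cor (Re z)" using z(2) by (simp add: complex_eq_iff)
 have z0: "z : dom0" using z dom1_sub by blast
 have op: "open dom0" "open dom1" by (auto simp: dom0_def dom1_def)
 have c0: "continuous_on dom0 (%z. us (fy0 z))" by (rule continuous_us[OF cont_phi(1) phi0_val(2)])
 have c1: "continuous_on dom1 (%z. us (fy1 z))" by (rule continuous_us[OF cont_phi(2) phi1_val(2)])
 have l0: "((%z. us (fy0 z)) \<longlongrightarrow> us (fy0 z)) (at z within half sg)" for sg
  using c0 op(1) z0 by (simp add: continuous_on_eq_continuous_at continuous_at tendsto_within_subset[OF _ subset_UNIV])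
 have l1: "((%z. us (fy1 z)) \<longlongrightarrow> us (fy1 z)) (at z within half sg)" for sg
  using c1 op(2) z(1) by (simp add: continuous_on_eq_continuous_at continuous_at tendsto_within_subset[OF _ subset_UNIV])
 have nb: "at z within half sg ~= bot" if "sg ~= 0" for sg using half_not_bot[OF that, of "Re z"] zr by simp
 have "us (fy0 z) : Sreg0 sg & us (fy1 z) : Sreg1 sg" if sg: "sg = 1 | sg = -1" for sg
 proof
  have n: "sg ~= 0" using sg by auto
  show "us (fy0 z) : Sreg0 sg"
  proof (rule Lim_in_closed_set[OF closed_Sreg(1) _ nb[OF n] l0])
   show "eventually (%z. us (fy0 z) : Sreg0 sg) (at z within half sg)"
    using ev_half by eventually_elim (rule region0(4)[OF _ sg])
  qed
  show "us (fy1 z) : Sreg1 sg"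
  proof (rule Lim_in_closed_set[OF closed_Sreg(2) _ nb[OF n] l1])
   show "eventually (%z. us (fy1 z) : Sreg1 sg) (at z within half sg)"
    using ev_half by eventually_elim (rule region1(3)[OF _ sg])
  qed
 qed
 thus "us (fy0 z) : Sreg0 1 \<inter> Sreg0 (-1)" "us (fy1 z) : Sreg1 1 \<inter> Sreg1 (-1)" by auto
qed

lemma Wf_phi0: assumes z: "z : dom1" shows "Wf (us (fy0 z)) ~: \<real>\<^sub>\<le>\<^sub>0" "Im z = 0 ==> Im (us (fy0 z)) = 0 & Re (us (fy0 z)) > 0"
proof -
 have z0: "z : dom0" using z dom1_sub by blast
 show r: "Im (us (fy0 z)) = 0 & Re (us (fy0 z)) > 0" if "Im z = 0"
 proof -
  have "Im (us (fy0 z)) = 0" "Re (us (fy0 z)) >= 0" using us_real_limit(1)[OF z that] by (auto simp: Sreg0_def)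
  moreover have "Re (us (fy0 z)) ~= 0"
  proof
   assume "Re (us (fy0 z)) = 0"
   hence "us (fy0 z) = 0" using calculation by (simp add: complex_eq_iff)
   hence "Wf (us (fy0 z)) = 0" by (simp add: Wf_def)
   thus False using Wf_nonzero[OF z phi0_val(3)[OF z0]] by simp
  qed
  ultimately show ?thesis by simp
 qed
 show "Wf (us (fy0 z)) ~: \<real>\<^sub>\<le>\<^sub>0"
 proof (cases "Im z = 0")
  case True
  have "J (us (fy0 z)) >= 0" using us_real_limit(1)[OF z True] by (auto simp: Sreg0_def)
  thus ?thesis using r[OF True] by (intro Wf_region0) auto
 next
  case False
  then obtain sg where sg: "sg = 1 | sg = -1" "z : half sg" by (rule half_cases)
  show ?thesis using region0(1,2)[OF sg(2,1)] by (intro Wf_region0) auto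
 qed
qed

lemma Wf_phi1: assumes z: "z : dom1" shows "- Wf (us (fy1 z)) ~: \<real>\<^sub>\<le>\<^sub>0"
proof (rule Wf_region1)
 show "Wf (us (fy1 z)) ~= 0" by (rule Wf_nonzero[OF z phi1_val(3)[OF z]])
 show "J (us (fy1 z)) <= 0"
 proof (cases "Im z = 0")
  case True
  thus ?thesis using us_real_limit(2)[OF z True] by (auto simp: Sreg1_def)
 next
  case False
  then obtain sg where sg: "sg = 1 | sg = -1" "z : half sg" by (rule half_cases)
  show ?thesis using region1(2)[OF sg(2,1)] by simp
 qed
qed

lemma dom1_connected: "connected dom1"
 unfolding dom1_def by (rule connected_complement_bounded_convex) (auto simp: DIM_complex bounded_closed_segment)

lemma continuous_Wf: "continuous_on S f ==> continuous_on S (%z. Wf (f z))"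
 unfolding Wf_def by (intro continuous_intros)

text \<open>\<open>Q0\<close> and \<open>Q1\<close> are explicit roots of D that are continuous
  along phi_0 and phi_1. The factor -i turns csqrt (-W) into csqrt W where Im W < 0, which makes the
  two agree at the point of comparison.\<close>

definition Q0 where "Q0 s = s^2 * cor (sqrt CD) * csqrt (Wf (us s))"
definition Q1 where "Q1 s = - \<i> * (s^2 * cor (sqrt CD) * csqrt (- Wf (us s)))"

lemma Q_square: assumes "s ~= 0" shows "(Q0 s)^2 = calD tt s" "(Q1 s)^2 = calD tt s"
proof -
 have "(cor (sqrt CD))^2 = cor CD" using CD_pos by (simp flip: of_real_power)
 thus "(Q0 s)^2 = calD tt s" "(Q1 s)^2 = calD tt s"
  unfolding calD_eq[OF assms] Q0_def Q1_def by (simp_all add: power_mult_distrib power_mult[symmetric])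
qed

lemma qf_phi_square:
 assumes "z : dom1" shows "(qf (fy0 z))^2 = calD tt (fy0 z)" "(qf (fy1 z))^2 = calD tt (fy1 z)"
  "fy0 z : - sqrtD_cut tt fy1" "fy1 z : - sqrtD_cut tt fy1"
proof -
 have z0: "z : dom0" using assms dom1_sub by blast
 show a: "fy0 z : - sqrtD_cut tt fy1" "fy1 z : - sqrtD_cut tt fy1"
  using not_in_cut[OF assms phi0_val(1,2)[OF z0]] not_in_cut[OF assms phi1_val(1,2)[OF assms]] by auto
 show "(qf (fy0 z))^2 = calD tt (fy0 z)" "(qf (fy1 z))^2 = calD tt (fy1 z)"
  using qs a by (auto simp: is_sqrtD_def)
qed

lemma cont_Q:
 "continuous_on dom1 (%z. Q0 (fy0 z))" "continuous_on dom1 (%z. Q1 (fy1 z))"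
 "continuous_on dom1 (%z. qf (fy0 z))" "continuous_on dom1 (%z. qf (fy1 z))"
proof -
 have c0: "continuous_on dom1 fy0" by (rule continuous_on_subset[OF cont_phi(1) dom1_sub])
 have nz: "fy0 z ~= 0" if "z : dom1" for z using phi0_val(2) dom1_sub that by blast
 have u0: "continuous_on dom1 (%z. us (fy0 z))" by (rule continuous_us[OF c0 nz])
 have u1: "continuous_on dom1 (%z. us (fy1 z))" by (rule continuous_us[OF cont_phi(2) phi1_val(2)])
 show "continuous_on dom1 (%z. Q0 (fy0 z))" unfolding Q0_def
  by (intro continuous_intros c0 continuous_on_csqrt_off_cut continuous_Wf u0 Wf_phi0)
 show "continuous_on dom1 (%z. Q1 (fy1 z))" unfolding Q1_def
  by (intro continuous_intros cont_phi(2) continuous_on_csqrt_off_cut continuous_Wf u1 Wf_phi1)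
 show "continuous_on dom1 (%z. qf (fy0 z))" by (rule continuous_on_compose2[OF qf_cont c0]) (use qf_phi_square(3) in blast)
 show "continuous_on dom1 (%z. qf (fy1 z))" by (rule continuous_on_compose2[OF qf_cont cont_phi(2)]) (use qf_phi_square(4) in blast)
qed

lemma Q0_nonzero: assumes "z : dom1" shows "Q0 (fy0 z) ~= 0"
proof -
 have z0: "z : dom0" using assms dom1_sub by blast
 show ?thesis using phi0_val(2)[OF z0] CD_pos Wf_nonzero[OF assms phi0_val(3)[OF z0]] by (simp add: Q0_def)
qed

lemma Q1_nonzero: assumes "z : dom1" shows "Q1 (fy1 z) ~= 0"
 using phi1_val(2)[OF assms] CD_pos Wf_nonzero[OF assms phi1_val(3)[OF assms]] by (simp add: Q1_def)

text \<open>On the connected domain the two square roots agree up to a constant sign. At a large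
  positive z the value of phi_0 is real and so large that \<open>qf\<close> is positive there, and
  so is \<open>Q0\<close>.\<close>

lemma qf_phi0:
 assumes "z : dom1" shows "qf (fy0 z) = Q0 (fy0 z)"
proof -
 have sq: "(qf (fy0 z))^2 = (Q0 (fy0 z))^2" if "z : dom1" for z
  using qf_phi_square(1)[OF that] Q_square(1)[of "fy0 z"] phi0_val(2) dom1_sub that by auto
 obtain e where e: "e = 1 | e = -1" "!!z. z : dom1 ==> qf (fy0 z) = e*Q0 (fy0 z)"
  by (rule connected_square_root_unique[OF dom1_connected cont_Q(3) cont_Q(1) sq Q0_nonzero]) (assumption | rule that)+
 have "(%z. fy0 z - z/cor (c0 tt)) : O[at_infinity](%_. 1)" using p0 by (simp add: is_phi0_def)
 then obtain K where K: "K > 0" "eventually (%z. norm (fy0 z - z/cor (c0 tt)) <= K*norm (1::complex)) at_infinity"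
  by (auto elim: landau_o.bigE)
 then obtain B where B: "!!z. norm z >= B ==> norm (fy0 z - z/cor (c0 tt)) <= K"
  by (auto simp: eventually_at_infinity)
 obtain S0 where S0: "!!s. s >= S0 ==> EX r>0. qf (cor s) = cor r"
  using qs by (auto simp: is_sqrtD_def eventually_at_top_linorder)
 have c0: "c0 tt > 0" by (rule theta_consts)
 define y where "y = max (max B 2) (c0 tt*(K + max S0 1))"
 have y: "y >= B" "y >= 2" "y >= c0 tt*(K + max S0 1)" by (auto simp: y_def)
 define w where "w = cor y"
 have wd: "w : dom1" unfolding dom1_alt w_def using y(2) by auto
 have wd0: "w : dom0" using wd dom1_sub by blast
 have u: "Im (us (fy0 w)) = 0" "Re (us (fy0 w)) > 0" using Wf_phi0(2)[OF wd] by (auto simp: w_def)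
 define mu where "mu = Re (us (fy0 w))"
 have u': "us (fy0 w) = cor mu" using u by (simp add: mu_def complex_eq_iff)
 have "fy0 w = sv (cor mu)" using sv_us[OF phi0_val(2)[OF wd0]] u' by simp
 hence "fy0 w = cor (1/(1 - 2 * mu))" by (simp add: sv_def)
 then obtain s where s: "fy0 w = cor s" by blast
 have "\<bar>s - y/c0 tt\<bar> <= K"
 proof -
  have "norm (fy0 w - w/cor (c0 tt)) <= K" by (rule B) (use y in \<open>simp add: w_def\<close>)
  moreover have "fy0 w - w/cor (c0 tt) = cor (s - y/c0 tt)" unfolding s by (simp add: w_def)
  ultimately show ?thesis by (simp only: norm_of_real)
 qed
 moreover have "y/c0 tt >= K + max S0 1" using y(3) c0 by (simp add: le_divide_eq mult.commute)
 ultimately have s1: "s >= S0" "s >= 1" by linarith+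
 obtain r where r: "r > 0" "qf (cor s) = cor r" using S0[OF s1(1)] by blast
 define W where "W = mu*(qq + 3 * pp * mu)"
 have mu0: "mu > 0" using u(2) by (simp only: mu_def)
 have W: "Wf (us (fy0 w)) = cor W" unfolding u' by (simp add: Wf_def W_def)
 have W0: "W > 0" unfolding W_def using mu0 pp qq by (intro mult_pos_pos add_pos_pos) auto
 have "Q0 (fy0 w) = cor (s^2 * sqrt CD * sqrt W)"
 proof -
  have c: "csqrt (cor W) = cor (sqrt W)" using W0 of_real_sqrt[of W] by simp
  show ?thesis unfolding Q0_def W c unfolding s by (simp only: of_real_mult of_real_power)
 qed
 hence q: "cor r = e * cor (s^2 * sqrt CD * sqrt W)" using e(2)[OF wd] r(2) unfolding s by metis
 have p: "s^2 * sqrt CD * sqrt W > 0" using s1(2) CD_pos W0 by simp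
 have "e = 1"
 proof (rule ccontr)
  assume "e ~= 1"
  hence "cor r = cor (- (s^2 * sqrt CD * sqrt W))" using q e(1) by simp
  hence "r = - (s^2 * sqrt CD * sqrt W)" by (simp only: of_real_eq_iff)
  thus False using r(1) p by linarith
 qed
 thus ?thesis using e(2)[OF assms] by simp
qed

lemma J_root:
 assumes "valid r" "sg = 1 | sg = -1" "r ~= - (3 * pp/qq)" shows "J (root sg r) = 0" "Im (root sg r) ~= 0"
proof -
 have i: "Im (root sg r) ~= 0" using Im_root_sign[OF assms(1,3)] assms(2) by auto
 have "Im (zeta (root sg r)) = Im (cor (1/X r))" unfolding root_zeta[OF assms(1,2)] by simp
 hence "- 2*Im (root sg r)*J (root sg r) = 0" unfolding Im_zeta by simp
 thus "J (root sg r) = 0" "Im (root sg r) ~= 0" using i by auto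
qed

lemma Wf_root:
 assumes "valid r" "sg = 1 | sg = -1" "r ~= - (3 * pp/qq)" shows "- Wf (root sg r) ~: \<real>\<^sub>\<le>\<^sub>0"
proof (rule Wf_region1)
 show "J (root sg r) <= 0" using J_root[OF assms] by simp
 show "Wf (root sg r) ~= 0"
 proof
  assume "Wf (root sg r) = 0"
  hence "Re (Wf (root sg r)) = 0" by simp
  hence "Im (root sg r) = 0" using J_root(1)[OF assms] pp by (simp add: Re_Wf)
  thus False using J_root(2)[OF assms] by simp
 qed
qed

lemma Wf_u0:
 assumes v: "valid r" "sg = 1 | sg = -1" shows "Wf (u0 sg r) ~: \<real>\<^sub>\<le>\<^sub>0"
proof (cases "r > 0")
 case True
 have s: "-sg = 1 | -sg = -1" using v(2) by auto
 have "Re (root (-sg) r) > 0" using True by (simp add: root_parts add_pos_nonneg)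
 moreover have "Im (root (-sg) r) ~= 0" by (rule J_root(2)[OF v(1) s pos_not_endpoint[OF True]])
 ultimately show ?thesis using True Wf_region0[of "root (-sg) r"] by (simp add: u0_def)
next
 case False
 hence "r < 0" using validD(3)[OF v(1)] by simp
 hence "Re (cor (- 1/(2*r))) > 0" by (simp add: zero_less_divide_iff)
 thus ?thesis using False J_third[OF v(1)] unfolding u0_def if_not_P[OF False] by (intro Wf_region0 disjI2) linarith+
qed

lemma Q0_limit:
 assumes v: "valid r" "sg = 1 | sg = -1"
 shows "((%z. qf (fy0 z)) \<longlongrightarrow> sv (u0 sg r)^2 * cor (sqrt CD) * csqrt (Wf (u0 sg r))) (at (cor (X r)) within half sg)"
proof -
 have "((%z. Q0 (fy0 z)) \<longlongrightarrow> sv (u0 sg r)^2 * cor (sqrt CD) * csqrt (Wf (u0 sg r))) (at (cor (X r)) within half sg)"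
  unfolding Q0_def
  by (intro tendsto_intros phi0_limit[OF v] tendsto_csqrt_off_cut Wf_u0[OF v]) (unfold Wf_def, intro tendsto_intros us_limit0[OF v, folded u0_def])
 thus ?thesis
 proof (rule Lim_transform_eventually)
  show "eventually (%z. Q0 (fy0 z) = qf (fy0 z)) (at (cor (X r)) within half sg)"
   using ev_half by eventually_elim (simp add: qf_phi0 subsetD[OF half_sub(1)])
 qed
qed

lemma Q1_limit_aux:
 assumes v: "valid r" "sg = 1 | sg = -1" "r ~= - (3 * pp/qq)"
 shows "((%z. Q1 (fy1 z)) \<longlongrightarrow> - \<i> * (sv (root sg r)^2 * cor (sqrt CD) * csqrt (- Wf (root sg r)))) (at (cor (X r)) within half sg)"
 unfolding Q1_def
 by (intro tendsto_intros phi1_limit[OF v(1,2)] tendsto_csqrt_off_cut Wf_root[OF v]) (unfold Wf_def, intro tendsto_intros us_limit1[OF v(1,2)])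

text \<open>The values of phi_1 near infinity are close to theta_1, where nothing is known about the
  sign. Instead, for 0 < x < 1 the limit of phi_1 from above and that of phi_0 from below are the
  same point \<open>s1\<close>; \<open>qf\<close> is continuous there, and
  \<open>csqrt_minus_lower\<close> shows that \<open>Q0\<close> and \<open>Q1\<close> have the same
  limit.\<close>

lemma qf_phi1:
 assumes "z : dom1" shows "qf (fy1 z) = Q1 (fy1 z)"
proof -
 have sq: "(qf (fy1 z))^2 = (Q1 (fy1 z))^2" if "z : dom1" for z
  using qf_phi_square(2)[OF that] Q_square(2)[of "fy1 z"] phi1_val(2) that by auto
 obtain e where e: "e = 1 | e = -1" "!!z. z : dom1 ==> qf (fy1 z) = e*Q1 (fy1 z)"
  by (rule connected_square_root_unique[OF dom1_connected cont_Q(4) cont_Q(2) sq Q1_nonzero]) (assumption | rule that)+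
 define r where "r = pp/(2*qq)"
 have r: "r > 0" "valid r"
 proof -
  show "r > 0" using pp qq by (simp add: r_def)
  have "- (3 * pp/qq) <= 0" using pp qq by simp
  moreover have "r < pp/qq" using pp qq by (simp add: r_def field_simps)
  ultimately show "valid r" using \<open>r > 0\<close> by (simp add: valid_def)
 qed
 have m: "(1::real) = 1 | (1::real) = -1" "(-1::real) = 1 | (-1::real) = -1" by auto
 define s1 where "s1 = sv (root 1 r)"
 have s1c: "s1 : - sqrtD_cut tt fy1" using s1_not_in_cut[OF r(2,1)] by (simp add: s1_def)
 have u0r: "u0 (-1) r = root 1 r" using r by (simp add: u0_def)
 let ?F = "at (cor (X r)) within half 1" and ?G = "at (cor (X r)) within half (-1)"
 have q1: "((%z. qf (fy1 z)) \<longlongrightarrow> qf s1) ?F"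
 proof (rule continuous_on_tendsto_compose[OF qf_cont])
  show "(fy1 \<longlongrightarrow> s1) ?F" unfolding s1_def by (rule phi1_limit[OF r(2) m(1)])
  show "eventually (%z. fy1 z : - sqrtD_cut tt fy1) ?F"
   using ev_half by eventually_elim (use qf_phi_square(4) half_sub in blast)
 qed (rule s1c)
 have q0: "((%z. qf (fy0 z)) \<longlongrightarrow> qf s1) ?G"
 proof (rule continuous_on_tendsto_compose[OF qf_cont])
  show "(fy0 \<longlongrightarrow> s1) ?G" unfolding s1_def using phi0_limit[OF r(2) m(2)] u0r by simp
  show "eventually (%z. fy0 z : - sqrtD_cut tt fy1) ?G"
   using ev_half by eventually_elim (use qf_phi_square(3) half_sub in blast)
 qed (rule s1c)
 have nbG: "?G ~= bot" by (rule half_not_bot) simp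
 have nbF: "?F ~= bot" by (rule half_not_bot) simp
 have v0: "qf s1 = s1^2 * cor (sqrt CD) * csqrt (Wf (root 1 r))"
  using tendsto_unique[OF nbG q0 Q0_limit[OF r(2) m(2)]] unfolding u0r s1_def[symmetric] .
 have "((%z. qf (fy1 z)) \<longlongrightarrow> e*(- \<i> * (s1^2 * cor (sqrt CD) * csqrt (- Wf (root 1 r))))) ?F"
 proof (rule Lim_transform_eventually)
  show "((%z. e*Q1 (fy1 z)) \<longlongrightarrow> e*(- \<i> * (s1^2 * cor (sqrt CD) * csqrt (- Wf (root 1 r))))) ?F"
   unfolding s1_def by (intro tendsto_mult tendsto_const Q1_limit_aux[OF r(2) m(1) pos_not_endpoint[OF r(1)]])
  show "eventually (%z. e*Q1 (fy1 z) = qf (fy1 z)) ?F"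
   using ev_half by eventually_elim (simp add: e(2) subsetD[OF half_sub(1)])
 qed
 hence v1: "qf s1 = e*(- \<i> * (s1^2 * cor (sqrt CD) * csqrt (- Wf (root 1 r))))"
  by (rule tendsto_unique[OF nbF q1])
 have W: "Im (Wf (root 1 r)) < 0"
 proof -
  have "Re (root 1 r) > 0" using r by (simp add: root_parts add_pos_nonneg)
  hence "qq + 6 * pp * Re (root 1 r) > 0" using pp qq by (intro add_pos_pos) auto
  thus ?thesis unfolding Im_Wf using Im_root_sign(1)[OF r(2) pos_not_endpoint[OF r(1)]] by (intro mult_neg_pos)
 qed
 have "- \<i> * (s1^2 * cor (sqrt CD) * csqrt (- Wf (root 1 r))) = s1^2 * cor (sqrt CD) * csqrt (Wf (root 1 r))"
  unfolding csqrt_minus_lower[OF W] by (simp add: complex_eq_iff algebra_simps del: csqrt.sel)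
 hence "qf s1 = e*qf s1" using v0 v1 by simp
 moreover have "qf s1 ~= 0"
 proof -
  have "s1 ~= 0" using root_nz[OF r(2) m(1)] by (simp add: s1_def sv_def)
  moreover have "Wf (root 1 r) ~= 0" using W by auto
  ultimately show ?thesis unfolding v0 using CD_pos by simp
 qed
 ultimately have "e = 1" by simp
 thus ?thesis using e(2)[OF assms] by simp
qed

lemma Q1_limit:
 assumes v: "valid r" "sg = 1 | sg = -1" "r ~= - (3 * pp/qq)"
 shows "((%z. qf (fy1 z)) \<longlongrightarrow> - \<i> * (sv (root sg r)^2 * cor (sqrt CD) * csqrt (- Wf (root sg r)))) (at (cor (X r)) within half sg)"
proof (rule Lim_transform_eventually[OF Q1_limit_aux[OF v]])
 show "eventually (%z. Q1 (fy1 z) = qf (fy1 z)) (at (cor (X r)) within half sg)"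
  using ev_half by eventually_elim (simp add: qf_phi1 subsetD[OF half_sub(1)])
qed

end

section \<open>Laplace's method for sums\<close>

lemma integral_cells:
 fixes f :: "real => 'a::banach" and n :: real
 assumes n: "n > 0" and kl: "kl <= kr + 1"
  and f: "f integrable_on {(real kl - 1/2)/n..(real kr + 1/2)/n}"
 shows "integral {(real kl - 1/2)/n..(real kr + 1/2)/n} f = (\<Sum>k=kl..kr. integral {(real k - 1/2)/n..(real k + 1/2)/n} f)"
 using kl f
proof (induction kr)
 case 0
 consider "kl = 0" | "kl = 1" using 0 by linarith
 thus ?case by cases auto
next
 case (Suc kr)
 show ?case
 proof (cases "kl = Suc kr + 1")
  case True
  thus ?thesis by simp
 next
  case False
  hence le: "kl <= kr + 1" using Suc.prems by simp
  have e: "real (Suc kr) - 1/2 = real kr + 1/2" by simp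
  have o1: "(real kl - 1/2)/n <= (real kr + 1/2)/n" using le n by (intro divide_right_mono) auto
  have o2: "(real kr + 1/2)/n <= (real (Suc kr) + 1/2)/n" using n by (intro divide_right_mono) auto
  have sub: "f integrable_on {(real kl - 1/2)/n..(real kr + 1/2)/n}"
   by (rule integrable_on_subinterval[OF Suc.prems(2)]) (use o2 in auto)
  have "integral {(real kl - 1/2)/n..(real (Suc kr) + 1/2)/n} f = integral {(real kl - 1/2)/n..(real kr + 1/2)/n} f + integral {(real kr + 1/2)/n..(real (Suc kr) + 1/2)/n} f"
   by (rule Henstock_Kurzweil_Integration.integral_combine[symmetric, OF o1 o2 Suc.prems(2)])
  also have "integral {(real kl - 1/2)/n..(real kr + 1/2)/n} f = (\<Sum>k=kl..kr. integral {(real k - 1/2)/n..(real k + 1/2)/n} f)"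
   by (rule Suc.IH[OF le sub])
  also have "{(real kr + 1/2)/n..(real (Suc kr) + 1/2)/n} = {(real (Suc kr) - 1/2)/n..(real (Suc kr) + 1/2)/n}" by (simp only: e)
  finally show ?thesis using le by (simp del: of_nat_Suc)
 qed
qed

text \<open>Each term is at most a constant times n times the integral of the Gaussian of half the
  rate over the cell of width 1/n around k/n. In a cell the offset e satisfies n e^2 <= 1/4, and (t
  - r0)^2 <= 2 (k/n - r0)^2 + 2 e^2.\<close>

lemma gaussian_sum_bound:
 fixes c :: real
 assumes c: "c > 0" and n: "n >= 1"
 shows "(\<Sum>k=kl..kr. exp (- (c*n*(real k/n - r0)^2))) <= exp (c/4) * sqrt (2 * pi/c) * sqrt n"
proof (cases "kl <= kr + 1")
 case False
 thus ?thesis using c n by simp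
next
 case True
 have n0: "n > 0" using n by simp
 let ?g = "%t::real. exp (- (c*n*(t - r0)^2/2))"
 have ig: "?g integrable_on {u..v}" for u v
  by (intro integrable_continuous_interval continuous_intros) auto
 have cell: "exp (- (c*n*(real k/n - r0)^2)) <= exp (c/4)*n*integral {(real k - 1/2)/n..(real k + 1/2)/n} ?g" for k
 proof -
  let ?A = "exp (- (c*n*(real k/n - r0)^2))"
  have len: "(real k + 1/2)/n - (real k - 1/2)/n = 1/n" by (simp add: diff_divide_distrib add_divide_distrib)
  have le: "(real k - 1/2)/n <= (real k + 1/2)/n" using n0 by (intro divide_right_mono) auto
  have "((%t. exp (- (c/4)) * ?A) has_integral (((real k + 1/2)/n - (real k - 1/2)/n) *\<^sub>R (exp (- (c/4)) * ?A))) {(real k - 1/2)/n..(real k + 1/2)/n}"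
   using le by (metis has_integral_const_real content_real)
  hence h: "((%t. exp (- (c/4)) * ?A) has_integral (1/n*(exp (- (c/4)) * ?A))) {(real k - 1/2)/n..(real k + 1/2)/n}"
   unfolding len by simp
  have "1/n*(exp (- (c/4)) * ?A) <= integral {(real k - 1/2)/n..(real k + 1/2)/n} ?g"
  proof (rule has_integral_le[OF h integrable_integral[OF ig]])
   fix t assume t: "t : {(real k - 1/2)/n..(real k + 1/2)/n}"
   define e where "e = t - real k/n"
   have "\<bar>e\<bar> <= 1/(2*n)" using t by (auto simp: e_def abs_le_iff diff_divide_distrib add_divide_distrib)
   hence "e^2 <= (1/(2*n))^2" by (metis abs_ge_zero power2_abs power_mono)
   hence "n*e^2 <= n*(1/(2*n))^2" using n0 by (intro mult_left_mono) auto
   also have "... = 1/(4*n)" using n0 by (simp add: power2_eq_square)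
   also have "... <= 1/4" using n by (intro divide_left_mono) auto
   finally have e2: "n*e^2 <= 1/4" .
   have "(t - r0)^2 <= 2*(real k/n - r0)^2 + 2*e^2"
   proof -
    define d where "d = real k/n - r0"
    have "t - r0 = d + e" by (simp add: d_def e_def)
    moreover have "2*d^2 + 2*e^2 - (d + e)^2 = (d - e)^2" by (simp add: power2_eq_square algebra_simps)
    ultimately show ?thesis unfolding d_def[symmetric] using zero_le_power2[of "d - e"] by (simp only:)
   qed
   hence "c*n*(t - r0)^2/2 <= c*n*(2*(real k/n - r0)^2 + 2*e^2)/2"
    using c n0 by (intro divide_right_mono mult_left_mono) auto
   also have "... = c*n*(real k/n - r0)^2 + c*(n*e^2)" by (simp add: algebra_simps)
   also have "... <= c*n*(real k/n - r0)^2 + c*(1/4)" using e2 c by (intro add_left_mono mult_left_mono) auto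
   finally show "exp (- (c/4)) * ?A <= ?g t" by (simp add: exp_add[symmetric])
  qed
  hence "exp (c/4)*n*(1/n*(exp (- (c/4)) * ?A)) <= exp (c/4)*n*integral {(real k - 1/2)/n..(real k + 1/2)/n} ?g"
   using n0 by (intro mult_left_mono) auto
  moreover have "exp (c/4)*n*(1/n*(exp (- (c/4)) * ?A)) = ?A" using n0 by (simp add: exp_minus)
  ultimately show ?thesis by simp
 qed
 have G: "(?g has_integral sqrt (2 * pi/(c*n))) UNIV"
  using gaussian_has_integral_centered[of "c*n" r0] c n0 by simp
 have "(\<Sum>k=kl..kr. exp (- (c*n*(real k/n - r0)^2))) <= (\<Sum>k=kl..kr. exp (c/4)*n*integral {(real k - 1/2)/n..(real k + 1/2)/n} ?g)"
  by (intro sum_mono cell)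
 also have "... = exp (c/4)*n*integral {(real kl - 1/2)/n..(real kr + 1/2)/n} ?g"
  by (simp only: sum_distrib_left[symmetric] integral_cells[OF n0 True ig])
 also have "... <= exp (c/4)*n*integral UNIV ?g"
  using n0 G by (intro mult_left_mono integral_subset_le[OF _ ig]) (auto simp: has_integral_iff)
 also have "integral UNIV ?g = sqrt (2 * pi/(c*n))" using G by (rule integral_unique)
 also have "exp (c/4)*n * sqrt (2 * pi/(c*n)) = exp (c/4) * sqrt (2 * pi/c) * sqrt n"
 proof -
  have "n * sqrt (2 * pi/(c*n)) = sqrt (2 * pi/c)*(n/sqrt n)" using c n0 by (simp add: real_sqrt_divide real_sqrt_mult)
  also have "n/sqrt n = sqrt n" using n0 by (simp add: real_div_sqrt)
  finally show ?thesis by simp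
 qed
 finally show ?thesis .
qed

text \<open>The linear Taylor term integrates to zero over the symmetric interval, so only the
  second derivative enters.\<close>

lemma midpoint_rule:
 fixes f f1 f2 :: "complex => complex" and c h B :: real
 assumes h: "h > 0"
  and d1: "!!r. r : {c-h..c+h} ==> (f has_field_derivative f1 (cor r)) (at (cor r))"
  and d2: "!!r. r : {c-h..c+h} ==> (f1 has_field_derivative f2 (cor r)) (at (cor r))"
  and B: "!!r. r : {c-h..c+h} ==> norm (f2 (cor r)) <= B"
 shows "norm (integral {c-h..c+h} (%r. f (cor r)) - cor (2*h)*f (cor c)) <= B*h^2*(2*h)"
proof -
 let ?I = "cor ` {c-h..c+h}"
 have vI: "convex ?I" by (intro convex_linear_image) (auto simp: linear_of_real)
 define F where "F = (%i::nat. if i = 0 then f else if i = 1 then f1 else f2)"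
 have Fd: "(F i has_field_derivative F (Suc i) x) (at x within ?I)" if xi: "x : ?I" "i <= 1" for i x
 proof -
  obtain r where r: "r : {c-h..c+h}" "x = cor r" using xi(1) by blast
  have "i = 0 | i = 1" using xi(2) by linarith
  hence "(F i has_field_derivative F (Suc i) x) (at x)"
   using d1[OF r(1)] d2[OF r(1)] unfolding r(2) F_def by (elim disjE) simp_all
  thus ?thesis by (rule has_field_derivative_at_within)
 qed
 have cI: "c : {c-h..c+h}" using h by simp
 have ty: "norm (f (cor r) - f (cor c) - f1 (cor c) * cor (r - c)) <= B*h^2" if r: "r : {c-h..c+h}" for r
 proof -
  have "norm (F 0 (cor r) - (\<Sum>i\<le>1. F i (cor c)*(cor r - cor c)^i/fact i)) <= B*norm (cor r - cor c :: complex)^(Suc 1)/fact 1"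
  proof (rule complex_Taylor[OF vI])
   fix i x assume "x : ?I" "i <= (1::nat)"
   thus "(F i has_field_derivative F (Suc i) x) (at x within ?I)" by (rule Fd)
  next
   fix x assume "x : ?I"
   thus "norm (F (Suc 1) x) <= B" using B by (auto simp: F_def)
  qed (use r cI in auto)
  moreover have "norm (cor r - cor c :: complex) = \<bar>r - c\<bar>" by (metis norm_of_real of_real_diff)
  ultimately have "norm (f (cor r) - f (cor c) - f1 (cor c) * cor (r - c)) <= B * \<bar>r - c\<bar>^2"
   by (simp add: F_def algebra_simps power2_eq_square)
  also have "... <= B*h^2"
  proof (intro mult_left_mono power_mono)
   show "0 <= B" using B[OF cI] norm_ge_zero order_trans by blast
  qed (use r in auto)
  finally show ?thesis .
 qed
 have cf: "continuous_on {c-h..c+h} (%r. f (cor r))"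
 proof (rule continuous_on_compose2[of ?I f "{c-h..c+h}" cor])
  show "continuous_on ?I f"
  proof (intro continuous_at_imp_continuous_on ballI)
   fix w assume "w : ?I"
   then obtain r where r: "r : {c-h..c+h}" "w = cor r" by blast
   show "isCont f w" unfolding r(2) by (rule DERIV_isCont[OF d1[OF r(1)]])
  qed
 qed (auto intro!: continuous_intros)
 have i0: "((%r. f1 (cor c) * cor (r - c)) has_integral 0) {c-h..c+h}"
 proof -
  have "((%r. f1 (cor c) * cor (r - c)) has_integral (f1 (cor c) * cor ((c + h - c)^2/2) - f1 (cor c) * cor ((c - h - c)^2/2))) {c-h..c+h}"
  proof (rule fundamental_theorem_of_calculus)
   fix r assume "r : {c-h..c+h}"
   have "((%r. (r - c)^2/2) has_real_derivative (r - c)) (at r within {c-h..c+h})"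
    by (auto intro!: derivative_eq_intros)
   hence "((%r. cor ((r - c)^2/2)) has_vector_derivative cor (r - c)) (at r within {c-h..c+h})"
    by (intro has_vector_derivative_of_real) (simp add: has_real_derivative_iff_has_vector_derivative)
   thus "((%r. f1 (cor c) * cor ((r - c)^2/2)) has_vector_derivative f1 (cor c) * cor (r - c)) (at r within {c-h..c+h})"
    by (rule has_vector_derivative_mult_right)
  qed (use h in auto)
  thus ?thesis by simp
 qed
 have i1: "((%r. f (cor r)) has_integral integral {c-h..c+h} (%r. f (cor r))) {c-h..c+h}"
  by (intro integrable_integral integrable_continuous_interval cf)
 have i2: "((%r. f (cor c)) has_integral cor (2*h)*f (cor c)) {c-h..c+h}"
 proof -
  have "((%r. f (cor c)) has_integral (measure lborel {c-h..c+h}) *\<^sub>R f (cor c)) {c-h..c+h}" by (rule has_integral_const_real)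
  thus ?thesis using h by (simp add: scaleR_conv_of_real)
 qed
 have "((%r. f (cor r) - f (cor c) - f1 (cor c) * cor (r - c)) has_integral (integral {c-h..c+h} (%r. f (cor r)) - cor (2*h)*f (cor c) - 0)) {c-h..c+h}"
  by (intro has_integral_diff i0 i1 i2)
 hence "norm (integral {c-h..c+h} (%r. f (cor r)) - cor (2*h)*f (cor c) - 0) <= B*h^2 * measure lborel {c-h..c+h}"
 proof (rule has_integral_bound_real[of _ "{}", rotated 2])
  show "0 <= B*h^2" using order_trans[OF norm_ge_zero ty[OF cI]] .
 qed (use ty in auto)
 thus ?thesis using h by simp
qed

locale laplace_real = laplace_curve S Ps "%z. z" B Lb Lb' a b m
 for S :: "complex set" and Ps B :: "complex => complex" and Lb Lb' :: "real => real" and a b m :: real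
begin

definition integrand :: "real => real => complex => complex" where
 "integrand n r0 z = exp (cor n*(Ps z + cor (Lb r0)*z))*B z"

lemma integrand_eq: "integrand n r0 (cor r) = exp (cor n * phase r0 r)*B (cor r)"
 by (simp add: integrand_def phase_def)

text \<open>Two derivatives of exp (n phase) produce n^2 (phase')^2 and n phase''. As phase'
  vanishes at r0, the first is of size n^2 (r - r0)^2, which is at most a constant times n exp (n m
  (r - r0)^2/4). Half of the Gaussian decay is spent on this, and the cost is n instead of
  n^2.\<close>

lemma integrand_second_deriv:
 obtains K where "K > 0" "!!n r0 r. n >= 1 ==> r0 : {a..b} ==> r : {a..b} ==>
  norm (integrand n r0 (cor r)) <= K*exp (- (n * m*(r - r0)^2/2))*exp (n * Re (phase r0 r0))"
 "!!n r0. n >= 1 ==> r0 : {a..b} ==> EX f1 f2 :: complex => complex. ALL r:{a..b}.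
   (integrand n r0 has_field_derivative f1 (cor r)) (at (cor r)) &
   (f1 has_field_derivative f2 (cor r)) (at (cor r)) &
   norm (f2 (cor r)) <= K*n*exp (- (n * m*(r - r0)^2/4))*exp (n * Re (phase r0 r0))"
proof -
 obtain M1 where M1: "M1 >= 0" "!!i r. i <= 4 ==> r : {a..b} ==> norm ((deriv ^^ i) Ps (cor r)) <= M1"
  by (rule taylor_on_real_interval[OF open_S hol(1)]) (erule sub, rule that)
 obtain M2 where M2: "M2 >= 0" "!!i r. i <= 4 ==> r : {a..b} ==> norm ((deriv ^^ i) B (cor r)) <= M2"
  by (rule taylor_on_real_interval[OF open_S hol(3)]) (erule sub, rule that)
 define K where "K = M1^2*M2*(4/m) + M1*M2 + M1*M2*(4/m + 1) + M2 + 1"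
 have K0: "K >= M1^2*M2*(4/m) + M1*M2 + M1*M2*(4/m + 1) + M2" "K > 0" "K >= M2"
  using M1(1) M2(1) m(1) by (auto simp: K_def intro!: add_nonneg_pos add_nonneg_nonneg)
 have mb: "exp (n * Re (phase r0 r)) <= exp (- (n * m*(r - r0)^2/2))*exp (n * Re (phase r0 r0))"
  if "n >= 1" "r0 : {a..b}" "r : {a..b}" for n r0 r
 proof -
  have "n * Re (phase r0 r) <= n*(Re (phase r0 r0) - m/2*(r - r0)^2)"
   using Re_phase_le[OF that(2,3)] that(1) by (intro mult_left_mono) auto
  thus ?thesis by (simp add: exp_add[symmetric] algebra_simps)
 qed
 have b0: "norm (integrand n r0 (cor r)) <= K*exp (- (n * m*(r - r0)^2/2))*exp (n * Re (phase r0 r0))"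
  if n: "n >= 1" and r0: "r0 : {a..b}" and r: "r : {a..b}" for n r0 r
 proof -
  have "norm (B (cor r)) <= K" using M2(2)[of 0 r] r K0(3) by simp
  moreover have "norm (integrand n r0 (cor r)) = norm (B (cor r))*exp (n * Re (phase r0 r))"
   unfolding integrand_eq by (simp add: norm_mult)
  ultimately have "norm (integrand n r0 (cor r)) <= K*(exp (- (n * m*(r - r0)^2/2))*exp (n * Re (phase r0 r0)))"
   using mb[OF n r0 r] K0(2) by (simp only:) (intro mult_mono, auto)
  thus ?thesis by (simp only: mult.assoc)
 qed
 have b2: "EX f1 f2 :: complex => complex. ALL r:{a..b}.
   (integrand n r0 has_field_derivative f1 (cor r)) (at (cor r)) &
   (f1 has_field_derivative f2 (cor r)) (at (cor r)) &
   norm (f2 (cor r)) <= K*n*exp (- (n * m*(r - r0)^2/4))*exp (n * Re (phase r0 r0))"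
  if n: "n >= 1" and r0: "r0 : {a..b}" for n r0
 proof -
  define fy where "fy = (%z. cor n*(Ps z + cor (Lb r0)*z))"
  define fy1 where "fy1 = (%z. cor n*(deriv Ps z + cor (Lb r0)))"
  define fy2 where "fy2 = (%z. cor n*deriv (deriv Ps) z)"
  define f1 where "f1 = (%z. exp (fy z)*(fy1 z*B z + deriv B z))"
  define f2 where "f2 = (%z. exp (fy z)*(fy1 z*(fy1 z*B z + deriv B z) + (fy2 z*B z + fy1 z*deriv B z + deriv (deriv B) z)))"
  have hd: "deriv Ps holomorphic_on S" "deriv B holomorphic_on S" using hol open_S by (auto intro: holomorphic_deriv)
  have D: "(F has_field_derivative deriv F (cor r)) (at (cor r))" if "F holomorphic_on S" "r : {a..b}" for F r
   by (rule holomorphic_derivI[OF that(1) open_S sub[OF that(2)]])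
  have e: "integrand n r0 = (%z. exp (fy z)*B z)" by (simp add: integrand_def fy_def fun_eq_iff)
  have dphi: "(fy has_field_derivative fy1 (cor r)) (at (cor r))" if "r : {a..b}" for r
   unfolding fy_def fy1_def by (auto intro!: derivative_eq_intros D[OF hol(1) that])
  have dphi1: "(fy1 has_field_derivative fy2 (cor r)) (at (cor r))" if "r : {a..b}" for r
   unfolding fy1_def fy2_def by (auto intro!: derivative_eq_intros D[OF hd(1) that])
  have dexp: "((%z. exp (fy z)) has_field_derivative exp (fy (cor r))*fy1 (cor r)) (at (cor r))" if "r : {a..b}" for r
   by (rule DERIV_chain'[OF dphi[OF that] DERIV_exp, THEN DERIV_cong]) (simp add: mult.commute)
  have d1: "(integrand n r0 has_field_derivative f1 (cor r)) (at (cor r))" if "r : {a..b}" for r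
   unfolding e f1_def by (rule DERIV_cong[OF DERIV_mult[OF dexp[OF that] D[OF hol(3) that]]]) (simp add: algebra_simps)
  have d2: "(f1 has_field_derivative f2 (cor r)) (at (cor r))" if "r : {a..b}" for r
   unfolding f1_def f2_def
   by (rule DERIV_cong[OF DERIV_mult[OF dexp[OF that] DERIV_add[OF DERIV_mult[OF dphi1[OF that] D[OF hol(3) that]] D[OF hd(2) that]]]]) (simp add: algebra_simps)
  have nb: "norm (f2 (cor r)) <= K*n*exp (- (n * m*(r - r0)^2/4))*exp (n * Re (phase r0 r0))" if r: "r : {a..b}" for r
  proof -
   define s where "s = \<bar>r - r0\<bar>"
   have s0: "s >= 0" "s^2 = (r - r0)^2" by (auto simp: s_def)
   have n0: "n >= 0" using n by simp
   have P0: "norm (B (cor r)) <= M2" using M2(2)[of 0 r] r by simp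
   have P1: "norm (deriv B (cor r)) <= M2" using M2(2)[of 1 r] r by simp
   have P2: "norm (deriv (deriv B) (cor r)) <= M2" using M2(2)[of 2 r] r by (simp add: numeral_2_eq_2)
   have Q2: "norm (fy2 (cor r)) <= n*M1"
    unfolding fy2_def norm_mult using M1(2)[of 2 r] r n0 by (simp add: numeral_2_eq_2 mult_left_mono)
   have Q1: "norm (fy1 (cor r)) <= n*(M1 * s)"
   proof -
    have z: "deriv Ps (cor r0) + cor (Lb r0) = 0" using Ps_deriv[OF r0] by simp
    have "norm (deriv Ps (cor r) - deriv Ps (cor r0)) <= M1*norm (cor r - cor r0)"
    proof (rule field_differentiable_bound[of "cor ` {a..b}"])
     show "convex (cor ` {a..b})" by (intro convex_linear_image) (auto simp: linear_of_real)
     fix w assume "w : cor ` {a..b}"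
     then obtain x where x: "x : {a..b}" "w = cor x" by blast
     show "(deriv Ps has_field_derivative deriv (deriv Ps) w) (at w within cor ` {a..b})"
      unfolding x(2) by (rule has_field_derivative_at_within[OF D[OF hd(1) x(1)]])
     show "norm (deriv (deriv Ps) w) <= M1" using M1(2)[of 2 x] x by (simp add: numeral_2_eq_2)
    qed (use r r0 in auto)
    also have "norm (cor r - cor r0) = s" unfolding s_def by (metis norm_of_real of_real_diff)
    also have "deriv Ps (cor r) - deriv Ps (cor r0) = deriv Ps (cor r) + cor (Lb r0)" using z by (simp add: add_eq_0_iff)
    finally show ?thesis unfolding fy1_def norm_mult using n0 by (simp add: mult_left_mono)
   qed
   have nP: "norm (fy1 (cor r)*(fy1 (cor r)*B (cor r) + deriv B (cor r)) + (fy2 (cor r)*B (cor r) + fy1 (cor r)*deriv B (cor r) + deriv (deriv B) (cor r)))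
    <= n*(M1 * s)*(n*(M1 * s)*M2 + M2) + (n*M1*M2 + n*(M1 * s)*M2 + M2)"
   proof -
    have t: "norm (x*y) <= X*Y" if "norm x <= X" "norm y <= Y" for x y :: complex and X Y
     unfolding norm_mult using that norm_ge_zero[of x] norm_ge_zero[of y] by (intro mult_mono) linarith+
    show ?thesis by (intro norm_triangle_mono t Q1 Q2 P0 P1 P2)
   qed
   define z where "z = n * m * s^2/4"
   have z0: "z >= 0" using n0 m(1) by (simp add: z_def)
   have ez: "exp z >= 1" "exp z >= z" proof -
    show "exp z >= 1" using z0 by simp
    show "exp z >= z" using exp_ge_add_one_self[of z] by linarith
   qed
   have c1: "(n * s)^2 <= n*(4/m)*exp z"
   proof -
    have "(n * s)^2 = n*(4/m)*z" using m(1) by (simp add: z_def power2_eq_square)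
    also have "... <= n*(4/m)*exp z" using ez n0 m(1) by (intro mult_left_mono) auto
    finally show ?thesis .
   qed
   have c2: "n <= n*exp z" using ez n0 by (simp add: mult_le_cancel_left1)
   have c3: "1 <= n*exp z" using c2 n by linarith
   have c4: "2*(n * s) <= n*(4/m + 1)*exp z"
   proof -
    have "2*(n * s) <= (n * s)^2 + 1" using zero_le_power2[of "n * s - 1"] by (simp add: power2_eq_square algebra_simps)
    also have "... <= n*(4/m)*exp z + n*exp z" by (intro add_mono c1 c3)
    finally show ?thesis by (simp add: algebra_simps)
   qed
   have "n*(M1 * s)*(n*(M1 * s)*M2 + M2) + (n*M1*M2 + n*(M1 * s)*M2 + M2)
     = M1^2*M2*(n * s)^2 + M1*M2*n + M1*M2*(2*(n * s)) + M2*1"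
    by (simp add: algebra_simps power2_eq_square)
   also have "... <= M1^2*M2*(n*(4/m)*exp z) + M1*M2*(n*exp z) + M1*M2*(n*(4/m + 1)*exp z) + M2*(n*exp z)"
    using M1(1) M2(1) by (intro add_mono mult_left_mono c1 c2 c3 c4) auto
   also have "... = (M1^2*M2*(4/m) + M1*M2 + M1*M2*(4/m + 1) + M2)*(n*exp z)"
    by (simp add: algebra_simps)
   also have "... <= K*(n*exp z)" using K0(1) n0 by (intro mult_right_mono) auto
   finally have A: "n*(M1 * s)*(n*(M1 * s)*M2 + M2) + (n*M1*M2 + n*(M1 * s)*M2 + M2) <= K*(n*exp z)" .
   have "norm (exp (fy (cor r))) = exp (n * Re (phase r0 r))" by (simp add: fy_def phase_def)
   also have "... <= exp (- (n * m*(r - r0)^2/2))*exp (n * Re (phase r0 r0))" by (rule mb[OF n r0 r])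
   finally have "norm (f2 (cor r)) <= (exp (- (n * m*(r - r0)^2/2))*exp (n * Re (phase r0 r0)))*(K*(n*exp z))"
    unfolding f2_def norm_mult using order_trans[OF nP A] by (intro mult_mono) auto
   also have "... = K*n*(exp (- (n * m*(r - r0)^2/2))*exp z)*exp (n * Re (phase r0 r0))" by (simp only: mult_ac)
   also have "exp (- (n * m*(r - r0)^2/2))*exp z = exp (- (n * m*(r - r0)^2/4))"
    unfolding exp_add[symmetric] z_def s0(2) by simp
   finally show ?thesis .
  qed
  show ?thesis by (rule exI[of _ f1], rule exI[of _ f2]) (intro ballI conjI d1 d2 nb)
 qed
 show ?thesis by (rule that[OF K0(2) b0 b2])
qed

text \<open>Replacing each summand by n times the integral over its cell costs a Gaussian weight
  over n by \<open>midpoint_rule\<close>, and the weights sum up to order sqrt n. Against the main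
  term of order sqrt n this is a relative error 1/n. The conditions on kl and kr say that the cells
  fill [a, b] up to end pieces at distance at least de/2 from r0, which are negligible.\<close>

lemma laplace_sum:
 assumes de: "de > 0"
 obtains C where "C >= 0" "!!n r0 kl kr. n >= 1 ==> r0 : {a+de..b-de} ==> kl <= kr + 1 ==>
  a <= (real kl - 1/2)/n ==> (real kl - 1/2)/n <= a + de/2 ==> b - de/2 <= (real kr + 1/2)/n ==> (real kr + 1/2)/n <= b ==>
  norm ((\<Sum>k=kl..kr. integrand n r0 (cor (real k/n)))
    - cor n*(exp (cor n * phase r0 r0)*(B (cor r0) * cor (sqrt (2 * pi/n))/csqrt (cor (Lb' r0)))))
  <= C/sqrt n*exp (n * Re (phase r0 r0))"
proof -
 obtain C1 where C1: "C1 >= 0" "!!n r0. n >= 1 ==> r0 : {a+de..b-de} ==>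
  norm (integral {a..b} (%r. exp (cor n * phase r0 r)*B (cor r))
   - exp (cor n * phase r0 r0)*(B (cor r0) * cor (sqrt (2 * pi/n))/csqrt (deriv (%z. z) (cor r0) * cor (Lb' r0))))
  <= C1/(n * sqrt n)*exp (n * Re (phase r0 r0))"
  by (rule laplace_uniform[OF de]) (rule that)
 obtain K where K: "K > 0" "!!n r0 r. n >= 1 ==> r0 : {a..b} ==> r : {a..b} ==>
  norm (integrand n r0 (cor r)) <= K*exp (- (n * m*(r - r0)^2/2))*exp (n * Re (phase r0 r0))"
 "!!n r0. n >= 1 ==> r0 : {a..b} ==> EX f1 f2 :: complex => complex. ALL r:{a..b}.
   (integrand n r0 has_field_derivative f1 (cor r)) (at (cor r)) &
   (f1 has_field_derivative f2 (cor r)) (at (cor r)) &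
   norm (f2 (cor r)) <= K*n*exp (- (n * m*(r - r0)^2/4))*exp (n * Re (phase r0 r0))"
  by (rule integrand_second_deriv) (rule that)
 define q where "q = m*(de/2)^2/2"
 have q: "q > 0" using m de by (simp add: q_def)
 define C2 where "C2 = K*exp (m/16)*(exp (m/32) * sqrt (16 * pi/m))"
 define C3 where "C3 = 2*(K*(4/q^2))*(b - a)"
 have main: "norm ((\<Sum>k=kl..kr. integrand n r0 (cor (real k/n)))
    - cor n*(exp (cor n * phase r0 r0)*(B (cor r0) * cor (sqrt (2 * pi/n))/csqrt (cor (Lb' r0)))))
  <= (C1 + C2 + C3)/sqrt n*exp (n * Re (phase r0 r0))"
  if n: "n >= 1" and r0: "r0 : {a+de..b-de}" and kk: "kl <= kr + 1"
  and l: "a <= (real kl - 1/2)/n" "(real kl - 1/2)/n <= a + de/2"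
  and u: "b - de/2 <= (real kr + 1/2)/n" "(real kr + 1/2)/n <= b" for n r0 kl kr
 proof -
  define E where "E = exp (n * Re (phase r0 r0))"
  have E0: "E > 0" by (simp add: E_def)
  have n0: "n > 0" using n by simp
  have r0': "r0 : {a..b}" using r0 de by auto
  define f where "f = (%r. integrand n r0 (cor r))"
  obtain f1 f2 :: "complex => complex" where F: "ALL r:{a..b}. (integrand n r0 has_field_derivative f1 (cor r)) (at (cor r)) &
   (f1 has_field_derivative f2 (cor r)) (at (cor r)) & norm (f2 (cor r)) <= K*n*exp (- (n * m*(r - r0)^2/4))*E"
   using K(3)[OF n r0'] unfolding E_def by (elim exE) (erule meta_allE, erule meta_allE, erule meta_mp)
  have ff: "!!r. r : {a..b} ==> (integrand n r0 has_field_derivative f1 (cor r)) (at (cor r))"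
   "!!r. r : {a..b} ==> (f1 has_field_derivative f2 (cor r)) (at (cor r))"
   "!!r. r : {a..b} ==> norm (f2 (cor r)) <= K*n*exp (- (n * m*(r - r0)^2/4))*E"
   by (rule bspec[OF F, THEN conjunct1], assumption, rule bspec[OF F, THEN conjunct2, THEN conjunct1], assumption, rule bspec[OF F, THEN conjunct2, THEN conjunct2], assumption)
  have cf: "continuous_on {a..b} f"
   unfolding f_def
  proof (rule continuous_on_compose2[of "cor ` {a..b}" "integrand n r0" "{a..b}" cor])
   show "continuous_on (cor ` {a..b}) (integrand n r0)"
   proof (intro continuous_at_imp_continuous_on ballI)
    fix w assume "w : cor ` {a..b}"
    then obtain r where r: "r : {a..b}" "w = cor r" by blast
    show "isCont (integrand n r0) w" unfolding r(2) by (rule DERIV_isCont[OF ff(1)[OF r(1)]])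
   qed
  qed (auto intro!: continuous_intros)
  have ifn: "f integrable_on {x..y}" if "a <= x" "y <= b" for x y
   by (intro integrable_continuous_interval continuous_on_subset[OF cf]) (use that in auto)
  have cell: "norm (f (real k/n) - cor n*integral {(real k - 1/2)/n..(real k + 1/2)/n} f)
   <= K*exp (m/16)*E/(4*n)*exp (- (m/8*n*(real k/n - r0)^2))" if k: "k : {kl..kr}" for k
  proof -
   define c where "c = real k/n"
   define h where "h = 1/(2*n)"
   have h: "h > 0" using n0 by (simp add: h_def)
   have ch: "(real k - 1/2)/n = c - h" "(real k + 1/2)/n = c + h" by (auto simp: c_def h_def diff_divide_distrib add_divide_distrib)
   have "(real kl - 1/2)/n <= (real k - 1/2)/n" "(real k + 1/2)/n <= (real kr + 1/2)/n"
    using k n0 by (auto intro!: divide_right_mono)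
   hence sub: "r : {a..b}" if "r : {c-h..c+h}" for r using that l u unfolding ch by auto
   define Bd where "Bd = K*n*(exp (m/16)*exp (- (m/8*n*(c - r0)^2)))*E"
   have bd: "norm (f2 (cor r)) <= Bd" if r: "r : {c-h..c+h}" for r
   proof -
    have "\<bar>r - c\<bar> <= h" using r by auto
    hence "(r - c)^2 <= h^2" using h by (metis abs_le_square_iff abs_of_pos)
    moreover have "(c - r0)^2 <= 2*(r - r0)^2 + 2*(r - c)^2"
    proof -
     have "2*(r - r0)^2 + 2*(r - c)^2 - (c - r0)^2 = (r - r0 + (r - c))^2" by (simp add: power2_eq_square algebra_simps)
     thus ?thesis using zero_le_power2[of "r - r0 + (r - c)"] by linarith
    qed
    ultimately have "(c - r0)^2 <= 2*(r - r0)^2 + 2*h^2" by linarith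
    hence "n * m/8*(c - r0)^2 <= n * m/8*(2*(r - r0)^2 + 2*h^2)" using n0 m(1) by (intro mult_left_mono) auto
    also have "... = n * m*(r - r0)^2/4 + m/16/n" using n0 by (simp add: h_def power2_eq_square field_simps)
    also have "m/16/n <= m/16" using n m(1) by (simp add: divide_le_eq mult_le_cancel_left1)
    finally have "- (n * m*(r - r0)^2/4) <= m/16 + - (m/8*n*(c - r0)^2)" by (simp add: algebra_simps)
    hence "exp (- (n * m*(r - r0)^2/4)) <= exp (m/16)*exp (- (m/8*n*(c - r0)^2))" by (simp only: exp_add[symmetric] exp_le_cancel_iff)
    hence "K*n*exp (- (n * m*(r - r0)^2/4))*E <= Bd" unfolding Bd_def using K(1) n0 E0 by (intro mult_right_mono mult_left_mono) auto
    thus ?thesis using ff(3)[OF sub[OF r]] by linarith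
   qed
   have "norm (integral {c-h..c+h} f - cor (2*h)*f c) <= Bd*h^2*(2*h)"
    unfolding f_def
   proof (rule midpoint_rule[OF h])
    fix r assume r: "r : {c-h..c+h}"
    show "(integrand n r0 has_field_derivative f1 (cor r)) (at (cor r))" by (rule ff(1)[OF sub[OF r]])
    show "(f1 has_field_derivative f2 (cor r)) (at (cor r))" by (rule ff(2)[OF sub[OF r]])
    show "norm (f2 (cor r)) <= Bd" by (rule bd[OF r])
   qed
   hence "n*norm (integral {c-h..c+h} f - cor (2*h)*f c) <= n*(Bd*h^2*(2*h))" using n0 by (intro mult_left_mono) auto
   moreover have "n*norm (integral {c-h..c+h} f - cor (2*h)*f c) = norm (f c - cor n*integral {c-h..c+h} f)"
   proof -
    have "n*norm (integral {c-h..c+h} f - cor (2*h)*f c) = norm (cor n*(integral {c-h..c+h} f - cor (2*h)*f c))" using n0 by (simp add: norm_mult)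
    also have "cor n*(integral {c-h..c+h} f - cor (2*h)*f c) = cor n*integral {c-h..c+h} f - f c" using n0 by (simp add: h_def right_diff_distrib)
    finally show ?thesis by (simp only: norm_minus_commute)
   qed
   moreover have "n*(Bd*h^2*(2*h)) = K*exp (m/16)*E/(4*n)*exp (- (m/8*n*(c - r0)^2))"
    using n0 by (simp add: Bd_def h_def power2_eq_square)
   ultimately show ?thesis unfolding ch by (simp only: c_def)
  qed
  have m8: "m/8 > 0" using m(1) by simp
  let ?A = "(real kl - 1/2)/n" and ?Z = "(real kr + 1/2)/n"
  have AZ: "?A <= ?Z" using kk n0 by (intro divide_right_mono) auto
  have S1: "norm ((\<Sum>k=kl..kr. f (real k/n)) - cor n*integral {?A..?Z} f) <= C2/sqrt n*E"
  proof -
   have "(\<Sum>k=kl..kr. f (real k/n)) - cor n*integral {?A..?Z} f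
     = (\<Sum>k=kl..kr. f (real k/n) - cor n*integral {(real k - 1/2)/n..(real k + 1/2)/n} f)"
    using integral_cells[OF n0 kk ifn[OF l(1) u(2)]] by (simp add: sum_subtractf sum_distrib_left)
   hence "norm ((\<Sum>k=kl..kr. f (real k/n)) - cor n*integral {?A..?Z} f)
     <= (\<Sum>k=kl..kr. norm (f (real k/n) - cor n*integral {(real k - 1/2)/n..(real k + 1/2)/n} f))"
    by (simp only: norm_sum)
   also have "... <= (\<Sum>k=kl..kr. K*exp (m/16)*E/(4*n)*exp (- (m/8*n*(real k/n - r0)^2)))"
    by (rule sum_mono) (rule cell)
   also have "... = K*exp (m/16)*E/(4*n)*(\<Sum>k=kl..kr. exp (- (m/8*n*(real k/n - r0)^2)))"
    by (rule sum_distrib_left[symmetric])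
   also have "... <= K*exp (m/16)*E/(4*n)*(exp (m/8/4) * sqrt (2 * pi/(m/8)) * sqrt n)"
    using K(1) E0 n0 by (intro mult_left_mono gaussian_sum_bound m8 n) auto
   also have "... = C2*E/4*(sqrt n/n)" by (simp add: C2_def)
   also have "sqrt n/n = 1/sqrt n" using n0 real_div_sqrt[of n] by (simp add: field_simps)
   also have "C2*E/4*(1/sqrt n) <= C2/sqrt n*E"
   proof -
    have "C2/sqrt n*E >= 0" using K(1) E0 n0 m(1) by (simp add: C2_def)
    thus ?thesis by simp
   qed
   finally show ?thesis .
  qed
  have ex: "exp (- (n*q)) <= 4/q^2/(n * sqrt n)"
  proof -
   have "(n*q)^2 <= 4*exp (n*q)" using power_le_exp[of "n*q" 2] n0 q by simp
   hence "exp (- (n*q)) <= 4/(n*q)^2" using n0 q by (simp add: exp_minus field_simps)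
   also have "... = 4/q^2/n^2" by (simp add: power_mult_distrib)
   also have "... <= 4/q^2/(n * sqrt n)"
    using n q by (intro divide_left_mono) (auto simp: power2_eq_square intro!: mult_left_mono real_le_lsqrt)
   finally show ?thesis .
  qed
  have fb: "norm (f r) <= K*(4/q^2/(n * sqrt n))*E" if "r : {a..b}" "\<bar>r - r0\<bar> >= de/2" for r
  proof -
   have "(de/2)^2 <= (r - r0)^2" using that(2) de abs_le_square_iff[of "de/2" "r - r0"] by simp
   hence "n * m/2*(de/2)^2 <= n * m/2*(r - r0)^2" using n0 m(1) by (intro mult_left_mono) auto
   hence "exp (- (n * m*(r - r0)^2/2)) <= exp (- (n*q))" by (simp add: q_def)
   also note ex
   finally have "K*exp (- (n * m*(r - r0)^2/2))*E <= K*(4/q^2/(n * sqrt n))*E" using K(1) E0 by (intro mult_right_mono mult_left_mono) auto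
   thus ?thesis using K(2)[OF n r0' that(1)] unfolding f_def E_def by linarith
  qed
  let ?b = "K*(4/q^2/(n * sqrt n))*E"
  have b0: "?b >= 0" using K(1) E0 n0 by simp
  have i1: "norm (integral {a..?A} f) <= ?b*(?A - a)"
  proof (rule integral_bound)
   show "a <= ?A" using l u by simp
   show "continuous_on {a..?A} f" by (rule continuous_on_subset[OF cf]) (use l u AZ in auto)
   fix t assume t: "t : {a..?A}"
   show "norm (f t) <= ?b" by (rule fb) (use t l u AZ r0 in auto)
  qed
  have i2: "norm (integral {?Z..b} f) <= ?b*(b - ?Z)"
  proof (rule integral_bound)
   show "?Z <= b" using l u by simp
   show "continuous_on {?Z..b} f" by (rule continuous_on_subset[OF cf]) (use l u AZ in auto)
   fix t assume t: "t : {?Z..b}"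
   show "norm (f t) <= ?b" by (rule fb) (use t l u AZ r0 in auto)
  qed
  have "integral {a..b} f = integral {a..?A} f + integral {?A..b} f"
   by (rule Henstock_Kurzweil_Integration.integral_combine[symmetric]) (use l u AZ in \<open>auto intro!: ifn\<close>)
  also have "integral {?A..b} f = integral {?A..?Z} f + integral {?Z..b} f"
   by (rule Henstock_Kurzweil_Integration.integral_combine[symmetric]) (use l u AZ in \<open>auto intro!: ifn\<close>)
  finally have "integral {?A..?Z} f - integral {a..b} f = - (integral {a..?A} f + integral {?Z..b} f)" by simp
  hence "norm (integral {?A..?Z} f - integral {a..b} f) <= ?b*(?A - a) + ?b*(b - ?Z)"
   by (simp only: norm_minus_cancel) (rule norm_triangle_mono[OF i1 i2])
  also have "... <= ?b*(b - a) + ?b*(b - a)" using b0 l u AZ by (intro add_mono mult_left_mono) auto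
  also have "... = C3/(n * sqrt n)*E" by (simp add: C3_def algebra_simps)
  finally have S2: "norm (integral {?A..?Z} f - integral {a..b} f) <= C3/(n * sqrt n)*E" .
  let ?R = "exp (cor n * phase r0 r0)*(B (cor r0) * cor (sqrt (2 * pi/n))/csqrt (cor (Lb' r0)))"
  have S3: "norm (integral {a..b} f - ?R) <= C1/(n * sqrt n)*E"
   using C1(2)[OF n r0] by (simp add: f_def integrand_eq E_def)
  have "norm (integral {?A..?Z} f - ?R) <= C3/(n * sqrt n)*E + C1/(n * sqrt n)*E"
   using norm_triangle_mono[OF S2 S3] by simp
  hence "n*norm (integral {?A..?Z} f - ?R) <= n*(C3/(n * sqrt n)*E + C1/(n * sqrt n)*E)" using n0 by (intro mult_left_mono) auto
  also have "... = (C1 + C3)/sqrt n*E" using n0 by (simp add: field_simps)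
  finally have S4: "norm (cor n*integral {?A..?Z} f - cor n * ?R) <= (C1 + C3)/sqrt n*E"
   unfolding right_diff_distrib[symmetric] norm_mult norm_of_real abs_of_pos[OF n0] .
  have "norm ((\<Sum>k=kl..kr. f (real k/n)) - cor n * ?R) <= C2/sqrt n*E + (C1 + C3)/sqrt n*E"
   using norm_triangle_mono[OF S1 S4] by simp
  also have "... = (C1 + C2 + C3)/sqrt n*E" by (simp add: add_divide_distrib algebra_simps)
  finally show ?thesis by (simp add: f_def E_def)
 qed
 have "C1 + C2 + C3 >= 0" using C1(1) K(1) m(1) ab by (auto simp: C2_def C3_def)
 thus ?thesis by (rule that[OF _ main])
qed

end

section \<open>Negative x: the sum of the terms p_k x^k\<close>

lemma DERIV_lf:
 assumes "z ~: \<real>\<^sub>\<le>\<^sub>0" shows "(lf has_field_derivative Ln z) (at z)"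
proof -
 have z: "z ~= 0" using assms by auto
 have "((%z. z*Ln z - z) has_field_derivative (1*Ln z + inverse z*z - 1)) (at z)"
  by (intro DERIV_diff DERIV_mult DERIV_ident has_field_derivative_Ln assms)
 moreover have "(%z. z*Ln z - z) = lf" by (simp add: lf_def fun_eq_iff)
 ultimately show ?thesis using z by simp
qed

text \<open>Since the ratios decrease, the sequence first rises and then falls. A later term
  exceeding \<open>ta i\<close> shows that it is still rising up to i. This controls the terms with
  k/n near 0 or 2, where Stirling's formula gives no uniform estimate.\<close>

lemma unimodal_left:
 fixes ta ro :: "nat => real"
 assumes step: "!!k. k < d ==> ta (Suc k) = ro k*ta k" and ta: "!!k. ta k >= 0"
  and anti: "!!k l. k <= l ==> l < d ==> ro l <= ro k"
  and ij: "i < j" "j <= d" "ta i < ta j" and k: "k <= i"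
 shows "ta k <= ta i"
proof -
 have ge: "ro l >= 1" if l: "l < i" for l
 proof (rule ccontr)
  assume "~ ro l >= 1"
  hence lt: "ro q <= 1" if "l <= q" "q < d" for q using anti[OF that] by linarith
  have "ta (i + q) <= ta i" if "i + q <= d" for q
   using that
  proof (induction q)
   case (Suc q)
   have "ta (i + Suc q) = ro (i + q)*ta (i + q)" using step[of "i + q"] Suc.prems by simp
   also have "... <= 1*ta (i + q)" using lt[of "i + q"] l Suc.prems ta by (intro mult_right_mono) auto
   finally show ?case using Suc.IH Suc.prems by simp
  qed simp
  from this[of "j - i"] show False using ij by simp
 qed
 have "ta (i - q) <= ta i" if "q <= i" for q
  using that
 proof (induction q)
  case (Suc q)
  define p where "p = i - Suc q"
  have p: "Suc p = i - q" "p < i" using Suc.prems by (auto simp: p_def)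
  have "1*ta p <= ro p*ta p" using ge[OF p(2)] ta by (intro mult_right_mono) auto
  also have "... = ta (i - q)" using step[of p] p ij by simp
  finally show ?case using Suc.IH Suc.prems by (simp add: p_def)
 qed simp
 from this[of "i - k"] show ?thesis using k by simp
qed

lemma unimodal_right:
 fixes ta ro :: "nat => real"
 assumes step: "!!k. k < d ==> ta (Suc k) = ro k*ta k" and ta: "!!k. ta k >= 0"
  and anti: "!!k l. k <= l ==> l < d ==> ro l <= ro k"
  and ij: "i < j" "j <= d" "ta j < ta i" and k: "j <= k" "k <= d"
 shows "ta k <= ta j"
proof -
 have "EX l. i <= l & l < j & ro l < 1"
 proof (rule ccontr)
  assume "~ ?thesis"
  hence ge: "ro l >= 1" if "i <= l" "l < j" for l using that by (meson not_less)
  have "ta (i + q) >= ta i" if "i + q <= j" for q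
   using that
  proof (induction q)
   case (Suc q)
   have "1*ta (i + q) <= ro (i + q)*ta (i + q)" using ge[of "i + q"] Suc.prems ta by (intro mult_right_mono) auto
   also have "... = ta (i + Suc q)" using step[of "i + q"] Suc.prems ij by simp
   finally show ?case using Suc.IH Suc.prems by simp
  qed simp
  from this[of "j - i"] show False using ij by simp
 qed
 then obtain l where l: "i <= l" "l < j" "ro l < 1" by blast
 have "ta (j + q) <= ta j" if "j + q <= d" for q
  using that
 proof (induction q)
  case (Suc q)
  have "ro (j + q) <= 1" using anti[of l "j + q"] l Suc.prems by linarith
  hence "ro (j + q)*ta (j + q) <= 1*ta (j + q)" using ta by (intro mult_right_mono) auto
  thus ?case using Suc.IH Suc.prems step[of "j + q"] by simp
 qed simp
 from this[of "k - j"] show ?thesis using k by simp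
qed

locale jpt = jp av1 av2 tt + jth tt for av1 av2 tt :: real
begin

text \<open>Minus the derivative of \<open>hm\<close>: the summand at k = n t is maximal where ln
  (-x) = \<open>Lm t\<close>, so x = - exp (Lm t) has its critical point at t.\<close>

definition Lm :: "real => real" where "Lm t = 3*ln t - ln (t + a) - ln (t + tt) - ln (2 - t)"
definition Lm' :: "real => real" where "Lm' t = 3/t - 1/(t + a) - 1/(t + tt) + 1/(2 - t)"

definition strip :: "complex set" where "strip = {z. 0 < Re z} \<inter> {z. Re z < 2}"

lemma strip_off_cut:
 assumes "z : strip"
 shows "z ~: \<real>\<^sub>\<le>\<^sub>0" "z + cor a ~: \<real>\<^sub>\<le>\<^sub>0" "z + cor tt ~: \<real>\<^sub>\<le>\<^sub>0" "2 - z ~: \<real>\<^sub>\<le>\<^sub>0"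
 using assms tt by (auto simp: strip_def complex_nonpos_Reals_iff)

lemma DERIV_lf_chain:
 assumes "f z ~: \<real>\<^sub>\<le>\<^sub>0" "(f has_field_derivative f') (at z)"
 shows "((%z. lf (f z)) has_field_derivative Ln (f z)*f') (at z)"
 by (rule DERIV_chain2[OF DERIV_lf[OF assms(1)] assms(2)])

lemma DERIV_hm:
 assumes z: "z : strip"
 shows "(hm has_field_derivative (Ln (z + cor a) + Ln (z + cor tt) - 3*Ln z + Ln (2 - z))) (at z)"
proof -
 note o = strip_off_cut[OF z]
 have "((%t. lf (t + cor a) + lf (t + cor tt) - 2*lf t - lf t - lf (2 - t)) has_field_derivative
   (Ln (z + cor a)*1 + Ln (z + cor tt)*1 - 2*Ln z - Ln z - Ln (2 - z)*(-1))) (at z)"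
  by (intro DERIV_diff DERIV_add DERIV_cmult DERIV_lf_chain o DERIV_lf) (auto intro!: derivative_eq_intros)
 moreover have "(%t. lf (t + cor a) + lf (t + cor tt) - 2*lf t - lf t - lf (2 - t)) = hm"
  by (simp add: hm_def hN_def fun_eq_iff)
 ultimately show ?thesis by (simp only:) (rule DERIV_cong, assumption, simp)
qed

lemma Am_holomorphic: "Am holomorphic_on strip"
 unfolding Am_def eN_def by (intro holomorphic_intros) (use strip_off_cut in auto)

lemma laplace_negative:
 assumes ep: "0 < ep" "ep < 1"
 shows "laplace_real strip hm Am Lm Lm' ep (2 - ep) (1/2)"
proof unfold_locales
 show "open strip" unfolding strip_def by (intro open_Int open_halfspace_Re_gt open_halfspace_Re_lt)
 show "hm holomorphic_on strip" unfolding holomorphic_on_def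
  using DERIV_hm field_differentiable_at_within field_differentiable_def by blast
 show "(%z. z) holomorphic_on strip" by (rule holomorphic_on_ident)
 show "Am holomorphic_on strip" by (rule Am_holomorphic)
 show "ep < 2 - ep" using ep by simp
 show s: "cor r : strip" if "r : {ep..2-ep}" for r using that ep by (simp add: strip_def)
 show "(Lm has_real_derivative Lm' r) (at r within {ep..2-ep})" if "r : {ep..2-ep}" for r
  unfolding Lm_def[abs_def] Lm'_def using that ep tt by (auto intro!: derivative_eq_intros)
 show "continuous_on {ep..2-ep} Lm'" unfolding Lm'_def
  by (intro continuous_intros) (use ep tt in auto)
 show "Lm' r >= 1/2" if r: "r : {ep..2-ep}" for r
 proof -
  have "1/(r + a) <= 1/r" "1/(r + tt) <= 1/r" using r ep tt by (auto intro!: divide_left_mono)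
  moreover have "1/2 <= 1/r" using r ep by (intro divide_left_mono) auto
  moreover have "1/(2 - r) >= 0" using r ep by simp
  moreover have "3/r = 1/r + 1/r + 1/r" by (simp add: add_divide_distrib[symmetric])
  ultimately show ?thesis unfolding Lm'_def by linarith
 qed
 show "deriv hm (cor r) = - cor (Lm r)*deriv (%z. z) (cor r)" if r: "r : {ep..2-ep}" for r
 proof -
  have "deriv hm (cor r) = Ln (cor r + cor a) + Ln (cor r + cor tt) - 3*Ln (cor r) + Ln (2 - cor r)"
   by (rule DERIV_imp_deriv[OF DERIV_hm[OF s[OF r]]])
  moreover have "Ln (cor r + cor a) = cor (ln (r + a))" "Ln (cor r + cor tt) = cor (ln (r + tt))"
   "Ln (cor r) = cor (ln r)" "Ln (2 - cor r) = cor (ln (2 - r))"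
   using r ep tt Ln_of_real[of "r + a"] Ln_of_real[of "r + tt"] Ln_of_real[of r] Ln_of_real[of "2 - r"] by auto
  ultimately show ?thesis by (simp add: Lm_def)
 qed
qed auto

text \<open>The term p_k x^k for x = -y, with the common sign (-1)^(n1 + n2) taken out.\<close>

definition Tk :: "nat => nat => real => nat => complex" where
 "Tk n1 n2 y k = cnst av1 av2 n1 n2*Npr av1 av2 n1 n2 (of_nat k)/(fact k*fact (n1 + n2 - k)) * cor y ^ k"

definition rho :: "nat => nat => real => nat => real" where
 "rho n1 n2 y k = y*((1 + n1/(k + 1 + av1))*((1 + n2/(k + 1 + av2))*((real (n1 + n2) - k)/(k + 1))))"

lemma prod_shift:
 "(\<Prod>j<m. of_nat (Suc k) + of_nat j + c)*(of_nat k + c) = (\<Prod>j<m. of_nat k + of_nat j + c)*(of_nat k + of_nat m + (c::complex))"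
 by (induction m) (auto simp: algebra_simps)

lemma Tk_step:
 assumes k: "k < n1 + n2"
 shows "Tk n1 n2 y (Suc k) = cor (rho n1 n2 y k)*Tk n1 n2 y k"
proof -
 have p: "(\<Prod>j<m. of_nat (Suc k) + of_nat j + cor (1 + av)) = (\<Prod>j<m. of_nat k + of_nat j + cor (1 + av)) * cor (1 + m/(real k + 1 + av))"
  if "av > -1" for av :: real and m
 proof -
  have nz: "real k + 1 + av > 0" using that by simp
  have c: "of_nat k + cor (1 + av) = cor (real k + 1 + av)" "of_nat k + of_nat m + cor (1 + av) = cor (real k + 1 + av + m)"
   by auto
  have "(\<Prod>j<m. of_nat (Suc k) + of_nat j + cor (1 + av)) * cor (real k + 1 + av) = (\<Prod>j<m. of_nat k + of_nat j + cor (1 + av)) * cor (real k + 1 + av + m)"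
   using prod_shift[of k "cor (1 + av)" m] unfolding c .
  moreover have "real k + 1 + av + m = (1 + m/(real k + 1 + av))*(real k + 1 + av)" using nz by (simp add: field_simps)
  ultimately have "(\<Prod>j<m. of_nat (Suc k) + of_nat j + cor (1 + av)) * cor (real k + 1 + av) = ((\<Prod>j<m. of_nat k + of_nat j + cor (1 + av)) * cor (1 + m/(real k + 1 + av))) * cor (real k + 1 + av)"
   by (simp only: of_real_mult mult.assoc)
  moreover have "cor (real k + 1 + av) ~= 0" using nz by (simp only: of_real_eq_0_iff)
  ultimately show ?thesis by (simp only: mult_cancel_right) simp
 qed
 have f: "(fact (n1 + n2 - k) :: complex) = cor (real (n1 + n2) - k)*fact (n1 + n2 - Suc k)"
 proof -
  have "n1 + n2 - k = Suc (n1 + n2 - Suc k)" using k by simp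
  hence "(fact (n1 + n2 - k) :: complex) = of_nat (n1 + n2 - k)*fact (n1 + n2 - Suc k)" by (metis fact_Suc)
  thus ?thesis using k by (simp add: of_nat_diff)
 qed
 have g: "(fact (Suc k) :: complex) = cor (real k + 1)*fact k" by (simp add: add.commute)
 have d: "real (n1 + n2) - k ~= 0" "real k + 1 ~= 0" using k by auto
 have d': "cor (real (n1 + n2) - k) ~= 0" "cor (real k + 1) ~= 0" using d by (simp_all only: of_real_eq_0_iff) auto
 have N: "Npr av1 av2 n1 n2 (of_nat (Suc k)) = Npr av1 av2 n1 n2 (of_nat k) * cor ((1 + n1/(real k + 1 + av1))*(1 + n2/(real k + 1 + av2)))"
  unfolding Npr_def p[OF av(1)] p[OF av(2)] of_real_mult by (simp only: mult_ac)
 have gen: "c*(N*A)/(K*F*G)*(Y*P) = Y*(A*(D/K))*(c*N/(F*(D*G))*P)" if "D ~= 0" for c N A K F G Y P D :: complex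
  using that by (simp add: mult_ac)
 have "cor (rho n1 n2 y k) = cor y*(cor ((1 + n1/(real k + 1 + av1))*(1 + n2/(real k + 1 + av2)))*(cor (real (n1 + n2) - k)/cor (real k + 1)))"
  unfolding rho_def by (simp only: of_real_mult of_real_divide mult.assoc)
 thus ?thesis unfolding Tk_def N f g power_Suc using gen[OF d'(1)] by (simp only:)
qed

lemma rho_antimono:
 assumes y: "y > 0" and kl: "k <= l" "l < n1 + n2"
 shows "rho n1 n2 y l <= rho n1 n2 y k"
proof -
 have f: "1 + real m/(real l + 1 + av) <= 1 + m/(real k + 1 + av)" "1 + real m/(real l + 1 + av) >= 0" if "av > -1" for av :: real and m :: nat
 proof -
  have p: "0 < real k + 1 + av" "real k + 1 + av <= real l + 1 + av" "0 < real l + 1 + av" using that kl by auto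
  show "1 + real m/(real l + 1 + av) <= 1 + m/(real k + 1 + av)" using p by (intro add_left_mono divide_left_mono mult_pos_pos) auto
  show "1 + real m/(real l + 1 + av) >= 0" using p by (intro add_nonneg_nonneg divide_nonneg_pos) auto
 qed
 have g: "(real (n1 + n2) - l)/(real l + 1) <= (real (n1 + n2) - k)/(real k + 1)" "(real (n1 + n2) - l)/(real l + 1) >= 0"
  using kl by (auto intro!: frac_le divide_nonneg_pos)
 have gen: "y*(A*(B*D)) <= y*(A'*(B'*D'))"
  if "0 <= A" "A <= A'" "0 <= B" "B <= B'" "0 <= D" "D <= D'" for A A' B B' D D'
  using y that by (intro mult_left_mono mult_mono mult_nonneg_nonneg) auto
 show ?thesis unfolding rho_def by (intro gen f av g)
qed

lemma poly_negative_sum: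
 assumes "mop av1 av2 n1 n2 P"
 shows "cor (poly P (- y)) = (-1)^(n1 + n2)*(\<Sum>k\<le>n1+n2. Tk n1 n2 y k)"
proof -
 interpret mop av1 av2 n1 n2 P by (rule assms)
 have "cor (poly P (- y)) = (\<Sum>k\<le>n1+n2. cor (coeff P k) * cor (- y)^k)"
  by (simp add: poly_altdef degree_P)
 also have "... = (\<Sum>k\<le>n1+n2. (-1)^(n1 + n2)*Tk n1 n2 y k)"
 proof (rule sum.cong[OF refl])
  fix k assume "k : {..n1+n2}"
  hence k: "k <= n1 + n2" by simp
  have "(-1::complex)^(n1 + n2 - k)*(-1)^k = (-1)^(n1 + n2)" using k by (simp add: power_add[symmetric])
  moreover have "cor (- y)^k = (-1)^k * cor y^k" by (simp add: power_minus[of "cor y"])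
  ultimately show "cor (coeff P k) * cor (- y)^k = (-1)^(n1 + n2)*Tk n1 n2 y k"
   unfolding coeff_formula[OF k] Tk_def by (simp add: field_simps)
 qed
 finally show ?thesis by (simp only: sum_distrib_left)
qed

definition pk :: "real => complex" where "pk t = hm (cor t) + cor (Lm t) * cor t - kp0"

lemma exp_minus_one_le:
 fixes e :: complex assumes "norm e <= 1" shows "norm (exp e - 1) <= 3*norm e"
proof -
 have "norm (exp e - exp 0) <= exp 1*norm (e - 0)"
 proof (rule field_differentiable_bound[of "cball 0 1" exp exp])
  show "norm (exp z) <= exp 1" if "z : cball 0 1" for z :: complex
   using that complex_Re_le_cmod[of z] by simp
 qed (use assms in \<open>auto intro: has_field_derivative_at_within DERIV_exp\<close>)
 moreover have "exp 1*norm e <= 3*norm e" using exp_le by (intro mult_right_mono) auto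
 ultimately show ?thesis by simp
qed

text \<open>For k/n in [ep, 2 - ep] the terms are known and \<open>laplace_sum\<close> evaluates
  their sum. The outer terms are dominated by the two boundary terms \<open>kl\<close>,
  \<open>kr\<close> through unimodality, which requires an inner term larger than both. If there
  were none, the inner sum would be smaller than its own main term, whose amplitude
  \<open>mt\<close> is bounded below by \<open>c1\<close>.\<close>

lemma poly_negative:
 assumes ep: "0 < ep" "ep < 1/2"
 obtains C N where "C >= 0" "N > 0" "!!n n1 n2 t P. n >= N ==> scaled n n1 n2 ==> t : {2*ep..2-2*ep} ==> mop av1 av2 n1 n2 P ==>
  norm (cor (poly P (- exp (Lm t))) - (-1)^(n1+n2)*exp (cor n * pk t)*(cor (sqrt 2)*Am (cor t)/csqrt (cor (Lm' t))))
   <= C/n*exp (n * Re (pk t))"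
proof -
 interpret L: laplace_real strip hm Am Lm Lm' ep "2 - ep" "1/2" by (rule laplace_negative) (use ep in auto)
 obtain C1 where C1: "C1 >= 0" "!!n r0 kl kr. n >= 1 ==> r0 : {ep+ep..2-ep-ep} ==> kl <= kr + 1 ==>
  ep <= (real kl - 1/2)/n ==> (real kl - 1/2)/n <= ep + ep/2 ==> 2-ep - ep/2 <= (real kr + 1/2)/n ==> (real kr + 1/2)/n <= 2-ep ==>
  norm ((\<Sum>k=kl..kr. L.integrand n r0 (cor (real k/n)))
    - cor n*(exp (cor n*L.phase r0 r0)*(Am (cor r0) * cor (sqrt (2 * pi/n))/csqrt (cor (Lm' r0)))))
  <= C1/sqrt n*exp (n * Re (L.phase r0 r0))"
  by (rule L.laplace_sum[OF ep(1)]) (rule that)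
 obtain K where K: "K > 0" "!!n r0 r. n >= 1 ==> r0 : {ep..2-ep} ==> r : {ep..2-ep} ==>
  norm (L.integrand n r0 (cor r)) <= K*exp (- (n*(1/2)*(r - r0)^2/2))*exp (n * Re (L.phase r0 r0))"
  by (rule L.integrand_second_deriv) (rule that)
 obtain C2 N2 where C2: "C2 >= 0" "N2 > 0"
  "!!n n1 n2 k t. scaled n n1 n2 ==> n >= N2 ==> real k = n*t ==> ep <= t ==> t <= 2 - ep ==>
   EX e. norm e <= C2/n & cnst av1 av2 n1 n2*Npr av1 av2 n1 n2 (of_nat k)/(fact k*fact (n1 + n2 - k))
    = exp (cor n*(hm (cor t) - kp0))*Am (cor t)*exp e/cor (sqrt (pi*n))"
  by (rule term_asymptotics[OF ep(1)]) (rule that)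
  define mt where "mt = (%t. cor (sqrt 2)*Am (cor t)/csqrt (cor (Lm' t)))"
 obtain c1 where c1: "c1 > 0" "!!t. t : {ep..2-ep} ==> norm (mt t) >= c1"
 proof -
  have pos: "Lm' t > 0" if "t : {ep..2-ep}" for t using L.m(2)[OF that] by simp
  have cAm: "continuous_on {ep..2-ep} (%t. Am (cor t))"
   by (rule continuous_on_compose2[OF holomorphic_on_imp_continuous_on[OF Am_holomorphic], of _ cor]) (auto intro!: continuous_intros L.sub)
  define F where "F = (%t. sqrt 2*norm (Am (cor t))/sqrt (Lm' t))"
  have cF: "continuous_on {ep..2-ep} F" unfolding F_def
  by (intro continuous_intros cAm L.Lb'_cont) (use pos in force)
  have ne: "{ep..2-ep} ~= {}" using ep by simp
  obtain t0 where t0: "t0 : {ep..2-ep}" "ALL t:{ep..2-ep}. F t0 <= F t"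
   using continuous_attains_inf[OF compact_Icc ne cF] by blast
  have nF: "norm (mt t) = F t" if "t : {ep..2-ep}" for t
   using pos[OF that] by (simp add: mt_def F_def norm_mult norm_divide)
  show ?thesis
  proof (rule that)
   show "F t0 > 0" using pos[OF t0(1)] by (simp add: F_def Am_def)
   show "norm (mt t) >= F t0" if "t : {ep..2-ep}" for t
    unfolding nF[OF that] using t0(2) that by blast
  qed
 qed
 define g where "g = ep^2/16"
 have g: "g > 0" using ep by (simp add: g_def)
 define C3 where "C3 = 3*C2*K*(exp (1/4/4) * sqrt (2 * pi/(1/4)))"
 define C4 where "C4 = C1 + C3"
 define C5 where "C5 = 2*K*(6*(27/g^3))"
 \<comment> \<open>The entry C2 keeps the Stirling error below 1, and 4/ep leaves room for
   \<open>kl\<close> and \<open>kr\<close>. The last two make C4/n and the bound on a sum without a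
   large term less than c1/2 each, which is the contradiction in \<open>big\<close>.\<close>
 define N where "N = Max {1, N2, C2, 4/ep, 2*C4/c1 + 1, 2*(12*K*(4/g^2))/c1 + 1}"
 have N: "N >= 1" "N >= N2" "N >= C2" "N >= 4/ep" "N >= 2*C4/c1 + 1" "N >= 2*(12*K*(4/g^2))/c1 + 1"
  unfolding N_def by (rule Max_ge; simp)+
 have C30: "C3 >= 0" "C4 >= 0" "C5 >= 0" using C1(1) C2(1) K(1) g by (auto simp: C3_def C4_def C5_def)
 have main: "norm (cor (poly P (- exp (Lm t))) - (-1)^(n1+n2)*exp (cor n * pk t)*(cor (sqrt 2)*Am (cor t)/csqrt (cor (Lm' t))))
   <= (C4 + C5)/n*exp (n * Re (pk t))"
  if n: "n >= N" and sc: "scaled n n1 n2" and t: "t : {2*ep..2-2*ep}" and P: "mop av1 av2 n1 n2 P" for n n1 n2 t P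
 proof -
  define y where "y = exp (Lm t)"
  define d where "d = n1 + n2"
  define E where "E = exp (n * Re (pk t))"
  have n1: "n >= 1" "n > 0" using n N(1) by auto
  have E0: "E > 0" by (simp add: E_def)
  have y0: "y > 0" by (simp add: y_def)
  have dn: "real d = 2*n" using scaled_sum[OF sc] by (simp add: d_def)
  have t': "t : {ep..2-ep}" "t : {ep+ep..2-ep-ep}" using t ep by auto
  have phk: "L.phase t t = pk t + kp0" by (simp add: L.phase_def pk_def)
  define w where "w = exp (- (cor n * kp0))/cor (sqrt (pi*n))"
  have nw: "norm w = exp (- (n * Re kp0))/sqrt (pi*n)" using n1 by (simp add: w_def norm_divide)
  have wE: "norm w*exp (n * Re (L.phase t t)) = E/sqrt (pi*n)"
   unfolding nw phk E_def by (simp add: exp_add[symmetric] algebra_simps)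
  have sqn: "sqrt (pi*n) >= sqrt n" "sqrt (pi*n) >= 1" "sqrt n > 0"
  proof -
   have "1*n <= pi*n" using pi_gt3 n1 by (intro mult_right_mono) auto
   thus "sqrt (pi*n) >= sqrt n" by simp
   moreover have "sqrt n >= 1" using n1 by simp
   ultimately show "sqrt (pi*n) >= 1" by linarith
   show "sqrt n > 0" using n1 by simp
  qed
  \<comment> \<open>The first and the last k for which the cell of width 1/n around k/n lies in
    [ep, 2 - ep].\<close>
  define kl where "kl = nat \<lceil>n*ep + 1/2\<rceil>"
  define kr where "kr = nat \<lfloor>n*(2 - ep) - 1/2\<rfloor>"
  have "4/ep <= n" using n N(4) by linarith
  hence ne: "n*ep >= 4" using ep by (simp add: divide_le_eq)
  have nee: "n*ep <= n*(1/2)" using n1 ep by (intro mult_left_mono) auto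
  have kl: "real kl >= n*ep + 1/2" "real kl <= n*ep + 3/2" unfolding kl_def using ne by linarith+
  have kr: "real kr <= n*(2 - ep) - 1/2" "real kr >= n*(2 - ep) - 3/2"
  proof -
   have "n*(2 - ep) = 2*n - n*ep" by (simp add: algebra_simps)
   hence "n*(2 - ep) - 1/2 >= 0" using nee n1 by linarith
   thus "real kr <= n*(2 - ep) - 1/2" "real kr >= n*(2 - ep) - 3/2" unfolding kr_def by linarith+
  qed
  have e2: "n*(2 - ep) = 2*n - n*ep" by (simp add: algebra_simps)
  have n8: "n >= 8" using ne nee by linarith
  have klr: "kl < kr" using kl(2) kr(2) nee n8 unfolding e2 by linarith
  have krd: "kr <= d" using kr(1) dn ne unfolding e2 by linarith
  have bl: "ep <= (real kl - 1/2)/n" "(real kl - 1/2)/n <= ep + ep/2"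
   "2-ep - ep/2 <= (real kr + 1/2)/n" "(real kr + 1/2)/n <= 2-ep"
  proof -
   have a: "n*ep <= real kl - 1/2" "real kl - 1/2 <= n*(ep + ep/2)" "n*(2-ep - ep/2) <= real kr + 1/2" "real kr + 1/2 <= n*(2-ep)"
    using kl kr ne by (simp_all add: distrib_left right_diff_distrib)
   show "ep <= (real kl - 1/2)/n" "(real kl - 1/2)/n <= ep + ep/2"
    "2-ep - ep/2 <= (real kr + 1/2)/n" "(real kr + 1/2)/n <= 2-ep"
    using a n1 by (simp_all only: le_divide_eq divide_le_eq if_True mult.commute)
  qed
  have rng: "real k/n : {ep..2-ep}" if "k : {kl..kr}" for k
  proof -
   have "real kl <= k" "real k <= kr" using that by auto
   hence "n*ep <= real k" "real k <= n*(2 - ep)" using kl(1) kr(1) by linarith+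
   thus ?thesis using n1 by (auto simp: le_divide_eq divide_le_eq mult.commute)
  qed
  define T where "T = Tk n1 n2 y"
  have Tas: "norm (T k - w*L.integrand n t (cor (real k/n))) <= 3*C2/n*(norm w*norm (L.integrand n t (cor (real k/n))))
    & norm (T k) <= 4*(norm w*norm (L.integrand n t (cor (real k/n))))" if k: "k : {kl..kr}" for k
  proof -
   define s where "s = real k/n"
   have s: "real k = n * s" "ep <= s" "s <= 2 - ep" using rng[OF k] n1 by (auto simp: s_def)
   have nN2: "n >= N2" using n N(2) by simp
   obtain e where e: "norm e <= C2/n" "cnst av1 av2 n1 n2*Npr av1 av2 n1 n2 (of_nat k)/(fact k*fact (n1 + n2 - k))
    = exp (cor n*(hm (cor s) - kp0))*Am (cor s)*exp e/cor (sqrt (pi*n))"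
    using C2(3)[OF sc nN2 s] by blast
   have yk: "cor y ^ k = exp (cor n*(cor (Lm t) * cor s))"
   proof -
    have "y ^ k = exp (real k*Lm t)" unfolding y_def by (rule exp_of_nat_mult[symmetric])
    also have "real k*Lm t = n*(Lm t * s)" by (simp add: s(1))
    finally have "cor (y ^ k) = cor (exp (n*(Lm t * s)))" by (simp only:)
    thus ?thesis by (simp only: of_real_power exp_of_real[symmetric] of_real_mult)
   qed
   have i: "L.integrand n t (cor s) = exp (cor n*(hm (cor s) + cor (Lm t) * cor s))*Am (cor s)"
    by (rule L.integrand_def)
   have x: "exp (cor n*(hm (cor s) - kp0))*exp (cor n*(cor (Lm t) * cor s)) = exp (- (cor n * kp0))*exp (cor n*(hm (cor s) + cor (Lm t) * cor s))"
    by (simp add: exp_add[symmetric] algebra_simps)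
   have gen: "X*A*e' / q*Y = (K' / q)*(H*A)*e'" if "X*Y = K'*H" for X Y A e' q K' H :: complex
   proof -
    have "X*A*e' / q*Y = (X*Y)*A*e' / q" by (simp add: mult_ac)
    thus ?thesis unfolding that by (simp add: mult_ac)
   qed
   have Tk: "T k = w*L.integrand n t (cor s)*exp e"
    unfolding T_def Tk_def e(2) yk i w_def by (rule gen[OF x])
   have "C2/n <= 1" using n N(3) n1 by (simp add: divide_le_eq)
   hence ne1: "norm e <= 1" using e(1) by simp
   have ee: "norm (exp e - 1) <= 3*(C2/n)" using exp_minus_one_le[OF ne1] e(1) by linarith
   have "norm (exp e - 1) <= 3" using exp_minus_one_le[OF ne1] ne1 by linarith
   hence e4: "norm (exp e) <= 4" using norm_triangle_ineq[of "exp e - 1" 1] by simp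
   have "T k - w*L.integrand n t (cor s) = w*L.integrand n t (cor s)*(exp e - 1)"
    unfolding Tk by (simp only: right_diff_distrib mult_1_right)
   hence "norm (T k - w*L.integrand n t (cor s)) = (norm w*norm (L.integrand n t (cor s)))*norm (exp e - 1)"
    by (simp only: norm_mult)
   also have "... <= (norm w*norm (L.integrand n t (cor s)))*(3*(C2/n))" by (intro mult_left_mono ee) auto
   finally have r1: "norm (T k - w*L.integrand n t (cor s)) <= 3*C2/n*(norm w*norm (L.integrand n t (cor s)))" by (simp add: mult_ac)
   have "norm (T k) = (norm w*norm (L.integrand n t (cor s)))*norm (exp e)" unfolding Tk by (simp only: norm_mult)
   also have "... <= (norm w*norm (L.integrand n t (cor s)))*4" by (intro mult_left_mono e4) auto
   finally show ?thesis using r1 by (simp add: s_def mult.commute)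
  qed
  have wI: "norm w*norm (L.integrand n t (cor (real k/n))) <= K/sqrt n*E*exp (- (1/4*n*(real k/n - t)^2))" if k: "k : {kl..kr}" for k
  proof -
   have "norm w*norm (L.integrand n t (cor (real k/n))) <= norm w*(K*exp (- (n*(1/2)*(real k/n - t)^2/2))*exp (n * Re (L.phase t t)))"
    by (intro mult_left_mono K(2) n1 t' rng k) auto
   also have "... = K*exp (- (1/4*n*(real k/n - t)^2))*(norm w*exp (n * Re (L.phase t t)))" by (simp add: mult_ac)
   also have "... = K*exp (- (1/4*n*(real k/n - t)^2))*(E/sqrt (pi*n))" by (simp only: wE)
   also have "... <= K*exp (- (1/4*n*(real k/n - t)^2))*(E/sqrt n)"
    using K(1) E0 sqn by (intro mult_left_mono divide_left_mono) auto
   finally show ?thesis by (simp add: mult_ac)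
  qed
  define I where "I = (\<Sum>k=kl..kr. L.integrand n t (cor (real k/n)))"
  have S1: "norm ((\<Sum>k=kl..kr. T k) - w*I) <= C3/n*E"
  proof -
   have "norm ((\<Sum>k=kl..kr. T k) - w*I) = norm (\<Sum>k=kl..kr. T k - w*L.integrand n t (cor (real k/n)))"
    unfolding I_def by (simp add: sum_subtractf sum_distrib_left)
   also have "... <= (\<Sum>k=kl..kr. norm (T k - w*L.integrand n t (cor (real k/n))))" by (rule norm_sum)
   also have "... <= (\<Sum>k=kl..kr. 3*C2/n*(K/sqrt n*E)*exp (- (1/4*n*(real k/n - t)^2)))"
   proof (rule sum_mono)
    fix k assume k: "k : {kl..kr}"
    have "norm (T k - w*L.integrand n t (cor (real k/n))) <= 3*C2/n*(norm w*norm (L.integrand n t (cor (real k/n))))"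
     using Tas[OF k] by (rule conjunct1)
    also have "... <= 3*C2/n*(K/sqrt n*E*exp (- (1/4*n*(real k/n - t)^2)))"
     using C2(1) n1 by (intro mult_left_mono wI[OF k]) auto
    finally show "norm (T k - w*L.integrand n t (cor (real k/n))) <= 3*C2/n*(K/sqrt n*E)*exp (- (1/4*n*(real k/n - t)^2))"
     by (simp only: mult.assoc)
   qed
   also have "... = 3*C2/n*(K/sqrt n*E)*(\<Sum>k=kl..kr. exp (- (1/4*n*(real k/n - t)^2)))"
    by (rule sum_distrib_left[symmetric])
   also have "... <= 3*C2/n*(K/sqrt n*E)*(exp (1/4/4) * sqrt (2 * pi/(1/4)) * sqrt n)"
    using C2(1) K(1) E0 n1 sqn by (intro mult_left_mono gaussian_sum_bound) auto
   also have "... = C3/n*E"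
   proof -
    have gen: "3*C2/n*(K/q*E)*(A*B*q) = 3*C2*K*(A*B)/n*E" if "q ~= 0" for q A B :: real using that by simp
    show ?thesis unfolding C3_def by (rule gen) (use sqn in simp)
   qed
   finally show ?thesis .
  qed
  have S2: "norm (w*I - exp (cor n * pk t) * mt t) <= C1/n*E"
  proof -
   let ?R = "cor n*(exp (cor n*L.phase t t)*(Am (cor t) * cor (sqrt (2 * pi/n))/csqrt (cor (Lm' t))))"
   have k1: "kl <= kr + 1" using klr by simp
   have "w * ?R = exp (cor n * pk t) * mt t"
   proof -
    have a: "cor n * cor (sqrt (2 * pi/n))/cor (sqrt (pi*n)) = cor (sqrt 2)"
    proof -
     have "n * sqrt (2 * pi/n)/sqrt (pi*n) = sqrt 2"
     proof -
      have "sqrt (2 * pi/n) = sqrt 2 * sqrt pi/sqrt n" by (simp add: real_sqrt_mult real_sqrt_divide)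
      moreover have "sqrt (pi*n) = sqrt pi * sqrt n" by (simp add: real_sqrt_mult)
      moreover have "n = sqrt n * sqrt n" using n1 by simp
      moreover have "(q*q)*(u * v/q)/(v * q) = u" if "q > 0" "v > 0" for q u v :: real using that by simp
      ultimately show ?thesis using sqn(3) by (metis pi_gt_zero real_sqrt_gt_zero)
     qed
     thus ?thesis by (metis of_real_divide of_real_mult)
    qed
    have b: "exp (- (cor n * kp0))*exp (cor n*L.phase t t) = exp (cor n * pk t)"
     unfolding phk exp_add[symmetric] by (simp add: algebra_simps)
    have gen: "(k/q)*(m*(h*(A * s/c))) = (k*h)*((m * s/q)*A/c)" for k q m h A s c :: complex by simp
    show ?thesis unfolding w_def gen a b mt_def ..
   qed
   hence "norm (w*I - exp (cor n * pk t) * mt t) = norm w*norm (I - ?R)"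
    by (metis norm_mult right_diff_distrib)
   also have "... <= norm w*(C1/sqrt n*exp (n * Re (L.phase t t)))"
    unfolding I_def by (intro mult_left_mono C1(2) n1 t' k1 bl) auto
   also have "... = C1/sqrt n*(norm w*exp (n * Re (L.phase t t)))" by (simp only: mult_ac)
   also have "... = C1/sqrt n*(E/sqrt (pi*n))" by (simp only: wE)
   also have "... <= C1/sqrt n*(E/sqrt n)" using C1(1) E0 sqn by (intro mult_left_mono divide_left_mono) auto
   also have "... = C1/n*E" using n1 by simp
   finally show ?thesis .
  qed
  have S3: "norm ((\<Sum>k=kl..kr. T k) - exp (cor n * pk t) * mt t) <= C4/n*E"
   using norm_triangle_mono[OF S1 S2] by (simp add: C4_def add_divide_distrib algebra_simps)
  define ta where "ta = (%k. norm (T k))"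
  have step: "ta (Suc k) = rho n1 n2 y k*ta k" if "k < d" for k
  proof -
   have "rho n1 n2 y k >= 0" unfolding rho_def using that y0 av
    by (intro mult_nonneg_nonneg add_nonneg_nonneg divide_nonneg_pos) (auto simp: d_def)
   thus ?thesis unfolding ta_def T_def using Tk_step[of k n1 n2 y] that by (simp add: norm_mult d_def)
  qed
  have ta0: "ta k >= 0" for k by (simp add: ta_def)
  have anti: "rho n1 n2 y l <= rho n1 n2 y k" if "k <= l" "l < d" for k l
   using rho_antimono[OF y0 that(1)] that(2) by (simp add: d_def)
  have endb: "ta k <= 4*K*E*exp (- (n*g))" if k: "k = kl | k = kr" for k
  proof -
   have kk: "k : {kl..kr}" using k klr by auto
   have "\<bar>real k/n - t\<bar> >= ep/2"
   proof -
    have A: "real kl/n <= ep + ep/2" "real kr/n >= 2 - ep - ep/2" using kl(2) kr(2) ne n1 by (auto simp: divide_le_eq le_divide_eq algebra_simps)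
    have t1: "2*ep <= t" "t <= 2-2*ep" using t by auto
    show ?thesis using k
    proof
     assume "k = kl"
     thus ?thesis using A(1) t1(1) abs_ge_minus_self[of "real k/n - t"] by (simp only:)
    next
     assume "k = kr"
     thus ?thesis using A(2) t1(2) abs_ge_self[of "real k/n - t"] by (simp only:)
    qed
   qed
   hence "(ep/2)^2 <= (real k/n - t)^2" using ep abs_le_square_iff[of "ep/2" "real k/n - t"] by simp
   hence "n*(1/4)*(ep/2)^2 <= n*(1/4)*(real k/n - t)^2" using n1 by (intro mult_left_mono) auto
   hence x: "exp (- (1/4*n*(real k/n - t)^2)) <= exp (- (n*g))" by (simp add: g_def power_divide)
   have "ta k <= 4*(norm w*norm (L.integrand n t (cor (real k/n))))" using Tas[OF kk] unfolding ta_def by (rule conjunct2)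
   also have "... <= 4*(K/sqrt n*E*exp (- (1/4*n*(real k/n - t)^2)))" by (intro mult_left_mono wI[OF kk]) auto
   also have "... <= 4*(K/1*E*exp (- (n*g)))"
    using K(1) E0 n1 x by (intro mult_left_mono mult_mono divide_left_mono) auto
   finally show ?thesis by simp
  qed
  have expg: "exp (- (n*g)) <= j ^ j/(n*g)^j" if "j > 0" for j :: nat
  proof -
   have "(n*g)^j <= real j ^ j*exp (n*g)" using power_le_exp[of "n*g" j] n1 g that by simp
   thus ?thesis using n1 g by (simp add: exp_minus field_simps)
  qed
  \<comment> \<open>Otherwise the at most 3n terms would have a sum that is O(1/n) relative to the
    exponential E, against a main term of size at least c1 E.\<close>
  have big: "EX k:{kl..kr}. ta k > 4*K*E*exp (- (n*g))"
  proof (rule ccontr)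
   assume "~ ?thesis"
   hence le: "ta k <= 4*K*E*exp (- (n*g))" if "k : {kl..kr}" for k using that by (meson not_less)
   have "norm (\<Sum>k=kl..kr. T k) <= (\<Sum>k=kl..kr. 4*K*E*exp (- (n*g)))"
    by (rule order_trans[OF norm_sum sum_mono]) (use le in \<open>simp add: ta_def\<close>)
   also have "... = real (card {kl..kr})*(4*K*E*exp (- (n*g)))" by simp
   also have "... <= (3*n)*(4*K*E*(4/(n*g)^2))"
   proof (intro mult_mono mult_left_mono)
    have "card {kl..kr} <= d + 1" using krd by simp
    thus "real (card {kl..kr}) <= 3*n" using dn n1 by linarith
    show "exp (- (n*g)) <= 4/(n*g)^2" using expg[of 2] by simp
   qed (use K(1) E0 n1 in auto)
   also have "... = 12*K*(4/g^2)/n*E*1" using n1 g by (simp add: field_simps power2_eq_square)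
   finally have up: "norm (\<Sum>k=kl..kr. T k) <= 12*K*(4/g^2)/n*E" by simp
   have "c1*E <= norm (exp (cor n * pk t) * mt t)"
    using mult_left_mono[OF c1(2)[OF t'(1)], of E] E0 by (simp add: norm_mult E_def mult.commute)
   also have "... <= norm (\<Sum>k=kl..kr. T k) + norm ((\<Sum>k=kl..kr. T k) - exp (cor n * pk t) * mt t)"
    by (metis norm_minus_commute norm_triangle_sub)
   also have "... <= 12*K*(4/g^2)/n*E + C4/n*E" by (intro add_mono up S3)
   finally have "c1*E <= (12*K*(4/g^2)/n + C4/n)*E" by (simp only: distrib_right)
   hence c: "c1 <= 12*K*(4/g^2)/n + C4/n" using E0 by (simp only: mult_le_cancel_right_pos)
   have h: "A/n < c1/m" if "n >= m*A/c1 + 1" "m > 0" "A >= 0" for A m :: real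
   proof -
    have "m*A/c1 < n" using that by linarith
    hence "m*A < n * c1" using c1(1) by (simp add: divide_less_eq)
    thus ?thesis using n1 that by (simp add: field_simps)
   qed
   have "C4/n < c1/2" using h[of 2 C4] n N(5) C30 by simp
   moreover have "12*K*(4/g^2)/n < c1/2" using h[of 2 "12*K*(4/g^2)"] n N(6) K(1) g by simp
   ultimately show False using c by linarith
  qed
  then obtain k2 where k2: "k2 : {kl..kr}" "ta k2 > 4*K*E*exp (- (n*g))" by blast
  have lt: "ta kl < ta k2" "ta kr < ta k2" using endb[of kl] endb[of kr] k2(2) by auto
  have kk2: "kl < k2" "k2 < kr" using k2(1) lt by (auto simp: order_less_le)
  have left: "ta k <= 4*K*E*exp (- (n*g))" if k: "k < kl" for k
   using unimodal_left[of d ta "rho n1 n2 y" kl k2 k] step ta0 anti kk2 krd lt(1) k endb[of kl] by fastforce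
  have right: "ta k <= 4*K*E*exp (- (n*g))" if k: "kr < k" "k <= d" for k
   using unimodal_right[of d ta "rho n1 n2 y" k2 kr k] step ta0 anti kk2 krd lt(2) k endb[of kr] by fastforce
  have S4: "norm ((\<Sum>k\<le>d. T k) - (\<Sum>k=kl..kr. T k)) <= C5/n*E"
  proof -
   have "{..d} = {kl..kr} \<union> ({..<kl} \<union> {kr<..d})" using klr krd by auto
   hence "(\<Sum>k\<le>d. T k) = (\<Sum>k=kl..kr. T k) + (\<Sum>k\<in>{..<kl} \<union> {kr<..d}. T k)"
    by (simp only:) (rule sum.union_disjoint, auto)
   hence "norm ((\<Sum>k\<le>d. T k) - (\<Sum>k=kl..kr. T k)) = norm (\<Sum>k\<in>{..<kl} \<union> {kr<..d}. T k)" by simp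
   also have "... <= (\<Sum>k\<in>{..<kl} \<union> {kr<..d}. 4*K*E*exp (- (n*g)))"
    by (rule order_trans[OF norm_sum sum_mono]) (use left right in \<open>auto simp: ta_def\<close>)
   also have "... = real (card ({..<kl} \<union> {kr<..d}))*(4*K*E*exp (- (n*g)))" by simp
   also have "... <= (3*n)*(4*K*E*(27/(n*g)^3))"
   proof (intro mult_mono mult_left_mono)
    have "card ({..<kl} \<union> {kr<..d}) <= card {..d}" by (rule card_mono) (use klr krd in auto)
    thus "real (card ({..<kl} \<union> {kr<..d})) <= 3*n" using dn n1 by simp
    show "exp (- (n*g)) <= 27/(n*g)^3" using expg[of 3] by simp
   qed (use K(1) E0 n1 in auto)
   also have "... = C5/n^2*E" using n1 g by (simp add: C5_def field_simps power2_eq_square power3_eq_cube)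
   also have "... <= C5/n*E"
    using C30 E0 n1 by (intro mult_right_mono divide_left_mono) (auto simp: power2_eq_square)
   finally show ?thesis .
  qed
  have "norm ((\<Sum>k\<le>d. T k) - exp (cor n * pk t) * mt t) <= C5/n*E + C4/n*E"
   using norm_triangle_mono[OF S4 S3] by simp
  also have "... = (C4 + C5)/n*E" by (simp add: add_divide_distrib algebra_simps)
  finally have fin: "norm ((\<Sum>k\<le>d. T k) - exp (cor n * pk t) * mt t) <= (C4 + C5)/n*E" .
  have "cor (poly P (- exp (Lm t))) = (-1)^(n1+n2)*(\<Sum>k\<le>d. T k)"
   using poly_negative_sum[OF P, of y] by (simp only: y_def T_def d_def)
  hence "cor (poly P (- exp (Lm t))) - (-1)^(n1+n2)*exp (cor n * pk t)*(cor (sqrt 2)*Am (cor t)/csqrt (cor (Lm' t)))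
    = (-1)^(n1+n2)*((\<Sum>k\<le>d. T k) - exp (cor n * pk t) * mt t)"
   unfolding mt_def by (simp only: right_diff_distrib mult.assoc)
  thus ?thesis using fin by (simp only: norm_mult norm_power norm_minus_cancel norm_one power_one mult_1_left E_def)
 qed
 have "C4 + C5 >= 0" "N > 0" using C30 N(1) by auto
 thus ?thesis by (rule that[OF _ _ main])
qed

end

section \<open>Positive x: the curve formed by the saddle points\<close>

lemma Im_Ln_add_le:
 assumes "Im t > 0" "c >= 0"
 shows "Im (Ln (t + cor c)) <= Im (Ln t)"
proof -
 have t: "t : upper_slit" using assms by (auto simp: upper_slit_def complex_nonpos_Reals_iff)
 have tc: "t + cor c : upper_slit" by (rule upper_slit_add[OF t assms(2)])
 have t0: "t ~= 0" "t + cor c ~= 0" using upper_slit_nonzero t tc by auto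
 have "(t + cor c)/t = 1 + cor c/t" using t0 by (simp add: add_divide_distrib)
 hence im: "Im ((t + cor c)/t) = - (c*Im t/norm t^2)" by (simp add: Im_divide cmod_power2)
 have "Im (Ln ((t + cor c)/t)) <= 0"
 proof (cases "c = 0")
  case True thus ?thesis using t0 by simp
 next
  case False
  hence "c*Im t/norm t^2 > 0" using assms t0 by simp
  hence "Im ((t + cor c)/t) < 0" using im by linarith
  hence "~ (0 <= Im (Ln ((t + cor c)/t)))"
   using Im_Ln_pos_le[of "(t + cor c)/t"] Im_Ln_le_pi[of "(t + cor c)/t"] t0 by simp
  thus ?thesis by simp
 qed
 thus ?thesis unfolding Ln_divide_upper_slit[OF t tc] by simp
qed

context jpt
begin

text \<open>The curve \<open>Tc\<close> consists of the saddle points of \<open>h0 t + t*ln (X r)\<close>, one for each \<open>r\<close>. The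
 same curve therefore serves as integration path for all \<open>x\<close>, and along it the real part of the
 exponent belonging to \<open>r0\<close> has derivative \<open>LL r0 - LL r\<close>.\<close>

definition Sc :: "complex set" where "Sc = {z. 0 < Re z} \<inter> {z. Re z < pp/qq}"
definition quot :: "complex => complex" where "quot z = (3 * cor pp + cor qq*z)/(cor pp - cor qq*z)"
definition Tc :: "complex => complex" where "Tc z = z*(1 + \<i> * csqrt (quot z))"
definition S1 :: "complex set" where "S1 = Sc \<inter> Tc -` {w. Im w > 0}"
definition LL :: "real => real" where "LL r = ln 4 + 3*ln r - ln (pp - qq*r + 4*r^3)"
definition LL' :: "real => real" where "LL' r = 3/r - (12*r^2 - qq)/(pp - qq*r + 4*r^3)"

lemma open_Sc: "open Sc"
 unfolding Sc_def by (intro open_Int open_halfspace_Re_gt open_halfspace_Re_lt)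

lemma Sc_parts:
 assumes "z : Sc" shows "Re (cor pp - cor qq*z) > 0" "Re (3 * cor pp + cor qq*z) > 0"
proof -
 have "qq * Re z < pp" using assms qq by (simp add: Sc_def less_divide_eq mult.commute)
 thus "Re (cor pp - cor qq*z) > 0" by simp
 have "qq * Re z > 0" using assms qq by (simp add: Sc_def)
 thus "Re (3 * cor pp + cor qq*z) > 0" using pp by simp
qed

lemma quot_off_cut:
 assumes "z : Sc" shows "quot z ~: \<real>\<^sub>\<le>\<^sub>0"
proof
 assume "quot z : \<real>\<^sub>\<le>\<^sub>0"
 then obtain ro where ro: "quot z = cor ro" "ro <= 0" by (auto elim: nonpos_Reals_cases)
 have d: "cor pp - cor qq*z ~= 0" using Sc_parts(1)[OF assms] by (metis less_irrefl zero_complex.sel(1))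
 have "3 * cor pp + cor qq*z = cor ro*(cor pp - cor qq*z)"
  using ro(1) d by (simp add: quot_def divide_eq_eq)
 hence "Re (3 * cor pp + cor qq*z) = ro * Re (cor pp - cor qq*z)" by (metis Re_complex_of_real Im_complex_of_real mult_zero_left diff_zero times_complex.sel(1))
 moreover have "ro * Re (cor pp - cor qq*z) <= 0" using ro(2) Sc_parts(1)[OF assms] by (intro mult_nonpos_nonneg) auto
 ultimately show False using Sc_parts(2)[OF assms] by linarith
qed

lemma Tc_holomorphic: "Tc holomorphic_on Sc"
proof -
 have q: "quot holomorphic_on Sc" unfolding quot_def
  by (intro holomorphic_intros) (use Sc_parts(1) in \<open>metis less_irrefl zero_complex.sel(1)\<close>)
 show ?thesis unfolding Tc_def by (intro holomorphic_intros q quot_off_cut)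
qed

lemma open_S1: "open S1"
 unfolding S1_def
 by (rule continuous_open_preimage[OF holomorphic_on_imp_continuous_on[OF Tc_holomorphic] open_Sc open_halfspace_Im_gt])

lemma Tc_real:
 assumes r: "0 < r" "r < pp/qq"
 shows "Tc (cor r) = Complex r (Y r)" "Y r > 0" "cor r : S1" "valid r"
proof -
 have v: "valid r"
 proof -
  have "- (3 * pp/qq) <= 0" using pp qq by simp
  thus ?thesis using r unfolding valid_def by simp
 qed
 thus "valid r" .
 note V = validD[OF v]
 have q0: "(3 * pp + qq*r)/(pp - qq*r) > 0" using V(1) r pp qq by (intro divide_pos_pos add_pos_pos) auto
 have "quot (cor r) = cor ((3 * pp + qq*r)/(pp - qq*r))" by (simp add: quot_def)
 moreover have "csqrt (cor ((3 * pp + qq*r)/(pp - qq*r))) = cor (sqrt ((3 * pp + qq*r)/(pp - qq*r)))"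
  using q0 of_real_sqrt[of "(3 * pp + qq*r)/(pp - qq*r)"] by simp
 ultimately have "Tc (cor r) = cor r*(1 + \<i> * cor (sqrt ((3 * pp + qq*r)/(pp - qq*r))))"
  unfolding Tc_def by (simp only:)
 thus T: "Tc (cor r) = Complex r (Y r)" using r by (simp add: complex_eq_iff Y_def)
 show Y: "Y r > 0" using r q0 by (simp add: Y_def)
 show "cor r : S1" using r T Y by (simp add: S1_def Sc_def)
qed

lemma upper_off_cut:
 assumes "Im t > 0"
 shows "t ~: \<real>\<^sub>\<le>\<^sub>0" "t + cor a ~: \<real>\<^sub>\<le>\<^sub>0" "t + cor tt ~: \<real>\<^sub>\<le>\<^sub>0" "t - 2 ~: \<real>\<^sub>\<le>\<^sub>0"
 using assms by (auto simp: complex_nonpos_Reals_iff)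

definition hs :: "complex => complex" where
 "hs t = Ln (t + cor a) + Ln (t + cor tt) + Ln (t - 2) - 3*Ln t"

lemma DERIV_h0:
 assumes t: "Im t > 0"
 shows "(h0 has_field_derivative hs t) (at t)"
proof -
 note o = upper_off_cut[OF t]
 have "((%t. lf (t + cor a) + lf (t + cor tt) - 2*lf t + lf (t - 2) - lf t) has_field_derivative
   (Ln (t + cor a)*1 + Ln (t + cor tt)*1 - 2*Ln t + Ln (t - 2)*1 - Ln t)) (at t)"
  by (intro DERIV_diff DERIV_add DERIV_cmult DERIV_lf_chain o DERIV_lf) (auto intro!: derivative_eq_intros)
 moreover have "(%t. lf (t + cor a) + lf (t + cor tt) - 2*lf t + lf (t - 2) - lf t) = h0"
  by (simp add: h0_def hN_def fun_eq_iff)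
 ultimately show ?thesis by (simp only:) (rule DERIV_cong, assumption, simp add: hs_def)
qed

lemma exp_hs:
 assumes "Im t > 0"
 shows "exp (hs t) = (t + cor a)*(t + cor tt)*(t - 2)/t^3"
proof -
 have nz: "t ~= 0" "t + cor a ~= 0" "t + cor tt ~= 0" "t - 2 ~= 0" using upper_off_cut[OF assms] by auto
 have "exp (3*Ln t) = t^3" using nz by (metis exp_Ln exp_of_nat_mult of_nat_numeral)
 thus ?thesis using nz by (simp add: hs_def exp_diff exp_add)
qed

text \<open>By the root equation exp (hs t) = zeta (1/t) = 1/X r, so hs is - ln (X r) up to a
  multiple of 2 pi i. The arguments satisfy 0 <= arg (t + a), arg (t + tt) <= arg t <= arg (t - 2) <
  pi and arg t < pi/2; together they put Im (hs t) into (-pi, pi), so the multiple is 0.\<close>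

lemma hs_on_curve:
 assumes r: "0 < r" "r < pp/qq"
 shows "hs (Tc (cor r)) = - cor (ln (X r))" "X r > 0"
proof -
 define t where "t = Complex r (Y r)"
 note T = Tc_real[OF r]
 have t: "Im t > 0" "Re t > 0" using T r by (auto simp: t_def)
 have t0: "t ~= 0" using t by auto
 have d: "pp - qq*r + 4*r^3 > 0" by (rule Xden_pos) (use T(4) in \<open>auto simp: valid_def\<close>)
 show X: "X r > 0" unfolding X_def using d r by simp
 have "zeta (1/t) = 1/cor (X r)" using zeta_roots[OF T(4), of "1/t"] by (simp add: t_def)
 moreover have "zeta (1/t) = (t + cor a)*(t + cor tt)*(t - 2)/t^3"
  unfolding zeta_factor3 using t0 by (simp add: field_simps power3_eq_cube)
 ultimately have e: "exp (hs t) = cor (1/X r)" unfolding exp_hs[OF t(1)] by simp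
 have a0: "a >= 0" "tt >= 0" using tt by auto
 have im: "Im (hs t) = Im (Ln (t + cor a)) + Im (Ln (t + cor tt)) + Im (Ln (t - 2)) - 3*Im (Ln t)" by (simp add: hs_def)
 have up: "w : upper_slit" if "Im w > 0" for w using that by (auto simp: upper_slit_def complex_nonpos_Reals_iff)
 have b1: "0 <= Im (Ln (t + cor a))" "0 <= Im (Ln (t + cor tt))" "Im (Ln (t - 2)) < pi"
  by (rule Im_Ln_upper_slit; rule up; use t in simp)+
 have b2: "Im (Ln (t + cor a)) <= Im (Ln t)" "Im (Ln (t + cor tt)) <= Im (Ln t)"
  using Im_Ln_add_le[OF t(1), of a] Im_Ln_add_le[OF t(1), of tt] a0 by blast+
 have b3: "Im (Ln t) <= Im (Ln (t - 2))" using Im_Ln_add_le[of "t - 2" 2] t by simp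
 have b4: "\<bar>Im (Ln t)\<bar> < pi/2" using Re_Ln_pos_lt[OF t0] t(2) by simp
 have b5: "0 < Im (Ln t)" using Im_Ln_pos_lt[OF t0] t(1) by simp
 have "- pi < Im (hs t)" "Im (hs t) < pi" unfolding im using b1 b2 b3 b4 b5 by linarith+
 hence "hs t = Ln (exp (hs t))" by (intro Ln_exp[symmetric]) auto
 also have "... = cor (ln (1/X r))" unfolding e using X by (intro Ln_of_real) simp
 also have "ln (1/X r) = - ln (X r)" using X by (simp add: ln_div)
 finally show "hs (Tc (cor r)) = - cor (ln (X r))" unfolding T(1) t_def by simp
qed

lemma LL_eq:
 assumes r: "0 < r" "r < pp/qq" shows "LL r = ln (X r)"
proof -
 have d: "pp - qq*r + 4*r^3 > 0" by (rule Xden_pos) (use Tc_real(4)[OF r] in \<open>auto simp: valid_def\<close>)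
 have "ln (X r) = ln (4*r^3) - ln (pp - qq*r + 4*r^3)" unfolding X_def using d r by (simp add: ln_div)
 also have "ln (4*r^3) = ln 4 + 3*ln r" using r by (simp add: ln_mult ln_realpow)
 finally show ?thesis by (simp add: LL_def)
qed

lemma LL'_pos:
 assumes r: "0 < r" "r < pp/qq" shows "LL' r > 0"
proof -
 note v = validD[OF Tc_real(4)[OF r]]
 have d: "pp - qq*r + 4*r^3 > 0" by (rule Xden_pos) (use Tc_real(4)[OF r] in \<open>auto simp: valid_def\<close>)
 have "LL' r = (3 * pp - 2*qq*r)/(r*(pp - qq*r + 4*r^3))"
 proof -
  have gen: "3/r - A/D = (3*D - A*r)/(r*D)" if "D ~= 0" for A D :: real using r that by (simp add: field_simps)
  show ?thesis unfolding LL'_def gen[OF less_imp_neq[OF d, symmetric]] by (simp add: algebra_simps power2_eq_square power3_eq_cube)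
 qed
 thus ?thesis using v(8) d r by simp
qed

lemma LL_deriv:
 assumes r: "0 < r" "r < pp/qq" shows "(LL has_real_derivative LL' r) (at r within A)"
proof -
 have d: "pp - qq*r + 4*r^3 > 0" by (rule Xden_pos) (use Tc_real(4)[OF r] in \<open>auto simp: valid_def\<close>)
 show ?thesis unfolding LL_def[abs_def] LL'_def
  by (rule derivative_eq_intros refl | use d r in simp)+
qed

lemma LL'_cont:
 assumes "0 < rl" "rh < pp/qq" shows "continuous_on {rl..rh} LL'"
proof -
 have "pp - qq*r + 4*r^3 ~= 0" if "r : {rl..rh}" for r
 proof -
  have r: "0 < r" "r < pp/qq" using that assms by auto
  have "pp - qq*r + 4*r^3 > 0" by (rule Xden_pos) (use Tc_real(4)[OF r] in \<open>auto simp: valid_def\<close>)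
  thus ?thesis by simp
 qed
 thus ?thesis unfolding LL'_def by (intro continuous_intros) (use assms in auto)
qed

lemma LL'_bound:
 assumes r: "0 < rl" "rl <= rh" "rh < pp/qq"
 obtains m where "m > 0" "!!r. r : {rl..rh} ==> LL' r >= m"
proof -
 have ne: "{rl..rh} ~= {}" using r by simp
 obtain r0 where r0: "r0 : {rl..rh}" "ALL t:{rl..rh}. LL' r0 <= LL' t"
  using continuous_attains_inf[OF compact_Icc ne LL'_cont[OF r(1,3)]] by blast
 show ?thesis
 proof (rule that)
  show "LL' r0 > 0" by (rule LL'_pos) (use r0 r in auto)
  show "LL' t >= LL' r0" if "t : {rl..rh}" for t using r0(2) that by blast
 qed
qed

lemma h0_holomorphic: "h0 holomorphic_on {w. Im w > 0}"
 unfolding holomorphic_on_def using DERIV_h0 field_differentiable_at_within field_differentiable_def by blast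

lemma A0_holomorphic: "A0 holomorphic_on {w. Im w > 0}"
 unfolding A0_def eN_def by (intro holomorphic_intros) (use upper_off_cut in auto)

definition Bc :: "complex => complex" where "Bc z = A0 (Tc z)*deriv Tc z"

lemma Tc_S1: "Tc holomorphic_on S1" "Tc ` S1 \<subseteq> {w. Im w > 0}"
 using Tc_holomorphic holomorphic_on_subset[of Tc Sc S1] by (auto simp: S1_def)

lemma laplace_positive:
 assumes r: "0 < rl" "rl < rh" "rh < pp/qq" and m: "m > 0" "!!r. r : {rl..rh} ==> LL' r >= m"
 shows "laplace_curve S1 (%z. h0 (Tc z)) Tc Bc LL LL' rl rh m"
proof unfold_locales
 show "open S1" by (rule open_S1)
 show "(%z. h0 (Tc z)) holomorphic_on S1"
  using holomorphic_on_compose_gen[OF Tc_S1(1) h0_holomorphic Tc_S1(2)] by (simp add: o_def)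
 show T: "Tc holomorphic_on S1" by (rule Tc_S1)
 have "(%z. A0 (Tc z)) holomorphic_on S1"
  using holomorphic_on_compose_gen[OF Tc_S1(1) A0_holomorphic Tc_S1(2)] by (simp add: o_def)
 thus "Bc holomorphic_on S1" unfolding Bc_def by (intro holomorphic_intros holomorphic_deriv T open_S1)
 show "rl < rh" by (rule r(2))
 have rr: "0 < x" "x < pp/qq" if "x : {rl..rh}" for x using that r by auto
 show sub: "cor x : S1" if "x : {rl..rh}" for x by (rule Tc_real(3)[OF rr[OF that]])
 show "(LL has_real_derivative LL' x) (at x within {rl..rh})" if "x : {rl..rh}" for x by (rule LL_deriv[OF rr[OF that]])
 show "continuous_on {rl..rh} LL'" by (rule LL'_cont[OF r(1,3)])
 show "m > 0" by (rule m)
 show "LL' x >= m" if "x : {rl..rh}" for x by (rule m(2)[OF that])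
 show "deriv (%z. h0 (Tc z)) (cor x) = - cor (LL x)*deriv Tc (cor x)" if x: "x : {rl..rh}" for x
 proof -
  have i: "Im (Tc (cor x)) > 0" using sub[OF x] by (simp add: S1_def)
  have "((%z. h0 (Tc z)) has_field_derivative hs (Tc (cor x))*deriv Tc (cor x)) (at (cor x))"
   by (rule DERIV_chain2[OF DERIV_h0[OF i] holomorphic_derivI[OF T open_S1 sub[OF x]]])
  thus ?thesis using hs_on_curve(1)[OF rr[OF x]] LL_eq[OF rr[OF x]] by (simp add: DERIV_imp_deriv)
 qed
 \<comment> \<open>The curve is parametrised by its real part: Re (Tc r) = r for real r.\<close>
 show "Re (deriv Tc (cor x)) = 1" if x: "x : {rl..rh}" for x
 proof -
  have "((%r. Tc (cor r)) has_vector_derivative deriv Tc (cor x)) (at x)"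
   by (rule has_vector_derivative_real_field[OF holomorphic_derivI[OF T open_S1 sub[OF x]]])
  hence "((%r. Re (Tc (cor r))) has_vector_derivative Re (deriv Tc (cor x))) (at x)"
   by (rule bounded_linear.has_vector_derivative[OF bounded_linear_Re])
  hence "((%r. r) has_vector_derivative Re (deriv Tc (cor x))) (at x)"
  proof (rule has_vector_derivative_transform_within_open[of _ _ _ "{0<..<pp/qq}"])
   show "x : {0<..<pp/qq}" using rr[OF x] by simp
   show "Re (Tc (cor y)) = y" if "y : {0<..<pp/qq}" for y using Tc_real(1)[of y] that by simp
  qed simp
  thus ?thesis using vector_derivative_unique_at has_vector_derivative_id[of "at x"] by (metis id_apply eq_id_iff)
 qed
qed

definition ph :: "real => real => complex" where
 "ph r0 r = h0 (Tc (cor r)) + cor (LL r0)*Tc (cor r)"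

lemma ph_Re_deriv:
 assumes r: "0 < r" "r < pp/qq"
 shows "((%r. Re (ph r0 r)) has_real_derivative (LL r0 - LL r)) (at r)"
proof -
 \<comment> \<open>Any compact interval around r inside (0, pp/qq) serves to bring the derivative
   formula into force.\<close>
 define rl rh where "rl = r/2" and "rh = (r + pp/qq)/2"
 have gen: "0 < r/2 & r/2 <= (r + B)/2 & r/2 < (r + B)/2 & (r + B)/2 < B & r/2 < r & r < (r + B)/2"
  if "r < B" for B using that r(1) by auto
 have b: "0 < rl" "rl <= rh" "rl < rh" "rh < pp/qq" "rl < r" "r < rh" unfolding rl_def rh_def using gen[OF r(2)] by blast+
 obtain m where m: "m > 0" "!!r. r : {rl..rh} ==> LL' r >= m" by (rule LL'_bound[OF b(1,2,4)]) (rule that)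
 interpret C: laplace_curve S1 "%z. h0 (Tc z)" Tc Bc LL LL' rl rh m
  by (rule laplace_positive[OF b(1,3,4) m])
 have "((%r. Re (C.phase r0 r)) has_real_derivative (LL r0 - LL r)) (at r within {rl..rh})"
  by (rule C.Re_phase_deriv) (use b in auto)
 moreover have "(%r. Re (C.phase r0 r)) = (%r. Re (ph r0 r))" by (simp add: C.phase_def ph_def)
 ultimately show ?thesis using at_within_Icc_at[OF b(5,6)] by simp
qed

lemma LL_mono:
 assumes "0 < r" "r <= r'" "r' < pp/qq" shows "LL r <= LL r'"
proof (rule DERIV_nonneg_imp_nondecreasing[OF assms(2)])
 fix x assume "r <= x" "x <= r'"
 hence x: "0 < x" "x < pp/qq" using assms by auto
 show "EX y. (LL has_real_derivative y) (at x) & y >= 0" using LL_deriv[OF x] LL'_pos[OF x] less_imp_le by blast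
qed

lemma ph_mono_left:
 assumes "0 < r" "r <= r'" "r' <= r0" "r0 < pp/qq" shows "Re (ph r0 r) <= Re (ph r0 r')"
proof (rule DERIV_nonneg_imp_nondecreasing[OF assms(2)])
 fix x assume "r <= x" "x <= r'"
 hence x: "0 < x" "x < pp/qq" "x <= r0" using assms by auto
 show "EX y. ((%r. Re (ph r0 r)) has_real_derivative y) (at x) & y >= 0"
  using ph_Re_deriv[OF x(1,2), of r0] LL_mono[OF x(1,3) assms(4)] by (intro exI[of _ "LL r0 - LL x"]) simp
qed

lemma ph_mono_right:
 assumes "0 < r0" "r0 <= r'" "r' <= r" "r < pp/qq" shows "Re (ph r0 r) <= Re (ph r0 r')"
proof (rule DERIV_nonpos_imp_nonincreasing[OF assms(3)])
 fix x assume "r' <= x" "x <= r"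
 hence x: "0 < x" "x < pp/qq" "r0 <= x" using assms by auto
 show "EX y. ((%r. Re (ph r0 r)) has_real_derivative y) (at x) & y <= 0"
  using ph_Re_deriv[OF x(1,2), of r0] LL_mono[OF assms(1) x(3,2)] by (intro exI[of _ "LL r0 - LL x"]) simp
qed

text \<open>At the two points ra and rb quadratic decay on a compact interval gives the gap. Beyond
  them no lower bound for LL' is at hand, but the real part of the exponent is monotone on either
  side of r0, so the gap persists up to the ends 0 and pp/qq.\<close>

lemma ph_gap:
 assumes r: "0 < r1" "r1 <= r2" "r2 < pp/qq"
 obtains ga ra rb where "ga > 0" "0 < ra" "ra < r1" "r2 < rb" "rb < pp/qq"
  "!!r0 r. r0 : {r1..r2} ==> 0 < r ==> r <= ra ==> Re (ph r0 r) <= Re (ph r0 r0) - ga"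
  "!!r0 r. r0 : {r1..r2} ==> rb <= r ==> r < pp/qq ==> Re (ph r0 r) <= Re (ph r0 r0) - ga"
proof -
 define ra rb where "ra = r1/2" and "rb = (r2 + pp/qq)/2"
 have gen: "0 < r1/2 & r1/2 < r1 & r2 < (r2 + B)/2 & (r2 + B)/2 < B & r1/2 <= (r2 + B)/2 & r1/2 < (r2 + B)/2"
  if "r2 < B" for B using that r(1,2) by auto
 have b: "0 < ra" "ra < r1" "r2 < rb" "rb < pp/qq" "ra <= rb" "ra < rb" unfolding ra_def rb_def using gen[OF r(3)] by blast+
 obtain m where m: "m > 0" "!!r. r : {ra..rb} ==> LL' r >= m" by (rule LL'_bound[OF b(1,5,4)]) (rule that)
 interpret C: laplace_curve S1 "%z. h0 (Tc z)" Tc Bc LL LL' ra rb m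
  by (rule laplace_positive[OF b(1,6,4) m])
 have ph: "C.phase = ph" by (simp add: C.phase_def ph_def fun_eq_iff)
 define s where "s = min (r1 - ra) (rb - r2)"
 have s: "s > 0" "s <= r1 - ra" "s <= rb - r2" using b by (auto simp: s_def)
 define ga where "ga = m/2 * s^2"
 have g: "ga > 0" using m(1) s by (simp add: ga_def)
 have e: "Re (ph r0 x) <= Re (ph r0 r0) - ga" if "r0 : {r1..r2}" "x = ra | x = rb" for r0 x
 proof -
  have "s <= \<bar>x - r0\<bar>" using that s b by auto
  hence "s^2 <= (x - r0)^2" using s(1) abs_le_square_iff[of s "x - r0"] by simp
  hence "ga <= m/2*(x - r0)^2" unfolding ga_def using m(1) by (intro mult_left_mono) auto
  moreover have "Re (ph r0 x) <= Re (ph r0 r0) - m/2*(x - r0)^2"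
   unfolding ph[symmetric] by (rule C.Re_phase_le) (use that b in auto)
  ultimately show ?thesis by linarith
 qed
 show ?thesis
 proof (rule that[OF g b(1-4)])
  fix r0 r assume h: "r0 : {r1..r2}" "0 < r" "r <= ra"
  have "Re (ph r0 r) <= Re (ph r0 ra)" by (rule ph_mono_left) (use h b assms in auto)
  thus "Re (ph r0 r) <= Re (ph r0 r0) - ga" using e[OF h(1), of ra] by simp
 next
  fix r0 r assume h: "r0 : {r1..r2}" "rb <= r" "r < pp/qq"
  have "Re (ph r0 r) <= Re (ph r0 rb)" by (rule ph_mono_right) (use h b assms in auto)
  thus "Re (ph r0 r) <= Re (ph r0 r0) - ga" using e[OF h(1), of rb] by simp
 qed
qed

end

section \<open>The contour integral that represents P(x)\<close>

definition contour_fun :: "real => real => nat => nat => real => complex => complex" where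
 "contour_fun av1 av2 n1 n2 ell w =
  cnst av1 av2 n1 n2*Npr av1 av2 n1 n2 w/(\<Prod>k\<le>n1+n2. w - of_nat k)*exp (w * cor ell)"

context mop
begin

abbreviation "cf \<equiv> contour_fun av1 av2 n1 n2"

lemma cf_eq:
 assumes "w ~: of_nat ` {..d}"
 shows "cf ell w = (\<Sum>k\<le>d. cor (coeff P k)*(exp (w * cor ell)/(w - of_nat k)))"
 unfolding contour_fun_def partial_fraction[OF assms, symmetric] sum_distrib_right by (simp add: mult_ac)

lemma cf_holomorphic: "cf ell holomorphic_on - (of_nat ` {..d})"
proof -
 have "(%w. \<Sum>k\<le>d. cor (coeff P k)*(exp (w * cor ell)/(w - of_nat k))) holomorphic_on - (of_nat ` {..d})"
  by (intro holomorphic_intros) auto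
 thus ?thesis by (rule holomorphic_transform) (use cf_eq in auto)
qed

lemma cf_cnj: assumes "w ~: of_nat ` {..d}" shows "cnj (cf ell (cnj w)) = cf ell w"
proof -
 have "cnj w ~: of_nat ` {..d}"
 proof
  assume "cnj w : of_nat ` {..d}"
  then obtain k where "k <= d" "cnj w = of_nat k" by auto
  hence "w = of_nat k" by (metis complex_cnj_cnj complex_cnj_of_nat)
  thus False using assms \<open>k <= d\<close> by auto
 qed
 thus ?thesis using assms by (simp add: cf_eq exp_cnj)
qed

lemma not_node: "Im w ~= 0 | Re w < 0 | Re w > d ==> w ~: of_nat ` {..d}"
 by auto

lemma cf_decay:
 assumes "ell < 0" "ep > 0"
 shows "EX L0. ALL L>=L0::real. L > real d & (ALL w. Re w = L --> norm (cf ell w) <= ep)"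
proof -
 define S where "S = (\<Sum>k\<le>d. \<bar>coeff P k\<bar>)"
 have "((%L. S*exp (L*ell)) \<longlongrightarrow> 0) at_top" using assms(1) by real_asymp
 hence "eventually (%L. S*exp (L*ell) < ep) at_top" using assms(2) by (rule order_tendstoD)
 moreover have "eventually (%L. L >= real d + 1) at_top" by (rule eventually_ge_at_top)
 ultimately have "eventually (%L. L > real d & (ALL w. Re w = L --> norm (cf ell w) <= ep)) at_top"
 proof eventually_elim
  case (elim L)
  have "norm (cf ell w) <= ep" if w: "Re w = L" for w
  proof -
   have "norm (cf ell w) <= (\<Sum>k\<le>d. \<bar>coeff P k\<bar> * exp (L*ell))"
   proof (subst cf_eq[OF not_node], use w elim in simp, rule sum_norm_le)
    fix k assume k: "k : {..d}"
    have "1 <= Re (w - of_nat k)" using w elim k by simp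
    also have "... <= norm (w - of_nat k)" by (rule complex_Re_le_cmod)
    finally have h: "exp (L*ell)/norm (w - of_nat k) <= exp (L*ell)" by (simp add: divide_le_eq)
    thus "norm (cor (coeff P k)*(exp (w * cor ell)/(w - of_nat k))) <= \<bar>coeff P k\<bar> * exp (L*ell)"
     using w mult_left_mono[OF h abs_ge_zero[of "coeff P k"]] by (simp add: norm_mult norm_divide)
   qed
   also have "... = S*exp (L*ell)" by (simp add: S_def sum_distrib_right)
   finally show ?thesis using elim by simp
  qed
  thus ?case using elim by simp
 qed
 thus ?thesis by (simp add: eventually_at_top_linorder)
qed

lemma cf_integral_bound:
 assumes "!!w. w : closed_segment u v ==> norm (cf ell w) <= B" "B >= 0" "(cf ell has_contour_integral i) (linepath u v)"
 shows "norm i <= B*norm (v - u)"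
 by (rule has_contour_integral_bound_linepath[OF assms(3,2,1)])

text \<open>A rectangle around the poles 0, ..., d. The top side is expressed by a primitive Q in
  the upper half plane, so that it can later be replaced by any path there. The bottom side follows
  by conjugation, as the coefficients of P are real. The vertical sides are only estimated.\<close>

lemma contour_identity:
 assumes kp: "kp > 0" and hh: "hh > 0" and L: "L > real d" and B: "BL >= 0" "BR >= 0"
  and Q: "!!w. Im w > 0 ==> (Q has_field_derivative cf ell w) (at w)"
  and left: "!!w. Re w = - kp ==> \<bar>Im w\<bar> <= hh ==> norm (cf ell w) <= BL"
  and right: "!!w. Re w = L ==> norm (cf ell w) <= BR"
 shows "norm (2 * pi * \<i> * cor (poly P (exp ell)) - (cnj (Q (Complex L hh) - Q (Complex (-kp) hh)) - (Q (Complex L hh) - Q (Complex (-kp) hh))))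
  <= 2*hh*(BL + BR)"
proof -
 define a1 a2 a3 a4 where "a1 = Complex (-kp) (-hh)" and "a2 = Complex L (-hh)" and "a3 = Complex L hh" and "a4 = Complex (-kp) hh"
 have L0: "L > 0" using L by (meson le_less_trans of_nat_0_le_iff)
 have sub: "closed_segment a2 a3 \<subseteq> {w. Re w = L}" "closed_segment a4 a1 \<subseteq> {w. Re w = -kp & \<bar>Im w\<bar> <= hh}"
  "closed_segment a1 a2 \<subseteq> {w. Im w < 0}" "closed_segment a3 a4 \<subseteq> {w. Im w > 0}"
  using hh by (auto simp: a1_def a2_def a3_def a4_def closed_segment_same_Re closed_segment_same_Im closed_segment_eq_real_ivl split: if_splits)
 have pi: "path_image (rectpath a1 a3) \<subseteq> - (of_nat ` {..d})"
 proof
  fix w assume "w : path_image (rectpath a1 a3)"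
  hence "w : closed_segment a1 a2 | w : closed_segment a2 a3 | w : closed_segment a3 a4 | w : closed_segment a4 a1"
   by (simp add: rectpath_def Let_def path_image_join a1_def a2_def a3_def a4_def)
  hence "Im w ~= 0 | Re w < 0 | Re w > d" using sub L kp by fastforce
  thus "w : - (of_nat ` {..d})" using not_node by blast
 qed
 have tot: "(cf ell has_contour_integral (2 * pi * \<i> * cor (poly P (exp ell)))) (rectpath a1 a3)"
 proof -
  have one: "((%w. exp (w * cor ell)/(w - of_nat k)) has_contour_integral (2 * pi * \<i> * exp (of_nat k * cor ell))) (rectpath a1 a3)" if k: "k <= d" for k
  proof -
   have "real k <= real d" using k by simp
   hence "winding_number (rectpath a1 a3) (of_nat k) = 1"
    using kp hh L by (intro winding_number_rectpath) (auto simp: in_box_complex_iff a1_def a3_def)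
   moreover have "((%w. exp (w * cor ell)/(w - of_nat k)) has_contour_integral (2 * pi * \<i> * winding_number (rectpath a1 a3) (of_nat k)*exp (of_nat k * cor ell))) (rectpath a1 a3)"
    by (rule Cauchy_integral_formula_convex_simple[of UNIV]) (use pi k in \<open>auto intro!: holomorphic_intros\<close>)
   ultimately show ?thesis by simp
  qed
  have "((%w. \<Sum>k\<le>d. cor (coeff P k)*(exp (w * cor ell)/(w - of_nat k))) has_contour_integral
   (\<Sum>k\<le>d. cor (coeff P k)*(2 * pi * \<i> * exp (of_nat k * cor ell)))) (rectpath a1 a3)"
   by (intro has_contour_integral_sum has_contour_integral_lmul one) auto
  moreover have "(\<Sum>k\<le>d. cor (coeff P k)*(2 * pi * \<i> * exp (of_nat k * cor ell))) = 2 * pi * \<i> * cor (poly P (exp ell))"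
  proof -
   have e: "exp (of_nat k * cor ell) = (cor (exp ell ^ k) :: complex)" for k
    by (simp add: exp_of_nat_mult exp_of_real[symmetric])
   show ?thesis unfolding e poly_altdef degree_P by (simp add: sum_distrib_left mult_ac)
  qed
  ultimately show ?thesis using pi cf_eq by (intro has_contour_integral_eq[of _ _ "rectpath a1 a3" "cf ell"]) (auto simp: subset_iff)
 qed
 have ci: "cf ell contour_integrable_on linepath u v" if "closed_segment u v \<subseteq> - (of_nat ` {..d})" for u v
  by (rule contour_integrable_continuous_linepath)
   (rule holomorphic_on_imp_continuous_on, rule holomorphic_on_subset[OF cf_holomorphic that])
 have s: "closed_segment a2 a3 \<subseteq> - (of_nat ` {..d})" "closed_segment a4 a1 \<subseteq> - (of_nat ` {..d})"
  using sub(1,2) not_node L kp by fastforce+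
 obtain i2 where i2: "(cf ell has_contour_integral i2) (linepath a2 a3)" using ci[OF s(1)] by (auto simp: contour_integrable_on_def)
 obtain i4 where i4: "(cf ell has_contour_integral i4) (linepath a4 a1)" using ci[OF s(2)] by (auto simp: contour_integrable_on_def)
 have i3: "(cf ell has_contour_integral (Q a4 - Q a3)) (linepath a3 a4)"
  using contour_integral_primitive[of "{w. Im w > 0}" Q "cf ell" "linepath a3 a4"] Q sub(4) by (simp add: has_field_derivative_at_within)
 have i1: "(cf ell has_contour_integral (cnj (Q a3) - cnj (Q a4))) (linepath a1 a2)"
 proof -
  have d: "((cnj \<circ> Q \<circ> cnj) has_field_derivative cf ell w) (at w)" if w: "Im w < 0" for w
  proof -
   have "((cnj \<circ> Q \<circ> cnj) has_field_derivative cnj (cf ell (cnj w))) (at w)"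
    by (rule has_field_derivative_cnj_cnj, rule Q) (use w in simp)
   thus ?thesis using cf_cnj[OF not_node[of w]] w by simp
  qed
  have "cnj a2 = a3" "cnj a1 = a4" by (simp_all add: a1_def a2_def a3_def a4_def complex_eq_iff)
  thus ?thesis using contour_integral_primitive[of "{w. Im w < 0}" "cnj \<circ> Q \<circ> cnj" "cf ell" "linepath a1 a2"] d sub(3)
   by (simp add: has_field_derivative_at_within)
 qed
 have "(cf ell has_contour_integral ((cnj (Q a3) - cnj (Q a4)) + (i2 + ((Q a4 - Q a3) + i4)))) (rectpath a1 a3)"
 proof -
  have "rectpath a1 a3 = linepath a1 a2 +++ linepath a2 a3 +++ linepath a3 a4 +++ linepath a4 a1"
   by (simp add: rectpath_def Let_def a1_def a2_def a3_def a4_def)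
  thus ?thesis by (simp only:) (intro has_contour_integral_join i1 i2 i3 i4; simp)
 qed
 hence "2 * pi * \<i> * cor (poly P (exp ell)) = (cnj (Q a3) - cnj (Q a4)) + (i2 + ((Q a4 - Q a3) + i4))"
  using tot by (rule has_contour_integral_unique[THEN sym])
 hence e: "2 * pi * \<i> * cor (poly P (exp ell)) - (cnj (Q a3 - Q a4) - (Q a3 - Q a4)) = i2 + i4" by (simp add: algebra_simps)
 have n: "norm (a3 - a2) = 2*hh" "norm (a1 - a4) = 2*hh" using hh by (auto simp: a1_def a2_def a3_def a4_def cmod_eq_Im)
 have "norm i2 <= BR*norm (a3 - a2)" by (rule cf_integral_bound[OF _ B(2) i2]) (use right sub(1) in auto)
 moreover have "norm i4 <= BL*norm (a1 - a4)" by (rule cf_integral_bound[OF _ B(1) i4]) (use left sub(2) in auto)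
 moreover have "norm (i2 + i4) <= norm i2 + norm i4" by (rule norm_triangle_ineq)
 ultimately have "norm (i2 + i4) <= 2*hh*(BL + BR)" unfolding n by (simp add: algebra_simps)
 thus ?thesis unfolding e[symmetric] a3_def a4_def .
qed

lemma cf_primitive: obtains Q where "!!w. Im w > 0 ==> (Q has_field_derivative cf ell w) (at w)"
proof -
 have "cf ell holomorphic_on {w. Im w > 0}" by (rule holomorphic_on_subset[OF cf_holomorphic]) (use not_node in auto)
 from holomorphic_convex_primitive'[OF convex_halfspace_Im_gt open_halfspace_Im_gt this]
 obtain Q where "!!w. w : {w. Im w > 0} ==> (Q has_field_derivative cf ell w) (at w within {w. Im w > 0})" by blast
 hence "(Q has_field_derivative cf ell w) (at w)" if "Im w > 0" for w
  using that at_within_open[of w "{w. Im w > 0}"] open_halfspace_Im_gt[of 0] by (metis mem_Collect_eq)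
 thus ?thesis by (rule that)
qed

text \<open>As ell = ln x is negative, the integrand tends to zero on the lines Re w = L, so the
  right side drops out. For the same reason the upper right corner may be moved to another height
  hh', which is needed because the curve ends at a different height from its start.\<close>

lemma contour_reduction:
 assumes l: "ell < 0" and kp: "kp > 0" and hh: "hh > 0" "hh' > 0" and B: "BL >= 0" and ep: "ep > 0"
  and Q: "!!w. Im w > 0 ==> (Q has_field_derivative cf ell w) (at w)"
  and left: "!!w. Re w = - kp ==> \<bar>Im w\<bar> <= hh ==> norm (cf ell w) <= BL"
 shows "EX L0. ALL L>=L0::real. norm (2 * pi * \<i> * cor (poly P (exp ell)) -
   (cnj (Q (Complex L hh') - Q (Complex (-kp) hh)) - (Q (Complex L hh') - Q (Complex (-kp) hh)))) <= 2*hh*BL + ep"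
proof -
 define ep' where "ep' = ep/(2*hh + 2 * \<bar>hh' - hh\<bar>)"
 have p: "2*hh + 2 * \<bar>hh' - hh\<bar> > 0" using hh by (simp add: add_pos_nonneg)
 hence e: "ep' > 0" using ep by (simp add: ep'_def)
 obtain L0 where L0: "!!L::real. L >= L0 ==> L > real d & (ALL w. Re w = L --> norm (cf ell w) <= ep')"
  using cf_decay[OF l e] by blast
 have "norm (2 * pi * \<i> * cor (poly P (exp ell)) -
   (cnj (Q (Complex L hh') - Q (Complex (-kp) hh)) - (Q (Complex L hh') - Q (Complex (-kp) hh)))) <= 2*hh*BL + ep" if L: "L >= L0" for L :: real
 proof -
  note LL = L0[OF L]
  have 1: "norm (2 * pi * \<i> * cor (poly P (exp ell)) -
   (cnj (Q (Complex L hh) - Q (Complex (-kp) hh)) - (Q (Complex L hh) - Q (Complex (-kp) hh)))) <= 2*hh*(BL + ep')"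
   by (rule contour_identity[OF kp hh(1) _ B less_imp_le[OF e] Q left]) (use LL in auto)
  have sub: "closed_segment (Complex L hh') (Complex L hh) \<subseteq> {w. Re w = L & Im w > 0}"
   using hh by (auto simp: closed_segment_same_Re closed_segment_eq_real_ivl split: if_splits)
  have "(cf ell has_contour_integral (Q (Complex L hh) - Q (Complex L hh'))) (linepath (Complex L hh') (Complex L hh))"
   using contour_integral_primitive[of "{w. Im w > 0}" Q "cf ell" "linepath (Complex L hh') (Complex L hh)"] Q sub
   by (auto simp: has_field_derivative_at_within)
  hence "norm (Q (Complex L hh) - Q (Complex L hh')) <= ep'*norm (Complex L hh - Complex L hh')"
   by (rule cf_integral_bound[rotated 2]) (use LL e sub in auto)
  also have "norm (Complex L hh - Complex L hh') = \<bar>hh' - hh\<bar>" by (simp add: cmod_def)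
  finally have 2: "norm (Q (Complex L hh) - Q (Complex L hh')) <= ep' * \<bar>hh' - hh\<bar>" .
  have gen: "norm (X - (cnj (q' - q4) - (q' - q4))) <= b + 2 * c"
   if "norm (X - (cnj (q - q4) - (q - q4))) <= b" "norm (q - q') <= c" for X q q' q4 :: complex and b c
  proof -
   have "X - (cnj (q' - q4) - (q' - q4)) = (X - (cnj (q - q4) - (q - q4))) + (cnj (q - q') - (q - q'))" by (simp add: algebra_simps)
   moreover have "norm (cnj (q - q') - (q - q')) <= 2 * c"
    using norm_triangle_ineq4[of "cnj (q - q')" "q - q'"] that(2) complex_mod_cnj[of "q - q'"] by linarith
   ultimately show ?thesis using norm_triangle_ineq that(1) by (smt (verit))
  qed
  have "norm (2 * pi * \<i> * cor (poly P (exp ell)) -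
   (cnj (Q (Complex L hh') - Q (Complex (-kp) hh)) - (Q (Complex L hh') - Q (Complex (-kp) hh)))) <= 2*hh*(BL + ep') + 2*(ep' * \<bar>hh' - hh\<bar>)"
   by (rule gen[OF 1 2])
  also have "... = 2*hh*BL + ep'*(2*hh + 2 * \<bar>hh' - hh\<bar>)" by (simp add: algebra_simps)
  also have "ep'*(2*hh + 2 * \<bar>hh' - hh\<bar>) = ep" using p by (simp add: ep'_def)
  finally show ?thesis .
 qed
 thus ?thesis by blast
qed

text \<open>The line Re w = -kp separates the pole 0 from the zeros, as kp < 1 + av1, 1 + av2. There
  |v| <= |Re v| + |Im v| bounds each numerator factor by its value at the real point hh, and |w| >=
  kp, |w - k| >= k bound the denominator below by kp d!.\<close>

lemma left_bound:
 assumes kp: "0 < kp" "kp <= 1" "kp < 1 + av1" "kp < 1 + av2" and w: "Re w = - kp" "\<bar>Im w\<bar> <= hh"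
 shows "norm (cf ell w) <= norm (Npr av1 av2 n1 n2 (cor hh))/(kp*norm (Npr av1 av2 n1 n2 (of_nat d)))*exp (- (kp*ell))"
proof -
 have hh: "hh >= 0" using w by linarith
 have f: "norm (w + of_nat j + cor (1 + av)) <= norm (cor hh + of_nat j + cor (1 + av))" if "kp < 1 + av" for j av
 proof -
  have "norm (w + of_nat j + cor (1 + av)) <= \<bar>Re (w + of_nat j + cor (1 + av))\<bar> + \<bar>Im (w + of_nat j + cor (1 + av))\<bar>" by (rule cmod_le)
  also have "... = - kp + real j + 1 + av + \<bar>Im w\<bar>" using w that kp by (simp add: abs_if)
  also have "... <= hh + real j + (1 + av)" using w kp by linarith
  also have "... = norm (cor hh + of_nat j + cor (1 + av))"
  proof -
   have "cor hh + of_nat j + cor (1 + av) = cor (hh + real j + (1 + av))" by simp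
   thus ?thesis using hh that kp by (simp only: norm_of_real)
  qed
  finally show ?thesis .
 qed
 have N: "norm (Npr av1 av2 n1 n2 w) <= norm (Npr av1 av2 n1 n2 (cor hh))"
  unfolding Npr_def norm_mult prod_norm[symmetric] using f[OF kp(3)] f[OF kp(4)]
  by (intro mult_mono prod_mono) (auto intro: prod_nonneg)
 have D: "kp*fact m <= norm (\<Prod>k\<le>m. w - of_nat k)" for m
 proof (induction m)
  case 0
  have "kp = \<bar>Re w\<bar>" using w kp by simp
  also have "... <= norm w" by (rule abs_Re_le_cmod)
  finally show ?case by simp
 next
  case (Suc m)
  have "real (Suc m) <= \<bar>Re (w - of_nat (Suc m))\<bar>" using w kp by simp
  also have "... <= norm (w - of_nat (Suc m))" by (rule abs_Re_le_cmod)
  finally have "kp*fact m*real (Suc m) <= norm (\<Prod>k\<le>m. w - of_nat k)*norm (w - of_nat (Suc m))"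
   using Suc kp by (intro mult_mono) auto
  thus ?case by (simp add: norm_mult mult_ac del: of_nat_Suc)
 qed
 define c where "c = norm (cnst av1 av2 n1 n2)"
 have c: "c = fact d/norm (Npr av1 av2 n1 n2 (of_nat d))" by (simp add: c_def cnst_def norm_divide norm_fact)
 have "norm (cf ell w) = c*norm (Npr av1 av2 n1 n2 w)/norm (\<Prod>k\<le>d. w - of_nat k)*exp (- (kp*ell))"
  unfolding contour_fun_def norm_mult norm_divide c_def using w by simp
 also have "... <= c*norm (Npr av1 av2 n1 n2 (cor hh))/(kp*fact d)*exp (- (kp*ell))"
  using N D[of d] kp by (intro mult_right_mono frac_le mult_left_mono mult_pos_pos) (auto simp: c_def)
 also have "c*norm (Npr av1 av2 n1 n2 (cor hh))/(kp*fact d) = norm (Npr av1 av2 n1 n2 (cor hh))/(kp*norm (Npr av1 av2 n1 n2 (of_nat d)))"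
  unfolding c by simp
 finally show ?thesis .
qed

end

section \<open>The pieces of the contour away from the saddle points\<close>

lemma Re_lf: "Re (lf v) = Re v * ln (norm v) - Im v * Im (Ln v) - Re v"
 by (cases "v = 0") (simp_all add: lf_def)

lemma abs_xlnx_le:
 fixes x :: real assumes "0 <= x" "x <= 1" shows "\<bar>x*ln x\<bar> <= 2 * sqrt x"
proof (cases "x = 0")
 case False
 hence x: "x > 0" using assms by simp
 have "ln (1/sqrt x) <= 1/sqrt x - 1" using x by (intro ln_le_minus_one) simp
 hence "- ln x <= 2/sqrt x" using x by (simp add: ln_div ln_sqrt)
 hence "x*(- ln x) <= x*(2/sqrt x)" using x by (intro mult_left_mono) auto
 also have "x*(2/sqrt x) = 2 * sqrt x" using x real_sqrt_mult_self[of x] by (simp add: field_simps)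
 finally have "x*(- ln x) <= 2 * sqrt x" .
 moreover have "ln x <= 0" using assms x by simp
 hence "x*ln x <= 0" using x by (intro mult_nonneg_nonpos) auto
 ultimately show ?thesis by simp
qed simp

text \<open>The real part of \<open>lf\<close> is continuous even across the cut and at 0: the
  jumping Im (Ln v) is bounded and multiplied by Im v, which tends to 0, and x ln x tends to
  0.\<close>

lemma Re_lf_limit:
 assumes f: "(f \<longlongrightarrow> cor c) F"
 shows "((%r. Re (lf (f r))) \<longlongrightarrow> c*ln \<bar>c\<bar> - c) F"
proof -
 have re: "((%r. Re (f r)) \<longlongrightarrow> c) F" using tendsto_Re[OF f] by simp
 have im: "((%r. Im (f r)) \<longlongrightarrow> 0) F" using tendsto_Im[OF f] by simp
 have nm: "((%r. norm (f r)) \<longlongrightarrow> \<bar>c\<bar>) F" using tendsto_norm[OF f] by simp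
 have 1: "((%r. Im (f r)*Im (Ln (f r))) \<longlongrightarrow> 0) F"
 proof (rule Lim_null_comparison)
  show "\<forall>\<^sub>F r in F. norm (Im (f r)*Im (Ln (f r))) <= \<bar>Im (f r)\<bar> * pi"
  proof (intro always_eventually allI)
   fix r show "norm (Im (f r)*Im (Ln (f r))) <= \<bar>Im (f r)\<bar> * pi"
   proof (cases "f r = 0")
    case False
    have "\<bar>Im (Ln (f r))\<bar> <= pi" using mpi_less_Im_Ln[OF False] Im_Ln_le_pi[OF False] by linarith
    thus ?thesis by (simp add: abs_mult mult_left_mono)
   qed simp
  qed
  show "((%r. \<bar>Im (f r)\<bar> * pi) \<longlongrightarrow> 0) F" using tendsto_mult[OF tendsto_rabs[OF im] tendsto_const[of pi]] by simp
 qed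
 have 2: "((%r. Re (f r)*ln (norm (f r))) \<longlongrightarrow> c*ln \<bar>c\<bar>) F"
 proof (cases "c = 0")
  case True
  have "((%r. Re (f r)*ln (norm (f r))) \<longlongrightarrow> 0) F"
  proof (rule Lim_null_comparison)
   have "\<forall>\<^sub>F r in F. norm (f r) < 1" by (rule order_tendstoD(2)[OF nm]) (simp add: True)
   thus "\<forall>\<^sub>F r in F. norm (Re (f r)*ln (norm (f r))) <= 2 * sqrt (norm (f r))"
   proof eventually_elim
    case (elim r)
    have "norm (Re (f r)*ln (norm (f r))) <= \<bar>norm (f r)*ln (norm (f r))\<bar>"
     by (simp add: abs_mult mult_right_mono abs_Re_le_cmod)
    also have "... <= 2 * sqrt (norm (f r))" by (rule abs_xlnx_le) (use elim in auto)
    finally show ?case .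
   qed
   show "((%r. 2 * sqrt (norm (f r))) \<longlongrightarrow> 0) F"
    using tendsto_mult[OF tendsto_const[of 2] tendsto_real_sqrt[OF nm]] True by simp
  qed
  thus ?thesis using True by simp
 next
  case False
  thus ?thesis by (intro tendsto_intros re nm) auto
 qed
 have "((%r. Re (f r)*ln (norm (f r)) - Im (f r)*Im (Ln (f r)) - Re (f r)) \<longlongrightarrow> c*ln \<bar>c\<bar> - 0 - c) F"
  by (intro tendsto_diff 1 2 re)
 thus ?thesis unfolding Re_lf by simp
qed

context jpt
begin

lemma LL_neg:
 assumes r: "0 < r" "r < pp/qq" shows "LL r < 0"
proof -
 have d: "pp - qq*r + 4*r^3 > 0" by (rule Xden_pos) (use Tc_real(4)[OF r] in \<open>auto simp: valid_def\<close>)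
 have "pp - qq*r > 0" using r qq by (simp add: less_divide_eq mult.commute)
 hence "X r < 1" unfolding X_def using d by (simp add: divide_less_eq)
 thus ?thesis unfolding LL_eq[OF r] using hs_on_curve(2)[OF r] by simp
qed

lemma ev_small: "pp/qq > 0 & eventually (%r. 0 < r & r < pp/qq) (at_right (0::real))"
proof -
 have b: "0 < pp/qq" using pp qq by simp
 show ?thesis using b eventually_at_right_real[OF b] by (auto elim: eventually_mono)
qed

lemma Y_limit_0: "(Y \<longlongrightarrow> 0) (at_right 0)"
proof -
 have "((%r. \<bar>r\<bar> * sqrt ((3 * pp + qq*r)/(pp - qq*r))) \<longlongrightarrow> \<bar>0\<bar> * sqrt ((3 * pp + qq*0)/(pp - qq*0))) (at_right 0)"
  by (intro tendsto_intros) (use pp in auto)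
 thus ?thesis by (simp add: Y_def[abs_def])
qed

lemma Tc_limit_0: "((%r. Tc (cor r)) \<longlongrightarrow> cor 0) (at_right 0)"
proof -
 have "((%r. Complex r (Y r)) \<longlongrightarrow> Complex 0 0) (at_right 0)" by (intro tendsto_Complex Y_limit_0 tendsto_ident_at)
 moreover have "Complex 0 0 = cor 0" by (simp add: complex_eq_iff)
 ultimately have "((%r. Complex r (Y r)) \<longlongrightarrow> cor 0) (at_right 0)" by simp
 moreover have "eventually (%r. Tc (cor r) = Complex r (Y r)) (at_right 0)"
  using conjunct2[OF ev_small] by eventually_elim (rule Tc_real(1), auto)
 ultimately show ?thesis by (simp add: tendsto_cong)
qed

text \<open>The common limit, as r tends to 0, of the exponent in the bound for the left side of the
  rectangle and, up to \<open>lf 2\<close>, of the exponent at the start of the curve. Hence the gap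
  at the start of the curve carries over to the left side.\<close>

definition v0 :: real where "v0 = a*ln a - a + (tt*ln tt - tt)"

lemma Re_hN_limit_0: "((%r. Re (hN (cor (Y r)))) \<longlongrightarrow> v0) (at_right 0)"
proof -
 have Yc: "((%r. cor (Y r)) \<longlongrightarrow> cor 0) (at_right 0)" by (intro tendsto_of_real Y_limit_0)
 have l: "((%r. Re (lf (cor (Y r) + cor c))) \<longlongrightarrow> c*ln \<bar>c\<bar> - c) (at_right 0)" for c
  by (rule Re_lf_limit) (use tendsto_add[OF Yc tendsto_const[of "cor c"]] in simp)
 have "((%r. Re (lf (cor (Y r) + cor a)) + Re (lf (cor (Y r) + cor tt)) - 2 * Re (lf (cor (Y r) + cor 0)))
  \<longlongrightarrow> (a*ln \<bar>a\<bar> - a) + (tt*ln \<bar>tt\<bar> - tt) - 2*(0*ln \<bar>0\<bar> - 0)) (at_right 0)"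
  by (intro tendsto_add tendsto_diff tendsto_mult tendsto_const l)
 thus ?thesis using tt by (simp add: v0_def hN_def)
qed

lemma Re_ph_limit_0: "((%r. Re (ph r0 r)) \<longlongrightarrow> v0 - Re (lf 2)) (at_right 0)"
proof -
 have l: "((%r. Re (lf (Tc (cor r) + cor c))) \<longlongrightarrow> c*ln \<bar>c\<bar> - c) (at_right 0)" for c
  by (rule Re_lf_limit) (use tendsto_add[OF Tc_limit_0 tendsto_const[of "cor c"]] in simp)
 have "((%r. Re (lf (Tc (cor r) + cor a)) + Re (lf (Tc (cor r) + cor tt)) - 2 * Re (lf (Tc (cor r) + cor 0))
   + Re (lf (Tc (cor r) + cor (-2))) - Re (lf (Tc (cor r) + cor 0)) + LL r0 * Re (Tc (cor r)))
  \<longlongrightarrow> (a*ln \<bar>a\<bar> - a) + (tt*ln \<bar>tt\<bar> - tt) - 2*(0*ln \<bar>0\<bar> - 0) + ((-2)*ln \<bar>-2\<bar> - (-2)) - (0*ln \<bar>0\<bar> - 0) + LL r0 * Re (cor 0)) (at_right 0)"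
  by (intro tendsto_add tendsto_diff tendsto_mult tendsto_const l tendsto_Re Tc_limit_0)
 moreover have "Re (lf 2) = 2*ln 2 - 2" by (simp add: Re_lf)
 ultimately show ?thesis using tt by (simp add: v0_def ph_def h0_def hN_def)
qed

lemma Re_hs:
 assumes "Im t > 0"
 shows "Re (hs t) = ln (norm (t + cor a)) + ln (norm (t + cor tt)) + ln (norm (t - 2)) - 3*ln (norm t)"
proof -
 have "t ~= 0" "t + cor a ~= 0" "t + cor tt ~= 0" "t - 2 ~= 0" using upper_off_cut[OF assms] by auto
 thus ?thesis by (simp add: hs_def)
qed

text \<open>Near t = 0 the term -3 ln |t| outweighs the bounded logarithms and any constant
  l.\<close>

lemma Re_hs_small:
 obtains ro where "ro > 0" "!!t. Im t > 0 ==> norm t <= ro ==> Re (hs t) + l >= 0"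
proof -
 define ro where "ro = min (tt/2) (exp ((l + 2*ln (tt/2))/3))"
 have "ro > 0" using tt by (simp add: ro_def)
 moreover have "Re (hs t) + l >= 0" if t: "Im t > 0" "norm t <= ro" for t
 proof -
  have t0: "norm t > 0" using t by auto
  have n: "norm t <= tt/2" using t by (simp add: ro_def)
  have b: "norm (t + cor c) >= c - tt/2" if "c >= 0" for c
   using norm_triangle_ineq4[of "t + cor c" t] n that by (simp add: norm_of_real)
  have "tt/2 <= norm (t + cor a)" "tt/2 <= norm (t + cor tt)" using b[of a] b[of tt] tt by auto
  hence 1: "ln (tt/2) <= ln (norm (t + cor a))" "ln (tt/2) <= ln (norm (t + cor tt))" using tt by (auto intro!: ln_mono)
  have "1 <= norm (t - 2)" using norm_triangle_ineq4[of "2 - t" "- t"] n tt by (simp add: norm_minus_commute)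
  hence 2: "0 <= ln (norm (t - 2))" by simp
  have "ln (norm t) <= ln ro" using t t0 by (intro ln_mono) auto
  also have "... <= ln (exp ((l + 2*ln (tt/2))/3))" using tt by (intro ln_mono) (auto simp: ro_def)
  finally have "3*ln (norm t) <= l + 2*ln (tt/2)" by simp
  thus ?thesis unfolding Re_hs[OF t(1)] using 1 2 by linarith
 qed
 ultimately show ?thesis by (rule that)
qed

text \<open>Each of the three logarithms of shifted t exceeds ln |t| by at most 2/|t|. High above
  the real axis the exponent is therefore nearly constant in the horizontal direction, and the decay
  of x^w prevails.\<close>

lemma Re_hs_large:
 assumes "Im t > 0" shows "Re (hs t) <= 6/norm t"
proof -
 have t0: "norm t > 0" using assms by auto
 have b: "ln (norm (t + cor c)) <= ln (norm t) + 2/norm t" if "\<bar>c\<bar> <= 2" "t + cor c ~= 0" for c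
 proof -
  have "norm (t + cor c) <= norm t + 2" using norm_triangle_ineq[of t "cor c"] that by (simp add: norm_of_real)
  hence "ln (norm (t + cor c)) <= ln (norm t + 2)" using that by (intro ln_mono) auto
  also have "norm t + 2 = norm t*(1 + 2/norm t)" using t0 by (simp add: field_simps)
  also have "ln ... = ln (norm t) + ln (1 + 2/norm t)" using t0 by (intro ln_mult_pos) (auto simp: add_pos_pos)
  also have "ln (1 + 2/norm t) <= 2/norm t" using t0 by (intro ln_add_one_self_le_self) auto
  finally show ?thesis by simp
 qed
 have "t + cor a ~= 0" "t + cor tt ~= 0" "t + cor (-2) ~= 0" using upper_off_cut[OF assms] by auto
 hence "ln (norm (t + cor a)) <= ln (norm t) + 2/norm t" "ln (norm (t + cor tt)) <= ln (norm t) + 2/norm t"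
  "ln (norm (t - 2)) <= ln (norm t) + 2/norm t"
  using b[of a] b[of tt] b[of "-2"] tt by auto
 thus ?thesis unfolding Re_hs[OF assms] by simp
qed

lemma Y_unbounded:
 assumes "ep > 0"
 obtains r where "pp/qq - ep <= r" "0 < r" "r < pp/qq" "Y r >= M"
proof -
 define K where "K = max M 1"
 \<comment> \<open>The first entry gives r >= pp/(2 qq), hence (K/r)^2 <= (2 qq K/pp)^2. The third
   makes the product of the latter with pp - qq r = qq e at most 3 pp, so the fraction under the
   root in \<open>Y r\<close> is at least (K/r)^2.\<close>
 define e where "e = min (min (pp/(2*qq)) ep) (3 * pp*(pp/(2*qq*K))^2/qq)"
 define r where "r = pp/qq - e"
 have K: "K >= 1" "K >= M" by (auto simp: K_def)
 have e: "e > 0" using assms pp qq K by (auto simp: e_def)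
 have e2: "e <= pp/(2*qq)" "e <= ep" "e <= 3 * pp*(pp/(2*qq*K))^2/qq" by (auto simp: e_def)
 have r1: "r >= pp/(2*qq)" using e2(1) by (simp add: r_def)
 have r0: "r > 0" using r1 pp qq by (meson divide_pos_pos less_le_trans mult_pos_pos zero_less_numeral)
 have pe: "pp - qq*r = qq*e" using qq by (simp add: r_def algebra_simps)
 have "(K/r)^2 <= (3 * pp + qq*r)/(pp - qq*r)"
 proof -
  have "(K/r)^2 <= (K/(pp/(2*qq)))^2" using r1 r0 K pp qq by (intro power_mono divide_left_mono mult_pos_pos divide_nonneg_pos) auto
  moreover have "(K/(pp/(2*qq)))^2*(qq*e) <= 3 * pp"
  proof -
   have "(K/(pp/(2*qq)))^2*(qq*e) <= (K/(pp/(2*qq)))^2*(qq*(3 * pp*(pp/(2*qq*K))^2/qq))"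
    using e2(3) qq by (intro mult_left_mono) auto
   also have "... = 3 * pp" using pp qq K by (simp add: field_simps power2_eq_square)
   finally show ?thesis .
  qed
  ultimately have "(K/r)^2*(qq*e) <= 3 * pp + qq*r"
   using mult_right_mono[of "(K/r)^2" "(K/(pp/(2*qq)))^2" "qq*e"] qq e r0 by (smt (verit) mult_pos_pos)
  thus ?thesis unfolding pe using qq e by (simp add: le_divide_eq)
 qed
 hence "sqrt ((K/r)^2) <= sqrt ((3 * pp + qq*r)/(pp - qq*r))" by (rule real_sqrt_le_mono)
 hence "K/r <= sqrt ((3 * pp + qq*r)/(pp - qq*r))" using r0 K by simp
 hence "K <= r * sqrt ((3 * pp + qq*r)/(pp - qq*r))" using r0 by (simp add: divide_le_eq mult.commute)
 hence "Y r >= M" using r0 K by (simp add: Y_def)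
 thus ?thesis using that[of r] e e2 r0 by (simp add: r_def)
qed

lemma h_horizontal_deriv:
 assumes "y > 0"
 shows "((%x. Re (h0 (Complex x y)) + l*x) has_real_derivative (Re (hs (Complex x y)) + l)) (at x)"
proof -
 have e: "Complex x y = cor x + \<i> * cor y" for x by (simp add: complex_eq_iff)
 have "((%z. h0 (z + \<i> * cor y)) has_field_derivative hs (cor x + \<i> * cor y)*1) (at (cor x))"
  by (rule DERIV_chain2[of h0]) (use assms in \<open>auto intro!: DERIV_h0 derivative_eq_intros\<close>)
 hence "((%x. h0 (cor x + \<i> * cor y)) has_vector_derivative hs (cor x + \<i> * cor y)) (at x)"
  using has_vector_derivative_real_field by simp
 hence "((%x. Re (h0 (cor x + \<i> * cor y))) has_vector_derivative Re (hs (cor x + \<i> * cor y))) (at x)"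
  by (rule bounded_linear.has_vector_derivative[OF bounded_linear_Re])
 hence "((%x. Re (h0 (Complex x y))) has_real_derivative Re (hs (Complex x y))) (at x)"
  by (simp add: e has_real_derivative_iff_has_vector_derivative)
 from DERIV_add[OF this DERIV_cmult[OF DERIV_ident, of l]] show ?thesis by simp
qed

lemma A0_bound_large:
 obtains M where "M >= 0" "!!t. Im t > 0 ==> Im t >= 4 ==> norm (A0 t) <= M"
proof -
 define E where "E = \<bar>av1 + 1/2\<bar> + \<bar>av2 + 1/2\<bar>"
 have main: "norm (A0 t) <= exp (E - Re (eN 2))" if t: "Im t > 0" "Im t >= 4" for t
 proof -
  have nt: "norm t >= 4" "norm (t - 2) >= 4" using abs_Im_le_cmod[of t] abs_Im_le_cmod[of "t - 2"] t by auto
  have nz: "t ~= 0" "t + cor a ~= 0" "t + cor tt ~= 0" "t - 2 ~= 0" using upper_off_cut[OF t(1)] by auto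
  have L: "\<bar>Re (Ln (t + cor c)) - Re (Ln t)\<bar> <= 1" if c: "0 <= c" "c <= 2" "t + cor c ~= 0" for c
  proof -
   have "norm (t + cor c) <= norm t + 2" using norm_triangle_ineq[of t "cor c"] c by (simp add: norm_of_real)
   hence 1: "norm (t + cor c) <= 2*norm t" using nt by linarith
   have "norm t <= norm (t + cor c) + 2" using norm_triangle_ineq4[of "t + cor c" "cor c"] c by (simp add: norm_of_real)
   hence 2: "norm t <= 2*norm (t + cor c)" using nt by linarith
   have "ln (norm (t + cor c)) <= ln (2*norm t)" using 1 c by (intro ln_mono) auto
   moreover have "ln (norm t) <= ln (2*norm (t + cor c))" using 2 nz by (intro ln_mono) auto
   moreover have "ln (2::real) <= 1" using ln_le_minus_one[of "2::real"] by simp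
   ultimately show ?thesis using nz c by (simp add: ln_mult abs_le_iff)
  qed
  have "Re (eN t) = (av1 + 1/2)*(Re (Ln (t + cor a)) - Re (Ln t)) + (av2 + 1/2)*(Re (Ln (t + cor tt)) - Re (Ln t))"
  proof -
   have "cor av1 + 1/2 = cor (av1 + 1/2)" "cor av2 + 1/2 = cor (av2 + 1/2)" by simp_all
   thus ?thesis unfolding eN_def by (simp only: plus_complex.sel Re_complex_of_real Im_complex_of_real times_complex.sel minus_complex.sel mult_zero_left diff_zero)
  qed
  also have "... <= \<bar>av1 + 1/2\<bar> * 1 + \<bar>av2 + 1/2\<bar> * 1"
  proof (intro add_mono)
   have k: "x*y <= \<bar>x\<bar> * 1" if "\<bar>y\<bar> <= 1" for x y :: real
   proof -
    have "x*y <= \<bar>x*y\<bar>" by simp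
    also have "... <= \<bar>x\<bar> * 1" unfolding abs_mult using that by (intro mult_left_mono) auto
    finally show ?thesis .
   qed
   show "(av1 + 1/2)*(Re (Ln (t + cor a)) - Re (Ln t)) <= \<bar>av1 + 1/2\<bar> * 1" by (rule k, rule L) (use nz tt in auto)
   show "(av2 + 1/2)*(Re (Ln (t + cor tt)) - Re (Ln t)) <= \<bar>av2 + 1/2\<bar> * 1" by (rule k, rule L) (use nz tt in auto)
  qed
  finally have "Re (eN t) <= E" by (simp add: E_def)
  moreover have "Re (Ln t) >= 0" "Re (Ln (t - 2)) >= 0" using nz nt by auto
  moreover have "x - c - (p + q)/2 <= u - c" if "x <= u" "0 <= p" "0 <= q" for x c p q u :: real
   using add_nonneg_nonneg[OF that(2,3)] that(1) by argo
  ultimately have "Re (eN t - eN 2 - (Ln t + Ln (t - 2))/2) <= E - Re (eN 2)" unfolding minus_complex.sel plus_complex.sel Re_divide_numeral by blast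
  thus ?thesis unfolding A0_def norm_exp_eq_Re by simp
 qed
 show ?thesis by (rule that[of "exp (E - Re (eN 2))"]) (use main in auto)
qed

lemma A0_bound_horizontal:
 assumes "y > 0"
 obtains M where "M >= 0" "!!x. x : {x1..x2} ==> norm (A0 (Complex x y)) <= M"
proof -
 have "continuous_on {x1..x2} (%x. A0 (Complex x y))"
  by (rule continuous_on_compose2[OF holomorphic_on_imp_continuous_on[OF A0_holomorphic]])
   (use assms in \<open>auto simp: Complex_eq intro!: continuous_intros\<close>)
 hence "bounded ((%x. A0 (Complex x y)) ` {x1..x2})" by (intro compact_imp_bounded compact_continuous_image) auto
 then obtain M where "M > 0" "ALL z:(%x. A0 (Complex x y)) ` {x1..x2}. norm z <= M" by (auto simp: bounded_pos)
 thus ?thesis using that[of M] by auto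
qed

end

context jpt
begin

lemma contour_fun_bound:
 assumes y: "y > 0"
 obtains K N where "K >= 0" "N >= 1"
  "!!n n1 n2 t ell. scaled n n1 n2 ==> n >= N ==> Im t >= y ==>
   norm (contour_fun av1 av2 n1 n2 ell (cor n*t)) <= K*norm (A0 t)*exp (n*(Re (h0 t) + ell * Re t - Re kp0))"
proof -
 obtain C N where CN: "C >= 0" "N > 0"
  "!!n n1 n2 t. scaled n n1 n2 ==> n >= N ==> far y t ==>
   EX e. norm e <= C/n & G n1 n2 (cor n*t) = cor (sqrt (4 * pi/n))*exp (cor n*(h0 t - kp0))*A0 t*exp e"
  by (rule G_asymptotics[OF y]) (rule that)
 show ?thesis
 proof (rule that[of "4*exp C" "max N 1"])
  fix n n1 n2 t and ell :: real
  assume h: "scaled n n1 n2" "n >= max N 1" "Im t >= y"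
  have n1: "n >= 1" using h(2) by simp
  have "far y t" unfolding far_def
  proof (intro conjI allI impI)
   fix ta :: real
   show "y <= norm (t - cor ta)" using abs_Im_le_cmod[of "t - cor ta"] h(3) by simp
  qed (use h(3) y in simp)
  then obtain e where e: "norm e <= C/n" "G n1 n2 (cor n*t) = cor (sqrt (4 * pi/n))*exp (cor n*(h0 t - kp0))*A0 t*exp e"
   using CN(3)[OF h(1)] h(2) by force
  have e1: "norm (exp e) <= exp C"
  proof -
   have "C/n <= C" using CN(1) n1 by (simp add: divide_le_eq mult_le_cancel_left1)
   hence "norm e <= C" using e(1) by linarith
   thus ?thesis using norm_exp[of e] by (meson exp_le_cancel_iff order_trans)
  qed
  have sq: "sqrt (4 * pi/n) <= 4"
  proof -
   have "4 * pi/n <= 4 * pi" using n1 by (simp add: divide_le_eq)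
   also have "... <= 4^2" using pi_less_4 by simp
   finally show ?thesis by (intro real_le_lsqrt) auto
  qed
  have "norm (contour_fun av1 av2 n1 n2 ell (cor n*t)) = norm (G n1 n2 (cor n*t))*exp (n*(ell * Re t))"
  proof -
   have "contour_fun av1 av2 n1 n2 ell (cor n*t) = G n1 n2 (cor n*t)*exp (cor n*t * cor ell)"
    by (simp add: contour_fun_def G_def)
   thus ?thesis by (simp add: norm_mult mult_ac)
  qed
  also have "norm (G n1 n2 (cor n*t)) = sqrt (4 * pi/n)*exp (n*(Re (h0 t) - Re kp0))*norm (A0 t)*norm (exp e)"
   unfolding e(2) using n1 by (simp add: norm_mult)
  also have "... * exp (n*(ell * Re t)) = (sqrt (4 * pi/n)*norm (exp e))*(norm (A0 t)*exp (n*(Re (h0 t) + ell * Re t - Re kp0)))"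
  proof -
   have "exp (n*(Re (h0 t) + ell * Re t - Re kp0)) = exp (n*(Re (h0 t) - Re kp0))*exp (n*(ell * Re t))"
    unfolding exp_add[symmetric] by (rule arg_cong[of _ _ exp]) (simp add: algebra_simps)
   thus ?thesis by (simp add: mult_ac)
  qed
  also have "... <= (4*exp C)*(norm (A0 t)*exp (n*(Re (h0 t) + ell * Re t - Re kp0)))"
   using sq e1 n1 by (intro mult_right_mono mult_mono) auto
  finally show "norm (contour_fun av1 av2 n1 n2 ell (cor n*t)) <= 4*exp C*norm (A0 t)*exp (n*(Re (h0 t) + ell * Re t - Re kp0))"
   by (simp only: mult.assoc)
 qed auto
qed

lemma Re_ph: "0 < r ==> r < pp/qq ==> Re (ph r0 r) = Re (h0 (Complex r (Y r))) + LL r0*r"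
 by (simp add: ph_def Tc_real(1))

lemma exp_gap_mono: "0 <= n ==> u <= v ==> exp (n*u) <= exp (n * v :: real)"
 by (simp add: mult_left_mono)

text \<open>A horizontal segment joins the left side of the rectangle to the point of the curve with
  parameter rl. It lies so close to 0 that Re hs + LL r0 >= 0 on it, so the exponent is largest at
  the point of the curve, where the gap applies. The second estimate is the bound for the left side
  itself.\<close>

lemma left_segment:
 assumes r: "0 < r1" "r1 <= r2" "r2 < pp/qq" and g: "ga > 0" "ra > 0"
  and gap: "!!r0 r. r0 : {r1..r2} ==> 0 < r ==> r <= ra ==> Re (ph r0 r) <= Re (ph r0 r0) - ga"
  and kp: "0 < kp" "kp <= 1"
 obtains rl C N where "0 < rl" "rl < ra" "rl < pp/qq" "C >= 0" "N >= 1"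
  "!!n n1 n2 r0 Q. scaled n n1 n2 ==> n >= N ==> r0 : {r1..r2} ==>
   (ALL w. Im w > 0 --> (Q has_field_derivative contour_fun av1 av2 n1 n2 (LL r0) w) (at w)) ==>
   norm (Q (cor n*Tc (cor rl)) - Q (Complex (-kp) (n*Y rl))) <= C*n*exp (n*(Re (ph r0 r0) - Re kp0 - ga/2))"
  "!!n n1 n2 r0. scaled n n1 n2 ==> n >= N ==> r0 : {r1..r2} ==>
   norm (Npr av1 av2 n1 n2 (cor (n*Y rl)))/(kp*norm (Npr av1 av2 n1 n2 (of_nat (n1 + n2))))*exp (- (kp*LL r0))
    <= C*exp (n*(Re (ph r0 r0) - Re kp0 - ga/2))"
proof -
 obtain ro where ro: "ro > 0" "!!t. Im t > 0 ==> norm t <= ro ==> Re (hs t) + LL r1 >= 0" by (rule Re_hs_small) (rule that)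
 \<comment> \<open>The gap inequality in the limit r -> 0; it will bound the left side of the
   rectangle.\<close>
 have v0: "v0 - Re (lf 2) <= Re (ph r0 r0) - ga" if r0: "r0 : {r1..r2}" for r0
 proof (rule tendsto_upperbound[OF Re_ph_limit_0[of r0]])
  have "eventually (%x. x < ra) (at_right 0)" using eventually_at_right_real[OF g(2)] by (auto elim: eventually_mono)
  with conjunct2[OF ev_small] show "\<forall>\<^sub>F x in at_right 0. Re (ph r0 x) <= Re (ph r0 r0) - ga"
   by eventually_elim (rule gap[OF r0], auto)
 qed simp
 have "eventually (%x. (0 < x & x < pp/qq) & (x < ra & (x < ro/3 & (Y x < ro/3 & Re (hN (cor (Y x))) < v0 + ga/2)))) (at_right 0)"
  by (intro eventually_conj conjunct2[OF ev_small] order_tendstoD(2)[OF Y_limit_0] order_tendstoD(2)[OF Re_hN_limit_0] order_tendstoD(2)[OF tendsto_ident_at])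
   (use g ro in auto)
 then obtain rl where rl: "0 < rl" "rl < pp/qq" "rl < ra" "rl < ro/3" "Y rl < ro/3" "Re (hN (cor (Y rl))) < v0 + ga/2"
  using eventually_happens'[of "at_right (0::real)"] by (metis (no_types, lifting) trivial_limit_at_right_real)
 define y where "y = Y rl"
 have y: "y > 0" using Tc_real(2)[OF rl(1,2)] by (simp add: y_def)
 obtain K N1 where K: "K >= 0" "N1 >= 1"
  "!!n n1 n2 t ell. scaled n n1 n2 ==> n >= N1 ==> Im t >= y ==>
   norm (contour_fun av1 av2 n1 n2 ell (cor n*t)) <= K*norm (A0 t)*exp (n*(Re (h0 t) + ell * Re t - Re kp0))"
  by (rule contour_fun_bound[OF y]) (rule that)
 obtain M where M: "M >= 0" "!!x. x : {-1..rl} ==> norm (A0 (Complex x y)) <= M" by (rule A0_bound_horizontal[OF y]) (rule that)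
 define et where "et = min y 2"
 have et: "et > 0" using y by (simp add: et_def)
 obtain C2 N2 where 2: "C2 >= 0" "N2 > 0"
  "!!n n1 n2 t. scaled n n1 n2 ==> n >= N2 ==> clear_right et t ==>
   EX e. norm e <= C2/n & Npr av1 av2 n1 n2 (cor n*t) = exp (cor n*hN t + cor (2*n*ln n) + eN t + e)"
  by (rule Npr_asymptotics[OF et]) (rule that)
 have cr: "clear_right et (cor u)" if "u >= et" for u
 proof -
  have "norm (cor u + cor ta) >= et" if "ta >= 0" for ta
  proof -
   have "cor u + cor ta = cor (u + ta)" by simp
   thus ?thesis using \<open>u >= et\<close> et that by (simp only: norm_of_real)
  qed
  thus ?thesis using that et by (auto simp: clear_right_def upper_slit_def complex_nonpos_Reals_iff)
 qed
 define C3 where "C3 = exp (Re (eN (cor y)) - Re (eN 2) + 2*C2)/kp*exp (- (kp*LL r1))"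
 define C where "C = max (K*M*(rl + 1)) C3"
 define N where "N = max (max N1 N2) (3/ro)"
 have N: "N >= N1" "N >= N2" "N >= 3/ro" "N >= 1" using K(2) by (auto simp: N_def)
 show ?thesis
 proof (rule that[OF rl(1,3,2), of C N])
  show "C >= 0" using K(1) M(1) rl(1) by (simp add: C_def le_max_iff_disj)
  show "N >= 1" by (rule N)
 next
  fix n n1 n2 r0 and Q :: "complex => complex"
  assume h: "scaled n n1 n2" "n >= N" "r0 : {r1..r2}"
   and Q0: "ALL w. Im w > 0 --> (Q has_field_derivative contour_fun av1 av2 n1 n2 (LL r0) w) (at w)"
  note Q = Q0[rule_format]
  have n: "n >= 1" "n >= N1" "n > 0" "n >= 3/ro" using h(2) N by linarith+
  have kn: "kp/n <= 1" "kp/n <= ro/3"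
  proof -
   have "3 <= n*ro" using n(4) ro(1) by (simp add: divide_le_eq)
   hence "kp*3 <= n*ro" using kp by linarith
    thus "kp/n <= ro/3" using n by (simp add: divide_le_eq mult.commute)
   show "kp/n <= 1" using kp n by simp
  qed
  define u v where "u = Complex (-kp) (n*y)" and "v = cor n*Tc (cor rl)"
  have v: "v = Complex (n*rl) (n*y)" using Tc_real(1)[OF rl(1,2)] by (simp add: v_def y_def complex_eq_iff)
  define B where "B = K*M*exp (n*(Re (ph r0 r0) - Re kp0 - ga))"
  have bd: "norm (contour_fun av1 av2 n1 n2 (LL r0) w) <= B" and imw: "Im w > 0" if w: "w : closed_segment u v" for w
  proof -
   have w': "Im w = n*y" "- kp <= Re w" "Re w <= n*rl"
   proof -
    have "0 <= n*rl" using n rl by simp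
    thus "Im w = n*y" "- kp <= Re w" "Re w <= n*rl" using w kp unfolding u_def v
     by (auto simp: closed_segment_same_Im closed_segment_eq_real_ivl split: if_splits)
   qed
   show "Im w > 0" using w'(1) n y by simp
   define x where "x = Re w/n"
   have x: "- (kp/n) <= x" "x <= rl"
    using w'(2,3) n by (simp_all add: x_def divide_le_eq mult.commute pos_le_divide_eq)
   have wx: "w = cor n*Complex x y" using w'(1) n by (simp add: complex_eq_iff x_def)
   have "norm (A0 (Complex x y)) <= M" by (rule M(2)) (use x kn in auto)
   moreover have "Re (h0 (Complex x y)) + LL r0*x <= Re (h0 (Complex rl y)) + LL r0*rl"
   proof (rule DERIV_nonneg_imp_nondecreasing[OF x(2), of "%x. Re (h0 (Complex x y)) + LL r0*x"])
    fix x' assume x': "x <= x'" "x' <= rl"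
    have "norm (Complex x' y) <= \<bar>x'\<bar> + \<bar>y\<bar>" using cmod_le[of "Complex x' y"] by simp
    also have "... <= ro" using x' x kn(2) rl(4,5) y by (simp add: y_def[symmetric])
    finally have "Re (hs (Complex x' y)) + LL r1 >= 0" using ro(2)[of "Complex x' y"] y by simp
    moreover have "LL r1 <= LL r0" by (rule LL_mono) (use h(3) r in auto)
    ultimately have "Re (hs (Complex x' y)) + LL r0 >= 0" by linarith
    thus "EX z. ((%x. Re (h0 (Complex x y)) + LL r0*x) has_real_derivative z) (at x') & 0 <= z"
     using h_horizontal_deriv[OF y] by blast
   qed
   moreover have "Re (h0 (Complex rl y)) + LL r0*rl <= Re (ph r0 r0) - ga"
    using gap[OF h(3) rl(1)] rl Re_ph[OF rl(1,2), of r0] by (simp add: y_def)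
   ultimately have "K*norm (A0 (Complex x y))*exp (n*(Re (h0 (Complex x y)) + LL r0 * Re (Complex x y) - Re kp0)) <= B"
    unfolding B_def using K(1) M(1) n by (intro mult_mono exp_gap_mono) auto
   thus "norm (contour_fun av1 av2 n1 n2 (LL r0) w) <= B"
    using K(3)[OF h(1) n(2), of "Complex x y" "LL r0"] unfolding wx by simp
  qed
  have B0: "B >= 0" using K(1) M(1) by (simp add: B_def)
  have "norm (Q v - Q u) <= B*norm (v - u)"
   by (rule field_differentiable_bound[of "closed_segment u v" Q "contour_fun av1 av2 n1 n2 (LL r0)"])
    (use bd imw Q in \<open>auto intro: has_field_derivative_at_within\<close>)
  also have "norm (v - u) = n*rl + kp"
  proof -
   have "v - u = cor (n*rl + kp)" unfolding u_def v by (simp add: complex_eq_iff)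
   moreover have "n*rl + kp >= 0" using n rl kp by simp
   ultimately show ?thesis by (simp only: norm_of_real abs_of_nonneg)
  qed
  also have "B*(n*rl + kp) <= B*(n*(rl + 1))" using B0 n kp by (intro mult_left_mono) (auto simp: algebra_simps)
  also have "... = (K*M*(rl + 1))*n*exp (n*(Re (ph r0 r0) - Re kp0 - ga))" by (simp add: B_def mult_ac)
  also have "... <= C*n*exp (n*(Re (ph r0 r0) - Re kp0 - ga/2))"
   using n K(1) M(1) rl(1) g by (intro mult_mono exp_gap_mono) (auto simp: C_def le_max_iff_disj)
  finally show "norm (Q (cor n*Tc (cor rl)) - Q (Complex (-kp) (n*Y rl))) <= C*n*exp (n*(Re (ph r0 r0) - Re kp0 - ga/2))"
   by (simp add: u_def v_def y_def)
 next
  fix n n1 n2 r0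
  assume h: "scaled n n1 n2" "n >= N" "r0 : {r1..r2}"
  have n: "n >= 1" "n >= N2" "n > 0" using h(2) N by linarith+
  have two: "clear_right et 2" using cr[of 2] by (simp add: et_def)
  have yy: "clear_right et (cor y)" using cr[of y] by (simp add: et_def)
  obtain e1 where e1: "norm e1 <= C2/n" "Npr av1 av2 n1 n2 (cor n * cor y) = exp (cor n*hN (cor y) + cor (2*n*ln n) + eN (cor y) + e1)"
   using 2(3)[OF h(1) n(2) yy] by blast
  obtain e2 where e2: "norm e2 <= C2/n" "Npr av1 av2 n1 n2 (cor n*2) = exp (cor n*hN 2 + cor (2*n*ln n) + eN 2 + e2)"
   using 2(3)[OF h(1) n(2) two] by blast
  have d: "of_nat (n1 + n2) = cor n*2"
   using arg_cong[OF scaled_sum[OF h(1)], of cor] by (simp add: mult.commute)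
  have "C2/n <= C2" using 2(1) n by (simp add: divide_le_eq mult_le_cancel_left1)
  hence ee: "Re e1 <= C2" "- Re e2 <= C2" using e1(1) e2(1) abs_Re_le_cmod[of e1] abs_Re_le_cmod[of e2] by linarith+
  have "norm (Npr av1 av2 n1 n2 (cor (n*y)))/(kp*norm (Npr av1 av2 n1 n2 (of_nat (n1 + n2))))
   = exp ((n * Re (hN (cor y)) + 2*n*ln n + Re (eN (cor y)) + Re e1) - (n * Re (hN 2) + 2*n*ln n + Re (eN 2) + Re e2))/kp"
   unfolding d of_real_mult e1(2) e2(2) norm_exp_eq_Re exp_diff by simp
  also have "... <= exp ((Re (eN (cor y)) - Re (eN 2) + 2*C2) + n*(Re (ph r0 r0) - Re kp0 - ga/2))/kp"
  proof (rule divide_right_mono)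
   have "Re (hN (cor y)) - Re (hN 2) <= Re (ph r0 r0) - Re kp0 - ga/2"
    using rl(6) v0[OF h(3)] by (simp add: kp0_def y_def)
   hence "n*(Re (hN (cor y)) - Re (hN 2)) <= n*(Re (ph r0 r0) - Re kp0 - ga/2)" using n by (intro mult_left_mono) auto
   hence "n * Re (hN (cor y)) - n * Re (hN 2) <= n*(Re (ph r0 r0) - Re kp0 - ga/2)" by (simp only: right_diff_distrib)
   thus "exp ((n * Re (hN (cor y)) + 2*n*ln n + Re (eN (cor y)) + Re e1) - (n * Re (hN 2) + 2*n*ln n + Re (eN 2) + Re e2))
    <= exp ((Re (eN (cor y)) - Re (eN 2) + 2*C2) + n*(Re (ph r0 r0) - Re kp0 - ga/2))"
    using ee unfolding exp_le_cancel_iff by linarith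
  qed (use kp in simp)
  finally have b1: "norm (Npr av1 av2 n1 n2 (cor (n*y)))/(kp*norm (Npr av1 av2 n1 n2 (of_nat (n1 + n2))))
   <= exp ((Re (eN (cor y)) - Re (eN 2) + 2*C2) + n*(Re (ph r0 r0) - Re kp0 - ga/2))/kp" .
  have "LL r1 <= LL r0" by (rule LL_mono) (use h(3) r in auto)
  hence b2: "exp (- (kp*LL r0)) <= exp (- (kp*LL r1))" using kp by simp
  have "norm (Npr av1 av2 n1 n2 (cor (n*y)))/(kp*norm (Npr av1 av2 n1 n2 (of_nat (n1 + n2))))*exp (- (kp*LL r0))
   <= exp ((Re (eN (cor y)) - Re (eN 2) + 2*C2) + n*(Re (ph r0 r0) - Re kp0 - ga/2))/kp*exp (- (kp*LL r1))"
   using kp by (intro mult_mono b1 b2) auto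
  also have "... = C3*exp (n*(Re (ph r0 r0) - Re kp0 - ga/2))"
   unfolding C3_def exp_add by simp
  also have "... <= C*exp (n*(Re (ph r0 r0) - Re kp0 - ga/2))" by (intro mult_right_mono) (auto simp: C_def)
  finally show "norm (Npr av1 av2 n1 n2 (cor (n*Y rl)))/(kp*norm (Npr av1 av2 n1 n2 (of_nat (n1 + n2))))*exp (- (kp*LL r0))
    <= C*exp (n*(Re (ph r0 r0) - Re kp0 - ga/2))" by (simp add: y_def)
 qed
qed

text \<open>A horizontal segment from the end of the curve to Re w = L. The end is chosen so high
  that Re hs <= de = - LL r2/2; since LL r0 <= LL r2, the exponent still falls at rate de. The
  resulting exponential is integrable, which makes the bound independent of L.\<close>

lemma right_segment:
 assumes r: "0 < r1" "r1 <= r2" "r2 < pp/qq" and g: "ga > 0" "rb < pp/qq"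
  and gap: "!!r0 r. r0 : {r1..r2} ==> rb <= r ==> r < pp/qq ==> Re (ph r0 r) <= Re (ph r0 r0) - ga"
 obtains rh C N where "rb <= rh" "0 < rh" "rh < pp/qq" "C >= 0" "N >= 1"
  "!!n n1 n2 r0 Q L. scaled n n1 n2 ==> n >= N ==> r0 : {r1..r2} ==>
   (ALL w. Im w > 0 --> (Q has_field_derivative contour_fun av1 av2 n1 n2 (LL r0) w) (at w)) ==> L > n*rh ==>
   norm (Q (Complex L (n*Y rh)) - Q (cor n*Tc (cor rh))) <= C*n*exp (n*(Re (ph r0 r0) - Re kp0 - ga/2))"
proof -
 define de where "de = - LL r2/2"
 have de: "de > 0" using LL_neg[of r2] r by (simp add: de_def)
 have e: "pp/qq - rb > 0" using g by simp
 obtain rh where rh: "pp/qq - (pp/qq - rb) <= rh" "0 < rh" "rh < pp/qq" "Y rh >= max 4 (6/de)" by (rule Y_unbounded[OF e]) (rule that)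
 have rb: "rb <= rh" using rh(1) by simp
 define y where "y = Y rh"
 have y: "y >= 4" "y >= 6/de" "y > 0" using rh(4) by (auto simp: y_def)
 obtain K N1 where K: "K >= 0" "N1 >= 1"
  "!!n n1 n2 t ell. scaled n n1 n2 ==> n >= N1 ==> Im t >= y ==>
   norm (contour_fun av1 av2 n1 n2 ell (cor n*t)) <= K*norm (A0 t)*exp (n*(Re (h0 t) + ell * Re t - Re kp0))"
  by (rule contour_fun_bound[OF y(3)]) (rule that)
 obtain M where M: "M >= 0" "!!t. Im t > 0 ==> Im t >= 4 ==> norm (A0 t) <= M" by (rule A0_bound_large) (rule that)
 show ?thesis
 proof (rule that[OF rb rh(2,3), of "K*M/de" N1])
  show "K*M/de >= 0" using K(1) M(1) de by simp
  show "N1 >= 1" by (rule K)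
  fix n n1 n2 r0 L and Q :: "complex => complex"
  assume h: "scaled n n1 n2" "n >= N1" "r0 : {r1..r2}"
   and Q0: "ALL w. Im w > 0 --> (Q has_field_derivative contour_fun av1 av2 n1 n2 (LL r0) w) (at w)" and L: "L > n*rh"
  note Q = Q0[rule_format]
  have n: "n >= 1" "n > 0" using h(2) K(2) by linarith+
  define b where "b = L/n"
  have b: "rh < b" using L n by (simp add: b_def less_divide_eq mult.commute)
  define E where "E = K*M*exp (n*(Re (ph r0 r0) - Re kp0 - ga))"
  have E: "E >= 0" using K(1) M(1) by (simp add: E_def)
  define F where "F = (%x. Q (cor n*Complex x y))"
  define fy where "fy = (%x. - E/de*exp (- (n*de*(x - rh))))"
  have dF: "(F has_vector_derivative contour_fun av1 av2 n1 n2 (LL r0) (cor n*Complex x y) * cor n) (at x)" for x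
  proof -
   have i: "cor n*Complex x y = cor n*(cor x + \<i> * cor y)" for x by (simp add: complex_eq_iff)
   have "((%z. Q (cor n*(z + \<i> * cor y))) has_field_derivative contour_fun av1 av2 n1 n2 (LL r0) (cor n*(cor x + \<i> * cor y)) * cor n) (at (cor x))"
    by (rule DERIV_chain2[of Q]) (use n y in \<open>auto intro!: Q derivative_eq_intros\<close>)
   thus ?thesis unfolding F_def i by (rule has_vector_derivative_real_field)
  qed
  have dfy: "(fy has_vector_derivative n*E*exp (- (n*de*(x - rh)))) (at x)" for x
   unfolding fy_def has_real_derivative_iff_has_vector_derivative[symmetric]
   by (rule derivative_eq_intros refl)+ (use de in simp)
  have bd: "norm (contour_fun av1 av2 n1 n2 (LL r0) (cor n*Complex x y) * cor n) <= n*E*exp (- (n*de*(x - rh)))" if x: "rh < x" for x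
  proof -
   have "(Re (h0 (Complex x y)) + (LL r0 + de)*x) <= (Re (h0 (Complex rh y)) + (LL r0 + de)*rh)"
   proof (rule DERIV_nonpos_imp_nonincreasing[of rh x "%x. Re (h0 (Complex x y)) + (LL r0 + de)*x"])
    fix x'
    have "y <= norm (Complex x' y)" using abs_Im_le_cmod[of "Complex x' y"] by simp
    hence "6/norm (Complex x' y) <= 6/y" using y by (intro divide_left_mono mult_pos_pos) auto
    also have "... <= de" using y de by (simp add: divide_le_eq mult.commute)
    finally have "Re (hs (Complex x' y)) <= de" using Re_hs_large[of "Complex x' y"] y by simp
    moreover have "LL r0 <= LL r2" by (rule LL_mono) (use h(3) r in auto)
    ultimately have "Re (hs (Complex x' y)) + (LL r0 + de) <= 0" by (simp add: de_def)
    thus "EX z. ((%x. Re (h0 (Complex x y)) + (LL r0 + de)*x) has_real_derivative z) (at x') & z <= 0"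
     using h_horizontal_deriv[OF y(3)] by blast
   qed (use x in simp)
   moreover have "Re (h0 (Complex rh y)) + LL r0*rh <= Re (ph r0 r0) - ga"
    using gap[OF h(3) rb rh(3)] Re_ph[OF rh(2,3), of r0] by (simp add: y_def)
   ultimately have "Re (h0 (Complex x y)) + LL r0*x - Re kp0 <= (Re (ph r0 r0) - Re kp0 - ga) + - (de*(x - rh))" by (simp add: algebra_simps)
   hence "exp (n*(Re (h0 (Complex x y)) + LL r0*x - Re kp0)) <= exp (n*((Re (ph r0 r0) - Re kp0 - ga) + - (de*(x - rh))))"
    using n by (intro exp_gap_mono) auto
   also have "... = exp (n*(Re (ph r0 r0) - Re kp0 - ga))*exp (- (n*de*(x - rh)))"
    unfolding exp_add[symmetric] by (rule arg_cong[of _ _ exp]) (simp add: algebra_simps)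
   finally have e1: "exp (n*(Re (h0 (Complex x y)) + LL r0*x - Re kp0)) <= exp (n*(Re (ph r0 r0) - Re kp0 - ga))*exp (- (n*de*(x - rh)))" .
   have "norm (contour_fun av1 av2 n1 n2 (LL r0) (cor n*Complex x y)) <= K*norm (A0 (Complex x y))*exp (n*(Re (h0 (Complex x y)) + LL r0 * Re (Complex x y) - Re kp0))"
    by (rule K(3)[OF h(1,2)]) simp
   also have "... <= K*M*(exp (n*(Re (ph r0 r0) - Re kp0 - ga))*exp (- (n*de*(x - rh))))"
    using e1 M(2)[of "Complex x y"] y K(1) M(1) by (intro mult_mono) auto
   also have "... = E*exp (- (n*de*(x - rh)))" by (simp add: E_def)
   finally have "norm (contour_fun av1 av2 n1 n2 (LL r0) (cor n*Complex x y)) <= E*exp (- (n*de*(x - rh)))" .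
   from mult_right_mono[OF this, of n] show ?thesis using n by (simp add: norm_mult mult_ac)
  qed
  have "norm (F b - F rh) <= fy b - fy rh"
  proof (rule differentiable_bound_general[OF b])
   show "continuous_on {rh..b} F" using dF has_vector_derivative_continuous continuous_at_imp_continuous_on by blast
   show "continuous_on {rh..b} fy" unfolding fy_def by (intro continuous_intros)
  qed (use dF dfy bd in auto)
  also have "... <= E/de" using E de by (simp add: fy_def)
  also have "... = K*M/de*1*exp (n*(Re (ph r0 r0) - Re kp0 - ga))" by (simp add: E_def)
  also have "... <= K*M/de*n*exp (n*(Re (ph r0 r0) - Re kp0 - ga/2))"
   using n K(1) M(1) de g by (intro mult_mono exp_gap_mono) auto
  also have "F b = Q (Complex L (n*Y rh))"
  proof -
   have "cor n*Complex b y = Complex L (n*y)" using n by (simp add: complex_eq_iff b_def)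
   thus ?thesis by (simp add: F_def y_def)
  qed
  also have "F rh = Q (cor n*Tc (cor rh))" unfolding F_def y_def Tc_real(1)[OF rh(2,3)] ..
  finally show "norm (Q (Complex L (n*Y rh)) - Q (cor n*Tc (cor rh))) <= K*M/de*n*exp (n*(Re (ph r0 r0) - Re kp0 - ga/2))" .
 qed
qed

end

section \<open>The two saddle points together: P on (0,1)\<close>

context jpt
begin

definition pk0 :: "real => complex" where "pk0 r0 = ph r0 r0 - kp0"

text \<open>The constant comes from sqrt (4 pi n) sqrt (2 pi/n) = 2 pi sqrt 2, divided by -2 pi i.
  The sign is minus because the poles are encircled counterclockwise, so the upper path runs from
  right to left.\<close>

definition amp0 :: "real => complex" where
 "amp0 r0 = cor (sqrt 2) * \<i> * (Bc (cor r0)/csqrt (deriv Tc (cor r0) * cor (LL' r0)))"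

text \<open>Keeps the part of the curve with r >= rl at height at least rl, where
  \<open>G_asymptotics\<close> is uniform.\<close>

lemma Y_ge: assumes r: "0 < r" "r < pp/qq" shows "Y r >= r"
proof -
 have "pp - qq*r > 0" using r qq by (simp add: less_divide_eq mult.commute)
 hence "1 <= (3 * pp + qq*r)/(pp - qq*r)" using r pp qq mult_pos_pos[of qq r] by (simp add: le_divide_eq)
 hence "1 <= sqrt ((3 * pp + qq*r)/(pp - qq*r))" by simp
 thus ?thesis using r mult_left_mono[of 1 "sqrt ((3 * pp + qq*r)/(pp - qq*r))" r] by (simp add: Y_def)
qed

text \<open>On the curve the integrand is its asymptotic form up to a relative error of order 1/n.
  Weighted with the Gaussian bound from \<open>Re_phase_le\<close> this error contributes O(1/n),
  and the asymptotic form is evaluated by \<open>laplace_uniform\<close>.\<close>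

lemma curve_part:
 assumes b: "0 < rl" "rl < r1" "r1 <= r2" "r2 < rh" "rh < pp/qq"
 obtains C N where "C >= 0" "N >= 1"
  "!!n n1 n2 r0 Q. scaled n n1 n2 ==> n >= N ==> r0 : {r1..r2} ==>
   (ALL w. Im w > 0 --> (Q has_field_derivative contour_fun av1 av2 n1 n2 (LL r0) w) (at w)) ==>
   norm (Q (cor n*Tc (cor rh)) - Q (cor n*Tc (cor rl)) + cor (2 * pi) * \<i> * (exp (cor n * pk0 r0)*amp0 r0))
    <= C/n*exp (n * Re (pk0 r0))"
proof -
 have lh: "rl < rh" using b by linarith
 obtain m where m: "m > 0" "!!r. r : {rl..rh} ==> LL' r >= m" by (rule LL'_bound[OF b(1) less_imp_le[OF lh] b(5)]) (rule that)
 interpret L: laplace_curve S1 "%z. h0 (Tc z)" Tc Bc LL LL' rl rh m by (rule laplace_positive[OF b(1) lh b(5) m])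
 have phe: "L.phase = ph" by (simp add: L.phase_def ph_def fun_eq_iff)
 define de where "de = min (r1 - rl) (rh - r2)"
 have de: "de > 0" "de <= r1 - rl" "de <= rh - r2" using b by (auto simp: de_def)
 obtain C1 where C1: "C1 >= 0" "!!n r0. n >= 1 ==> r0 : {rl+de..rh-de} ==>
  norm (integral {rl..rh} (%r. exp (cor n*L.phase r0 r)*Bc (cor r))
   - exp (cor n*L.phase r0 r0)*(Bc (cor r0) * cor (sqrt (2 * pi/n))/csqrt (deriv Tc (cor r0) * cor (LL' r0))))
  <= C1/(n * sqrt n)*exp (n * Re (L.phase r0 r0))"
  by (rule L.laplace_uniform[OF de(1)]) (rule that)
 obtain C2 N2 where C2: "C2 >= 0" "N2 > 0"
  "!!n n1 n2 t. scaled n n1 n2 ==> n >= N2 ==> far rl t ==>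
   EX e. norm e <= C2/n & G n1 n2 (cor n*t) = cor (sqrt (4 * pi/n))*exp (cor n*(h0 t - kp0))*A0 t*exp e"
  by (rule G_asymptotics[OF b(1)]) (rule that)
 have contreal: "continuous_on {rl..rh} (%r. f (cor r))" if "f holomorphic_on S1" for f :: "complex => complex"
  by (rule continuous_on_compose2[OF holomorphic_on_imp_continuous_on[OF that]]) (use L.sub in \<open>auto intro!: continuous_intros\<close>)
 have "bounded ((%r. Bc (cor r)) ` {rl..rh})"
  by (intro compact_imp_bounded compact_continuous_image contreal L.hol) auto
 then obtain M where M: "M > 0" "!!r. r : {rl..rh} ==> norm (Bc (cor r)) <= M" by (auto simp: bounded_pos)
 define C where "C = 3*C2*M*(sqrt 8 * pi/sqrt m) + sqrt (4 * pi)*C1"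
 define N where "N = max (max N2 1) C2"
 show ?thesis
 proof (rule that[of C N])
  show "C >= 0" unfolding C_def using C2(1) C1(1) M(1) m(1) by (intro add_nonneg_nonneg mult_nonneg_nonneg) auto
  show "N >= 1" by (simp add: N_def)
  fix n n1 n2 r0 and Q :: "complex => complex"
  assume h: "scaled n n1 n2" "n >= N" "r0 : {r1..r2}"
   and Q0: "ALL w. Im w > 0 --> (Q has_field_derivative contour_fun av1 av2 n1 n2 (LL r0) w) (at w)"
  note Q = Q0[rule_format]
  have n: "n >= 1" "n >= N2" "n >= C2" "n > 0" using h(2) by (auto simp: N_def)
  have r0: "r0 : {rl..rh}" "r0 : {rl+de..rh-de}" using h(3) b de by auto
  have rr: "0 < r" "r < pp/qq" if "r : {rl..rh}" for r using that b by auto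
  define c where "c = cor (sqrt (4 * pi*n))*exp (- (cor n * kp0))"
  define F' where "F' = (%r. contour_fun av1 av2 n1 n2 (LL r0) (cor n*Tc (cor r))*(cor n*deriv Tc (cor r)))"
  define g where "g = (%r. exp (cor n * ph r0 r)*Bc (cor r))"
  define V where "V = Re (ph r0 r0)"
  have dF: "((%r. Q (cor n*Tc (cor r))) has_vector_derivative F' r) (at r within {rl..rh})" if r: "r : {rl..rh}" for r
  proof -
   have "Im (cor n*Tc (cor r)) > 0" using Tc_real(1,2)[OF rr[OF r]] n by simp
   hence "((%z. Q (cor n*Tc z)) has_field_derivative F' r) (at (cor r))"
    unfolding F'_def by (intro DERIV_chain2[of Q] Q DERIV_cmult holomorphic_derivI[OF L.hol(2) open_S1 L.sub[OF r]])
   thus ?thesis by (rule has_vector_derivative_at_within[OF has_vector_derivative_real_field])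
  qed
  have iF: "(F' has_integral (Q (cor n*Tc (cor rh)) - Q (cor n*Tc (cor rl)))) {rl..rh}"
   by (rule fundamental_theorem_of_calculus[of rl rh "%r. Q (cor n*Tc (cor r))"]) (use lh dF in auto)
  have cg: "continuous_on {rl..rh} g"
   unfolding g_def ph_def by (intro continuous_intros contreal L.hol) auto
  have ig: "g integrable_on {rl..rh}" by (rule integrable_continuous_real[OF cg])
  have pt: "norm (F' r - c*g r) <= norm c*(M*(3*C2/n)*exp (n*V))*exp (- (n * m*(r - r0)^2/2))" if r: "r : {rl..rh}" for r
  proof -
   have fr: "far rl (Tc (cor r))" unfolding far_def
   proof (intro conjI allI impI)
    have i: "Im (Tc (cor r)) >= rl" using Tc_real(1)[OF rr[OF r]] Y_ge[OF rr[OF r]] r by simp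
    thus "0 <= Im (Tc (cor r))" using b by simp
    show "rl <= norm (Tc (cor r) - cor ta)" for ta using abs_Im_le_cmod[of "Tc (cor r) - cor ta"] i by simp
   qed
   obtain e where e: "norm e <= C2/n" "G n1 n2 (cor n*Tc (cor r)) = cor (sqrt (4 * pi/n))*exp (cor n*(h0 (Tc (cor r)) - kp0))*A0 (Tc (cor r))*exp e"
    using C2(3)[OF h(1) n(2) fr] by blast
   have sq: "sqrt (4 * pi/n)*n = sqrt (4 * pi*n)"
   proof -
    have "sqrt (4 * pi*n) = sqrt (4 * pi/n*n^2)" using n by (simp add: power2_eq_square)
    also have "... = sqrt (4 * pi/n) * sqrt (n^2)" by (rule real_sqrt_mult)
    also have "sqrt (n^2) = n" using n by simp
    finally show ?thesis by simp
   qed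
   have "F' r = cor (sqrt (4 * pi/n)*n)*(exp (cor n*(h0 (Tc (cor r)) - kp0))*exp (cor n*Tc (cor r) * cor (LL r0)))*Bc (cor r)*exp e"
   proof -
    have "contour_fun av1 av2 n1 n2 (LL r0) (cor n*Tc (cor r)) = G n1 n2 (cor n*Tc (cor r))*exp (cor n*Tc (cor r) * cor (LL r0))"
     by (simp add: contour_fun_def G_def)
    thus ?thesis unfolding F'_def e(2) Bc_def by simp
   qed
   also have "exp (cor n*(h0 (Tc (cor r)) - kp0))*exp (cor n*Tc (cor r) * cor (LL r0)) = exp (- (cor n * kp0))*exp (cor n * ph r0 r)"
    unfolding exp_add[symmetric] by (rule arg_cong[of _ _ exp]) (simp add: ph_def algebra_simps)
   also have "cor (sqrt (4 * pi/n)*n)*(exp (- (cor n * kp0))*exp (cor n * ph r0 r))*Bc (cor r)*exp e = c*g r*exp e"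
    unfolding sq c_def g_def by (simp add: mult_ac)
   finally have "F' r - c*g r = c*g r*(exp e - 1)" by (simp add: algebra_simps)
   hence "norm (F' r - c*g r) = norm c*(exp (n * Re (ph r0 r))*norm (Bc (cor r)))*norm (exp e - 1)" by (simp add: norm_mult g_def)
   also have "... <= norm c*(exp (n*V + - (n * m*(r - r0)^2/2))*M)*(3*(C2/n))"
   proof (intro mult_mono mult_left_mono)
    have "Re (ph r0 r) <= V - m/2*(r - r0)^2" unfolding V_def phe[symmetric] by (rule L.Re_phase_le[OF r0(1) r])
    hence "n * Re (ph r0 r) <= n*(V - m/2*(r - r0)^2)" using n by (intro mult_left_mono) auto
    thus "exp (n * Re (ph r0 r)) <= exp (n*V + - (n * m*(r - r0)^2/2))" by (simp add: algebra_simps)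
    have "C2/n <= 1" using n by simp
    hence "norm e <= 1" using e(1) by linarith
    from exp_minus_one_le[OF this] show "norm (exp e - 1) <= 3*(C2/n)" using e(1) by linarith
   qed (use M r in \<open>auto intro: less_imp_le\<close>)
   also have "... = norm c*(M*(3*C2/n)*exp (n*V))*exp (- (n * m*(r - r0)^2/2))" unfolding exp_add by simp
   finally show ?thesis .
  qed
  define gs where "gs = (%r. exp (- (n * m*(r - r0)^2/2)))"
  have nm: "n * m > 0" using n m by simp
  have gi: "(gs has_integral sqrt (2 * pi/(n * m))) UNIV" unfolding gs_def by (rule gaussian_has_integral_centered[OF nm])
  have gc: "gs integrable_on {rl..rh}" unfolding gs_def by (intro integrable_continuous_real continuous_intros) auto
  have gle: "integral {rl..rh} gs <= sqrt (2 * pi/(n * m))"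
   using integral_subset_le[of "{rl..rh}" UNIV gs] gi gc by (simp add: integral_unique has_integral_integrable gs_def)
  have "norm (integral {rl..rh} (%r. F' r - c*g r)) <= integral {rl..rh} (%r. norm c*(M*(3*C2/n)*exp (n*V))*gs r)"
  proof (rule integral_norm_bound_integral)
   show "(%r. F' r - c*g r) integrable_on {rl..rh}"
    by (intro integrable_diff has_integral_integrable[OF iF] integrable_continuous_real continuous_on_mult_left cg)
   show "(%r. norm c*(M*(3*C2/n)*exp (n*V))*gs r) integrable_on {rl..rh}"
    unfolding gs_def by (intro integrable_continuous_real continuous_intros) auto
  qed (use pt in \<open>simp only: gs_def\<close>)
  also have "... = norm c*(M*(3*C2/n)*exp (n*V))*integral {rl..rh} gs" by simp
  also have "... <= norm c*(M*(3*C2/n)*exp (n*V)) * sqrt (2 * pi/(n * m))"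
   using gle M C2(1) n by (intro mult_left_mono) auto
  also have "norm c = sqrt (4 * pi*n)*exp (- (n * Re kp0))" using n by (simp add: c_def norm_mult)
  also have "sqrt (4 * pi*n)*exp (- (n * Re kp0))*(M*(3*C2/n)*exp (n*V)) * sqrt (2 * pi/(n * m))
   = (3*C2*M/n)*(sqrt (4 * pi*n) * sqrt (2 * pi/(n * m)))*(exp (- (n * Re kp0))*exp (n*V))" by simp
  also have "sqrt (4 * pi*n) * sqrt (2 * pi/(n * m)) = sqrt 8 * pi/sqrt m"
  proof -
   have "sqrt (4 * pi*n) * sqrt (2 * pi/(n * m)) = sqrt (4 * pi*n*(2 * pi/(n * m)))" by (rule real_sqrt_mult[symmetric])
   also have "4 * pi*n*(2 * pi/(n * m)) = 8 * pi^2/m" using n m by (simp add: power2_eq_square field_simps)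
   also have "sqrt (8 * pi^2/m) = sqrt 8 * sqrt (pi^2)/sqrt m" by (simp only: real_sqrt_divide real_sqrt_mult)
   also have "sqrt (pi^2) = pi" by simp
   finally show ?thesis .
  qed
  also have "exp (- (n * Re kp0))*exp (n*V) = exp (n * Re (pk0 r0))"
   unfolding exp_add[symmetric] by (rule arg_cong[of _ _ exp]) (simp add: pk0_def V_def algebra_simps)
  finally have A: "norm (integral {rl..rh} (%r. F' r - c*g r)) <= 3*C2*M/n*(sqrt 8 * pi/sqrt m)*exp (n * Re (pk0 r0))" .
  have int: "integral {rl..rh} (%r. F' r - c*g r) = Q (cor n*Tc (cor rh)) - Q (cor n*Tc (cor rl)) - c*integral {rl..rh} g"
   using iF ig by (simp add: integral_diff has_integral_integrable integrable_on_mult_right integral_unique)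
  define I0 where "I0 = exp (cor n * ph r0 r0)*(Bc (cor r0) * cor (sqrt (2 * pi/n))/csqrt (deriv Tc (cor r0) * cor (LL' r0)))"
  have "norm (integral {rl..rh} g - I0) <= C1/(n * sqrt n)*exp (n*V)"
   using C1(2)[OF n(1) r0(2)] unfolding phe g_def I0_def V_def .
  hence "norm c*norm (integral {rl..rh} g - I0) <= norm c*(C1/(n * sqrt n)*exp (n*V))" by (rule mult_left_mono) simp
  hence "norm (c*integral {rl..rh} g - c*I0) <= norm c*(C1/(n * sqrt n)*exp (n*V))" by (simp add: norm_mult[symmetric] right_diff_distrib)
  also have "... = sqrt (4 * pi)*C1/n*exp (n * Re (pk0 r0))"
  proof -
   have "norm c = sqrt (4 * pi) * sqrt n*exp (- (n * Re kp0))" using n by (simp add: c_def norm_mult real_sqrt_mult)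
   moreover have "exp (n * Re (pk0 r0)) = exp (- (n * Re kp0))*exp (n*V)"
    unfolding exp_add[symmetric] by (rule arg_cong[of _ _ exp]) (simp add: pk0_def V_def algebra_simps)
   moreover have "s*q*e1*(C1/(n*q)*e2) = s*C1/n*(e1*e2)" if "q > 0" for s q e1 e2 :: real using that n by (simp add: field_simps)
   ultimately show ?thesis using n by simp
  qed
  finally have B: "norm (c*integral {rl..rh} g - c*I0) <= sqrt (4 * pi)*C1/n*exp (n * Re (pk0 r0))" .
  have E: "c*I0 = - (cor (2 * pi) * \<i> * (exp (cor n * pk0 r0)*amp0 r0))"
  proof -
   have "sqrt (4 * pi*n) * sqrt (2 * pi/n) = sqrt (4 * pi*n*(2 * pi/n))" by (rule real_sqrt_mult[symmetric])
   also have "4 * pi*n*(2 * pi/n) = (2 * pi)^2*2" using n by (simp add: power2_eq_square)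
   also have "sqrt ... = sqrt ((2 * pi)^2) * sqrt 2" by (rule real_sqrt_mult)
   also have "sqrt ((2 * pi)^2) = 2 * pi" unfolding real_sqrt_abs by (rule abs_of_pos) simp
   finally have s: "cor (sqrt (4 * pi*n)) * cor (sqrt (2 * pi/n)) = cor (2 * pi) * cor (sqrt 2)"
    by (simp only: of_real_mult[symmetric])
   have x: "exp (cor n * pk0 r0) = exp (- (cor n * kp0))*exp (cor n * ph r0 r0)"
    unfolding exp_add[symmetric] by (rule arg_cong[of _ _ exp]) (simp add: pk0_def algebra_simps)
   have "c*I0 = (cor (sqrt (4 * pi*n)) * cor (sqrt (2 * pi/n)))*(exp (- (cor n * kp0))*exp (cor n * ph r0 r0))*(Bc (cor r0)/csqrt (deriv Tc (cor r0) * cor (LL' r0)))"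
    by (simp add: c_def I0_def)
   also have "... = - (cor (2 * pi) * \<i> * (exp (cor n * pk0 r0)*amp0 r0))"
   proof -
    have gen: "p * s*x*y = - (p * \<i> * (x*(s * \<i> * y)))" for p s x y :: complex using i_squared by (simp add: mult_ac)
    show ?thesis unfolding s x[symmetric] amp0_def by (rule gen)
   qed
   finally show ?thesis .
  qed
  have "norm (Q (cor n*Tc (cor rh)) - Q (cor n*Tc (cor rl)) - c*I0)
   <= 3*C2*M/n*(sqrt 8 * pi/sqrt m)*exp (n * Re (pk0 r0)) + sqrt (4 * pi)*C1/n*exp (n * Re (pk0 r0))"
   proof -
   have "Q (cor n*Tc (cor rh)) - Q (cor n*Tc (cor rl)) - c*I0 = integral {rl..rh} (%r. F' r - c*g r) + (c*integral {rl..rh} g - c*I0)"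
    unfolding int by simp
   thus ?thesis by (simp only:) (rule norm_triangle_mono[OF A B])
  qed
  also have "... = C/n*exp (n * Re (pk0 r0))" using n by (simp add: C_def field_simps)
  finally show "norm (Q (cor n*Tc (cor rh)) - Q (cor n*Tc (cor rl)) + cor (2 * pi) * \<i> * (exp (cor n * pk0 r0)*amp0 r0))
    <= C/n*exp (n * Re (pk0 r0))" unfolding E by simp
 qed
qed

lemma poly_positive:
 assumes r: "0 < r1" "r1 <= r2" "r2 < pp/qq"
 obtains C N where "C >= 0" "N > 0" "!!n n1 n2 r0 P. n >= N ==> scaled n n1 n2 ==> r0 : {r1..r2} ==> mop av1 av2 n1 n2 P ==>
  norm (cor (poly P (X r0)) - (exp (cor n * pk0 r0)*amp0 r0 + cnj (exp (cor n * pk0 r0)*amp0 r0)))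
   <= C/n*exp (n * Re (pk0 r0))"
proof -
 obtain ga ra rb where g: "ga > 0" "0 < ra" "ra < r1" "r2 < rb" "rb < pp/qq"
  and gapl: "!!r0 r. r0 : {r1..r2} ==> 0 < r ==> r <= ra ==> Re (ph r0 r) <= Re (ph r0 r0) - ga"
  and gapr: "!!r0 r. r0 : {r1..r2} ==> rb <= r ==> r < pp/qq ==> Re (ph r0 r) <= Re (ph r0 r0) - ga"
  by (rule ph_gap[OF r]) (rule that)
 \<comment> \<open>Half of the distance to the nearest zero, capped, so that the line Re w = -kp
   lies strictly between zeros and poles.\<close>
 define kp where "kp = min 1 (min (1 + av1) (1 + av2))/2"
 have kp: "0 < kp" "kp <= 1" "kp < 1 + av1" "kp < 1 + av2" using av by (auto simp: kp_def min_def)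
 obtain rl Cl Nl where l: "0 < rl" "rl < ra" "rl < pp/qq" "Cl >= 0" "Nl >= 1"
  "!!n n1 n2 r0 Q. scaled n n1 n2 ==> n >= Nl ==> r0 : {r1..r2} ==>
   (ALL w. Im w > 0 --> (Q has_field_derivative contour_fun av1 av2 n1 n2 (LL r0) w) (at w)) ==>
   norm (Q (cor n*Tc (cor rl)) - Q (Complex (-kp) (n*Y rl))) <= Cl*n*exp (n*(Re (ph r0 r0) - Re kp0 - ga/2))"
  "!!n n1 n2 r0. scaled n n1 n2 ==> n >= Nl ==> r0 : {r1..r2} ==>
   norm (Npr av1 av2 n1 n2 (cor (n*Y rl)))/(kp*norm (Npr av1 av2 n1 n2 (of_nat (n1 + n2))))*exp (- (kp*LL r0))
    <= Cl*exp (n*(Re (ph r0 r0) - Re kp0 - ga/2))"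
  by (rule left_segment[OF r g(1,2) gapl kp(1,2)]) (assumption | rule that)+
 obtain rh Cr Nr where h: "rb <= rh" "0 < rh" "rh < pp/qq" "Cr >= 0" "Nr >= 1"
  "!!n n1 n2 r0 Q L. scaled n n1 n2 ==> n >= Nr ==> r0 : {r1..r2} ==>
   (ALL w. Im w > 0 --> (Q has_field_derivative contour_fun av1 av2 n1 n2 (LL r0) w) (at w)) ==> L > n*rh ==>
   norm (Q (Complex L (n*Y rh)) - Q (cor n*Tc (cor rh))) <= Cr*n*exp (n*(Re (ph r0 r0) - Re kp0 - ga/2))"
  by (rule right_segment[OF r g(1,5) gapr]) (assumption | rule that)+
 have b: "rl < r1" "r2 < rh" using l(2) g h(1) by auto
 obtain Cm Nm where m: "Cm >= 0" "Nm >= 1"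
  "!!n n1 n2 r0 Q. scaled n n1 n2 ==> n >= Nm ==> r0 : {r1..r2} ==>
   (ALL w. Im w > 0 --> (Q has_field_derivative contour_fun av1 av2 n1 n2 (LL r0) w) (at w)) ==>
   norm (Q (cor n*Tc (cor rh)) - Q (cor n*Tc (cor rl)) + cor (2 * pi) * \<i> * (exp (cor n * pk0 r0)*amp0 r0))
    <= Cm/n*exp (n * Re (pk0 r0))"
  by (rule curve_part[OF l(1) b(1) r(2) b(2) h(3)]) (rule that)
 define y where "y = Y rl"
 have y: "y > 0" "Y rh > 0" using Tc_real(2)[OF l(1,3)] Tc_real(2)[OF h(2,3)] by (auto simp: y_def)
 define D where "D = 2*y*Cl + 1 + 2*Cl + 2*Cr"
 have D: "D >= 0" using y l(4) h(4) by (simp add: D_def)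
 define C where "C = D*(4*(2/ga)^2) + 2*Cm"
 show ?thesis
 proof (rule that[of C "max (max Nl Nr) Nm"])
  show "C >= 0" using D m(1) by (simp add: C_def)
  show "max (max Nl Nr) Nm > 0" using l(5) by simp
  fix n n1 n2 r0 P
  assume n: "n >= max (max Nl Nr) Nm" and s: "scaled n n1 n2" and r0: "r0 : {r1..r2}" and mop: "mop av1 av2 n1 n2 P"
  interpret mop av1 av2 n1 n2 P by (rule mop)
  have nn: "n >= Nl" "n >= Nr" "n >= Nm" "n >= 1" using n l(5) by auto
  have rr: "0 < r0" "r0 < pp/qq" using r0 r by auto
  define W where "W = Re (pk0 r0)"
  have W: "Re (ph r0 r0) - Re kp0 - ga/2 = W - ga/2" by (simp add: W_def pk0_def)
  define ex where "ex = exp (n*(W - ga/2))"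
  have ex: "ex > 0" by (simp add: ex_def)
  obtain Q where Q: "!!w. Im w > 0 ==> (Q has_field_derivative cf (LL r0) w) (at w)" by (rule cf_primitive) (rule that)
  hence QQ: "ALL w. Im w > 0 --> (Q has_field_derivative cf (LL r0) w) (at w)" by blast
  have left: "norm (cf (LL r0) w) <= Cl*ex" if "Re w = - kp" "\<bar>Im w\<bar> <= n*y" for w
   using order_trans[OF left_bound[OF kp that] l(7)[OF s nn(1) r0, folded y_def]] unfolding W ex_def .
  have "EX L0. ALL L>=L0::real. norm (2 * pi * \<i> * cor (poly P (exp (LL r0))) -
   (cnj (Q (Complex L (n*Y rh)) - Q (Complex (-kp) (n*y))) - (Q (Complex L (n*Y rh)) - Q (Complex (-kp) (n*y))))) <= 2*(n*y)*(Cl*ex) + ex"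
   by (rule contour_reduction[OF LL_neg[OF rr] kp(1) _ _ _ ex Q left]) (use y nn l(4) ex in auto)
  then obtain L0 where L0: "!!L::real. L >= L0 ==> norm (2 * pi * \<i> * cor (poly P (exp (LL r0))) -
   (cnj (Q (Complex L (n*Y rh)) - Q (Complex (-kp) (n*y))) - (Q (Complex L (n*Y rh)) - Q (Complex (-kp) (n*y))))) <= 2*(n*y)*(Cl*ex) + ex"
   by blast
  define L where "L = max L0 (n*rh + 1)"
  have L: "L >= L0" "L > n*rh" by (auto simp: L_def)
  define I where "I = Q (Complex L (n*Y rh)) - Q (Complex (-kp) (n*y))"
  define Z where "Z = exp (cor n * pk0 r0)*amp0 r0"
  define e where "e = Cm/n*exp (n*W)"
  have 1: "norm (Q (cor n*Tc (cor rl)) - Q (Complex (-kp) (n*y))) <= Cl*n*ex"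
   using l(6)[OF s nn(1) r0 QQ] unfolding W y_def ex_def .
  have 2: "norm (Q (Complex L (n*Y rh)) - Q (cor n*Tc (cor rh))) <= Cr*n*ex"
   using h(6)[OF s nn(2) r0 QQ L(2)] unfolding W ex_def .
  have 3: "norm (Q (cor n*Tc (cor rh)) - Q (cor n*Tc (cor rl)) + cor (2 * pi) * \<i> * Z) <= e"
   using m(3)[OF s nn(3) r0 QQ] unfolding Z_def e_def W_def .
  have I: "norm (I + cor (2 * pi) * \<i> * Z) <= Cl*n*ex + Cr*n*ex + e"
  proof -
   have "I + cor (2 * pi) * \<i> * Z = (Q (cor n*Tc (cor rl)) - Q (Complex (-kp) (n*y))) + (Q (Complex L (n*Y rh)) - Q (cor n*Tc (cor rh)))
    + (Q (cor n*Tc (cor rh)) - Q (cor n*Tc (cor rl)) + cor (2 * pi) * \<i> * Z)" by (simp add: I_def)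
   thus ?thesis by (simp only:) (intro norm_triangle_mono 1 2 3)
  qed
  have T: "norm (2 * pi * \<i> * cor (poly P (exp (LL r0))) - (cnj I - I)) <= 2*(n*y)*(Cl*ex) + ex"
   unfolding I_def by (rule L0[OF L(1)])
  \<comment> \<open>If J is close to - 2 pi i z, then cnj J - J is close to 2 pi i (z + cnj
    z).\<close>
  have gen: "2 * pi*norm (p - (z + cnj z)) <= u + 2 * v"
   if "norm (2 * pi * \<i> * p - (cnj J - J)) <= u" "norm (J + cor (2 * pi) * \<i> * z) <= v" for p z J :: complex and u v
  proof -
   have "cor (2 * pi) * \<i> * (p - (z + cnj z)) = (2 * pi * \<i> * p - (cnj J - J)) + (cnj (J + cor (2 * pi) * \<i> * z) - (J + cor (2 * pi) * \<i> * z))"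
    by (simp add: algebra_simps)
   moreover have "norm (cnj (J + cor (2 * pi) * \<i> * z) - (J + cor (2 * pi) * \<i> * z)) <= v + v"
    by (rule order_trans[OF norm_triangle_ineq4]) (use that(2) in \<open>simp only: complex_mod_cnj; linarith\<close>)
   ultimately have "norm (cor (2 * pi) * \<i> * (p - (z + cnj z))) <= u + (v + v)"
    by (simp only:) (intro norm_triangle_mono that(1))
   thus ?thesis by (simp add: norm_mult)
  qed
  define d where "d = norm (cor (poly P (X r0)) - (Z + cnj Z))"
  have X: "exp (LL r0) = X r0" using LL_eq[OF rr] hs_on_curve(2)[OF rr] by simp
  have "2 * pi*d <= 2*(n*y)*(Cl*ex) + ex + 2*(Cl*n*ex + Cr*n*ex + e)"
   unfolding d_def X[symmetric] by (rule gen[OF T I])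
  moreover have "1*d <= 2 * pi*d" using pi_gt3 by (intro mult_right_mono) (auto simp: d_def)
  moreover have "ex <= n*ex" using nn ex by simp
  ultimately have "d <= D*(n*ex) + 2*e" by (simp add: D_def algebra_simps)
  \<comment> \<open>The exponential gap ga/2 pays for the factor n and for one more factor 1/n, by
    z^2 <= 4 exp z.\<close>
  also have "n*ex <= 4*(2/ga)^2/n*exp (n*W)"
  proof -
   have "(n*ga/2)^2 <= 2^2*exp (n*ga/2)" using power_le_exp[of "n*ga/2" 2] nn g by simp
   hence "n^2 <= 4*(2/ga)^2*exp (n*ga/2)" using g by (simp add: field_simps power2_eq_square)
   hence "n^2*ex <= 4*(2/ga)^2*exp (n*ga/2)*ex" using ex by (intro mult_right_mono) auto
   also have "... = 4*(2/ga)^2*(exp (n*ga/2)*ex)" by simp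
   also have "exp (n*ga/2)*ex = exp (n*W)" unfolding ex_def exp_add[symmetric] by (simp add: algebra_simps)
   finally have "n*(n*ex) <= 4*(2/ga)^2*exp (n*W)" by (simp add: power2_eq_square mult.assoc)
   thus ?thesis using nn by (simp add: le_divide_eq mult.commute)
  qed
  hence "D*(n*ex) + 2*e <= D*(4*(2/ga)^2/n*exp (n*W)) + 2*e" using D by (intro add_right_mono mult_left_mono)
  also have "... = C/n*exp (n*W)" using nn by (simp add: C_def e_def field_simps)
  finally show "norm (cor (poly P (X r0)) - (exp (cor n * pk0 r0)*amp0 r0 + cnj (exp (cor n * pk0 r0)*amp0 r0)))
   <= C/n*exp (n * Re (pk0 r0))" by (simp add: d_def Z_def W_def)
 qed
qed

end

section \<open>Logarithmic form of the boundary values of H and of the amplitude\<close>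

lemma Ln_limit_neg:
 assumes f: "(f \<longlongrightarrow> cor x) F" and x: "x < 0" and s: "sg = 1 | sg = -1" and ev: "\<forall>\<^sub>F z in F. 0 < sg*Im (f z)"
 shows "((%z. Ln (f z)) \<longlongrightarrow> cor (ln (- x)) + cor (sg * pi) * \<i>) F"
proof -
 have "((%z. - f z) \<longlongrightarrow> cor (- x)) F" using tendsto_minus[OF f] by simp
 hence "((%z. Ln (- f z)) \<longlongrightarrow> Ln (cor (- x))) F"
  by (rule tendsto_Ln) (use x in \<open>auto simp: complex_nonpos_Reals_iff\<close>)
 moreover have "Ln (cor (- x)) = cor (ln (- x))" by (rule Ln_of_real) (use x in simp)
 ultimately have "((%z. Ln (- f z) + cor (sg * pi) * \<i>) \<longlongrightarrow> cor (ln (- x)) + cor (sg * pi) * \<i>) F"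
  by (intro tendsto_add tendsto_const) simp
 thus ?thesis
 proof (rule Lim_transform_eventually)
  show "\<forall>\<^sub>F z in F. Ln (- f z) + cor (sg * pi) * \<i> = Ln (f z)" using ev
  proof eventually_elim
   case (elim z)
   hence "f z ~= 0" by auto
   thus ?case using Ln_minus[of "- f z"] elim s by (auto simp: algebra_simps)
  qed
 qed
qed

lemma bdry_H:
 assumes "sg ~= 0" "((%z. Ln (fy z - cor (theta1 tt))) \<longlongrightarrow> l1) (at (cor x) within half sg)"
  "((%z. Ln (fy z - cor (theta2 tt))) \<longlongrightarrow> l2) (at (cor x) within half sg)"
 shows "bdry sg (H tt fy) x = cor (2 - tt)*l1 + cor tt*l2 + cor (C_const tt)"
  "bdry sg (H0_tilde tt fy) x = cor (2 - tt)*l1 + cor tt*l2 + cor (C_const tt) - cor (C0_const tt)"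
 unfolding H_def H0_tilde_def by (intro bdry_eqI assms tendsto_intros)+

lemma bdry_amplitude:
 assumes sg: "sg ~= 0" and fy: "(fy \<longlongrightarrow> s) (at (cor x) within half sg)" and q: "((%z. q (fy z)) \<longlongrightarrow> Q) (at (cor x) within half sg)"
  and l: "((%z. Ln (fy z - cor (theta2 tt))) \<longlongrightarrow> l2) (at (cor x) within half sg)"
   "((%z. Ln (fy z)) \<longlongrightarrow> l0) (at (cor x) within half sg)" "(Ln \<longlongrightarrow> lx) (at (cor x) within half sg)"
  and nz: "s ~= 0" "s ~= cor (theta2 tt)" "x ~= 0" "Q ~= 0" "(2 + tt)*(4 - tt) ~= 0"
 shows "bdry sg (amplitude av1 av2 tt q fy) x = 4 powr cor av1*(s - cor (theta1 tt))*exp (cor (av2 - av1 + 1)*l2)*exp (cor (2*av1 - av2)*l0)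
  / (cor ((2 + tt)*(4 - tt)) powr cor av1*exp (cor av1*lx)*Q)" (is "_ = ?A")
proof (rule bdry_eqI[OF sg], rule Lim_transform_eventually)
 have c: "cor ((2 + tt)*(4 - tt)) powr cor av1 ~= 0" using nz(5) by (simp only: powr_eq_0_iff of_real_eq_0_iff) simp
 show "((%z. 4 powr cor av1*(fy z - cor (theta1 tt))*exp (cor (av2 - av1 + 1)*Ln (fy z - cor (theta2 tt)))*exp (cor (2*av1 - av2)*Ln (fy z))
  / (cor ((2 + tt)*(4 - tt)) powr cor av1*exp (cor av1*Ln z)*q (fy z))) \<longlongrightarrow> ?A) (at (cor x) within half sg)"
  using nz(4) c by (intro tendsto_divide tendsto_mult tendsto_diff tendsto_const tendsto_exp fy q l) (simp only: mult_eq_0_iff exp_not_eq_zero simp_thms)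
 have "\<forall>\<^sub>F z in at (cor x) within half sg. fy z ~= 0" "\<forall>\<^sub>F z in at (cor x) within half sg. fy z ~= cor (theta2 tt)"
  "\<forall>\<^sub>F z in at (cor x) within half sg. z ~= 0"
  using tendsto_imp_eventually_ne[OF fy nz(1)] tendsto_imp_eventually_ne[OF fy nz(2)] tendsto_imp_eventually_ne[OF tendsto_ident_at, of "cor x" 0] nz(3) by auto
 thus "\<forall>\<^sub>F z in at (cor x) within half sg. 4 powr cor av1*(fy z - cor (theta1 tt))*exp (cor (av2 - av1 + 1)*Ln (fy z - cor (theta2 tt)))*exp (cor (2*av1 - av2)*Ln (fy z))
  / (cor ((2 + tt)*(4 - tt)) powr cor av1*exp (cor av1*Ln z)*q (fy z)) = amplitude av1 av2 tt q fy z"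
  by eventually_elim (simp add: amplitude_def powr_def)
qed

context jpt
begin

text \<open>With s = t/(t - 2) one has s - theta1 = exp k1 (t + a)/(t - 2) and s - theta2 = exp k2
  (t + tt)/(t - 2), see \<open>s_shift\<close>. All constants of the statement are then expressed
  through k1 and k2, in particular c0 = exp (k1 + k2).\<close>

definition k1 :: real where "k1 = ln (2/(4 - tt))"
definition k2 :: real where "k2 = ln (2/(2 + tt))"

lemma k_facts: "exp k1 = 2/(4 - tt)" "exp k2 = 2/(2 + tt)" "ln (4 - tt) = ln 2 - k1" "ln (2 + tt) = ln 2 - k2"
proof -
 show "exp k1 = 2/(4 - tt)" "exp k2 = 2/(2 + tt)" unfolding k1_def k2_def by (rule exp_ln; use tt in simp)+
 show "ln (4 - tt) = ln 2 - k1" "ln (2 + tt) = ln 2 - k2" unfolding k1_def k2_def using tt by (simp_all add: ln_div)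
qed

lemma c0_exp: "c0 tt = exp (k1 + k2)" "CD = exp (k1 + k2)"
 using tt theta_consts(5) by (auto simp: exp_add k_facts c0_def CD_def mult_ac)

lemma log_consts:
 "eN 2 = - cor ((av1 + 1/2) * k1 + (av2 + 1/2) * k2)"
 "(4::complex) powr cor av1 = exp (cor (av1*(k1 + k2))) * cor ((2 + tt)*(4 - tt)) powr cor av1"
 "sqrt CD = exp ((k1 + k2)/2)"
 "kp0 = - cor (a * k1 + tt * k2 + 2*(k1 + k2))"
 "C_const tt - C0_const tt = 2*(k1 + k2)"
proof -
 have L: "Ln (2 + cor a) = cor (ln 2 - k1)" "Ln (2 + cor tt) = cor (ln 2 - k2)" "Ln (2::complex) = cor (ln 2)"
 proof -
  have e: "2 + cor a = cor (4 - tt)" "2 + cor tt = cor (2 + tt)" by simp_all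
  have "0 < 4 - tt" "0 < 2 + tt" using tt by auto
  thus "Ln (2 + cor a) = cor (ln 2 - k1)" "Ln (2 + cor tt) = cor (ln 2 - k2)"
   unfolding e k_facts(3,4)[symmetric] by (auto simp only: Ln_of_real)
  show "Ln (2::complex) = cor (ln 2)" using Ln_of_real[of 2] by simp
 qed
 show "eN 2 = - cor ((av1 + 1/2) * k1 + (av2 + 1/2) * k2)" unfolding eN_def L by (simp add: algebra_simps)
 have pos: "(2 + tt)*(4 - tt) > 0" using tt by simp
 hence n: "cor ((2 + tt)*(4 - tt)) ~= 0" by (metis of_real_eq_0_iff less_irrefl)
 note l0 = Ln_of_real[OF pos]
 have p: "cor ((2 + tt)*(4 - tt)) powr cor av1 = exp (cor (av1*ln ((2 + tt)*(4 - tt))))"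
  unfolding powr_def l0 of_real_mult[of av1] using n by (simp only: if_False)
 have l: "ln ((2 + tt)*(4 - tt)) = 2*ln 2 - k1 - k2" using tt by (simp add: ln_mult_pos k_facts)
 have "ln (4::real) = 2*ln 2" using ln_realpow[of 2 2] by simp
 hence "Ln (4::complex) = cor (2*ln 2)" using Ln_of_real[of 4] by simp
 thus "(4::complex) powr cor av1 = exp (cor (av1*(k1 + k2))) * cor ((2 + tt)*(4 - tt)) powr cor av1"
  unfolding p l exp_add[symmetric] by (simp add: powr_def algebra_simps)
 have "(exp ((k1 + k2)/2))^2 = CD" unfolding c0_exp power2_eq_square exp_add[symmetric] by simp
 thus "sqrt CD = exp ((k1 + k2)/2)" by (rule real_sqrt_unique) simp
 show "kp0 = - cor (a * k1 + tt * k2 + 2*(k1 + k2))" unfolding kp0_def hN_def lf_def L by (simp add: algebra_simps)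
 have "ln (1/c0 tt) = - (k1 + k2)" by (simp add: c0_exp(1) ln_div)
 thus "C_const tt - C0_const tt = 2*(k1 + k2)" by (simp add: C0_const_def)
qed

text \<open>The left side is the logarithmic derivative of 1/zeta(1/t), and the derivative of
  \<open>zeta\<close> is -2 Wf. This turns second derivatives at saddle points into the square of
  the root of D.\<close>

lemma log_deriv:
 fixes t :: complex
 assumes nz: "t ~= 0" "t + cor a ~= 0" "t + cor tt ~= 0" "t - 2 ~= 0" and z: "zeta (1/t) = 1/cor x" and x: "x ~= 0"
 shows "3/t - 1/(t + cor a) - 1/(t + cor tt) - 1/(t - 2) = - 2 * cor x*Wf (1/t)/t^2"
  "t^3 = cor x*((t + cor a)*(t + cor tt)*(t - 2))"
proof -
 define N where "N = (t + cor a)*(t + cor tt)*(t - 2)"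
 have N0: "N ~= 0" using nz by (simp add: N_def)
 have "zeta (1/t) = N/t^3" unfolding zeta_factor3 N_def using nz(1) by (simp add: field_simps power3_eq_cube)
 thus 1: "t^3 = cor x*((t + cor a)*(t + cor tt)*(t - 2))" using z nz(1) x by (simp add: N_def field_simps)
 have gen: "3/t - 1/A - 1/B - 1/D = (3*(A*B*D) - t*(B*D + A*D + A*B))/(t*(A*B*D))"
  if "A ~= 0" "B ~= 0" "D ~= 0" for A B D using that nz(1) by (simp add: field_simps)
 have "3/t - 1/(t + cor a) - 1/(t + cor tt) - 1/(t - 2) = - 2*(cor qq*t + 3 * cor pp)/(t*N)"
  unfolding gen[OF nz(2-4)] N_def[symmetric] by (rule arg_cong2[of _ _ _ _ "(/)"]) (simp_all add: N_def pp_def qq_def algebra_simps)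
 also have "... = - 2*(cor qq*t + 3 * cor pp) * cor x/t^4"
 proof -
  have "t^4 = t*(cor x*N)" using 1 by (simp add: N_def power4_eq_xxxx power3_eq_cube)
  thus ?thesis using N0 nz(1) x by (simp add: field_simps)
 qed
 also have "... = - 2 * cor x*Wf (1/t)/t^2" unfolding Wf_def using nz(1) by (simp add: field_simps power4_eq_xxxx power2_eq_square)
 finally show "3/t - 1/(t + cor a) - 1/(t + cor tt) - 1/(t - 2) = - 2 * cor x*Wf (1/t)/t^2" .
qed

lemma s_shift:
 fixes t :: complex
 assumes "t ~= 2"
 shows "t/(t - 2) - cor (theta1 tt) = cor (exp k1)*((t + cor a)/(t - 2))"
  "t/(t - 2) - cor (theta2 tt) = cor (exp k2)*((t + cor tt)/(t - 2))"
proof -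
 have "cor (4 - tt) ~= 0" "cor (2 + tt) ~= 0" using tt by (simp_all only: of_real_eq_0_iff)
 hence n: "4 - cor tt ~= 0" "2 + cor tt ~= 0" by simp_all
 show "t/(t - 2) - cor (theta1 tt) = cor (exp k1)*((t + cor a)/(t - 2))"
  "t/(t - 2) - cor (theta2 tt) = cor (exp k2)*((t + cor tt)/(t - 2))"
  unfolding k_facts theta1_def theta2_def using n assms by (simp_all add: field_simps)
qed

text \<open>The amplitude of the statement equals the saddle point amplitude once all factors are
  exponentials of the logarithms A, B, D, T of t + a, t + tt, t - 2, t; the hypothesis is the saddle
  point equation. The logarithms are left abstract so that the identity serves for 0 < x < 1 with
  complex logarithms and for x < 0 with the real logarithm of 2 - t in the place of D.\<close>

lemma amplitude_algebra:
 fixes A B D T l w :: complex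
 assumes "A + B + D - 3*T = - l"
 shows "4 powr cor av1*exp (cor k1 + A - D)*exp (cor (av2 - av1 + 1)*(cor k2 + B - D))*exp (cor (2*av1 - av2)*(T - D))
  / (cor ((2 + tt)*(4 - tt)) powr cor av1*exp (cor av1*l)*(exp (T - D)^2 * cor (sqrt CD)*w))
 = exp ((cor av1 + 1/2)*(A - T) + (cor av2 + 1/2)*(B - T) - eN 2 - (T + D)/2)*exp (T - l/2)/w"
proof -
 have c: "cor ((2 + tt)*(4 - tt)) powr cor av1 ~= 0" using tt by (simp only: powr_eq_0_iff of_real_eq_0_iff) auto
 have l: "l = 3*T - A - B - D" using assms by (simp add: algebra_simps)
 have gen: "e0 * p*e1*e2*e3/(p*e4*(e5^2*e6*w)) = e0*e1*e2*e3/(e4*(e5*e5)*e6)/w" if "p ~= 0" for e0 e1 e2 e3 e4 e5 e6 p :: complex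
  using that by (simp add: power2_eq_square mult_ac)
 have s: "cor (sqrt CD) = exp (cor ((k1 + k2)/2))" unfolding log_consts(3) exp_of_real ..
 show ?thesis unfolding log_consts(2) gen[OF c] s exp_add[symmetric] exp_diff[symmetric] log_consts(1) l
  by (rule arg_cong[of _ _ "%e. exp e/w"]) (simp add: field_simps)
qed

text \<open>The common boundary value of phi_1 from above and phi_0 from below at x =
  \<open>X r\<close>. The two remaining boundary values at this x are its conjugate.\<close>

definition sA :: "real => complex" where "sA r = Tc (cor r)/(Tc (cor r) - 2)"

definition HA :: "real => complex" where
 "HA r = cor (2 - tt)*Ln (sA r - cor (theta1 tt)) + cor tt*Ln (sA r - cor (theta2 tt)) + cor (C_const tt)"

definition ampA :: "real => complex" where
 "ampA r = 4 powr cor av1*(sA r - cor (theta1 tt))*exp (cor (av2 - av1 + 1)*Ln (sA r - cor (theta2 tt)))*exp (cor (2*av1 - av2)*Ln (sA r))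
  / (cor ((2 + tt)*(4 - tt)) powr cor av1*exp (cor av1 * cor (LL r))*(sA r^2 * cor (sqrt CD) * csqrt (Wf (1/Tc (cor r)))))"

lemma sA_facts:
 assumes r: "0 < r" "r < pp/qq"
 defines "t \<equiv> Tc (cor r)"
 shows "Ln (sA r - cor (theta1 tt)) = cor k1 + Ln (t + cor a) - Ln (t - 2)"
  "Ln (sA r - cor (theta2 tt)) = cor k2 + Ln (t + cor tt) - Ln (t - 2)"
  "Ln (sA r) = Ln t - Ln (t - 2)"
  "sA r = exp (Ln t - Ln (t - 2))" "sA r - cor (theta1 tt) = exp (cor k1 + Ln (t + cor a) - Ln (t - 2))"
  "Ln (t + cor a) + Ln (t + cor tt) + Ln (t - 2) - 3*Ln t = - cor (LL r)"
proof -
 have i: "Im t > 0" using Tc_real(1,2)[OF r] by (simp add: t_def)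
 have up: "w : upper_slit" if "Im w > 0" for w using that by (auto simp: upper_slit_def complex_nonpos_Reals_iff)
 note o = upper_off_cut[OF i]
 have nz: "t ~= 0" "t + cor a ~= 0" "t + cor tt ~= 0" "t - 2 ~= 0" "t ~= 2" using o by auto
 have u: "t : upper_slit" "t + cor a : upper_slit" "t + cor tt : upper_slit" "t - 2 : upper_slit" by (rule up; use i in simp)+
 have sc: "Ln (cor (exp k)*(x/(t - 2))) = cor k + Ln x - Ln (t - 2)" if "x : upper_slit" for k :: real and x
 proof -
  have "x/(t - 2) ~= 0" using upper_slit_nonzero[OF that] nz by simp
  hence "Ln (cor (exp k)*(x/(t - 2))) = cor (ln (exp k)) + Ln (x/(t - 2))" using Ln_times_of_real[of "exp k" "x/(t - 2)"] Ln_of_real[of "exp k"] by (simp only: exp_gt_zero simp_thms)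
  thus ?thesis unfolding Ln_divide_upper_slit[OF u(4) that] by simp
 qed
 have s: "sA r = t/(t - 2)" by (simp add: sA_def t_def)
 show 1: "Ln (sA r - cor (theta1 tt)) = cor k1 + Ln (t + cor a) - Ln (t - 2)"
  "Ln (sA r - cor (theta2 tt)) = cor k2 + Ln (t + cor tt) - Ln (t - 2)"
  unfolding s s_shift[OF nz(5)] by (rule sc, rule u)+
 show "Ln (sA r) = Ln t - Ln (t - 2)" unfolding s by (rule Ln_divide_upper_slit[OF u(4) u(1)])
 show "sA r = exp (Ln t - Ln (t - 2))" unfolding s using nz by (simp add: exp_diff)
 show "sA r - cor (theta1 tt) = exp (cor k1 + Ln (t + cor a) - Ln (t - 2))"
  unfolding 1(1)[symmetric] by (rule exp_Ln[symmetric]) (use nz s s_shift[OF nz(5)] in simp)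
 show "Ln (t + cor a) + Ln (t + cor tt) + Ln (t - 2) - 3*Ln t = - cor (LL r)"
  using hs_on_curve(1)[OF r] LL_eq[OF r] by (simp add: hs_def t_def)
qed

lemma HA_eq: assumes r: "0 < r" "r < pp/qq" shows "HA r - cor (C0_const tt) = pk0 r"
proof -
 define t where "t = Tc (cor r)"
 note S = sA_facts[OF r, folded t_def]
 have "h0 t = t*(Ln (t + cor a) + Ln (t + cor tt) + Ln (t - 2) - 3*Ln t) + cor a*Ln (t + cor a) + cor tt*Ln (t + cor tt) - 2*Ln (t - 2)"
  by (simp add: h0_def hN_def lf_def algebra_simps)
 hence p: "pk0 r = cor a*Ln (t + cor a) + cor tt*Ln (t + cor tt) - 2*Ln (t - 2) + cor (a * k1 + tt * k2 + 2*(k1 + k2))"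
  unfolding S(6) pk0_def ph_def log_consts(4) by (simp add: t_def algebra_simps)
 have "cor (C_const tt) - cor (C0_const tt) = cor (2*(k1 + k2))" unfolding log_consts(5)[symmetric] by simp
 thus ?thesis unfolding p HA_def S(1,2) by (simp add: algebra_simps)
qed

text \<open>The relation hs (Tc r) = - LL r is differentiated along the curve, and
  \<open>log_deriv\<close> evaluates the derivative of \<open>hs\<close>.\<close>

lemma LL'_eq:
 assumes r: "0 < r" "r < pp/qq"
 shows "cor (LL' r) = - 2 * cor (X r)*Wf (1/Tc (cor r))/Tc (cor r)^2*deriv Tc (cor r)"
proof -
 define t where "t = Tc (cor r)"
 have i: "Im t > 0" using Tc_real(1,2)[OF r] by (simp add: t_def)
 note o = upper_off_cut[OF i]
 have nz: "t ~= 0" "t + cor a ~= 0" "t + cor tt ~= 0" "t - 2 ~= 0" using o by auto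
 define D where "D = 1/(t + cor a) + 1/(t + cor tt) + 1/(t - 2) - 3/t"
 have Ld: "((%t. Ln (t + c)) has_field_derivative 1/(t + c)) (at t)" if "t + c ~: \<real>\<^sub>\<le>\<^sub>0" for c
  using DERIV_chain2[OF has_field_derivative_Ln[OF that] DERIV_add[OF DERIV_ident DERIV_const]] by (simp add: inverse_eq_divide)
 have "((%t. Ln (t + cor a) + Ln (t + cor tt) + Ln (t + (-2)) - 3*Ln (t + 0)) has_field_derivative 1/(t + cor a) + 1/(t + cor tt) + 1/(t + (-2)) - 3*(1/(t + 0))) (at t)"
  by (intro DERIV_add DERIV_diff DERIV_cmult Ld) (use o in simp_all)
 hence "(hs has_field_derivative D) (at t)" by (simp add: hs_def[abs_def] D_def)
 hence "((%z. hs (Tc z)) has_field_derivative D*deriv Tc (cor r)) (at (cor r))"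
  unfolding t_def by (intro DERIV_chain2[of hs] holomorphic_derivI[OF Tc_S1(1) open_S1 Tc_real(3)[OF r]])
 hence 1: "((%x. hs (Tc (cor x))) has_vector_derivative D*deriv Tc (cor r)) (at r)" by (rule has_vector_derivative_real_field)
 have "((%x. cor (- LL x)) has_vector_derivative cor (- LL' r)) (at r)"
  by (intro has_vector_derivative_of_real DERIV_minus LL_deriv[OF r])
 hence "((%x. hs (Tc (cor x))) has_vector_derivative cor (- LL' r)) (at r)"
  by (rule has_vector_derivative_transform_within_open[of _ _ _ "{0<..<pp/qq}"]) (use r hs_on_curve(1) LL_eq in auto)
 with 1 have e: "cor (LL' r) = - (D*deriv Tc (cor r))" using vector_derivative_unique_at by fastforce
 have z: "zeta (1/t) = 1/cor (X r)" using zeta_roots[OF Tc_real(4)[OF r], of "1/t"] Tc_real(1)[OF r] by (simp add: t_def)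
 have "- D = - 2 * cor (X r)*Wf (1/t)/t^2"
  unfolding D_def log_deriv(1)[OF nz z validD(6)[OF Tc_real(4)[OF r]], symmetric] by simp
 thus ?thesis unfolding e t_def[symmetric] by (metis mult_minus_left)
qed

lemma Wf_curve:
 assumes r: "0 < r" "r < pp/qq"
 shows "Im (Wf (1/Tc (cor r))) < 0" "Re (csqrt (Wf (1/Tc (cor r)))) > 0" "Im (csqrt (Wf (1/Tc (cor r)))*(1/Tc (cor r))) < 0"
proof -
 define u where "u = 1/Tc (cor r)"
 have u: "Re u > 0" "Im u < 0" using Tc_real(1,2)[OF r] r by (auto simp: u_def Re_divide Im_divide add_pos_pos divide_neg_pos)
 have "Im (Wf u) = Im u*(qq + 6 * pp * Re u)" by (simp add: Wf_def algebra_simps)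
 also have "... < 0" using u pp qq by (intro mult_neg_pos add_pos_nonneg) auto
 finally show W: "Im (Wf (1/Tc (cor r))) < 0" by (simp add: u_def)
 define c where "c = csqrt (Wf u)"
 have "c^2 = Wf u" by (simp add: c_def)
 hence im: "2 * Re c*Im c < 0" using Im_power2[of c] W by (simp add: u_def)
 have "Re c >= 0" using csqrt_principal[of "Wf u"] unfolding c_def[symmetric] by (auto simp: c_def[symmetric])
 hence rc: "Re c > 0" using im by (cases "Re c = 0") auto
 thus "Re (csqrt (Wf (1/Tc (cor r)))) > 0" by (simp add: c_def u_def)
 have ic: "Im c < 0" using im rc by (simp add: mult_less_0_iff)
 have "Im (c*u) = Re c*Im u + Im c * Re u" by simp
 also have "... < 0" using rc ic u by (intro add_neg_neg mult_pos_neg mult_neg_pos) auto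
 finally show "Im (csqrt (Wf (1/Tc (cor r)))*(1/Tc (cor r))) < 0" by (simp add: c_def u_def)
qed

text \<open>Only the sign of a square root is in question. By \<open>LL'_eq\<close> the root of T'
  LL' is plus or minus p = i sqrt (2x) v T' with v = c/t. The product p v is a negative multiple of
  i, and Im v < 0 by \<open>Wf_curve\<close>; hence Re p > 0 and p is the principal root.\<close>

lemma ampA_eq: assumes r: "0 < r" "r < pp/qq" shows "ampA r = amp0 r"
proof -
 define t where "t = Tc (cor r)"
 define c where "c = csqrt (Wf (1/t))"
 define T' where "T' = deriv Tc (cor r)"
 define x where "x = X r"
 have t0: "t ~= 0" using Tc_real(1,2)[OF r] by (auto simp: t_def complex_eq_iff)
 note S = sA_facts[OF r, folded t_def]
 have x: "x > 0" using hs_on_curve(2)[OF r] by (simp add: x_def)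
 have W: "Re c > 0" "Im (c*(1/t)) < 0" using Wf_curve[OF r] by (auto simp: c_def t_def)
 have c0: "c ~= 0" using W(1) by auto
 have L': "cor (LL' r) = - 2 * cor x * c^2/t^2*T'" unfolding c_def power2_csqrt using LL'_eq[OF r] by (simp add: t_def T'_def x_def)
 have T0: "T' ~= 0" using L' LL'_pos[OF r] by auto
 define p where "p = cor (sqrt 2 * sqrt x) * \<i> * (c*(1/t))*T'"
 have sq: "cor (sqrt 2 * sqrt x)^2 = 2 * cor x"
 proof -
  have "(sqrt 2 * sqrt x)^2 = 2*x" using x by (simp add: power_mult_distrib)
  thus ?thesis by (metis of_real_power of_real_mult of_real_numeral)
 qed
 have "csqrt (T' * cor (LL' r)) = p"
 proof (rule csqrt_unique)
  show "p^2 = T' * cor (LL' r)" unfolding p_def L' power_mult_distrib sq using t0 by (simp add: power_divide power2_eq_square)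
  have "p*(c*(1/t)) = cor (sqrt 2 * sqrt x) * \<i> * (c^2/t^2*T')" using t0 by (simp add: p_def power2_eq_square)
  also have "c^2/t^2*T' = cor (- (LL' r/(2*x)))" using arg_cong[OF L', of "%z. z/(-2 * cor x)"] x by simp
  finally have "p*(c*(1/t)) = - (cor (sqrt 2 * sqrt x*(LL' r/(2*x))) * \<i>)" by simp
  moreover define mu where "mu = sqrt 2 * sqrt x*(LL' r/(2*x))"
  ultimately have pu: "p*(c*(1/t)) = - (cor mu * \<i>)" by simp
  have mu: "mu > 0" using x LL'_pos[OF r] by (simp add: mu_def)
  define v where "v = c*(1/t)"
  have v: "Im v < 0" using W(2) by (simp add: v_def)
  have pv: "p * v = - (cor mu * \<i>)" using pu by (simp add: v_def)
  have "p * cor ((cmod v)^2) = p * v * cnj v" unfolding complex_norm_square by (simp only: mult.assoc)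
  hence "Re (p * cor ((cmod v)^2)) = Re (- (cor mu * \<i>) * cnj v)" unfolding pv by simp
  hence "Re p*(cmod v)^2 = - (mu*Im v)" by simp
  moreover have "- (mu*Im v) > 0" using mu v by (simp add: mult_pos_neg)
  ultimately have "Re p*(cmod v)^2 > 0" by simp
  thus "0 < Re p | Re p = 0 & 0 <= Im p" by (simp add: zero_less_mult_iff)
 qed
 hence a0: "amp0 r = cor (sqrt 2) * \<i> * (A0 t*T' / p)" by (simp add: amp0_def Bc_def t_def T'_def)
 have a1: "cor (sqrt 2) * \<i> * (A0 t*T' / p) = A0 t*(t/cor (sqrt x))/c"
  unfolding p_def using T0 c0 t0 x by (simp add: field_simps)
 have e: "exp (Ln t - cor (LL r)/2) = t/cor (sqrt x)"
 proof -
  have "exp (LL r/2) = sqrt x" using LL_eq[OF r] x by (simp add: x_def powr_half_sqrt[symmetric] powr_def)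
  hence "exp (cor (LL r)/2) = cor (sqrt x)" by (metis exp_of_real of_real_divide of_real_numeral)
  thus ?thesis using t0 by (simp add: exp_diff)
 qed
 have "ampA r = exp ((cor av1 + 1/2)*(Ln (t + cor a) - Ln t) + (cor av2 + 1/2)*(Ln (t + cor tt) - Ln t) - eN 2 - (Ln t + Ln (t - 2))/2)*exp (Ln t - cor (LL r)/2)/c"
  unfolding ampA_def S(2,3) S(5) c_def t_def[symmetric] amplitude_algebra[OF S(6), symmetric] unfolding S(4) ..
 also have "... = A0 t*(t/cor (sqrt x))/c" unfolding e A0_def eN_def ..
 finally show ?thesis unfolding a0 a1 .
qed

end

section \<open>The expansion on the two sides of (0,1)\<close>

locale jfin = jpt av1 av2 tt + jbr tt fy0 fy1 qf for av1 av2 tt :: real and fy0 fy1 qf :: "complex => complex"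
begin

definition expansion :: "real => real => real poly => real => real => bool" where
 "expansion M n P x sg \<longleftrightarrow> (EX ep0 ep1 :: complex. norm ep0 <= M/n & norm ep1 <= M/n &
  cor (poly P x) = exp (cor n*bdry sg (H0_tilde tt fy0) x) *
    (bdry sg (amplitude av1 av2 tt qf fy0) x + ep0
     + cor sg*exp (cor n*(bdry sg (H tt fy1) x - bdry sg (H tt fy0) x))
      * (bdry sg (amplitude av1 av2 tt qf fy1) x + ep1)))"

text \<open>The whole error is put into the first error term, the second one being 0. This is
  possible as soon as the error is O(1/n) relative to the modulus of the common exponential
  factor.\<close>

lemma expansionI:
 assumes "bdry sg (H0_tilde tt fy0) x = h" "bdry sg (amplitude av1 av2 tt qf fy0) x = A"
  "cor sg*exp (cor n*(bdry sg (H tt fy1) x - bdry sg (H tt fy0) x))*bdry sg (amplitude av1 av2 tt qf fy1) x = B"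
  and b: "norm (cor (poly P x) - exp (cor n*h)*(A + B)) <= M/n*norm (exp (cor n*h))" and M: "M >= 0" "n > 0"
 shows "expansion M n P x sg"
proof -
 define E where "E = exp (cor n*h)"
 define e where "e = (cor (poly P x) - E*(A + B))/E"
 have E: "E ~= 0" by (simp add: E_def)
 have "norm e <= M/n" using b E by (simp add: e_def norm_divide divide_le_eq E_def[symmetric])
 moreover have "cor (poly P x) = E*(A + e + B)" using E by (simp add: e_def field_simps)
 ultimately show ?thesis unfolding expansion_def assms(1,2) distrib_left[of "_ * _"]
  by (intro exI[of _ e] exI[of _ 0]) (use M assms(3) in \<open>simp add: E_def\<close>)
qed

definition QA :: "real => complex" where "QA r = sA r^2 * cor (sqrt CD) * csqrt (Wf (1/Tc (cor r)))"

lemma cnj_real_powr: assumes "k > 0" shows "cnj (cor k powr cor b) = cor k powr cor b"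
 using assms by (simp add: powr_def exp_cnj Ln_of_real)

lemma nonreal_off_cut: "Im z ~= 0 ==> z ~: \<real>\<^sub>\<le>\<^sub>0"
 by (auto simp: complex_nonpos_Reals_iff)

lemma Im_sA: assumes r: "0 < r" "r < pp/qq" shows "Im (sA r) < 0"
proof -
 define t where "t = Tc (cor r)"
 have i: "Im t > 0" using Tc_real(1,2)[OF r] by (simp add: t_def)
 have "t - 2 ~= 0" using i by auto
 hence "0 < (cmod (t - 2))^2" by simp
 moreover have "Im (sA r) = - 2*Im t/(cmod (t - 2))^2" unfolding sA_def t_def[symmetric] by (simp add: Im_divide cmod_power2 algebra_simps)
 ultimately show ?thesis using i by (simp add: divide_neg_pos)
qed

text \<open>Treats phi_0 and phi_1 on both sides of (0,1) at once: \<open>v\<close> says whether the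
  boundary value is \<open>sA r\<close> or its conjugate, and the sign \<open>e\<close> is that of
  the square root of D there.\<close>

lemma bdry_nonreal:
 assumes r: "0 < r" "r < pp/qq" and sg: "sg ~= 0" and v: "v = id | v = cnj" and e: "e = 1 | e = -1"
  and fy: "(fy \<longlongrightarrow> v (sA r)) (at (cor (X r)) within half sg)" and q: "((%z. qf (fy z)) \<longlongrightarrow> e * v (QA r)) (at (cor (X r)) within half sg)"
 shows "bdry sg (amplitude av1 av2 tt qf fy) (X r) = e * v (amp0 r)"
  "bdry sg (H0_tilde tt fy) (X r) = v (pk0 r)" "bdry sg (H tt fy) (X r) = v (pk0 r) + cor (C0_const tt)"
proof -
 have im: "Im (v (sA r)) ~= 0" "Im (sA r) ~= 0" using Im_sA[OF r] v by auto
 have x: "X r > 0" by (rule hs_on_curve(2)[OF r])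
 have L: "((%z. Ln (fy z - cor c)) \<longlongrightarrow> v (Ln (sA r - cor c))) (at (cor (X r)) within half sg)" for c
 proof -
  have "((%z. Ln (fy z - cor c)) \<longlongrightarrow> Ln (v (sA r) - cor c)) (at (cor (X r)) within half sg)"
   by (intro tendsto_Ln tendsto_diff fy tendsto_const nonreal_off_cut) (use im in simp)
  moreover have "Ln (v (sA r) - cor c) = v (Ln (sA r - cor c))"
   using v cnj_Ln[OF nonreal_off_cut, of "sA r - cor c"] im by auto
  ultimately show ?thesis by simp
 qed
 have Lx: "(Ln \<longlongrightarrow> cor (LL r)) (at (cor (X r)) within half sg)"
 proof -
  have "(Ln \<longlongrightarrow> Ln (cor (X r))) (at (cor (X r)) within half sg)"
   by (rule tendsto_Ln[OF tendsto_ident_at]) (use x in \<open>simp add: complex_nonpos_Reals_iff\<close>)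
  thus ?thesis using Ln_of_real[OF x] LL_eq[OF r] by simp
 qed
 have Q0: "QA r ~= 0" using Wf_curve(2)[OF r] im CD_pos by (auto simp: QA_def)
 have c: "(2 + tt)*(4 - tt) > 0" using tt by simp
 have "bdry sg (amplitude av1 av2 tt qf fy) (X r) = 4 powr cor av1*(v (sA r) - cor (theta1 tt))*exp (cor (av2 - av1 + 1) * v (Ln (sA r - cor (theta2 tt))))*exp (cor (2*av1 - av2) * v (Ln (sA r)))
  / (cor ((2 + tt)*(4 - tt)) powr cor av1*exp (cor av1 * cor (LL r))*(e * v (QA r)))"
  by (rule bdry_amplitude[OF sg fy q L L[of 0, simplified] Lx]) (use im x Q0 c v e in auto)
 also have "... = e * v (ampA r)"
 proof -
  have k: "cnj (4 powr cor av1) = 4 powr cor av1" using cnj_real_powr[of 4 av1] by simp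
  have gen: "x/(y*(e*z)) = e*(x/(y*z))" for x y z :: complex using e by auto
  have "cnj (ampA r) = 4 powr cor av1*(cnj (sA r) - cor (theta1 tt))*exp (cor (av2 - av1 + 1) * cnj (Ln (sA r - cor (theta2 tt))))*exp (cor (2*av1 - av2) * cnj (Ln (sA r)))
  / (cor ((2 + tt)*(4 - tt)) powr cor av1*exp (cor av1 * cor (LL r)) * cnj (QA r))"
   by (simp only: ampA_def QA_def[symmetric] complex_cnj_divide complex_cnj_mult complex_cnj_diff exp_cnj complex_cnj_complex_of_real k cnj_real_powr[OF c])
  moreover have "ampA r = 4 powr cor av1*(sA r - cor (theta1 tt))*exp (cor (av2 - av1 + 1)*Ln (sA r - cor (theta2 tt)))*exp (cor (2*av1 - av2)*Ln (sA r))
  / (cor ((2 + tt)*(4 - tt)) powr cor av1*exp (cor av1 * cor (LL r))*QA r)" unfolding ampA_def QA_def ..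
  ultimately show ?thesis unfolding gen using v by (elim disjE) (simp_all only: id_apply)
 qed
 finally show "bdry sg (amplitude av1 av2 tt qf fy) (X r) = e * v (amp0 r)" unfolding ampA_eq[OF r] .
 have "cor (2 - tt) * v (Ln (sA r - cor (theta1 tt))) + cor tt * v (Ln (sA r - cor (theta2 tt))) + cor (C_const tt) = v (HA r)"
  using v by (auto simp: HA_def)
 moreover have "v (HA r) = v (pk0 r) + cor (C0_const tt)" using HA_eq[OF r, symmetric] v by auto
 ultimately show "bdry sg (H0_tilde tt fy) (X r) = v (pk0 r)" "bdry sg (H tt fy) (X r) = v (pk0 r) + cor (C0_const tt)"
  unfolding bdry_H[OF sg L L] by auto
qed

lemma root_cnj: "root (-1) r = cnj (root 1 r)" "sv (cnj u) = cnj (sv u)" "Wf (cnj u) = cnj (Wf u)"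
 by (simp_all add: root_def sv_def Wf_def complex_eq_iff Re_divide Im_divide)

text \<open>From above, phi_0 tends to the conjugate of \<open>sA r\<close> and phi_1 to
  \<open>sA r\<close>; from below they are exchanged. The square root along phi_1 acquires the sign
  sg, which the sign in front of the second term of the expansion cancels. So both sides give the
  same two conjugate contributions.\<close>

lemma bdry_positive:
 assumes r: "0 < r" "r < pp/qq" and sg: "sg = 1 | sg = -1"
 shows "bdry sg (H0_tilde tt fy0) (X r) = (if sg = 1 then cnj else id) (pk0 r)"
  "bdry sg (amplitude av1 av2 tt qf fy0) (X r) = (if sg = 1 then cnj else id) (amp0 r)"
  "cor sg*exp (cor n*(bdry sg (H tt fy1) (X r) - bdry sg (H tt fy0) (X r)))*bdry sg (amplitude av1 av2 tt qf fy1) (X r)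
  = (if sg = 1 then exp (cor n*(pk0 r - cnj (pk0 r)))*amp0 r else exp (cor n*(cnj (pk0 r) - pk0 r)) * cnj (amp0 r))"
proof -
 define v where "v = (if sg = 1 then cnj else id)"
 define v' where "v' = (if sg = 1 then id else cnj)"
 note V = Tc_real(4)[OF r]
 have rt: "root 1 r = 1/Tc (cor r)" using Tc_real(1)[OF r] by (simp add: root_def)
 have t: "Tc (cor r) ~= 0" "Tc (cor r) - 2 ~= 0" using Tc_real(1,2)[OF r] by (auto simp: complex_eq_iff)
 have s: "sv (root 1 r) = sA r" unfolding rt sv_def sA_def using t by (simp add: field_simps)
 have ne: "r ~= - (3 * pp/qq)" by (rule pos_not_endpoint[OF r(1)])
 have W: "Wf (root 1 r) ~: \<real>\<^sub>\<le>\<^sub>0" "csqrt (- Wf (root 1 r)) = \<i> * csqrt (Wf (root 1 r))" "- Wf (root 1 r) ~: \<real>\<^sub>\<le>\<^sub>0"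
 proof -
  show "csqrt (- Wf (root 1 r)) = \<i> * csqrt (Wf (root 1 r))" unfolding rt by (rule csqrt_minus_lower[OF Wf_curve(1)[OF r]])
  show "Wf (root 1 r) ~: \<real>\<^sub>\<le>\<^sub>0" "- Wf (root 1 r) ~: \<real>\<^sub>\<le>\<^sub>0"
   by (rule nonreal_off_cut; use Wf_curve(1)[OF r] in \<open>simp add: rt\<close>)+
 qed
 have u0: "u0 sg r = v (root 1 r)" "root sg r = v' (root 1 r)" using r sg by (auto simp: u0_def v_def v'_def root_cnj(1))
 have sv0: "sv (u0 sg r) = v (sA r)" "sv (root sg r) = v' (sA r)" unfolding u0 v_def v'_def by (auto simp: root_cnj(2) s)
 have q0: "sv (u0 sg r)^2 * cor (sqrt CD) * csqrt (Wf (u0 sg r)) = 1 * v (QA r)"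
  unfolding sv0 unfolding u0 v_def QA_def rt[symmetric] using cnj_csqrt[OF W(1)] by (auto simp: root_cnj(3) simp del: csqrt.sel)
 have q1: "- \<i> * (sv (root sg r)^2 * cor (sqrt CD) * csqrt (- Wf (root sg r))) = cor sg * v' (QA r)"
 proof -
  have c: "csqrt (- cnj (Wf (root 1 r))) = - \<i> * cnj (csqrt (Wf (root 1 r)))" by (simp only: complex_cnj_minus[symmetric] cnj_csqrt[OF W(3), symmetric] W(2) complex_cnj_mult complex_cnj_i)
  have gen: "- \<i> * (x*y*(\<i> * c)) = x*y * c" "- \<i> * (x*y*(- \<i> * c)) = - (x*y * c)" for x y c :: complex
   by (simp_all add: complex_eq_iff algebra_simps)
  show ?thesis
  proof (cases "sg = 1")
   case True thus ?thesis unfolding sv0 unfolding u0 v'_def QA_def rt[symmetric] if_P[OF True] id_apply W(2) gen using True by (simp del: csqrt.sel)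
  next
   case False
   hence "sg = -1" using sg by simp
   thus ?thesis unfolding sv0 unfolding u0 v'_def QA_def rt[symmetric] if_not_P[OF False] root_cnj(3) c gen by (simp del: csqrt.sel)
  qed
 qed
 have sg0: "sg ~= 0" using sg by auto
 have e: "cor sg = 1 | cor sg = -1" using sg by auto
 note p0 = phi0_limit[OF V sg, unfolded sv0] note p1 = phi1_limit[OF V sg, unfolded sv0]
 have vv: "v = id | v = cnj" "v' = id | v' = cnj" by (auto simp: v_def v'_def)
 note B0 = bdry_nonreal[OF r sg0 vv(1) disjI1[OF refl] p0 Q0_limit[OF V sg, unfolded q0]]
 note B1 = bdry_nonreal[OF r sg0 vv(2) e p1 Q1_limit[OF V sg ne, unfolded q1]]
 show "bdry sg (H0_tilde tt fy0) (X r) = (if sg = 1 then cnj else id) (pk0 r)"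
  "bdry sg (amplitude av1 av2 tt qf fy0) (X r) = (if sg = 1 then cnj else id) (amp0 r)"
  using B0(1,2) by (auto simp: v_def)
 show "cor sg*exp (cor n*(bdry sg (H tt fy1) (X r) - bdry sg (H tt fy0) (X r)))*bdry sg (amplitude av1 av2 tt qf fy1) (X r)
  = (if sg = 1 then exp (cor n*(pk0 r - cnj (pk0 r)))*amp0 r else exp (cor n*(cnj (pk0 r) - pk0 r)) * cnj (amp0 r))"
  unfolding B1(1,3) B0(3) using sg by (auto simp: v_def v'_def)
qed

lemma expansion_positive:
 assumes r: "0 < r1" "r1 <= r2" "r2 < pp/qq"
 obtains C N where "C >= 0" "N > 0" "!!n n1 n2 r0 P sg. n >= N ==> scaled n n1 n2 ==> r0 : {r1..r2} ==> sg = 1 | sg = -1 ==>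
  mop av1 av2 n1 n2 P ==> expansion C n P (X r0) sg"
proof -
 obtain C N where C: "C >= 0" "N > 0" "!!n n1 n2 r0 P. n >= N ==> scaled n n1 n2 ==> r0 : {r1..r2} ==> mop av1 av2 n1 n2 P ==>
  norm (cor (poly P (X r0)) - (exp (cor n * pk0 r0)*amp0 r0 + cnj (exp (cor n * pk0 r0)*amp0 r0)))
   <= C/n*exp (n * Re (pk0 r0))" by (rule poly_positive[OF r]) (rule that)
 show ?thesis
 proof (rule that[OF C(1,2)])
  fix n n1 n2 r0 P and sg :: real
  assume h: "n >= N" "scaled n n1 n2" "r0 : {r1..r2}" and sg: "sg = 1 | sg = -1" and m: "mop av1 av2 n1 n2 P"
  have rr: "0 < r0" "r0 < pp/qq" using h(3) r by auto
  define k where "k = pk0 r0"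
  define A where "A = amp0 r0"
  have Z: "exp (cor n*(if sg = 1 then cnj else id) k)*((if sg = 1 then cnj else id) A +
   (if sg = 1 then exp (cor n*(k - cnj k))*A else exp (cor n*(cnj k - k)) * cnj A)) = exp (cor n * k)*A + cnj (exp (cor n * k)*A)"
  proof -
   have "exp (cor n * cnj k)*exp (cor n*(k - cnj k)) = exp (cor n * k)"
    "exp (cor n * k)*exp (cor n*(cnj k - k)) = exp (cor n * cnj k)"
    unfolding exp_add[symmetric] by (rule arg_cong[of _ _ exp]; simp add: algebra_simps)+
   thus ?thesis by (simp add: distrib_left mult.assoc[symmetric] exp_cnj add.commute)
  qed
  show "expansion C n P (X r0) sg"
  proof (rule expansionI[OF bdry_positive(1,2)[OF rr sg] bdry_positive(3)[OF rr sg, of n]])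
   show "norm (cor (poly P (X r0)) - exp (cor n*(if sg = 1 then cnj else id) (pk0 r0))*((if sg = 1 then cnj else id) (amp0 r0) +
   (if sg = 1 then exp (cor n*(pk0 r0 - cnj (pk0 r0)))*amp0 r0 else exp (cor n*(cnj (pk0 r0) - pk0 r0)) * cnj (amp0 r0))))
    <= C/n*norm (exp (cor n*(if sg = 1 then cnj else id) (pk0 r0)))"
    unfolding Z[unfolded k_def A_def] using C(3)[OF h m] by simp
  qed (use C h in auto)
 qed
qed

text \<open>Transfers compactness from x to the parameter: the preimage of a compact set that avoids
  the end values stays away from the ends of the parameter interval. If it is empty, the midpoint
  serves for r1 = r2.\<close>

lemma X_preimage:
 assumes K: "compact K'" and lu: "l < u" and c: "continuous_on {l..u} X" and e: "X l ~: K'" "X u ~: K'"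
 obtains r1 r2 where "l < r1" "r1 <= r2" "r2 < u" "!!r. r : {l..u} ==> X r : K' ==> r : {r1..r2}"
proof -
 define S where "S = {l..u} \<inter> X -` K'"
 have "closed S" unfolding S_def by (intro continuous_closed_preimage c compact_imp_closed[OF K]) auto
 moreover have "bounded S" by (rule bounded_subset[of "{l..u}"]) (auto simp: S_def)
 ultimately have cS: "compact S" by (simp add: compact_eq_bounded_closed)
 show ?thesis
 proof (cases "S = {}")
  case True
  show ?thesis by (rule that[of "(l + u)/2" "(l + u)/2"]) (use True lu in \<open>auto simp: S_def\<close>)
 next
  case False
  obtain r1 where r1: "r1 : S" "ALL t:S. r1 <= t" using compact_attains_inf[OF cS False] by blast
  obtain r2 where r2: "r2 : S" "ALL t:S. t <= r2" using compact_attains_sup[OF cS False] by blast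
  have "r1 ~= l" "r2 ~= u" using r1(1) r2(1) e by (auto simp: S_def)
  thus ?thesis using r1 r2 by (intro that[of r1 r2]) (auto simp: S_def)
 qed
qed

end

section \<open>Boundary values on the two sides of (x_star, 0)\<close>

context jfin
begin

text \<open>With w = 1 - 2u the value of phi_1 is 1/w, and |1/w - ta| <= ta means 1 <= 2 ta Re w.
  Now Re u <= - qq/(3 pp) for negative r, so Re w >= (8 + pp)/(3 pp). For the smaller of the two
  thetas this suffices because 2 (4 - tt) >= 3 (2 - tt).\<close>

lemma s1_bound:
 assumes v: "valid r" "r < 0" "r ~= - (3 * pp/qq)" and sg: "sg = 1 | sg = -1" and ta: "ta = theta1 tt | ta = theta2 tt"
 shows "norm (sv (root sg r) - cor ta) <= ta" "Im (sv (root sg r)) ~= 0"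
proof -
 define u where "u = root sg r"
 note D = validD[OF v(1)]
 have nz: "1 - 2*u ~= 0" unfolding u_def by (rule root_nz[OF v(1) sg])
 show "Im (sv (root sg r)) ~= 0" using Im_sv[OF nz] J_root(2)[OF v(1) sg v(3)] nz by (simp add: u_def)
 have sq: "(sg*Y r)^2 = Y r^2" using sg by auto
 have "Re u = (pp - qq*r)/(4 * pp*r)" unfolding u_def root_parts sq D(5) using v D(1) pp by (simp add: field_simps power2_eq_square)
 also have "... = 1/(4*r) - qq/(4 * pp)" using v(2) pp by (simp add: field_simps)
 also have "... <= - qq/(12 * pp) - qq/(4 * pp)"
 proof -
  have "3 * pp + qq*r >= 0" by (rule D(2))
  hence "1/(4*r) <= - qq/(12 * pp)" using v(2) pp by (simp add: divide_simps mult_ac)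
  thus ?thesis by simp
 qed
 also have "... = - (qq/(3 * pp))" using pp by (simp add: field_simps)
 finally have m: "1 - 2 * Re u >= 1 + 2*qq/(3 * pp)" by simp
 have th: "2*theta2 tt*(1 + 2*qq/(3 * pp)) >= 1"
 proof -
  have t: "0 < tt" "tt < 1" by (rule tt)+
  have e: "1 + 2*qq/(3 * pp) = (8 + pp)/(3 * pp)" using pp by (simp add: qq_def field_simps)
  have "2*theta2 tt*((8 + pp)/(3 * pp)) = 2*(4 - tt)/(3*(2 - tt))"
   unfolding theta_consts(5)[symmetric] theta2_def pp_def using t by (simp add: divide_simps) (simp add: algebra_simps)
  also have "... >= 1" using t by (simp add: le_divide_eq)
  finally show ?thesis unfolding e by simp
 qed
 have ta2: "theta2 tt <= ta" "ta > 0" using ta theta_consts by auto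
 have q: "0 <= 1 + 2*qq/(3 * pp)" using pp qq by simp
 have "1 <= 2*ta*(1 + 2*qq/(3 * pp))" using th mult_right_mono[OF ta2(1) q] by linarith
 also have "... <= 2*ta*(1 - 2 * Re u)" using m ta2 by (intro mult_left_mono) auto
 finally have k: "1 <= 2*ta * Re (1 - 2*u)" by simp
 define w where "w = 1 - 2*u"
 have "(norm (1 - cor ta*w))^2 <= (ta*norm w)^2"
  using k unfolding w_def[symmetric] by (simp add: cmod_power2 power_mult_distrib) (simp add: power2_eq_square algebra_simps)
 hence "norm (1 - cor ta*w) <= ta*norm w" by (rule power2_le_imp_le) (use ta2 in simp)
 moreover have "sv (root sg r) - cor ta = (1 - cor ta*w)/w" using nz by (simp add: sv_def u_def w_def field_simps)
 ultimately show "norm (sv (root sg r) - cor ta) <= ta" using nz by (simp add: norm_divide divide_le_eq w_def)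
qed

definition Q1f :: "real => real => complex" where
 "Q1f sg r = - \<i> * (sv (root sg r)^2 * cor (sqrt CD) * csqrt (- Wf (root sg r)))"

definition amp1 :: "real => real => complex" where
 "amp1 sg r = 4 powr cor av1*(sv (root sg r) - cor (theta1 tt))*exp (cor (av2 - av1 + 1)*Ln (sv (root sg r) - cor (theta2 tt)))*exp (cor (2*av1 - av2)*Ln (sv (root sg r)))
  / (cor ((2 + tt)*(4 - tt)) powr cor av1*exp (cor av1*(cor (ln (- X r)) + cor (sg * pi) * \<i>))*Q1f sg r)"

lemma neg_valid: assumes "- (3 * pp/qq) < r" "r < 0" shows "valid r" "r ~= - (3 * pp/qq)" "X r < 0" "- 1 < r"
proof -
 have "0 < pp/qq" using pp qq by simp
 thus v: "valid r" using assms by (simp add: valid_def)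
 show "r ~= - (3 * pp/qq)" using assms by simp
 have d: "pp - qq*r + 4*r^3 > 0" by (rule Xden_pos) (use v in \<open>auto simp: valid_def\<close>)
 have "r^3 < 0" using assms by (simp add: power3_eq_cube mult_neg_neg mult_pos_neg)
 thus "X r < 0" unfolding X_def using d by (intro divide_neg_pos) auto
 have "3 * pp/qq < 1" using pp qq by (simp add: divide_less_eq)
 thus "- 1 < r" using assms by linarith
qed

lemma Q1f_nz: assumes "- (3 * pp/qq) < r" "r < 0" "sg = 1 | sg = -1" shows "Q1f sg r ~= 0"
proof -
 note v = neg_valid[OF assms(1,2)]
 have "Wf (root sg r) ~= 0" using Wf_root[OF v(1) assms(3) v(2)] by auto
 thus ?thesis using root_nz[OF v(1) assms(3)] CD_pos by (simp add: Q1f_def sv_def del: csqrt.sel)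
qed

lemma amp1_bound:
 assumes r: "- (3 * pp/qq) < ra" "ra <= rb" "rb < 0" and sg: "sg = 1 | sg = -1"
 obtains M where "M >= 0" "!!r. r : {ra..rb} ==> norm (amp1 sg r) <= M"
proof -
 have rr: "- (3 * pp/qq) < x" "x < 0" if "x : {ra..rb}" for x using that r by auto
 have V: "valid x" "x ~= - (3 * pp/qq)" "X x < 0" if "x : {ra..rb}" for x using neg_valid[OF rr[OF that]] by auto
 have cX: "continuous_on {ra..rb} X" by (rule continuous_on_subset[OF X_cont]) (use V in \<open>auto simp: valid_def less_imp_le\<close>)
 have cY: "continuous_on {ra..rb} Y" unfolding Y_def
  by (intro continuous_intros) (use V validD(1) in \<open>force+\<close>)
 have cr: "continuous_on {ra..rb} (root sg)"
 proof -
  have "continuous_on {ra..rb} (%x. 1/(cor x + \<i> * cor (sg*Y x)))"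
   by (intro continuous_intros cY) (use rr in \<open>force simp: complex_eq_iff\<close>)
  thus ?thesis by (simp add: root_def[abs_def] Complex_eq)
 qed
 have cs: "continuous_on {ra..rb} (%x. sv (root sg x))" unfolding sv_def
  by (intro continuous_intros cr) (use root_nz[OF V(1) sg] in auto)
 have im: "Im (sv (root sg x)) ~= 0" if "x : {ra..rb}" for x by (rule s1_bound(2)[OF V(1)[OF that] rr(2)[OF that] V(2)[OF that] sg disjI1[OF refl]])
 have cW: "continuous_on {ra..rb} (%x. csqrt (- Wf (root sg x)))"
  by (rule continuous_on_csqrt_off_cut) (use Wf_root[OF V(1) sg V(2)] in \<open>auto simp: Wf_def intro!: continuous_intros cr\<close>)
 have cQ: "continuous_on {ra..rb} (Q1f sg)" unfolding Q1f_def by (intro continuous_intros cs cW)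
 have cL: "continuous_on {ra..rb} (%x. Ln (sv (root sg x) - cor k))" for k
  by (intro continuous_on_Ln' continuous_intros cs nonreal_off_cut) (use im in simp)
 have cL0: "continuous_on {ra..rb} (%x. Ln (sv (root sg x)))" using cL[of 0] by simp
 have c: "cor ((2 + tt)*(4 - tt)) powr cor av1 ~= 0" using tt by (simp only: powr_eq_0_iff of_real_eq_0_iff) auto
 have cl: "continuous_on {ra..rb} (%x. cor (ln (- X x)))"
  by (intro continuous_intros cX) (use V(3) in fastforce)
 have "continuous_on {ra..rb} (amp1 sg)" unfolding amp1_def
  by (rule continuous_on_divide; (intro continuous_on_mult continuous_on_add continuous_on_diff continuous_on_exp continuous_on_const cL cL0 cs cQ cl)?)
   (use c Q1f_nz rr sg in \<open>force simp del: of_real_mult\<close>)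
 hence "bounded (amp1 sg ` {ra..rb})" by (intro compact_imp_bounded compact_continuous_image) auto
 then obtain M where "M > 0" "ALL z:amp1 sg ` {ra..rb}. norm z <= M" by (auto simp: bounded_pos)
 thus ?thesis using that[of M] by auto
qed

lemma Lx_neg:
 assumes "x < 0" "sg = 1 | sg = -1"
 shows "(Ln \<longlongrightarrow> cor (ln (- x)) + cor (sg * pi) * \<i>) (at (cor x) within half sg)"
 by (rule Ln_limit_neg[OF tendsto_ident_at assms]) (use ev_half in \<open>auto simp: half_def elim: eventually_mono\<close>)

lemma bdry_negative1:
 assumes r: "- (3 * pp/qq) < r" "r < 0" and sg: "sg = 1 | sg = -1"
 shows "bdry sg (amplitude av1 av2 tt qf fy1) (X r) = amp1 sg r"
  "Re (bdry sg (H tt fy1) (X r)) <= (2 - tt)*ln (theta1 tt) + tt*ln (theta2 tt) + C_const tt"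
proof -
 note v = neg_valid[OF r]
 define s where "s = sv (root sg r)"
 have im: "Im s ~= 0" unfolding s_def by (rule s1_bound(2)[OF v(1) r(2) v(2) sg disjI1[OF refl]])
 have sg0: "sg ~= 0" using sg by auto
 note p1 = phi1_limit[OF v(1) sg, folded s_def]
 have L: "((%z. Ln (fy1 z - cor c)) \<longlongrightarrow> Ln (s - cor c)) (at (cor (X r)) within half sg)" for c
  by (intro tendsto_Ln tendsto_diff p1 tendsto_const nonreal_off_cut) (use im in simp)
 have c: "(2 + tt)*(4 - tt) ~= 0" using tt by simp
 show "bdry sg (amplitude av1 av2 tt qf fy1) (X r) = amp1 sg r" unfolding amp1_def s_def[symmetric]
  by (rule bdry_amplitude[OF sg0 p1 Q1_limit[OF v(1) sg v(2), folded Q1f_def] L L[of 0, simplified] Lx_neg[OF v(3) sg]])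
   (use im v(3) Q1f_nz[OF r sg] c in auto)
 have n: "Re (Ln (s - cor ta)) <= ln ta" if "ta = theta1 tt | ta = theta2 tt" for ta
 proof -
  have "s - cor ta ~= 0" using im by auto
  moreover from this have "ln (norm (s - cor ta)) <= ln ta"
   using s1_bound(1)[OF v(1) r(2) v(2) sg that] by (intro ln_mono) (auto simp: s_def[symmetric])
  ultimately show ?thesis by simp
 qed
 have "(2 - tt) * Re (Ln (s - cor (theta1 tt))) <= (2 - tt)*ln (theta1 tt)" "tt * Re (Ln (s - cor (theta2 tt))) <= tt*ln (theta2 tt)"
  using n tt by (auto intro!: mult_left_mono)
 thus "Re (bdry sg (H tt fy1) (X r)) <= (2 - tt)*ln (theta1 tt) + tt*ln (theta2 tt) + C_const tt"
  unfolding bdry_H(1)[OF sg0 L L] by simp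
qed

text \<open>Here phi_0 tends to the negative number s = ta/(ta - 2), and since it has the sign of Im
  z in its imaginary part, each logarithm is a real one plus P = sg pi i. The real logarithms
  satisfy the saddle point equation, so \<open>amplitude_algebra\<close> applies once the phases
  have cancelled.\<close>

lemma bdry_negative0:
 assumes r: "- (3 * pp/qq) < r" "r < 0" and sg: "sg = 1 | sg = -1"
 defines "ta \<equiv> - 2*r"
 shows "bdry sg (amplitude av1 av2 tt qf fy0) (X r) = cor (sqrt 2)*Am (cor ta)/csqrt (cor (Lm' ta))"
  "bdry sg (H0_tilde tt fy0) (X r) = pk ta + cor (2*(sg * pi)) * \<i>"
  "Re (bdry sg (H tt fy0) (X r)) >= (2 - tt)*ln (theta1 tt - r) + tt*ln (theta2 tt - r) + C_const tt"
  "X r = - exp (Lm ta)"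
proof -
 note v = neg_valid[OF r]
 have ta: "0 < ta" "ta < 2" using r v(4) by (auto simp: ta_def)
 have sg0: "sg ~= 0" using sg by auto
 define s where "s = ta/(ta - 2)"
 define P where "P = cor (sg * pi) * \<i>"
 define A B D T where "A = ln (ta + a)" and "B = ln (ta + tt)" and "D = ln (2 - ta)" and "T = ln ta"
 have pos: "ta + a > 0" "ta + tt > 0" "2 - ta > 0" using ta tt by auto
 have ct: "cor ta ~= (0::complex)" "cor ta + cor a ~= (0::complex)" "cor ta + cor tt ~= (0::complex)" "cor ta - 2 ~= (0::complex)"
 proof -
  have "cor ta + cor a = cor (ta + a)" "cor ta + cor tt = cor (ta + tt)" "cor ta - 2 = cor (ta - 2)" by simp_all
  thus "cor ta ~= (0::complex)" "cor ta + cor a ~= (0::complex)" "cor ta + cor tt ~= (0::complex)" "cor ta - 2 ~= (0::complex)"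
   using pos ta by (simp_all only: of_real_eq_0_iff)
 qed
 have u: "u0 sg r = 1/cor ta" using r by (simp add: u0_def ta_def)
 have sv: "sv (u0 sg r) = cor s" unfolding u sv_def s_def using ct ta by (simp add: field_simps)
 have z: "zeta (1/cor ta) = 1/cor (X r)" using third_zeta[OF v(1)] by (simp add: ta_def)
 have x0: "X r ~= 0" using v(3) by simp
 note LD = log_deriv[OF ct z x0]
 have cube: "ta^3 = X r*((ta + a)*(ta + tt)*(ta - 2))"
  using arg_cong[OF LD(2), of Re] by (simp add: of_real_power[symmetric] of_real_add[symmetric] of_real_mult[symmetric] of_real_diff[symmetric] del: of_real_power of_real_add of_real_mult of_real_diff)
 have nx: "- X r = ta^3/((ta + a)*(ta + tt)*(2 - ta))"
 proof -
  have "- X r*((ta + a)*(ta + tt)*(2 - ta)) = ta^3" unfolding cube by (simp add: algebra_simps)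
  thus ?thesis using pos by (simp add: eq_divide_eq)
 qed
 have "- X r = exp (Lm ta)" unfolding Lm_def exp_diff using ta pos nx by (simp add: exp_of_nat_mult[of 3, simplified] mult.assoc)
 thus X: "X r = - exp (Lm ta)" by simp
 have lX: "ln (- X r) = Lm ta" unfolding X by simp
 have rel: "cor A + cor B + cor D - 3 * cor T = - cor (Lm ta)" by (simp add: A_def B_def D_def T_def Lm_def)
 have sT: "- s = exp (T - D)" unfolding s_def T_def D_def exp_diff using ta pos by (simp add: field_simps)
 have shift: "theta1 tt - s = exp (k1 + A - D)" "theta2 tt - s = exp (k2 + B - D)"
 proof -
  have n: "4 - tt ~= 0" "2 + tt ~= 0" "ta - 2 ~= 0" "2 - ta ~= 0" using tt ta by auto
  show "theta1 tt - s = exp (k1 + A - D)" "theta2 tt - s = exp (k2 + B - D)"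
   unfolding exp_diff exp_add k_facts theta1_def theta2_def s_def A_def B_def D_def using pos n by (simp_all add: divide_simps) (simp_all add: algebra_simps)
 qed
 have neg: "s - theta1 tt < 0" "s - theta2 tt < 0" "s < 0" using shift sT exp_gt_zero by (metis diff_less_0_iff_less diff_gt_0_iff_gt, metis diff_less_0_iff_less diff_gt_0_iff_gt, metis neg_0_less_iff_less)
 have ev: "\<forall>\<^sub>F z in at (cor (X r)) within half sg. 0 < sg*Im (fy0 z - cor c)" for c
  using ev_half
 proof eventually_elim
  case (elim z)
  have "fy0 z ~= 0" using phi0_val(2) half_sub elim by blast
  moreover have "0 < sg*Im (us (fy0 z))" by (rule region0(1)[OF elim sg])
  ultimately show ?case by (simp add: Im_us zero_less_mult_iff zero_less_divide_iff divide_less_0_iff)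
 qed
 note p0 = phi0_limit[OF v(1) sg, unfolded sv]
 have L: "((%z. Ln (fy0 z - cor c)) \<longlongrightarrow> cor (ln (c - s)) + P) (at (cor (X r)) within half sg)" if "s - c < 0" for c
 proof -
  have "((%z. fy0 z - cor c) \<longlongrightarrow> cor (s - c)) (at (cor (X r)) within half sg)" using tendsto_diff[OF p0 tendsto_const[of "cor c"]] by simp
  from Ln_limit_neg[OF this that sg ev] show ?thesis by (simp add: P_def)
 qed
 have L0: "((%z. Ln (fy0 z)) \<longlongrightarrow> cor (T - D) + P) (at (cor (X r)) within half sg)" using L[of 0] neg(3) sT by simp
 have L1: "((%z. Ln (fy0 z - cor (theta1 tt))) \<longlongrightarrow> cor (k1 + A - D) + P) (at (cor (X r)) within half sg)" using L[OF neg(1)] unfolding shift ln_exp .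
 have L2: "((%z. Ln (fy0 z - cor (theta2 tt))) \<longlongrightarrow> cor (k2 + B - D) + P) (at (cor (X r)) within half sg)" using L[OF neg(2)] unfolding shift ln_exp .
 define om where "om = 1/ta*(qq + 3 * pp*(1/ta))"
 have om: "om > 0" unfolding om_def using ta pp qq by (intro mult_pos_pos add_pos_pos) auto
 have W: "Wf (1/cor ta) = cor om" by (simp add: Wf_def om_def)
 define w where "w = cor (sqrt om)"
 have cw: "csqrt (Wf (1/cor ta)) = w" unfolding W w_def using om by (intro csqrt_of_real) auto
 have w0: "w ~= 0" using om by (simp add: w_def)
 have Q: "((%z. qf (fy0 z)) \<longlongrightarrow> cor s^2 * cor (sqrt CD)*w) (at (cor (X r)) within half sg)"
  using Q0_limit[OF v(1) sg] unfolding sv unfolding u cw .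
 have c: "(2 + tt)*(4 - tt) ~= 0" using tt by simp
 have "bdry sg (amplitude av1 av2 tt qf fy0) (X r) = 4 powr cor av1*(cor s - cor (theta1 tt))*exp (cor (av2 - av1 + 1)*(cor (k2 + B - D) + P))*exp (cor (2*av1 - av2)*(cor (T - D) + P))
  / (cor ((2 + tt)*(4 - tt)) powr cor av1*exp (cor av1*(cor (Lm ta) + P))*(cor s^2 * cor (sqrt CD)*w))"
  by (rule bdry_amplitude[OF sg0 p0 Q L2 L0 Lx_neg[OF v(3) sg, folded P_def, unfolded lX]]) (use neg x0 w0 CD_pos c in auto)
 also have "... = exp ((cor av1 + 1/2)*(cor A - cor T) + (cor av2 + 1/2)*(cor B - cor T) - eN 2 - (cor T + cor D)/2)*exp (cor T - cor (Lm ta)/2)/w"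
 proof -
  have s1: "cor s - cor (theta1 tt) = - exp (cor k1 + cor A - cor D)"
  proof -
   have "cor s - cor (theta1 tt) = - cor (theta1 tt - s)" by simp
   thus ?thesis unfolding shift exp_of_real[symmetric] by simp
  qed
  have s2: "cor s^2 = exp (cor T - cor D)^2"
  proof -
   have "cor s^2 = (cor (- s))^2" by simp
   thus ?thesis unfolding sT exp_of_real[symmetric] by simp
  qed
  have eP: "exp P = -1" using sg exp_pi_i by (auto simp: P_def mult.commute exp_minus)
  \<comment> \<open>The exponents add up to av1 + 1. The factor exp P = -1 cancels the negative sign
    of s - theta1, and exp (av1 P) cancels against the phase of z^av1.\<close>
  have ph: "exp (cor (av2 - av1 + 1)*P)*exp (cor (2*av1 - av2)*P) = - exp (cor av1*P)"
  proof -
   have "exp (cor (av2 - av1 + 1)*P)*exp (cor (2*av1 - av2)*P) = exp P*exp (cor av1*P)"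
    unfolding exp_add[symmetric] by (rule arg_cong[of _ _ exp]) (simp add: algebra_simps)
   thus ?thesis by (simp add: eP)
  qed
  have gen: "K * - S*(E1*F1)*(E2*F2)/(c*(E3*F3)*Z) = K * S*E1*E2/(c*E3*Z)" if "F1*F2 = - F3" "F3 ~= 0" for K S E1 F1 E2 F2 c E3 F3 Z :: complex
  proof -
   have "K * - S*(E1*F1)*(E2*F2) = - (K * S*E1*E2)*(F1*F2)" by (simp add: mult_ac)
   also have "... = (K * S*E1*E2)*F3" unfolding that(1) by simp
   finally have e: "K * - S*(E1*F1)*(E2*F2) = (K * S*E1*E2)*F3" .
   have "c*(E3*F3)*Z = (c*E3*Z)*F3" by (simp add: mult_ac)
   thus ?thesis unfolding e by (simp only: nonzero_mult_divide_mult_cancel_right[OF that(2)])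
  qed
  show ?thesis unfolding amplitude_algebra[OF rel, symmetric] s1 s2 distrib_left[of _ _ P] exp_add[of _ "_*P"] gen[OF ph exp_not_eq_zero] by simp
 qed
 also have "... = Am (cor ta)*(exp (cor T - cor (Lm ta)/2)/w)"
 proof -
  have "Ln (cor ta + cor a) = cor A" "Ln (cor ta + cor tt) = cor B" "Ln (2 - cor ta) = cor D" "Ln (cor ta) = cor T"
   using Ln_of_real[OF pos(1)] Ln_of_real[OF pos(2)] Ln_of_real[OF pos(3)] Ln_of_real[OF ta(1)] by (simp_all add: A_def B_def D_def T_def)
  thus ?thesis unfolding Am_def eN_def[of "cor ta"] by (simp only: times_divide_eq_right)
 qed
 also have "exp (cor T - cor (Lm ta)/2)/w = cor (sqrt 2)/csqrt (cor (Lm' ta))"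
 proof -
  have "cor (Lm' ta) = 3/cor ta - 1/(cor ta + cor a) - 1/(cor ta + cor tt) - 1/(cor ta - 2)"
  proof -
   have "Lm' ta = 3/ta - 1/(ta + a) - 1/(ta + tt) - 1/(ta - 2)" unfolding Lm'_def using minus_divide_right[of 1 "ta - 2"] by simp
   thus ?thesis by simp
  qed
  also have "... = cor (2*(- X r) * om/ta^2)" unfolding LD(1) W by simp
  finally have e: "Lm' ta = 2*exp (Lm ta) * om/ta^2" unfolding X of_real_eq_iff by simp
  have "sqrt (Lm' ta) = sqrt 2*exp (Lm ta/2) * sqrt om/ta"
  proof (rule real_sqrt_unique)
   have "exp (Lm ta/2)^2 = exp (Lm ta)" by (simp add: power2_eq_square exp_add[symmetric])
   thus "(sqrt 2*exp (Lm ta/2) * sqrt om/ta)^2 = Lm' ta" unfolding e using om by (simp add: power_divide power_mult_distrib)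
  qed (use ta om in simp)
  moreover have "csqrt (cor (Lm' ta)) = cor (sqrt (Lm' ta))" by (rule csqrt_of_real) (use ta om in \<open>simp add: e\<close>)
  ultimately have "cor (sqrt 2)/csqrt (cor (Lm' ta)) = cor (sqrt 2/(sqrt 2*exp (Lm ta/2) * sqrt om/ta))" by simp
  also have "sqrt 2/(sqrt 2*exp (Lm ta/2) * sqrt om/ta) = exp (T - Lm ta/2)/sqrt om"
   using ta om by (simp add: exp_diff T_def)
  finally show ?thesis by (simp add: w_def exp_of_real[symmetric])
 qed
 finally show "bdry sg (amplitude av1 av2 tt qf fy0) (X r) = cor (sqrt 2)*Am (cor ta)/csqrt (cor (Lm' ta))" by simp
 have pk: "pk ta = cor (a*A + tt*B - 2*D) - kp0"
 proof -
  have l: "Ln (cor ta + cor a) = cor A" "Ln (cor ta + cor tt) = cor B" "Ln (2 - cor ta) = cor D" "Ln (cor ta) = cor T"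
   using Ln_of_real[OF pos(1)] Ln_of_real[OF pos(2)] Ln_of_real[OF pos(3)] Ln_of_real[OF ta(1)] by (simp_all add: A_def B_def D_def T_def)
  have lm: "cor (Lm ta) = 3 * cor T - cor A - cor B - cor D" by (simp add: Lm_def A_def B_def D_def T_def)
  show ?thesis unfolding pk_def hm_def hN_def lf_def l lm by (simp add: algebra_simps)
 qed
 have CC: "C_const tt = C0_const tt + 2*(k1 + k2)" using log_consts(5) by simp
 \<comment> \<open>The weights 2 - tt and tt of the two logarithms add up to 2, whence the phase
   2P.\<close>
 show "bdry sg (H0_tilde tt fy0) (X r) = pk ta + cor (2*(sg * pi)) * \<i>"
  unfolding bdry_H(2)[OF sg0 L1 L2] pk log_consts(4) CC by (simp add: P_def algebra_simps)
 \<comment> \<open>Gives |phi_0 - theta_j| >= theta_j - r, an explicit margin over the bound theta_j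
   for phi_1.\<close>
 have sr: "- s >= - r"
 proof -
  have "ta/2 <= ta/(2 - ta)" using ta by (intro divide_left_mono) auto
  moreover have "- s = ta/(2 - ta)" unfolding s_def using minus_divide_right[of ta "ta - 2"] by simp
  ultimately show ?thesis by (simp add: ta_def)
 qed
 have lm: "ln (t0 - r) <= k" if "t0 - s = exp k" "t0 > 0" for t0 k
 proof -
  have "ln (t0 - r) <= ln (t0 - s)" by (intro ln_mono) (use sr r that(2) in auto)
  thus ?thesis unfolding that(1) by simp
 qed
 have "ln (theta1 tt - r) <= k1 + A - D" "ln (theta2 tt - r) <= k2 + B - D"
  by (rule lm, rule shift, rule theta_consts)+
 hence "(2 - tt)*ln (theta1 tt - r) <= (2 - tt)*(k1 + A - D)" "tt*ln (theta2 tt - r) <= tt*(k2 + B - D)"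
  using tt by (auto intro!: mult_left_mono)
 thus "Re (bdry sg (H tt fy0) (X r)) >= (2 - tt)*ln (theta1 tt - r) + tt*ln (theta2 tt - r) + C_const tt"
  unfolding bdry_H(1)[OF sg0 L1 L2] by (simp add: P_def)
qed

end

section \<open>The expansion on (x_star, 0) and uniformity on compact sets\<close>

context jfin
begin

text \<open>\<open>poly_negative\<close> supplies the phi_0 term. The phi_1 term is smaller by exp
  (- n de) with a bounded amplitude, and exp (- n de) <= 1/(n de) moves it into the error.\<close>

lemma expansion_negative:
 assumes r: "- (3 * pp/qq) < ra" "ra <= rb" "rb < 0"
 obtains C N where "C >= 0" "N > 0" "!!n n1 n2 r P sg. n >= N ==> scaled n n1 n2 ==> r : {ra..rb} ==> sg = 1 | sg = -1 ==>
  mop av1 av2 n1 n2 P ==> expansion C n P (X r) sg"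
proof -
 have ra1: "-1 < ra" by (rule neg_valid(4)) (use r in auto)
 \<comment> \<open>The first two entries place t = -2r, for r between ra and rb, into
   [2 ep, 2 - 2 ep].\<close>
 define ep where "ep = min (min (- rb) (1 + ra)) (1/4)"
 have "ep <= 1/4" unfolding ep_def by (rule min.cobounded2)
 hence ep: "0 < ep" "ep < 1/2" "ep <= - rb" "ep <= 1 + ra" using r ra1 by (auto simp: ep_def)
 obtain C N where C: "C >= 0" "N > 0" "!!n n1 n2 t P. n >= N ==> scaled n n1 n2 ==> t : {2*ep..2-2*ep} ==> mop av1 av2 n1 n2 P ==>
  norm (cor (poly P (- exp (Lm t))) - (-1)^(n1+n2)*exp (cor n * pk t)*(cor (sqrt 2)*Am (cor t)/csqrt (cor (Lm' t))))
   <= C/n*exp (n * Re (pk t))" by (rule poly_negative[OF ep(1,2)]) (rule that)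
 obtain M1 where M1: "M1 >= 0" "!!r. r : {ra..rb} ==> norm (amp1 1 r) <= M1" by (rule amp1_bound[OF r disjI1[OF refl]]) (rule that)
 obtain M2 where M2: "M2 >= 0" "!!r. r : {ra..rb} ==> norm (amp1 (-1) r) <= M2" by (rule amp1_bound[OF r disjI2[OF refl]]) (rule that)
 \<comment> \<open>A lower bound for Re H_0 - Re H_1: the theta1 logarithm gains at least this much,
   by the bounds theta1 for phi_1 and theta1 - rb for phi_0, and the theta2 logarithm does not
   lose.\<close>
 define de where "de = (2 - tt)*(ln (theta1 tt - rb) - ln (theta1 tt))"
 have "ln (theta1 tt) < ln (theta1 tt - rb)" using theta_consts(1) r by (subst ln_less_cancel_iff) auto
 hence de: "de > 0" using tt by (simp add: de_def)
 define M where "M = C + (M1 + M2)/de"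
 show ?thesis
 proof (rule that[of M N])
  show "M >= 0" using C(1) M1(1) M2(1) de by (simp add: M_def)
  show "N > 0" by (rule C)
  fix n n1 n2 r' P and sg :: real
  assume h: "n >= N" "scaled n n1 n2" "r' : {ra..rb}" and sg: "sg = 1 | sg = -1" and mop: "mop av1 av2 n1 n2 P"
  have rr: "- (3 * pp/qq) < r'" "r' < 0" "r' <= rb" using h(3) r by auto
  have n: "n > 0" using h(1) C(2) by linarith
  define ta where "ta = - 2*r'"
  note B = bdry_negative0[OF rr(1,2) sg, folded ta_def]
  define A where "A = cor (sqrt 2)*Am (cor ta)/csqrt (cor (Lm' ta))"
  define hh where "hh = pk ta + cor (2*(sg * pi)) * \<i>"
  define BB where "BB = cor sg*exp (cor n*(bdry sg (H tt fy1) (X r') - bdry sg (H tt fy0) (X r')))*bdry sg (amplitude av1 av2 tt qf fy1) (X r')"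
  \<comment> \<open>Since 2n is the integer n1 + n2, the phase 2 sg pi i of the exponent turns into
    (-1)^(n1 + n2), the sign taken out of the sum over k.\<close>
  have Eh: "exp (cor n*hh) = (-1)^(n1+n2)*exp (cor n * pk ta)"
  proof -
   have d: "cor n*2 = of_nat (n1 + n2)" using arg_cong[OF scaled_sum[OF h(2)], of cor] by (simp add: mult.commute)
   have "cor n*hh = of_nat (n1 + n2)*(cor (sg * pi) * \<i>) + cor n * pk ta" unfolding d[symmetric] hh_def by (simp add: algebra_simps)
   moreover have "exp (cor (sg * pi) * \<i>) = -1" using sg exp_pi_i by (auto simp: mult.commute exp_minus)
   ultimately show ?thesis by (simp only: exp_add exp_of_nat_mult)
  qed
  have nE: "norm (exp (cor n*hh)) = exp (n * Re (pk ta))" unfolding Eh by (simp add: norm_mult norm_power)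
  have b1: "norm (cor (poly P (X r')) - exp (cor n*hh)*A) <= C/n*exp (n * Re (pk ta))"
   unfolding Eh B(4) A_def by (rule C(3)[OF h(1,2) _ mop]) (use h(3) ep in \<open>auto simp: ta_def\<close>)
  have b2: "norm BB <= (M1 + M2)/de/n"
  proof -
   have "(2 - tt)*ln (theta1 tt - rb) <= (2 - tt)*ln (theta1 tt - r')" "tt*ln (theta2 tt) <= tt*ln (theta2 tt - r')"
    using tt rr r theta_consts(1,2) by (auto intro!: mult_left_mono ln_mono)
   hence "Re (bdry sg (H tt fy1) (X r') - bdry sg (H tt fy0) (X r')) <= - de"
    using bdry_negative1(2)[OF rr(1,2) sg] B(3) unfolding de_def right_diff_distrib minus_complex.sel by linarith
   hence "n * Re (bdry sg (H tt fy1) (X r') - bdry sg (H tt fy0) (X r')) <= n * - de" using n by (intro mult_left_mono) auto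
   hence "norm (exp (cor n*(bdry sg (H tt fy1) (X r') - bdry sg (H tt fy0) (X r')))) <= exp (- (n*de))" by simp
   also have "... <= 1/(n*de)"
   proof -
    have "n*de <= exp (n*de)" using exp_ge_add_one_self[of "n*de"] by linarith
    thus ?thesis using n de by (simp add: exp_minus inverse_eq_divide frac_le)
   qed
   finally have e: "norm (exp (cor n*(bdry sg (H tt fy1) (X r') - bdry sg (H tt fy0) (X r')))) <= 1/(n*de)" .
   have a: "norm (amp1 sg r') <= M1 + M2" using M1(1) M2(1) M1(2)[OF h(3)] M2(2)[OF h(3)] sg by auto
   have "norm BB = norm (exp (cor n*(bdry sg (H tt fy1) (X r') - bdry sg (H tt fy0) (X r'))))*norm (amp1 sg r')"
    unfolding BB_def bdry_negative1(1)[OF rr(1,2) sg] norm_mult using sg by auto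
   also have "... <= 1/(n*de)*(M1 + M2)" by (rule mult_mono[OF e a]) (use n de in auto)
   finally show ?thesis by (simp add: mult.commute)
  qed
  show "expansion M n P (X r') sg"
  proof (rule expansionI[OF B(2)[folded hh_def] B(1)[folded A_def] BB_def[symmetric]])
   have "norm (cor (poly P (X r')) - exp (cor n*hh)*(A + BB)) <= norm (cor (poly P (X r')) - exp (cor n*hh)*A) + norm (exp (cor n*hh)*BB)"
    using norm_triangle_ineq4[of "cor (poly P (X r')) - exp (cor n*hh)*A" "exp (cor n*hh)*BB"] by (simp only: distrib_left diff_diff_eq)
   also have "... <= C/n*exp (n * Re (pk ta)) + exp (n * Re (pk ta))*((M1 + M2)/de/n)"
    unfolding norm_mult[of "exp _"] nE by (intro add_mono b1 mult_left_mono b2) simp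
   also have "... = M/n*norm (exp (cor n*hh))"
   proof -
    have "C/n*e + e*(m/n) = (C + m)/n*e" for e m by (simp add: add_divide_distrib algebra_simps)
    thus ?thesis unfolding nE M_def by blast
   qed
   finally show "norm (cor (poly P (X r')) - exp (cor n*hh)*(A + BB)) <= M/n*norm (exp (cor n*hh))" .
  qed (use n C(1) M1(1) M2(1) de in \<open>simp_all add: M_def\<close>)
 qed
qed

lemma expansion_mono: "expansion M n P x sg ==> M <= M' ==> n > 0 ==> expansion M' n P x sg"
 unfolding expansion_def using divide_right_mono[of M M' n] by (meson less_imp_le order_trans)

lemma expansion_compact:
 assumes K: "compact K" "K \<subseteq> {0<..<1} \<union> {x_star tt<..<0}"
 shows "EX M N. N > 0 & (ALL n n1 n2 P. n >= N --> scaled n n1 n2 --> mop av1 av2 n1 n2 P --> (ALL x:K. ALL sg:{1, -1}. expansion M n P x sg))"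
proof -
 have pq: "0 < pp/qq" "- (3 * pp/qq) < 0" "- (3 * pp/qq) <= pp/qq" using pp qq by (auto intro: order_trans[of _ 0])
 have c1: "continuous_on {0..pp/qq} X" "continuous_on {- (3 * pp/qq)..0} X"
  by (rule continuous_on_subset[OF X_cont]; use pq in auto)+
 have X0: "X 0 = 0" by (simp add: X_def)
 have e: "X 0 ~: K \<inter> {0..}" "X (pp/qq) ~: K \<inter> {0..}" "X (- (3 * pp/qq)) ~: K \<inter> {..0}" "X 0 ~: K \<inter> {..0}"
  unfolding X0 X_at_1 x_star_eq using K(2) x_star_neg by auto
 have cK: "compact (K \<inter> {0..})" "compact (K \<inter> {..0})" using K(1) by (auto intro: compact_Int_closed)
 obtain r1 r2 where r: "0 < r1" "r1 <= r2" "r2 < pp/qq" and rp: "!!r. r : {0..pp/qq} ==> X r : K \<inter> {0..} ==> r : {r1..r2}"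
  by (rule X_preimage[OF cK(1) pq(1) c1(1) e(1,2)]) (rule that)
 obtain ra rb where ra: "- (3 * pp/qq) < ra" "ra <= rb" "rb < 0" and rn: "!!r. r : {- (3 * pp/qq)..0} ==> X r : K \<inter> {..0} ==> r : {ra..rb}"
  by (rule X_preimage[OF cK(2) pq(2) c1(2) e(3,4)]) (rule that)
 obtain C1 N1 where 1: "C1 >= 0" "N1 > 0" "!!n n1 n2 r0 P sg. n >= N1 ==> scaled n n1 n2 ==> r0 : {r1..r2} ==> sg = 1 | sg = -1 ==>
  mop av1 av2 n1 n2 P ==> expansion C1 n P (X r0) sg" by (rule expansion_positive[OF r]) (rule that)
 obtain C2 N2 where 2: "C2 >= 0" "N2 > 0" "!!n n1 n2 r P sg. n >= N2 ==> scaled n n1 n2 ==> r : {ra..rb} ==> sg = 1 | sg = -1 ==>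
  mop av1 av2 n1 n2 P ==> expansion C2 n P (X r) sg" by (rule expansion_negative[OF ra]) (rule that)
 have main: "expansion (max C1 C2) n P x sg"
  if n: "n >= max N1 N2" and s: "scaled n n1 n2" and m: "mop av1 av2 n1 n2 P" and x: "x : K" and sg: "sg : {1, -1}" for n n1 n2 P x sg
 proof -
  have n': "n >= N1" "n >= N2" "n > 0" using n 1(2) by auto
  have sg': "sg = 1 | sg = -1" using sg by auto
  show ?thesis
  proof (cases "x > 0")
   case True
   hence "0 < x" "x < 1" using x K(2) x_star_neg by auto
   then obtain r0 where "0 < r0" "r0 < pp/qq" "X r0 = x" by (rule X_surj_pos)
   hence "r0 : {r1..r2}" by (intro rp) (use x True in auto)
   from 1(3)[OF n'(1) s this sg' m] show ?thesis using \<open>X r0 = x\<close> expansion_mono n'(3) by auto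
  next
   case False
   hence "x_star tt < x" "x < 0" using x K(2) by auto
   then obtain r0 where "- (3 * pp/qq) < r0" "r0 < 0" "X r0 = x" by (rule X_surj_neg)
   hence "r0 : {ra..rb}" by (intro rn) (use x False in auto)
   from 2(3)[OF n'(2) s this sg' m] show ?thesis using \<open>X r0 = x\<close> expansion_mono n'(3) by auto
  qed
 qed
 show ?thesis by (intro exI[of _ "max C1 C2"] exI[of _ "max N1 N2"]) (use 1(2) main in auto)
qed

end

theorem theorem7p2:
  fixes \<alpha>1 \<alpha>2 \<theta> :: real
    and \<phi>0 \<phi>1 q :: "complex \<Rightarrow> complex"
    and K :: "real set"
  assumes "\<alpha>1 > -1" "\<alpha>2 > -1" "\<alpha>1 - \<alpha>2 \<notin> \<int>"
    and "0 < \<theta>" "\<theta> < 1"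
    and "is_phi0 \<theta> \<phi>0" "is_phi1 \<theta> \<phi>1" "is_sqrtD \<theta> \<phi>1 q"
    and "compact K" "K \<subseteq> {0<..<1} \<union> {x_star \<theta><..<0}"
  shows "\<exists>M N :: real. \<forall>(n1::nat) (n2::nat) (n::real) (P :: real poly).
    real n1 + real n2 = 2 * n \<longrightarrow> real n2 / (real n1 + real n2) = \<theta> / 2 \<longrightarrow> n \<ge> N \<longrightarrow>
    is_multiple_orthogonal \<alpha>1 \<alpha>2 n1 n2 P \<longrightarrow>
    (\<forall>x\<in>K. \<forall>\<sigma>\<in>{1, -1 :: real}. \<exists>\<epsilon>0 \<epsilon>1 :: complex.
       norm \<epsilon>0 \<le> M / n \<and> norm \<epsilon>1 \<le> M / n \<and>
       complex_of_real (poly P x) =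
         exp (of_real n * bdry \<sigma> (H0_tilde \<theta> \<phi>0) x) *
         (bdry \<sigma> (amplitude \<alpha>1 \<alpha>2 \<theta> q \<phi>0) x + \<epsilon>0
          + of_real \<sigma> * exp (of_real n * (bdry \<sigma> (H \<theta> \<phi>1) x - bdry \<sigma> (H \<theta> \<phi>0) x))
            * (bdry \<sigma> (amplitude \<alpha>1 \<alpha>2 \<theta> q \<phi>1) x + \<epsilon>1)))"
proof -
  interpret jfin \<alpha>1 \<alpha>2 \<theta> \<phi>0 \<phi>1 q by unfold_locales (use assms in auto)
  obtain M N where MN: "N > 0" "\<And>n n1 n2 P x \<sigma>. n \<ge> N \<Longrightarrow> scaled n n1 n2 \<Longrightarrow> mop \<alpha>1 \<alpha>2 n1 n2 P \<Longrightarrow> x \<in> K \<Longrightarrow> \<sigma> \<in> {1, -1} \<Longrightarrow> expansion M n P x \<sigma>"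
    using expansion_compact[OF assms(9,10)] by blast
  have "expansion M n P x \<sigma>"
    if "real n1 + real n2 = 2 * n" "real n2 / (real n1 + real n2) = \<theta> / 2" "n \<ge> N" "is_multiple_orthogonal \<alpha>1 \<alpha>2 n1 n2 P" "x \<in> K" "\<sigma> \<in> {1, -1}" for n1 n2 n P x \<sigma>
  proof (rule MN(2)[OF that(3) _ _ that(5,6)])
    have "n > 0" using that(3) MN(1) by linarith
    hence "real n2 = \<theta> * n" using that(2) unfolding that(1) by (simp add: field_simps)
    thus "scaled n n1 n2" using that(1) by (simp add: scaled_def algebra_simps)
    show "mop \<alpha>1 \<alpha>2 n1 n2 P" by unfold_locales (use assms that in auto)
  qed
  thus ?thesis unfolding expansion_def by blast
qed

end
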